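(* Let $k$ be a field, let $\Lambda$ be a finite-dimensional quadratic monomial $k$-algebra and let $\Lambda^!$ be its quadratic dual. (a) If $M$ is a finitely presented graded $\Lambda^!$-module, then there exists a short exact sequence of graded $\Lambda^!$-modules $$0\longrightarrow N\longrightarrow M\longrightarrow L\longrightarrow0$$ where $N$ is linear and $L$ is finite-dimensional. (b) If $M$ is a finitely copresented graded $\Lambda^!$-module, then there exists a short exact sequence of graded $\Lambda^!$-modules $$0\longrightarrow N'\longrightarrow M\longrightarrow L'\longrightarrow0$$ where $N'$ is finite-dimensional and $L'$ is colinear.
   Context: A finite-dimensional quadratic monomial algebra is $\Lambda=kQ/I$ with $Q$ a finite quiver (vertex set $Q_0$) and $I$ an admissible ideal generated by paths of length $2$. Paths compose like functions: for $\alpha\colon x\to y$, $\beta\colon y\to z$, the path $\beta\alpha$ goes from $x$ to $z$. The quadratic (Koszul) dual is $\Lambda^!=kQ^{\mathrm{op}}/I^!$, with $I^!$ generated by the paths $\alpha^{\mathrm{op}}\beta^{\mathrm{op}}$ for all composable $\alpha,\beta$ with $\beta\alpha\notin I$; it is graded by path length and possibly infinite-dimensional (its global dimension is finite). Graded $\Lambda^!$-modules are $\mathbb Z$-graded left modules with finite-dimensional homogeneous components (arrows raise the degree by $1$), with degree-preserving morphisms; $M\langle i\rangle_n=M_{n-i}$. $P^!_x=\Lambda^!e_x$ is the indecomposable graded projective generated in degree $0$, and $I^!_x$ the indecomposable graded injective with socle in degree $0$: $I_x^!(y)=\operatorname{Hom}_k(\Lambda^!(y,x),k)$, where $\Lambda^!(y,x)$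 is the span of nonzero paths from $y$ to $x$ and the dual of a path of length $n$ has degree $-n$. Finitely presented: there is an exact sequence $P^1\to P^0\to M\to0$ with $P^0,P^1$ finite direct sums of modules $P^!_x\langle i\rangle$. Finitely copresented: there is an exact sequence $0\to M\to I^0\to I^1$ with $I^0,I^1$ finite direct sums of modules $I^!_x\langle i\rangle$. A graded $\Lambda^!$-module is Koszul if it has a finite projective resolution whose $n$-th term (homological degree $n$) is a finite direct sum of modules $P^!_x\langle n\rangle$ for each $n\ge0$. It is coKoszul if it has a finite injective coresolution $0\to M\to I^0\to I^1\to\cdots$ with $I^n$ a finite direct sum of modules $I^!_x\langle -n\rangle$ for each $n\ge 0$. A graded module $M$ is linear (resp. colinear) if $M\langle -i\rangle$ is Koszul (resp. coKoszul) for some integer $i$. The zero module is allowed. *)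

theory Defs
  imports
    "Graph_Theory.Arc_Walk"
    "HOL-Algebra.QuotRing"
    "HOL-Algebra.Ideal_Product"
    "HOL-Algebra.Module"
begin

section \<open>Path algebras of quivers and their quotients\<close>

text \<open>
  Quivers are directed multigraphs \<^typ>\<open>('v, 'e) pre_digraph\<close>; an arrow \<open>e\<close> goes from
  \<open>tail Q e\<close> to \<open>head Q e\<close>.  A path is a triple \<open>(x, p, y)\<close> of its source, the list of its
  arrows in the order in which they are traversed, and its target, so that the trivial path at
  \<open>x\<close> is \<open>(x, [], x)\<close>, and the path \<open>\<beta>\<alpha>\<close> with \<open>\<alpha>: x \<rightarrow> y\<close> and \<open>\<beta>: y \<rightarrow> z\<close> (composition as for
  functions) is \<open>(x, [\<alpha>, \<beta>], z)\<close>.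
\<close>

type_synonym ('v, 'e) qpath = "'v \<times> 'e list \<times> 'v"

definition paths :: "('v, 'e) pre_digraph \<Rightarrow> ('v, 'e) qpath set" where
  "paths Q = {(x, p, y). pre_digraph.awalk Q x p y}"

definition path_source :: "('v, 'e) qpath \<Rightarrow> 'v" where
  "path_source p = fst p"

definition path_target :: "('v, 'e) qpath \<Rightarrow> 'v" where
  "path_target p = snd (snd p)"

definition path_length :: "('v, 'e) qpath \<Rightarrow> nat" where
  "path_length p = length (fst (snd p))"

text \<open>\<open>path_comp q p\<close> is the path \<open>qp\<close>: first \<open>p\<close>, then \<open>q\<close>.\<close>
definition path_comp :: "('v, 'e) qpath \<Rightarrow> ('v, 'e) qpath \<Rightarrow> ('v, 'e) qpath" where
  "path_comp q p = (path_source p, fst (snd p) @ fst (snd q), path_target q)"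

text \<open>
  An element of \<open>kQ\<close> is a finitely supported family of coefficients; the product is
  \<open>(fg)(r) = \<Sum>\<^bsub>r = qp\<^esub> f(q) g(p)\<close>.
\<close>
definition path_algebra :: "('v, 'e) pre_digraph \<Rightarrow> (('v, 'e) qpath \<Rightarrow> 'k::field) ring" where
  "path_algebra Q =
    \<lparr>carrier = {f. finite {p. f p \<noteq> 0} \<and> {p. f p \<noteq> 0} \<subseteq> paths Q},
     mult = (\<lambda>f g r. \<Sum>(q, p) \<in> {(q, p). q \<in> paths Q \<and> p \<in> paths Q \<and>
                path_source q = path_target p \<and> path_comp q p = r}. f q * g p),
     one = (\<lambda>p. if \<exists>x \<in> verts Q. p = (x, [], x) then 1 else 0),
     zero = (\<lambda>p. 0),
     add = (\<lambda>f g p. f p + g p)\<rparr>"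

definition path_elt :: "('v, 'e) qpath \<Rightarrow> ('v, 'e) qpath \<Rightarrow> 'k::field" where
  "path_elt p = (\<lambda>q. if q = p then 1 else 0)"

abbreviation bound_algebra ::
    "('v, 'e) pre_digraph \<Rightarrow> (('v, 'e) qpath \<Rightarrow> 'k::field) set \<Rightarrow> (('v, 'e) qpath \<Rightarrow> 'k) set ring"
  where "bound_algebra Q I \<equiv> path_algebra Q Quot I"

text \<open>The structure map \<open>k \<rightarrow> kQ/I\<close>, \<open>c \<mapsto> c \<cdot> 1 + I\<close>.\<close>
definition algebra_scalar ::
    "('v, 'e) pre_digraph \<Rightarrow> (('v, 'e) qpath \<Rightarrow> 'k::field) set \<Rightarrow> 'k \<Rightarrow> (('v, 'e) qpath \<Rightarrow> 'k) set"
  where "algebra_scalar Q I c =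
    I +>\<^bsub>path_algebra Q\<^esub> (\<lambda>p. c * \<one>\<^bsub>path_algebra Q\<^esub> p)"

text \<open>The class of \<open>e\<^sub>x\<close> in \<open>kQ/I\<close>.\<close>
definition vertex_idem ::
    "('v, 'e) pre_digraph \<Rightarrow> (('v, 'e) qpath \<Rightarrow> 'k::field) set \<Rightarrow> 'v \<Rightarrow> (('v, 'e) qpath \<Rightarrow> 'k) set"
  where "vertex_idem Q I x = I +>\<^bsub>path_algebra Q\<^esub> path_elt (x, [], x)"

text \<open>The part of degree \<open>n\<close> of \<open>kQ/I\<close> with respect to path length.\<close>
definition algebra_degree ::
    "('v, 'e) pre_digraph \<Rightarrow> (('v, 'e) qpath \<Rightarrow> 'k::field) set \<Rightarrow> int \<Rightarrow> (('v, 'e) qpath \<Rightarrow> 'k) set set"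
  where "algebra_degree Q I n =
    {I +>\<^bsub>path_algebra Q\<^esub> f | f. f \<in> carrier (path_algebra Q) \<and>
       (\<forall>p. f p \<noteq> 0 \<longrightarrow> int (path_length p) = n)}"

text \<open>
  Finite-dimensionality of a subspace \<open>S\<close> of the \<open>k\<close>-vector space with additive structure \<open>V\<close> and
  scalar multiplication \<open>act\<close>.
\<close>
definition finite_dim ::
    "('m, 'c) ring_scheme \<Rightarrow> ('k::field \<Rightarrow> 'm \<Rightarrow> 'm) \<Rightarrow> 'm set \<Rightarrow> bool"
  where "finite_dim V act S \<longleftrightarrow>
    (\<exists>B. finite B \<and> B \<subseteq> S \<and> (\<forall>v \<in> S. \<exists>c. v = (\<Oplus>\<^bsub>V\<^esub>b\<in>B. act (c b) b)))"


section \<open>Quadratic monomial algebras and quadratic duals\<close>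

definition arrow_ideal :: "('v, 'e) pre_digraph \<Rightarrow> (('v, 'e) qpath \<Rightarrow> 'k::field) set" where
  "arrow_ideal Q = Idl\<^bsub>path_algebra Q\<^esub> {path_elt p | p. p \<in> paths Q \<and> path_length p = 1}"

text \<open>Powers are taken in the monoid of two-sided ideals of \<open>kQ\<close>.\<close>
definition admissible_ideal ::
    "('v, 'e) pre_digraph \<Rightarrow> (('v, 'e) qpath \<Rightarrow> 'k::field) set \<Rightarrow> bool"
  where "admissible_ideal Q I \<longleftrightarrow>
    ideal I (path_algebra Q) \<and>
    I \<subseteq> arrow_ideal Q [^]\<^bsub>ideals_set (path_algebra Q)\<^esub> (2::nat) \<and>
    (\<exists>N::nat. N \<ge> 2 \<and> arrow_ideal Q [^]\<^bsub>ideals_set (path_algebra Q)\<^esub> N \<subseteq> I)"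

text \<open>\<open>kQ/I\<close> is a finite-dimensional quadratic monomial algebra.\<close>
definition fd_quadratic_monomial ::
    "('v, 'e) pre_digraph \<Rightarrow> (('v, 'e) qpath \<Rightarrow> 'k::field) set \<Rightarrow> bool"
  where "fd_quadratic_monomial Q I \<longleftrightarrow>
    fin_digraph Q \<and>
    (\<exists>S. S \<subseteq> {p \<in> paths Q. path_length p = 2} \<and> I = Idl\<^bsub>path_algebra Q\<^esub> (path_elt ` S)) \<and>
    admissible_ideal Q I \<and>
    finite_dim (bound_algebra Q I)
      (\<lambda>c a. algebra_scalar Q I c \<otimes>\<^bsub>bound_algebra Q I\<^esub> a) (carrier (bound_algebra Q I))"

text \<open>The arrow \<open>\<alpha>\<^sup>o\<^sup>p\<close> of the opposite quiver is represented by \<open>\<alpha>\<close> itself.\<close>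
definition opposite_quiver :: "('v, 'e) pre_digraph \<Rightarrow> ('v, 'e) pre_digraph" where
  "opposite_quiver Q = \<lparr>verts = verts Q, arcs = arcs Q, tail = head Q, head = tail Q\<rparr>"

text \<open>
  For \<open>\<alpha>: x \<rightarrow> y\<close> and \<open>\<beta>: y \<rightarrow> z\<close> in \<open>Q\<close>, the path \<open>\<beta>\<alpha>\<close> is \<open>(x, [\<alpha>, \<beta>], z)\<close>, and the path
  \<open>\<alpha>\<^sup>o\<^sup>p\<beta>\<^sup>o\<^sup>p\<close> of the opposite quiver is \<open>(z, [\<beta>, \<alpha>], x)\<close>.
\<close>
definition dual_ideal ::
    "('v, 'e) pre_digraph \<Rightarrow> (('v, 'e) qpath \<Rightarrow> 'k::field) set \<Rightarrow> (('v, 'e) qpath \<Rightarrow> 'k) set"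
  where "dual_ideal Q I = Idl\<^bsub>path_algebra (opposite_quiver Q)\<^esub>
    {path_elt (head Q \<beta>, [\<beta>, \<alpha>], tail Q \<alpha>) | \<alpha> \<beta>.
       \<alpha> \<in> arcs Q \<and> \<beta> \<in> arcs Q \<and> head Q \<alpha> = tail Q \<beta> \<and>
       path_elt (tail Q \<alpha>, [\<alpha>, \<beta>], head Q \<beta>) \<notin> I}"


section \<open>Graded modules\<close>

locale left_module = R?: ring R + M?: abelian_group M
  for R :: "('a, 'b) ring_scheme" (structure) and M :: "('a, 'm, 'c) module_scheme" (structure) +
  assumes smult_closed:
      "\<lbrakk>a \<in> carrier R; x \<in> carrier M\<rbrakk> \<Longrightarrow> a \<odot>\<^bsub>M\<^esub> x \<in> carrier M"
    and smult_l_distr: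
      "\<lbrakk>a \<in> carrier R; b \<in> carrier R; x \<in> carrier M\<rbrakk> \<Longrightarrow>
        (a \<oplus>\<^bsub>R\<^esub> b) \<odot>\<^bsub>M\<^esub> x = a \<odot>\<^bsub>M\<^esub> x \<oplus>\<^bsub>M\<^esub> b \<odot>\<^bsub>M\<^esub> x"
    and smult_r_distr:
      "\<lbrakk>a \<in> carrier R; x \<in> carrier M; y \<in> carrier M\<rbrakk> \<Longrightarrow>
        a \<odot>\<^bsub>M\<^esub> (x \<oplus>\<^bsub>M\<^esub> y) = a \<odot>\<^bsub>M\<^esub> x \<oplus>\<^bsub>M\<^esub> a \<odot>\<^bsub>M\<^esub> y"
    and smult_assoc:
      "\<lbrakk>a \<in> carrier R; b \<in> carrier R; x \<in> carrier M\<rbrakk> \<Longrightarrow>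
        (a \<otimes>\<^bsub>R\<^esub> b) \<odot>\<^bsub>M\<^esub> x = a \<odot>\<^bsub>M\<^esub> (b \<odot>\<^bsub>M\<^esub> x)"
    and smult_one:
      "x \<in> carrier M \<Longrightarrow> \<one>\<^bsub>R\<^esub> \<odot>\<^bsub>M\<^esub> x = x"

text \<open>
  As for \<^typ>\<open>('a, 'm) module\<close>, the inherited fields \<open>mult\<close> and \<open>one\<close> carry no information.
\<close>
record ('a, 'm) graded_module = "('a, 'm) module" +
  hcomp :: "int \<Rightarrow> 'm set"

abbreviation fd_over_field ::
    "('v, 'e) pre_digraph \<Rightarrow> (('v, 'e) qpath \<Rightarrow> 'k::field) set \<Rightarrow>
     ((('v, 'e) qpath \<Rightarrow> 'k) set, 'm, 'c) module_scheme \<Rightarrow> 'm set \<Rightarrow> bool"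
  where "fd_over_field Q I M S \<equiv> finite_dim M (\<lambda>c m. algebra_scalar Q I c \<odot>\<^bsub>M\<^esub> m) S"

text \<open>
  \<open>\<int>\<close>-graded left \<open>kQ/I\<close>-modules \<open>M = \<Oplus>\<^sub>n M\<^sub>n\<close> with finite-dimensional homogeneous components
  \<open>M\<^sub>n = hcomp M n\<close>.
\<close>
locale graded_left_module = left_module "bound_algebra Q I" M
  for Q :: "('v, 'e) pre_digraph" and I :: "(('v, 'e) qpath \<Rightarrow> 'k::field) set"
    and M :: "((('v, 'e) qpath \<Rightarrow> 'k) set, 'm) graded_module" +
  assumes hcomp_subgroup: "additive_subgroup (hcomp M n) M"
    and hcomp_decomposition: "m \<in> carrier M \<Longrightarrow>
      \<exists>!f. (\<forall>n. f n \<in> hcomp M n) \<and> finite {n. f n \<noteq> \<zero>\<^bsub>M\<^esub>} \<and>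
           m = (\<Oplus>\<^bsub>M\<^esub>n\<in>{n. f n \<noteq> \<zero>\<^bsub>M\<^esub>}. f n)"
    and smult_hcomp: "\<lbrakk>a \<in> algebra_degree Q I i; m \<in> hcomp M j\<rbrakk> \<Longrightarrow> a \<odot>\<^bsub>M\<^esub> m \<in> hcomp M (i + j)"
    and hcomp_finite_dim: "fd_over_field Q I M (hcomp M n)"

definition finite_dim_module ::
    "('v, 'e) pre_digraph \<Rightarrow> (('v, 'e) qpath \<Rightarrow> 'k::field) set \<Rightarrow>
     ((('v, 'e) qpath \<Rightarrow> 'k) set, 'm) graded_module \<Rightarrow> bool"
  where "finite_dim_module Q I M \<longleftrightarrow> fd_over_field Q I M (carrier M)"

definition graded_hom ::
    "('v, 'e) pre_digraph \<Rightarrow> (('v, 'e) qpath \<Rightarrow> 'k::field) set \<Rightarrow>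
     ((('v, 'e) qpath \<Rightarrow> 'k) set, 'm) graded_module \<Rightarrow>
     ((('v, 'e) qpath \<Rightarrow> 'k) set, 'n) graded_module \<Rightarrow> ('m \<Rightarrow> 'n) set"
  where "graded_hom Q I M N =
    {f. f \<in> hom (add_monoid M) (add_monoid N) \<and>
        (\<forall>a \<in> carrier (bound_algebra Q I). \<forall>m \<in> carrier M. f (a \<odot>\<^bsub>M\<^esub> m) = a \<odot>\<^bsub>N\<^esub> f m) \<and>
        (\<forall>n. f ` hcomp M n \<subseteq> hcomp N n)}"

definition short_exact ::
    "('v, 'e) pre_digraph \<Rightarrow> (('v, 'e) qpath \<Rightarrow> 'k::field) set \<Rightarrow>
     ((('v, 'e) qpath \<Rightarrow> 'k) set, 'l) graded_module \<Rightarrow> ('l \<Rightarrow> 'm) \<Rightarrow>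
     ((('v, 'e) qpath \<Rightarrow> 'k) set, 'm) graded_module \<Rightarrow> ('m \<Rightarrow> 'n) \<Rightarrow>
     ((('v, 'e) qpath \<Rightarrow> 'k) set, 'n) graded_module \<Rightarrow> bool"
  where "short_exact Q I L f M g N \<longleftrightarrow>
    graded_left_module Q I L \<and> graded_left_module Q I M \<and> graded_left_module Q I N \<and>
    f \<in> graded_hom Q I L M \<and> g \<in> graded_hom Q I M N \<and>
    inj_on f (carrier L) \<and> f ` carrier L = a_kernel M N g \<and> g ` carrier M = carrier N"

text \<open>\<open>M\<langle>i\<rangle>\<^sub>n = M\<^bsub>n-i\<^esub>\<close>\<close>
definition shift :: "int \<Rightarrow> ('a, 'm) graded_module \<Rightarrow> ('a, 'm) graded_module" where
  "shift i M = M\<lparr>hcomp := (\<lambda>n. hcomp M (n - i))\<rparr>"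

text \<open>For finite \<open>J\<close> only; elements are extensional families.\<close>
definition direct_sum :: "'j set \<Rightarrow> ('j \<Rightarrow> ('a, 'm) graded_module) \<Rightarrow> ('a, 'j \<Rightarrow> 'm) graded_module"
  where "direct_sum J M =
    \<lparr>carrier = (\<Pi>\<^sub>E j\<in>J. carrier (M j)),
     mult = undefined,
     one = undefined,
     zero = (\<lambda>j\<in>J. \<zero>\<^bsub>M j\<^esub>),
     add = (\<lambda>f g. \<lambda>j\<in>J. f j \<oplus>\<^bsub>M j\<^esub> g j),
     smult = (\<lambda>a f. \<lambda>j\<in>J. a \<odot>\<^bsub>M j\<^esub> f j),
     hcomp = (\<lambda>n. \<Pi>\<^sub>E j\<in>J. hcomp (M j) n)\<rparr>"


section \<open>Projective and injective graded modules\<close>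

text \<open>\<open>P\<^sub>x = A e\<^sub>x\<close> for \<open>A = kQ/I\<close>\<close>
definition projective ::
    "('v, 'e) pre_digraph \<Rightarrow> (('v, 'e) qpath \<Rightarrow> 'k::field) set \<Rightarrow> 'v \<Rightarrow>
     ((('v, 'e) qpath \<Rightarrow> 'k) set, (('v, 'e) qpath \<Rightarrow> 'k) set) graded_module"
  where "projective Q I x =
    (let A = bound_algebra Q I; Ae = {a \<otimes>\<^bsub>A\<^esub> vertex_idem Q I x | a. a \<in> carrier A} in
     \<lparr>carrier = Ae,
      mult = undefined,
      one = undefined,
      zero = \<zero>\<^bsub>A\<^esub>,
      add = (\<oplus>\<^bsub>A\<^esub>),
      smult = (\<otimes>\<^bsub>A\<^esub>),
      hcomp = (\<lambda>n. Ae \<inter> algebra_degree Q I n)\<rparr>)"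

definition right_ideal_at ::
    "('v, 'e) pre_digraph \<Rightarrow> (('v, 'e) qpath \<Rightarrow> 'k::field) set \<Rightarrow> 'v \<Rightarrow> (('v, 'e) qpath \<Rightarrow> 'k) set set"
  where "right_ideal_at Q I x =
    {vertex_idem Q I x \<otimes>\<^bsub>bound_algebra Q I\<^esub> a | a. a \<in> carrier (bound_algebra Q I)}"

text \<open>
  \<open>I\<^sub>x\<close> is the graded \<open>k\<close>-dual of the right module \<open>e\<^sub>xA = \<Oplus>\<^sub>y e\<^sub>xAe\<^sub>y\<close>, where \<open>e\<^sub>xAe\<^sub>y\<close> is the span of
  the paths from \<open>y\<close> to \<open>x\<close>, with \<open>(a \<phi>)(b) = \<phi>(b a)\<close>.  Its elements are the \<open>k\<close>-linear functionals
  on \<open>e\<^sub>xA\<close> vanishing in all large degrees; those of degree \<open>n\<close> vanish outside the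
  part of degree \<open>-n\<close> of \<open>e\<^sub>xA\<close>.
\<close>
definition dual_functionals ::
    "('v, 'e) pre_digraph \<Rightarrow> (('v, 'e) qpath \<Rightarrow> 'k::field) set \<Rightarrow> 'v \<Rightarrow>
     ((('v, 'e) qpath \<Rightarrow> 'k) set \<Rightarrow> 'k) set"
  where "dual_functionals Q I x =
    (let A = bound_algebra Q I; eA = right_ideal_at Q I x in
     {\<phi> \<in> extensional eA.
        (\<forall>b \<in> eA. \<forall>b' \<in> eA. \<phi> (b \<oplus>\<^bsub>A\<^esub> b') = \<phi> b + \<phi> b') \<and>
        (\<forall>c. \<forall>b \<in> eA. \<phi> (algebra_scalar Q I c \<otimes>\<^bsub>A\<^esub> b) = c * \<phi> b) \<and>
        (\<exists>d. \<forall>n > d. \<forall>b \<in> eA \<inter> algebra_degree Q I n. \<phi> b = 0)})"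

definition injective ::
    "('v, 'e) pre_digraph \<Rightarrow> (('v, 'e) qpath \<Rightarrow> 'k::field) set \<Rightarrow> 'v \<Rightarrow>
     ((('v, 'e) qpath \<Rightarrow> 'k) set, (('v, 'e) qpath \<Rightarrow> 'k) set \<Rightarrow> 'k) graded_module"
  where "injective Q I x =
    (let A = bound_algebra Q I; eA = right_ideal_at Q I x in
     \<lparr>carrier = dual_functionals Q I x,
      mult = undefined,
      one = undefined,
      zero = (\<lambda>b\<in>eA. 0),
      add = (\<lambda>\<phi> \<psi>. \<lambda>b\<in>eA. \<phi> b + \<psi> b),
      smult = (\<lambda>a \<phi>. \<lambda>b\<in>eA. \<phi> (b \<otimes>\<^bsub>A\<^esub> a)),
      hcomp = (\<lambda>n. {\<phi> \<in> dual_functionals Q I x.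
                 \<forall>m. m \<noteq> - n \<longrightarrow> (\<forall>b \<in> eA \<inter> algebra_degree Q I m. \<phi> b = 0)})\<rparr>)"

text \<open>The list \<open>[(x\<^sub>1, i\<^sub>1), \<dots>, (x\<^sub>r, i\<^sub>r)]\<close> stands for \<open>P\<^bsub>x\<^sub>1\<^esub>\<langle>i\<^sub>1\<rangle> \<oplus> \<dots> \<oplus> P\<^bsub>x\<^sub>r\<^esub>\<langle>i\<^sub>r\<rangle>\<close>, similarly for \<open>I\<^sub>x\<close>.\<close>
definition projective_sum where
  "projective_sum Q I xs =
    direct_sum {..<length xs} (\<lambda>j. shift (snd (xs ! j)) (projective Q I (fst (xs ! j))))"

definition injective_sum where
  "injective_sum Q I xs =
    direct_sum {..<length xs} (\<lambda>j. shift (snd (xs ! j)) (injective Q I (fst (xs ! j))))"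


section \<open>Finiteness conditions, Koszul and linear modules\<close>

definition finitely_presented ::
    "('v, 'e) pre_digraph \<Rightarrow> (('v, 'e) qpath \<Rightarrow> 'k::field) set \<Rightarrow>
     ((('v, 'e) qpath \<Rightarrow> 'k) set, 'm) graded_module \<Rightarrow> bool"
  where "finitely_presented Q I M \<longleftrightarrow>
    (\<exists>xs0 xs1 d \<pi>.
       fst ` set xs0 \<subseteq> verts Q \<and> fst ` set xs1 \<subseteq> verts Q \<and>
       d \<in> graded_hom Q I (projective_sum Q I xs1) (projective_sum Q I xs0) \<and>
       \<pi> \<in> graded_hom Q I (projective_sum Q I xs0) M \<and>
       d ` carrier (projective_sum Q I xs1) = a_kernel (projective_sum Q I xs0) M \<pi> \<and>
       \<pi> ` carrier (projective_sum Q I xs0) = carrier M)"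

definition finitely_copresented ::
    "('v, 'e) pre_digraph \<Rightarrow> (('v, 'e) qpath \<Rightarrow> 'k::field) set \<Rightarrow>
     ((('v, 'e) qpath \<Rightarrow> 'k) set, 'm) graded_module \<Rightarrow> bool"
  where "finitely_copresented Q I M \<longleftrightarrow>
    (\<exists>xs0 xs1 \<iota> d.
       fst ` set xs0 \<subseteq> verts Q \<and> fst ` set xs1 \<subseteq> verts Q \<and>
       \<iota> \<in> graded_hom Q I M (injective_sum Q I xs0) \<and>
       d \<in> graded_hom Q I (injective_sum Q I xs0) (injective_sum Q I xs1) \<and>
       inj_on \<iota> (carrier M) \<and>
       \<iota> ` carrier M = a_kernel (injective_sum Q I xs0) (injective_sum Q I xs1) d)"

text \<open>
  The list \<open>xs n\<close> of vertices describes the term \<open>P\<^sup>n = \<Oplus> P\<^sub>x\<langle>n\<rangle>\<close> (\<open>x\<close> in \<open>xs n\<close>), and \<open>d n\<close> is the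
  differential \<open>P\<^sup>n\<^sup>+\<^sup>1 \<rightarrow> P\<^sup>n\<close>; dually, \<open>I\<^sup>n = \<Oplus> I\<^sub>x\<langle>-n\<rangle>\<close> and \<open>d n: I\<^sup>n \<rightarrow> I\<^sup>n\<^sup>+\<^sup>1\<close> below.
\<close>
definition koszul ::
    "('v, 'e) pre_digraph \<Rightarrow> (('v, 'e) qpath \<Rightarrow> 'k::field) set \<Rightarrow>
     ((('v, 'e) qpath \<Rightarrow> 'k) set, 'm) graded_module \<Rightarrow> bool"
  where "koszul Q I M \<longleftrightarrow>
    (\<exists>(xs :: nat \<Rightarrow> 'v list) d \<pi>.
       let P = (\<lambda>n. projective_sum Q I (map (\<lambda>x. (x, int n)) (xs n))) in
       (\<forall>n. set (xs n) \<subseteq> verts Q) \<and> (\<exists>N. \<forall>n \<ge> N. xs n = []) \<and>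
       \<pi> \<in> graded_hom Q I (P 0) M \<and> (\<forall>n. d n \<in> graded_hom Q I (P (Suc n)) (P n)) \<and>
       \<pi> ` carrier (P 0) = carrier M \<and>
       d 0 ` carrier (P 1) = a_kernel (P 0) M \<pi> \<and>
       (\<forall>n. d (Suc n) ` carrier (P (Suc (Suc n))) = a_kernel (P (Suc n)) (P n) (d n)))"

definition cokoszul ::
    "('v, 'e) pre_digraph \<Rightarrow> (('v, 'e) qpath \<Rightarrow> 'k::field) set \<Rightarrow>
     ((('v, 'e) qpath \<Rightarrow> 'k) set, 'm) graded_module \<Rightarrow> bool"
  where "cokoszul Q I M \<longleftrightarrow>
    (\<exists>(xs :: nat \<Rightarrow> 'v list) d \<iota>.
       let J = (\<lambda>n. injective_sum Q I (map (\<lambda>x. (x, - int n)) (xs n))) in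
       (\<forall>n. set (xs n) \<subseteq> verts Q) \<and> (\<exists>N. \<forall>n \<ge> N. xs n = []) \<and>
       \<iota> \<in> graded_hom Q I M (J 0) \<and> (\<forall>n. d n \<in> graded_hom Q I (J n) (J (Suc n))) \<and>
       inj_on \<iota> (carrier M) \<and>
       \<iota> ` carrier M = a_kernel (J 0) (J 1) (d 0) \<and>
       (\<forall>n. d n ` carrier (J n) = a_kernel (J (Suc n)) (J (Suc (Suc n))) (d (Suc n))))"

definition linear_module ::
    "('v, 'e) pre_digraph \<Rightarrow> (('v, 'e) qpath \<Rightarrow> 'k::field) set \<Rightarrow>
     ((('v, 'e) qpath \<Rightarrow> 'k) set, 'm) graded_module \<Rightarrow> bool"
  where "linear_module Q I M \<longleftrightarrow> (\<exists>i. koszul Q I (shift (- i) M))"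

definition colinear_module ::
    "('v, 'e) pre_digraph \<Rightarrow> (('v, 'e) qpath \<Rightarrow> 'k::field) set \<Rightarrow>
     ((('v, 'e) qpath \<Rightarrow> 'k) set, 'm) graded_module \<Rightarrow> bool"
  where "colinear_module Q I M \<longleftrightarrow> (\<exists>i. cokoszul Q I (shift (- i) M))"

end

theory Submission
  imports Defs
begin

text \<open>
  The quadratic dual is again a quadratic monomial algebra \<open>A\<close>: it has the basis of all paths that
  contain none of the relations of length two.  Hence left and right multiplication by an arrow are
  transparent.  A combination \<open>\<Sum> a u\<^sub>a\<close> over the arrows vanishes only if each \<open>a u\<^sub>a\<close> does, and the
  annihilator of an arrow \<open>a\<close> is generated by the arrows \<open>b\<close> that form a relation \<open>ab = 0\<close>
  (\<open>ann_left\<close>, \<open>ann_right\<close>).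

  For (a), the submodule \<open>N\<close> is the truncation of \<open>M\<close> to the degrees from \<open>d\<close> on, and \<open>L\<close> is the
  quotient, which is finite-dimensional because \<open>M\<close> is bounded below.  Let \<open>d\<close> exceed the degrees of
  all generators and relations of \<open>M\<close>.  From degree \<open>d - 1\<close> on, arrows generate \<open>M\<close>, the images of
  different arrows are independent, and the kernel of an arrow \<open>a\<close> is the sum of the images of the
  arrows \<open>b\<close> with \<open>ab = 0\<close>: projective modules have these properties, and they pass to the cokernel of
  a map between two of them.  Choose, for every arrow, a basis of its image in degree \<open>d\<close>.  The
  resulting elements \<open>v\<^sub>j = b\<^sub>j w\<^sub>j\<close> generate \<open>N\<close>, and \<open>\<Sum> f\<^sub>j v\<^sub>j = 0\<close> holds only when
  \<open>f\<^sub>j b\<^sub>j = 0\<close> for all \<open>j\<close>; this is \<open>generator_relation\<close>, by induction on the degree.  So the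
  relations of \<open>N\<close> are the annihilators of arrows, each of which is generated by arrows, the relations
  between these are again annihilators of arrows, and so on: this is a linear resolution of \<open>N\<close>
  (\<open>koszulI\<close>).  It stops because its terms are indexed by chains of arrows in which neighbours form
  relations of the dual; read backwards, such a chain is a nonzero path of the finite-dimensional
  algebra \<open>kQ/I\<close> (\<open>dual_chain_bound\<close>).

  For (b), \<open>N'\<close> and \<open>L'\<close> are the truncations of \<open>M\<close> to the degrees from \<open>d\<close> on and below \<open>d\<close>, where
  \<open>d\<close> is now small enough; \<open>N'\<close> is finite-dimensional because \<open>M\<close> is bounded above.  Below \<open>d\<close>, no nonzero element of \<open>M\<close> is killed by all arrows, the actions of
  the arrows on an element can be prescribed separately, and the image of an arrow \<open>a\<close> consists of
  what is killed by all \<open>b\<close> with \<open>ba = 0\<close>; this holds for injective modules and passes to kernels.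
  With the same bases of the images of the arrows in degree \<open>d\<close>, the coordinates of \<open>b\<^sub>j u\<close>, for \<open>u\<close> of
  degree \<open>d - 1\<close>, are functionals \<open>\<lambda>\<^sub>j\<close>, and \<open>m \<mapsto> (X \<mapsto> \<lambda>\<^sub>j(X m))\<^sub>j\<close> embeds \<open>L'\<close> into a sum of
  injective modules.  Its image consists of the families that vanish on the elements \<open>g X\<close> with
  \<open>b\<^sub>j g = 0\<close> (\<open>envelope_image\<close>), and such families are coresolved linearly along the same chains
  of arrows (\<open>cokoszulI\<close>).
\<close>

section \<open>The path algebra is a ring\<close>

lemma paths_iff: "(x, l, y) \<in> paths Q \<longleftrightarrow> pre_digraph.awalk Q x l y"
  by (simp add: paths_def)

text \<open>The index set of the sum that defines the product of the path algebra.\<close>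

definition factors :: "('v, 'e) pre_digraph \<Rightarrow> ('v, 'e) qpath \<Rightarrow> (('v, 'e) qpath \<times> ('v, 'e) qpath) set"
  where "factors Q r = {(q, p). q \<in> paths Q \<and> p \<in> paths Q \<and>
                path_source q = path_target p \<and> path_comp q p = r}"

definition mono_elt :: "'k::field \<Rightarrow> ('v, 'e) qpath \<Rightarrow> ('v, 'e) qpath \<Rightarrow> 'k" where
  "mono_elt c p = (\<lambda>q. if q = p then c else 0)"

lemma path_elt_mono_elt: "path_elt p = mono_elt 1 p"
  by (simp add: path_elt_def mono_elt_def)

lemma path_algebra_simps:
  "f \<in> carrier (path_algebra Q) \<longleftrightarrow> finite {p. f p \<noteq> 0} \<and> {p. f p \<noteq> 0} \<subseteq> paths Q"
  "f \<otimes>\<^bsub>path_algebra Q\<^esub> g = (\<lambda>r. \<Sum>(q, p) \<in> factors Q r. f q * g p)"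
  "\<one>\<^bsub>path_algebra Q\<^esub> = (\<lambda>p. if \<exists>x \<in> verts Q. p = (x, [], x) then 1 else 0)"
  "\<zero>\<^bsub>path_algebra Q\<^esub> = (\<lambda>p. 0)"
  "f \<oplus>\<^bsub>path_algebra Q\<^esub> g = (\<lambda>p. f p + g p)"
  by (simp_all add: path_algebra_def factors_def)

lemma factors_iff:
  "((v, m, y), (x, l, w)) \<in> factors Q (x', k, y') \<longleftrightarrow>
     pre_digraph.awalk Q v m y \<and> pre_digraph.awalk Q x l w \<and> v = w \<and>
     x' = x \<and> y' = y \<and> k = l @ m"
  by (auto simp: factors_def paths_def path_source_def path_target_def path_comp_def)

context fin_digraph
begin

declare awalkE [rule del] awalkE' [rule del]

lemma factors_path: "(q, p) \<in> factors G r \<Longrightarrow> r \<in> paths G"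
  by (cases q, cases p, cases r) (auto simp: factors_iff paths_iff awalk_append_iff)

lemma finite_factors [simp]: "finite (factors G r)"
proof -
  obtain x l y where r: "r = (x, l, y)" by (cases r)
  have "factors G r \<subseteq> (\<lambda>i. ((awlast x (take i l), drop i l, y), (x, take i l, awlast x (take i l)))) ` {..length l}"
  proof
    fix qp assume "qp \<in> factors G r"
    then obtain v m k where qp: "qp = ((v, m, y), (x, k, v))" "awalk v m y" "awalk x k v" "l = k @ m"
      unfolding r by (cases qp) (clarsimp simp: factors_iff)
    have v: "v = awlast x k" using awlast_of_awalk[OF qp(3)] by simp
    show "qp \<in> (\<lambda>i. ((awlast x (take i l), drop i l, y), (x, take i l, awlast x (take i l)))) ` {..length l}"
      by (rule image_eqI[where x = "length k"]) (simp_all add: qp(1,4) v)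
  qed
  then show ?thesis by (rule finite_subset) simp
qed

lemma path_algebra_mult_closed:
  fixes f g :: "('a, 'b) qpath \<Rightarrow> 'k::field"
  assumes f: "f \<in> carrier (path_algebra G)" and g: "g \<in> carrier (path_algebra G)"
  shows "f \<otimes>\<^bsub>path_algebra G\<^esub> g \<in> carrier (path_algebra G)"
proof -
  let ?h = "f \<otimes>\<^bsub>path_algebra G\<^esub> g"
  have *: "\<exists>q p. (q, p) \<in> factors G r \<and> f q \<noteq> 0 \<and> g p \<noteq> 0" if "?h r \<noteq> 0" for r
  proof (rule ccontr)
    assume "\<not> ?thesis"
    then have "?h r = 0" unfolding path_algebra_simps(2) by (intro sum.neutral) auto
    with that show False by simp
  qed
  have "{r. ?h r \<noteq> 0} \<subseteq> (\<lambda>(q, p). path_comp q p) ` ({q. f q \<noteq> 0} \<times> {p. g p \<noteq> 0})"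
  proof
    fix r assume "r \<in> {r. ?h r \<noteq> 0}"
    then obtain q p where "(q, p) \<in> factors G r" "f q \<noteq> 0" "g p \<noteq> 0" using * by blast
    then show "r \<in> (\<lambda>(q, p). path_comp q p) ` ({q. f q \<noteq> 0} \<times> {p. g p \<noteq> 0})"
      by (intro image_eqI[where x = "(q, p)"]) (auto simp: factors_def)
  qed
  then have "finite {r. ?h r \<noteq> 0}"
    by (rule finite_subset) (use f g in \<open>simp add: path_algebra_simps\<close>)
  moreover have "{r. ?h r \<noteq> 0} \<subseteq> paths G" using * factors_path by blast
  ultimately show ?thesis by (simp add: path_algebra_simps(1))
qed

lemma path_comp_closed:
  "q \<in> paths G \<Longrightarrow> p \<in> paths G \<Longrightarrow> path_source q = path_target p \<Longrightarrow> path_comp q p \<in> paths G"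
  by (cases q, cases p)
    (auto simp: paths_iff path_source_def path_target_def path_comp_def awalk_append_iff)

lemma path_comp_ends:
  "path_source (path_comp q p) = path_source p" "path_target (path_comp q p) = path_target q"
  by (simp_all add: path_source_def path_target_def path_comp_def)

lemma path_comp_assoc: "path_comp (path_comp q p) r = path_comp q (path_comp p r)"
  by (simp add: path_source_def path_target_def path_comp_def)

lemma factors_comp: "v \<in> factors G r \<Longrightarrow> path_comp (fst v) (snd v) = r"
  by (cases v) (simp add: factors_def)

lemma factors_assoc_left:
  assumes "u \<in> factors G r" "v \<in> factors G (fst u)"
  shows "(fst v, path_comp (snd v) (snd u)) \<in> factors G r"
    and "(snd v, snd u) \<in> factors G (path_comp (snd v) (snd u))"
proof -
  obtain s p t q where uv: "u = (s, p)" "v = (t, q)" by (cases u, cases v) auto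
  have *: "s \<in> paths G" "p \<in> paths G" "path_source s = path_target p" "path_comp s p = r"
    "t \<in> paths G" "q \<in> paths G" "path_source t = path_target q" "path_comp t q = s"
    using assms by (auto simp: uv factors_def)
  have src: "path_source q = path_target p" using * path_comp_ends(1)[of t q] by simp
  have r: "path_comp t (path_comp q p) = r" using * path_comp_assoc[of t q p] by simp
  show "(fst v, path_comp (snd v) (snd u)) \<in> factors G r"
    using * src r by (simp add: uv factors_def path_comp_closed path_comp_ends)
  show "(snd v, snd u) \<in> factors G (path_comp (snd v) (snd u))"
    using * src by (simp add: uv factors_def)
qed

lemma factors_assoc_right:
  assumes "u \<in> factors G r" "v \<in> factors G (snd u)"
  shows "(path_comp (fst u) (fst v), snd v) \<in> factors G r"
    and "(fst u, fst v) \<in> factors G (path_comp (fst u) (fst v))"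
proof -
  obtain s p t q where uv: "u = (s, p)" "v = (t, q)" by (cases u, cases v) auto
  have *: "s \<in> paths G" "p \<in> paths G" "path_source s = path_target p" "path_comp s p = r"
    "t \<in> paths G" "q \<in> paths G" "path_source t = path_target q" "path_comp t q = p"
    using assms by (auto simp: uv factors_def)
  have src: "path_source s = path_target t" using * path_comp_ends(2)[of t q] by simp
  have r: "path_comp (path_comp s t) q = r" using * path_comp_assoc[of s t q] by simp
  show "(path_comp (fst u) (fst v), snd v) \<in> factors G r"
    using * src r by (simp add: uv factors_def path_comp_closed path_comp_ends)
  show "(fst u, fst v) \<in> factors G (path_comp (fst u) (fst v))"
    using * src by (simp add: uv factors_def)
qed

text \<open>Both sides sum over the factorizations of a path into three, grouped in two ways.\<close>

lemma path_algebra_assoc: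
  fixes f g h :: "('a, 'b) qpath \<Rightarrow> 'k::field"
  shows "(f \<otimes>\<^bsub>path_algebra G\<^esub> g) \<otimes>\<^bsub>path_algebra G\<^esub> h = f \<otimes>\<^bsub>path_algebra G\<^esub> (g \<otimes>\<^bsub>path_algebra G\<^esub> h)"
proof
  fix r
  let ?i = "\<lambda>w. ((path_comp (fst (fst w)) (fst (snd w)), snd (snd w)), (fst (fst w), fst (snd w)))"
  let ?j = "\<lambda>w. ((fst (snd w), path_comp (snd (snd w)) (snd (fst w))), (snd (snd w), snd (fst w)))"
  have "((f \<otimes>\<^bsub>path_algebra G\<^esub> g) \<otimes>\<^bsub>path_algebra G\<^esub> h) r =
     (\<Sum>u\<in>factors G r. \<Sum>v\<in>factors G (fst u). f (fst v) * g (snd v) * h (snd u))"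
    by (simp add: path_algebra_simps sum_distrib_right split_def)
  also have "\<dots> = (\<Sum>(u, v)\<in>(SIGMA u:factors G r. factors G (fst u)). f (fst v) * g (snd v) * h (snd u))"
    by (rule sum.Sigma) auto
  also have "\<dots> = (\<Sum>(u, v)\<in>(SIGMA u:factors G r. factors G (snd u)). f (fst u) * (g (fst v) * h (snd v)))"
  proof (rule sum.reindex_bij_witness[where i = ?i and j = ?j])
    fix w assume "w \<in> (SIGMA u:factors G r. factors G (fst u))"
    then have w: "fst w \<in> factors G r" "snd w \<in> factors G (fst (fst w))" by auto
    show "?j w \<in> (SIGMA u:factors G r. factors G (snd u))"
      using factors_assoc_left[OF w] by simp
    show "?i (?j w) = w"
      using factors_comp[OF w(2)] by simp
    show "(case ?j w of (u, v) \<Rightarrow> f (fst u) * (g (fst v) * h (snd v))) =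
        (case w of (u, v) \<Rightarrow> f (fst v) * g (snd v) * h (snd u))"
      by (simp add: split_def mult.assoc)
  next
    fix w assume "w \<in> (SIGMA u:factors G r. factors G (snd u))"
    then have w: "fst w \<in> factors G r" "snd w \<in> factors G (snd (fst w))" by auto
    show "?i w \<in> (SIGMA u:factors G r. factors G (fst u))"
      using factors_assoc_right[OF w] by simp
    show "?j (?i w) = w"
      using factors_comp[OF w(2)] by simp
  qed
  also have "\<dots> = (\<Sum>u\<in>factors G r. \<Sum>v\<in>factors G (snd u). f (fst u) * (g (fst v) * h (snd v)))"
    by (rule sum.Sigma[symmetric]) auto
  also have "\<dots> = (f \<otimes>\<^bsub>path_algebra G\<^esub> (g \<otimes>\<^bsub>path_algebra G\<^esub> h)) r"
    by (simp add: path_algebra_simps sum_distrib_left split_def)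
  finally show "((f \<otimes>\<^bsub>path_algebra G\<^esub> g) \<otimes>\<^bsub>path_algebra G\<^esub> h) r =
    (f \<otimes>\<^bsub>path_algebra G\<^esub> (g \<otimes>\<^bsub>path_algebra G\<^esub> h)) r" .
qed

text \<open>Only the trivial factorization of a path meets the support of a linear combination of
  trivial paths.\<close>

lemma sum_factors_trivial_left:
  fixes f g :: "('a, 'b) qpath \<Rightarrow> 'k::field"
  assumes r: "r \<in> paths G" and q: "\<And>v m w. m \<noteq> [] \<Longrightarrow> f (v, m, w) = 0"
  shows "(\<Sum>(q, p)\<in>factors G r. f q * g p) = f (path_target r, [], path_target r) * g r"
proof -
  obtain x l y where r': "r = (x, l, y)" by (cases r)
  have aw: "awalk x l y" using r r' by (simp add: paths_iff)
  have "(\<Sum>(q, p)\<in>factors G r. f q * g p) = (\<Sum>(q, p)\<in>{((y, [], y), r)}. f q * g p)"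
  proof (rule sum.mono_neutral_right)
    show "{((y, [], y), r)} \<subseteq> factors G r"
      using aw awalk_last_in_verts[OF aw] awalk_hd_in_verts[OF aw]
      by (simp add: r' factors_iff awalk_Nil_iff)
    show "\<forall>i\<in>factors G r - {((y, [], y), r)}. (case i of (q, p) \<Rightarrow> f q * g p) = 0"
    proof
      fix i assume i: "i \<in> factors G r - {((y, [], y), r)}"
      obtain v m w x' k z where i': "i = ((v, m, w), (x', k, z))" by (cases i) auto
      have "m \<noteq> []" using i unfolding i' r' by (clarsimp simp: factors_iff awalk_Nil_iff)
      then show "(case i of (q, p) \<Rightarrow> f q * g p) = 0" using q by (simp add: i')
    qed
  qed simp
  then show ?thesis by (simp add: r' path_target_def)
qed

lemma sum_factors_trivial_right:
  fixes f g :: "('a, 'b) qpath \<Rightarrow> 'k::field"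
  assumes r: "r \<in> paths G" and q: "\<And>v m w. m \<noteq> [] \<Longrightarrow> g (v, m, w) = 0"
  shows "(\<Sum>(q, p)\<in>factors G r. f q * g p) = f r * g (path_source r, [], path_source r)"
proof -
  obtain x l y where r': "r = (x, l, y)" by (cases r)
  have aw: "awalk x l y" using r r' by (simp add: paths_iff)
  have "(\<Sum>(q, p)\<in>factors G r. f q * g p) = (\<Sum>(q, p)\<in>{(r, (x, [], x))}. f q * g p)"
  proof (rule sum.mono_neutral_right)
    show "{(r, (x, [], x))} \<subseteq> factors G r"
      using aw awalk_last_in_verts[OF aw] awalk_hd_in_verts[OF aw]
      by (simp add: r' factors_iff awalk_Nil_iff)
    show "\<forall>i\<in>factors G r - {(r, (x, [], x))}. (case i of (q, p) \<Rightarrow> f q * g p) = 0"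
    proof
      fix i assume i: "i \<in> factors G r - {(r, (x, [], x))}"
      obtain v m w x' k z where i': "i = ((v, m, w), (x', k, z))" by (cases i) auto
      have "k \<noteq> []" using i unfolding i' r' by (clarsimp simp: factors_iff awalk_Nil_iff)
      then show "(case i of (q, p) \<Rightarrow> f q * g p) = 0" using q by (simp add: i')
    qed
  qed simp
  then show ?thesis by (simp add: r' path_source_def)
qed

lemma path_target_in_verts: "r \<in> paths G \<Longrightarrow> path_target r \<in> verts G"
  by (cases r) (simp add: paths_iff path_target_def awalk_last_in_verts)

lemma path_source_in_verts: "r \<in> paths G \<Longrightarrow> path_source r \<in> verts G"
  by (cases r) (simp add: paths_iff path_source_def awalk_hd_in_verts)

lemma not_path_factors: "r \<notin> paths G \<Longrightarrow> factors G r = {}"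
  using factors_path[of _ _ r] by (cases "factors G r = {}") (simp, metis ex_in_conv surj_pair)

lemma path_algebra_ring: "ring (path_algebra G :: (('a, 'b) qpath \<Rightarrow> 'k::field) ring)"
proof (rule ringI)
  let ?K = "path_algebra G :: (('a, 'b) qpath \<Rightarrow> 'k) ring"
  show "abelian_group ?K"
  proof (rule abelian_groupI)
    fix f g assume f: "f \<in> carrier ?K" and g: "g \<in> carrier ?K"
    have sub: "{p. f p + g p \<noteq> 0} \<subseteq> {p. f p \<noteq> 0} \<union> {p. g p \<noteq> 0}" by auto
    then have "finite {p. f p + g p \<noteq> 0}"
      by (rule finite_subset) (use f g in \<open>simp add: path_algebra_simps(1)\<close>)
    with sub f g show "f \<oplus>\<^bsub>?K\<^esub> g \<in> carrier ?K"
      unfolding path_algebra_simps(1,5) by blast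
  next
    fix f assume f: "f \<in> carrier ?K"
    then show "\<exists>g\<in>carrier ?K. g \<oplus>\<^bsub>?K\<^esub> f = \<zero>\<^bsub>?K\<^esub>"
      by (intro bexI[where x = "\<lambda>p. - f p"]) (auto simp: path_algebra_simps)
  qed (auto simp: path_algebra_simps)
  have one: "f \<otimes>\<^bsub>?K\<^esub> \<one>\<^bsub>?K\<^esub> = f \<and> \<one>\<^bsub>?K\<^esub> \<otimes>\<^bsub>?K\<^esub> f = f" if f: "f \<in> carrier ?K" for f
  proof -
    have "(f \<otimes>\<^bsub>?K\<^esub> \<one>\<^bsub>?K\<^esub>) r = f r \<and> (\<one>\<^bsub>?K\<^esub> \<otimes>\<^bsub>?K\<^esub> f) r = f r" for r
    proof (cases "r \<in> paths G")
      case True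
      then show ?thesis
        by (simp add: path_algebra_simps sum_factors_trivial_left sum_factors_trivial_right
            path_source_in_verts path_target_in_verts)
    next
      case False
      with f have "f r = 0" by (auto simp: path_algebra_simps)
      with False show ?thesis by (simp add: path_algebra_simps not_path_factors)
    qed
    then show ?thesis by auto
  qed
  show "monoid ?K"
  proof (rule monoidI)
    have "{p. \<one>\<^bsub>?K\<^esub> p \<noteq> 0} = (\<lambda>x. (x, [], x)) ` verts G"
      by (auto simp: path_algebra_simps(3))
    moreover have "(\<lambda>x. (x, [], x)) ` verts G \<subseteq> paths G"
      by (auto simp: paths_iff awalk_Nil_iff)
    ultimately show "\<one>\<^bsub>?K\<^esub> \<in> carrier ?K"
      by (simp add: path_algebra_simps(1))
  qed (simp_all only: one path_algebra_mult_closed path_algebra_assoc)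
qed (simp_all add: path_algebra_simps(2,5) distrib_left distrib_right sum.distrib split_def)

lemma awalk_append_Cons:
  "awalk x (l @ a # m) y \<longleftrightarrow> awalk x l (tail G a) \<and> a \<in> arcs G \<and> awalk (head G a) m y"
proof
  assume "awalk x (l @ a # m) y"
  then have *: "awalk x l (awlast x l)" "awlast x l = tail G a" "a \<in> arcs G" "awalk (head G a) m y"
    unfolding awalk_append_iff awalk_Cons_iff by blast+
  show "awalk x l (tail G a) \<and> a \<in> arcs G \<and> awalk (head G a) m y"
    using *(1,3,4) unfolding *(2) by blast
next
  assume *: "awalk x l (tail G a) \<and> a \<in> arcs G \<and> awalk (head G a) m y"
  then have l: "awlast x l = tail G a" unfolding awalk_conv by blast
  show "awalk x (l @ a # m) y"
    unfolding awalk_append_iff awalk_Cons_iff l using * by blast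
qed

lemma mono_elt_carrier: "p \<in> paths G \<Longrightarrow> mono_elt c p \<in> carrier (path_algebra G)"
  by (auto simp: path_algebra_simps(1) mono_elt_def)

lemma mono_elt_mult:
  assumes "q \<in> paths G" "p \<in> paths G" "path_source q = path_target p"
  shows "mono_elt c q \<otimes>\<^bsub>path_algebra G\<^esub> mono_elt d p = mono_elt (c * d) (path_comp q p)"
proof
  fix r
  have "(mono_elt c q \<otimes>\<^bsub>path_algebra G\<^esub> mono_elt d p) r =
      (\<Sum>i\<in>factors G r. if i = (q, p) then c * d else 0)"
    by (auto simp: path_algebra_simps mono_elt_def split_def prod_eq_iff intro!: sum.cong)
  also have "\<dots> = (if (q, p) \<in> factors G r then c * d else 0)" by simp
  also have "(q, p) \<in> factors G r \<longleftrightarrow> r = path_comp q p" using assms by (auto simp: factors_def)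
  finally show "(mono_elt c q \<otimes>\<^bsub>path_algebra G\<^esub> mono_elt d p) r = mono_elt (c * d) (path_comp q p) r"
    by (simp add: mono_elt_def)
qed

end

section \<open>Quadratic monomial algebras have a basis of paths\<close>

lemma not_successively_decomp:
  "\<not> successively P l \<Longrightarrow> \<exists>l1 a b l2. l = l1 @ [a, b] @ l2 \<and> \<not> P a b"
proof (induction l)
  case (Cons a l)
  show ?case
  proof (cases "successively P l")
    case True
    then obtain b l' where "l = b # l'" "\<not> P a b" using Cons.prems by (cases l) auto
    then have "a # l = [] @ [a, b] @ l' \<and> \<not> P a b" by simp
    then show ?thesis by blast
  next
    case False
    then obtain l1 a' b l2 where "l = l1 @ [a', b] @ l2 \<and> \<not> P a' b" using Cons.IH by blast
    then have "a # l = (a # l1) @ [a', b] @ l2 \<and> \<not> P a' b" by simp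
    then show ?thesis by blast
  qed
qed simp

locale quadratic_monomial = fin_digraph Q
  for Q :: "('v, 'e) pre_digraph" +
  fixes S :: "('v, 'e) qpath set" and I :: "(('v, 'e) qpath \<Rightarrow> 'k::field) set"
  assumes relations: "S \<subseteq> {p \<in> paths Q. path_length p = 2}"
    and I_def: "I = Idl\<^bsub>path_algebra Q\<^esub> (path_elt ` S)"
begin

text \<open>The pair \<open>a\<close>, \<open>b\<close> of consecutive arrows, first \<open>a\<close>, is not a relation.\<close>

definition compatible :: "'e \<Rightarrow> 'e \<Rightarrow> bool" where
  "compatible a b \<longleftrightarrow> (tail Q a, [a, b], head Q b) \<notin> S"

definition nonzero_path :: "('v, 'e) qpath \<Rightarrow> bool" where
  "nonzero_path r \<longleftrightarrow> r \<in> paths Q \<and> successively compatible (fst (snd r))"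

abbreviation KQ :: "(('v, 'e) qpath \<Rightarrow> 'k) ring" where "KQ \<equiv> path_algebra Q"

sublocale KQ: ring KQ by (rule path_algebra_ring)

lemma nonzero_path_factor:
  "nonzero_path r \<Longrightarrow> (q, p) \<in> factors Q r \<Longrightarrow> nonzero_path q \<and> nonzero_path p"
  by (cases q, cases p, cases r)
    (clarsimp simp: nonzero_path_def factors_iff paths_iff successively_append_iff)

lemma relations_carrier: "path_elt ` S \<subseteq> carrier KQ"
  using relations by (auto simp: path_elt_mono_elt intro: mono_elt_carrier)

lemma ideal_I: "ideal I KQ"
  unfolding I_def by (rule KQ.genideal_ideal[OF relations_carrier])

sublocale I: ideal I KQ by (rule ideal_I)

text \<open>A path that vanishes has a relation as a subpath.\<close>

lemma zero_path_in_I: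
  assumes r: "r \<in> paths Q" "\<not> nonzero_path r"
  shows "mono_elt c r \<in> I"
proof -
  obtain x l y where r': "r = (x, l, y)" by (cases r)
  have aw: "awalk x l y" using r r' by (simp add: paths_iff)
  have "\<not> successively compatible l" using r r' by (simp add: nonzero_path_def)
  then obtain l1 a b l2 where l: "l = l1 @ [a, b] @ l2" "\<not> compatible a b"
    using not_successively_decomp by metis
  let ?s = "(tail Q a, [a, b], head Q b)" and ?p = "(x, l1, tail Q a)" and ?q = "(head Q b, l2, y)"
  have s: "?s \<in> S" using l(2) by (simp add: compatible_def)
  have "?s \<in> paths Q" using relations s by blast
  moreover have "?p \<in> paths Q" "?q \<in> paths Q" using aw
    by (simp_all add: l(1) paths_iff awalk_append_Cons awalk_Cons_iff del: awalk_append_iff)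
  ultimately have p: "?p \<in> paths Q" "?q \<in> paths Q" "?s \<in> paths Q" by simp_all
  have "path_elt ?s \<in> I" using s KQ.genideal_self[OF relations_carrier] unfolding I_def by blast
  then have "path_elt ?s \<otimes>\<^bsub>KQ\<^esub> mono_elt 1 ?p \<in> I"
    by (rule I.I_r_closed) (rule mono_elt_carrier[OF p(1)])
  then have I: "mono_elt c ?q \<otimes>\<^bsub>KQ\<^esub> (path_elt ?s \<otimes>\<^bsub>KQ\<^esub> mono_elt 1 ?p) \<in> I"
    by (rule I.I_l_closed) (rule mono_elt_carrier[OF p(2)])
  have sp: "path_elt ?s \<otimes>\<^bsub>KQ\<^esub> mono_elt 1 ?p = (mono_elt 1 (x, l1 @ [a, b], head Q b) :: _ \<Rightarrow> 'k)"
    unfolding path_elt_mono_elt using mono_elt_mult[OF p(3,1), of 1 1]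
    by (simp add: path_source_def path_target_def path_comp_def)
  have "(x, l1 @ [a, b], head Q b) \<in> paths Q"
    using p by (simp add: paths_iff awalk_append_Cons awalk_Cons_iff del: awalk_append_iff)
  from mono_elt_mult[OF p(2) this, of c 1]
  have "mono_elt c ?q \<otimes>\<^bsub>KQ\<^esub> mono_elt 1 (x, l1 @ [a, b], head Q b) = mono_elt c r"
    by (simp add: path_source_def path_target_def path_comp_def r' l)
  with I show ?thesis by (simp only: sp)
qed

text \<open>An ideal generated by paths is spanned by paths: the combinations of vanishing paths form an ideal
  that contains the relations, and every vanishing path is a multiple of a relation.\<close>

lemma I_iff: "f \<in> I \<longleftrightarrow> f \<in> carrier KQ \<and> (\<forall>r. nonzero_path r \<longrightarrow> f r = 0)"
proof
  let ?J = "{f \<in> carrier KQ. \<forall>r. nonzero_path r \<longrightarrow> f r = 0}"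
  have "ideal ?J KQ"
  proof (rule idealI)
    show "subgroup ?J (add_monoid KQ)"
    proof (rule subgroup.intro)
      show "?J \<subseteq> carrier (add_monoid KQ)" by auto
      show "\<one>\<^bsub>add_monoid KQ\<^esub> \<in> ?J" using KQ.zero_closed by (simp add: path_algebra_simps(4))
      fix f assume f: "f \<in> ?J"
      then have neg: "(\<lambda>p. - f p) \<in> carrier KQ" by (simp add: path_algebra_simps(1))
      have "\<ominus>\<^bsub>KQ\<^esub> f = (\<lambda>p. - f p)"
        by (rule KQ.minus_equality) (use f neg in \<open>simp_all add: path_algebra_simps(4,5)\<close>)
      then show "inv\<^bsub>add_monoid KQ\<^esub> f \<in> ?J"
        unfolding a_inv_def using f neg by simp
    next
      fix f g assume "f \<in> ?J" "g \<in> ?J"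
      then show "f \<otimes>\<^bsub>add_monoid KQ\<^esub> g \<in> ?J"
        using KQ.a_closed[of f g] by (simp add: path_algebra_simps(5))
    qed
  next
    fix f g assume f: "f \<in> ?J" and g: "g \<in> carrier KQ"
    have "(g \<otimes>\<^bsub>KQ\<^esub> f) r = 0 \<and> (f \<otimes>\<^bsub>KQ\<^esub> g) r = 0" if "nonzero_path r" for r
      unfolding path_algebra_simps(2) using f nonzero_path_factor[OF that]
      by (auto intro!: sum.neutral)
    then show "g \<otimes>\<^bsub>KQ\<^esub> f \<in> ?J" "f \<otimes>\<^bsub>KQ\<^esub> g \<in> ?J"
      using path_algebra_mult_closed[of f g] path_algebra_mult_closed[of g f] f g by simp_all
  qed (rule KQ.ring_axioms)
  moreover have "path_elt ` S \<subseteq> ?J"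
  proof
    fix f :: "('v, 'e) qpath \<Rightarrow> 'k" assume "f \<in> path_elt ` S"
    then obtain s where s: "s \<in> S" "f = path_elt s" by blast
    then obtain x l y where s': "s = (x, l, y)" "awalk x l y" "length l = 2"
      using relations by (cases s) (auto simp: paths_iff path_length_def)
    then obtain a b where "l = [a, b]" by (auto simp: numeral_2_eq_2 length_Suc_conv)
    then have "\<not> nonzero_path s" using s s' by (auto simp: nonzero_path_def compatible_def awalk_Cons_iff awalk_Nil_iff)
    then show "f \<in> ?J" using s relations_carrier by (auto simp: path_elt_def)
  qed
  ultimately have "I \<subseteq> ?J" unfolding I_def by (rule KQ.genideal_minimal)
  then show "f \<in> I \<Longrightarrow> f \<in> carrier KQ \<and> (\<forall>r. nonzero_path r \<longrightarrow> f r = 0)" by blast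
next
  assume f: "f \<in> carrier KQ \<and> (\<forall>r. nonzero_path r \<longrightarrow> f r = 0)"
  have "g \<in> I" if "finite F" "F \<subseteq> paths Q" "{p. g p \<noteq> 0} \<subseteq> F" "\<forall>r. nonzero_path r \<longrightarrow> g r = 0" for F g
    using that
  proof (induction F arbitrary: g)
    case empty
    then have "g = \<zero>\<^bsub>KQ\<^esub>" by (auto simp: path_algebra_simps)
    then show ?case by simp
  next
    case (insert p F)
    have "g(p := 0) \<in> I" using insert.prems by (intro insert.IH) auto
    moreover have "mono_elt (g p) p \<in> I"
    proof (cases "nonzero_path p")
      case True
      then have "g p = 0" using insert.prems by blast
      then have "mono_elt (g p) p = \<zero>\<^bsub>KQ\<^esub>" by (simp add: mono_elt_def path_algebra_simps(4))
      then show ?thesis by simp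
    qed (use insert.prems zero_path_in_I in auto)
    ultimately have "mono_elt (g p) p \<oplus>\<^bsub>KQ\<^esub> g(p := 0) \<in> I" by simp
    also have "mono_elt (g p) p \<oplus>\<^bsub>KQ\<^esub> g(p := 0) = g" by (auto simp: path_algebra_simps mono_elt_def)
    finally show ?case .
  qed
  from this[of "{p. f p \<noteq> 0}" f] f show "f \<in> I" by (auto simp: path_algebra_simps)
qed

end

context quadratic_monomial
begin

abbreviation A :: "(('v, 'e) qpath \<Rightarrow> 'k) set ring" where "A \<equiv> bound_algebra Q I"
abbreviation mult_A (infixl "\<star>" 70) where "a \<star> b \<equiv> a \<otimes>\<^bsub>A\<^esub> b"
abbreviation cls :: "(('v, 'e) qpath \<Rightarrow> 'k) \<Rightarrow> (('v, 'e) qpath \<Rightarrow> 'k) set" where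
  "cls f \<equiv> I +>\<^bsub>KQ\<^esub> f"

sublocale A: ring A by (rule I.quotient_is_ring)

text \<open>The coefficients with respect to the basis of nonzero paths.  On these paths all representatives of
  a class agree, which makes the choice harmless; elsewhere the value is set to 0.\<close>

definition coef :: "(('v, 'e) qpath \<Rightarrow> 'k) set \<Rightarrow> ('v, 'e) qpath \<Rightarrow> 'k" where
  "coef X r = (if nonzero_path r then (SOME f. f \<in> X) r else 0)"

lemma coef_cls:
  assumes f: "f \<in> carrier KQ"
  shows "coef (cls f) r = (if nonzero_path r then f r else 0)"
proof -
  have "f \<in> cls f" using f by (rule I.a_rcos_self)
  then have "(SOME g. g \<in> cls f) \<in> cls f" by (rule someI[where P = "\<lambda>g. g \<in> cls f"])
  then obtain h where h: "h \<in> I" "(SOME g. g \<in> cls f) = h \<oplus>\<^bsub>KQ\<^esub> f"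
    unfolding a_r_coset_def' by blast
  have "nonzero_path r \<Longrightarrow> h r = 0" using h(1) I_iff by blast
  then show ?thesis by (simp add: coef_def h(2) path_algebra_simps(5))
qed

lemma carrier_A_iff: "X \<in> carrier A \<longleftrightarrow> (\<exists>f \<in> carrier KQ. X = cls f)"
  by (auto simp: FactRing_def A_RCOSETS_def')

lemma carrier_A_E:
  assumes "X \<in> carrier A"
  obtains f where "f \<in> carrier KQ" "X = cls f"
  using assms carrier_A_iff by blast

lemma cls_closed: "f \<in> carrier KQ \<Longrightarrow> cls f \<in> carrier A"
  using carrier_A_iff by blast

lemma coef_nonzero: "coef X r \<noteq> 0 \<Longrightarrow> nonzero_path r"
  by (auto simp: coef_def split: if_splits)

lemma finite_coef: "X \<in> carrier A \<Longrightarrow> finite {r. coef X r \<noteq> 0}"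
proof -
  assume "X \<in> carrier A"
  then obtain f where f: "f \<in> carrier KQ" "X = cls f" using carrier_A_iff by blast
  then have "{r. coef X r \<noteq> 0} \<subseteq> {r. f r \<noteq> 0}" by (auto simp: coef_cls)
  moreover have "finite {r. f r \<noteq> 0}" using f by (simp add: path_algebra_simps(1))
  ultimately show ?thesis by (rule finite_subset)
qed

lemma coef_eqI:
  assumes X: "X \<in> carrier A" and Y: "Y \<in> carrier A"
    and eq: "\<And>r. nonzero_path r \<Longrightarrow> coef X r = coef Y r"
  shows "X = Y"
proof -
  obtain f where f: "f \<in> carrier KQ" "X = cls f" using X by (rule carrier_A_E)
  obtain g where g: "g \<in> carrier KQ" "Y = cls g" using Y by (rule carrier_A_E)
  have d: "f \<ominus>\<^bsub>KQ\<^esub> g \<in> carrier KQ" using f g by simp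
  have "(f \<ominus>\<^bsub>KQ\<^esub> g) \<oplus>\<^bsub>KQ\<^esub> g = f"
    using f(1) g(1) by (simp add: KQ.minus_eq KQ.a_assoc KQ.l_neg)
  then have sum: "(f \<ominus>\<^bsub>KQ\<^esub> g) r + g r = f r" for r by (metis path_algebra_simps(5))
  have fg: "f r = g r" if "nonzero_path r" for r
    using eq[OF that] that unfolding f(2) g(2) coef_cls[OF f(1)] coef_cls[OF g(1)] by simp
  have "(f \<ominus>\<^bsub>KQ\<^esub> g) r = 0" if "nonzero_path r" for r
    using sum[of r] unfolding fg[OF that] by simp
  with d have "f \<ominus>\<^bsub>KQ\<^esub> g \<in> I" by (simp add: I_iff)
  then show ?thesis using KQ.quotient_eq_iff_same_a_r_cos[OF ideal_I f(1) g(1)] by (simp add: f g)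
qed

lemma cls_add: "f \<in> carrier KQ \<Longrightarrow> g \<in> carrier KQ \<Longrightarrow> cls f \<oplus>\<^bsub>A\<^esub> cls g = cls (f \<oplus>\<^bsub>KQ\<^esub> g)"
  by (simp add: FactRing_def I.a_rcos_sum)

lemma cls_mult: "f \<in> carrier KQ \<Longrightarrow> g \<in> carrier KQ \<Longrightarrow> cls f \<star> cls g = cls (f \<otimes>\<^bsub>KQ\<^esub> g)"
  by (simp add: FactRing_def I.rcoset_mult_add)

lemma coef_add:
  assumes "X \<in> carrier A" "Y \<in> carrier A"
  shows "coef (X \<oplus>\<^bsub>A\<^esub> Y) r = coef X r + coef Y r"
proof -
  obtain f where f: "f \<in> carrier KQ" "X = cls f" using assms(1) by (rule carrier_A_E)
  obtain g where g: "g \<in> carrier KQ" "Y = cls g" using assms(2) by (rule carrier_A_E)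
  show ?thesis
    unfolding f(2) g(2) cls_add[OF f(1) g(1)] coef_cls[OF f(1)] coef_cls[OF g(1)]
      coef_cls[OF KQ.a_closed[OF f(1) g(1)]]
    by (simp only: path_algebra_simps(5)) simp
qed

lemma coef_zero: "coef \<zero>\<^bsub>A\<^esub> r = 0"
proof -
  have "coef \<zero>\<^bsub>A\<^esub> r + coef \<zero>\<^bsub>A\<^esub> r = coef \<zero>\<^bsub>A\<^esub> r" 
    using coef_add[of "\<zero>\<^bsub>A\<^esub>" "\<zero>\<^bsub>A\<^esub>" r] A.zero_closed A.l_zero[OF A.zero_closed] by metis
  then show ?thesis by (metis add_cancel_right_right)
qed

lemma coef_mult:
  assumes "X \<in> carrier A" "Y \<in> carrier A" and r: "nonzero_path r"
  shows "coef (X \<star> Y) r = (\<Sum>(q, p)\<in>factors Q r. coef X q * coef Y p)"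
proof -
  obtain f where f: "f \<in> carrier KQ" "X = cls f" using assms(1) by (rule carrier_A_E)
  obtain g where g: "g \<in> carrier KQ" "Y = cls g" using assms(2) by (rule carrier_A_E)
  have "coef (X \<star> Y) r = (\<Sum>(q, p)\<in>factors Q r. f q * g p)"
    unfolding f(2) g(2) cls_mult[OF f(1) g(1)]
      coef_cls[OF path_algebra_mult_closed[OF f(1) g(1)]]
    using r by (simp only: path_algebra_simps(2)) simp
  also have "\<dots> = (\<Sum>(q, p)\<in>factors Q r. coef X q * coef Y p)"
    unfolding f(2) g(2) coef_cls[OF f(1)] coef_cls[OF g(1)]
    by (rule sum.cong) (use nonzero_path_factor[OF r] in auto)
  finally show ?thesis .
qed

lemma coef_finsum:
  assumes "finite T" "\<And>t. t \<in> T \<Longrightarrow> f t \<in> carrier A"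
  shows "coef (\<Oplus>\<^bsub>A\<^esub>t\<in>T. f t) r = (\<Sum>t\<in>T. coef (f t) r)"
  using assms
proof (induction T)
  case (insert t T)
  then have "f \<in> T \<rightarrow> carrier A" "f t \<in> carrier A" by auto
  with insert show ?case by (simp add: A.finsum_insert coef_add)
qed (simp add: coef_zero)

definition elt :: "(('v, 'e) qpath \<Rightarrow> 'k) \<Rightarrow> (('v, 'e) qpath \<Rightarrow> 'k) set" where
  "elt c = cls (\<lambda>r. if nonzero_path r then c r else 0)"

lemma
  assumes "finite {r. c r \<noteq> 0}"
  shows elt_closed: "elt c \<in> carrier A"
    and coef_elt: "coef (elt c) r = (if nonzero_path r then c r else 0)"
proof -
  have "{r. (if nonzero_path r then c r else 0) \<noteq> 0} \<subseteq> {r. c r \<noteq> 0}" by auto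
  then have "finite {r. (if nonzero_path r then c r else 0) \<noteq> 0}" using assms by (rule finite_subset)
  then have *: "(\<lambda>r. if nonzero_path r then c r else 0) \<in> carrier KQ"
    by (auto simp: path_algebra_simps(1) nonzero_path_def)
  show "elt c \<in> carrier A" unfolding elt_def by (rule cls_closed[OF *])
  show "coef (elt c) r = (if nonzero_path r then c r else 0)" unfolding elt_def by (simp add: coef_cls[OF *])
qed

lemma elt_coef: "X \<in> carrier A \<Longrightarrow> elt (coef X) = X"
  using finite_coef[of X] by (intro coef_eqI) (simp_all add: elt_closed coef_elt)

subsection \<open>Scalars, idempotents and arrows\<close>

abbreviation sc :: "'k \<Rightarrow> (('v, 'e) qpath \<Rightarrow> 'k) set" where "sc \<equiv> algebra_scalar Q I"
abbreviation e :: "'v \<Rightarrow> (('v, 'e) qpath \<Rightarrow> 'k) set" where "e \<equiv> vertex_idem Q I"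
abbreviation dg :: "int \<Rightarrow> (('v, 'e) qpath \<Rightarrow> 'k) set set" where "dg \<equiv> algebra_degree Q I"
definition ar :: "'e \<Rightarrow> (('v, 'e) qpath \<Rightarrow> 'k) set" where
  "ar a = cls (mono_elt 1 (tail Q a, [a], head Q a))"

lemma nonzero_Nil: "nonzero_path (x, [], y) \<longleftrightarrow> x = y \<and> x \<in> verts Q"
  by (auto simp: nonzero_path_def paths_iff awalk_Nil_iff)

lemma nonzero_Cons:
  "nonzero_path (x, a # l, y) \<longleftrightarrow> a \<in> arcs Q \<and> x = tail Q a \<and> nonzero_path (head Q a, l, y) \<and>
     (l \<noteq> [] \<longrightarrow> compatible a (hd l))"
  by (auto simp: nonzero_path_def paths_iff awalk_Cons_iff successively_Cons)

lemma nonzero_snoc: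
  "nonzero_path (x, l @ [a], y) \<longleftrightarrow> a \<in> arcs Q \<and> y = head Q a \<and> nonzero_path (x, l, tail Q a) \<and>
     (l \<noteq> [] \<longrightarrow> compatible (last l) a)"
  using awalk_append_Cons[of x l a "[]" y]
  by (cases "a \<in> arcs Q") (auto simp: nonzero_path_def paths_iff awalk_Nil_iff successively_append_iff simp del: awalk_append_iff)

lemma path_elt_Nil_carrier: "x \<in> verts Q \<Longrightarrow> path_elt (x, [], x) \<in> carrier KQ"
  unfolding path_elt_mono_elt by (rule mono_elt_carrier) (simp add: paths_iff awalk_Nil_iff)

lemma e_closed [simp]: "x \<in> verts Q \<Longrightarrow> e x \<in> carrier A"
  unfolding vertex_idem_def by (intro cls_closed path_elt_Nil_carrier)

lemma coef_e: "x \<in> verts Q \<Longrightarrow> coef (e x) r = (if r = (x, [], x) then 1 else 0)"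
  unfolding vertex_idem_def coef_cls[OF path_elt_Nil_carrier]
  by (simp add: path_elt_def nonzero_Nil)

lemma ar_path: "a \<in> arcs Q \<Longrightarrow> (tail Q a, [a], head Q a) \<in> paths Q"
  by (simp add: paths_iff arc_implies_awalk)

lemma ar_closed [simp]: "a \<in> arcs Q \<Longrightarrow> ar a \<in> carrier A"
  unfolding ar_def by (intro cls_closed mono_elt_carrier ar_path)

lemma coef_ar: "a \<in> arcs Q \<Longrightarrow> coef (ar a) r = (if r = (tail Q a, [a], head Q a) then 1 else 0)"
  unfolding ar_def coef_cls[OF mono_elt_carrier[OF ar_path]]
  by (simp add: mono_elt_def nonzero_Cons nonzero_Nil)

lemma scalar_one_carrier: "(\<lambda>p. c * \<one>\<^bsub>KQ\<^esub> p) \<in> carrier KQ"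
proof -
  have "{p. c * \<one>\<^bsub>KQ\<^esub> p \<noteq> 0} \<subseteq> {p. \<one>\<^bsub>KQ\<^esub> p \<noteq> 0}" by auto
  moreover have "finite {p. \<one>\<^bsub>KQ\<^esub> p \<noteq> 0} \<and> {p. \<one>\<^bsub>KQ\<^esub> p \<noteq> 0} \<subseteq> paths Q"
    using KQ.one_closed unfolding path_algebra_simps(1) .
  ultimately show ?thesis unfolding path_algebra_simps(1) using finite_subset by blast
qed

lemma sc_closed [simp]: "sc c \<in> carrier A"
  unfolding algebra_scalar_def by (intro cls_closed scalar_one_carrier)

lemma coef_sc: "coef (sc c) r = (if nonzero_path r \<and> fst (snd r) = [] then c else 0)"
  unfolding algebra_scalar_def coef_cls[OF scalar_one_carrier]
  by (cases r) (auto simp: nonzero_Nil path_algebra_simps(3))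

lemma coef_sc_mult:
  assumes "X \<in> carrier A"
  shows "coef (sc c \<star> X) r = c * coef X r"
proof (cases "nonzero_path r")
  case True
  then have r: "r \<in> paths Q" by (simp add: nonzero_path_def)
  show ?thesis
    using True path_target_in_verts[OF r]
    by (subst coef_mult[OF sc_closed assms True], subst sum_factors_trivial_left[OF r])
      (simp_all add: coef_sc nonzero_Nil)
next
  case False then show ?thesis by (simp add: coef_def)
qed

lemma coef_mult_sc:
  assumes "X \<in> carrier A"
  shows "coef (X \<star> sc c) r = c * coef X r"
proof (cases "nonzero_path r")
  case True
  then have r: "r \<in> paths Q" by (simp add: nonzero_path_def)
  show ?thesis
    using True path_source_in_verts[OF r]
    by (subst coef_mult[OF assms sc_closed True], subst sum_factors_trivial_right[OF r])
      (simp_all add: coef_sc nonzero_Nil)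
next
  case False then show ?thesis by (simp add: coef_def)
qed

lemma coef_e_mult:
  assumes "X \<in> carrier A" "x \<in> verts Q"
  shows "coef (e x \<star> X) r = (if path_target r = x then coef X r else 0)"
proof (cases "nonzero_path r")
  case True
  then have r: "r \<in> paths Q" by (simp add: nonzero_path_def)
  show ?thesis
    by (subst coef_mult[OF e_closed[OF assms(2)] assms(1) True], subst sum_factors_trivial_left[OF r])
      (simp_all add: coef_e assms)
next
  case False then show ?thesis by (simp add: coef_def)
qed

lemma coef_mult_e:
  assumes "X \<in> carrier A" "x \<in> verts Q"
  shows "coef (X \<star> e x) r = (if path_source r = x then coef X r else 0)"
proof (cases "nonzero_path r")
  case True
  then have r: "r \<in> paths Q" by (simp add: nonzero_path_def)
  show ?thesis
    by (subst coef_mult[OF assms(1) e_closed[OF assms(2)] True], subst sum_factors_trivial_right[OF r])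
      (simp_all add: coef_e assms)
next
  case False then show ?thesis by (simp add: coef_def)
qed

lemma coef_ar_mult_snoc:
  assumes "X \<in> carrier A" "a \<in> arcs Q" "nonzero_path (x, l @ [a], y)"
  shows "coef (ar a \<star> X) (x, l @ [a], y) = coef X (x, l, tail Q a)"
proof -
  let ?i = "((tail Q a, [a], head Q a), (x, l, tail Q a))"
  have i: "?i \<in> factors Q (x, l @ [a], y)"
    using assms(3) ar_path[OF assms(2)]
    unfolding factors_iff nonzero_snoc by (simp add: nonzero_path_def paths_iff)
  have "coef (ar a \<star> X) (x, l @ [a], y) =
      (\<Sum>(q, p)\<in>factors Q (x, l @ [a], y). coef (ar a) q * coef X p)"
    by (rule coef_mult) (use assms in simp_all)
  also have "\<dots> = (\<Sum>(q, p)\<in>{?i}. coef (ar a) q * coef X p)"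
  proof (rule sum.mono_neutral_right)
    show "\<forall>j\<in>factors Q (x, l @ [a], y) - {?i}. (case j of (q, p) \<Rightarrow> coef (ar a) q * coef X p) = 0"
    proof
      fix j assume j: "j \<in> factors Q (x, l @ [a], y) - {?i}"
      obtain v m w x' k z where j': "j = ((v, m, w), (x', k, z))" by (cases j) auto
      have "(v, m, w) \<noteq> (tail Q a, [a], head Q a)" using j unfolding j'
        by (clarsimp simp: factors_iff)
      then show "(case j of (q, p) \<Rightarrow> coef (ar a) q * coef X p) = 0" using assms by (auto simp: j' coef_ar)
    qed
  qed (use i in simp_all)
  also have "\<dots> = coef X (x, l, tail Q a)" using assms by (simp add: coef_ar)
  finally show ?thesis .
qed

lemma coef_ar_mult_eq_0:
  assumes "X \<in> carrier A" "a \<in> arcs Q" "l = [] \<or> last l \<noteq> a"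
  shows "coef (ar a \<star> X) (x, l, y) = 0"
proof (cases "nonzero_path (x, l, y)")
  case True
  have "coef (ar a \<star> X) (x, l, y) = (\<Sum>(q, p)\<in>factors Q (x, l, y). coef (ar a) q * coef X p)"
    by (rule coef_mult) (use assms True in simp_all)
  also have "\<dots> = 0"
  proof (rule sum.neutral, rule ballI)
    fix j assume j: "j \<in> factors Q (x, l, y)"
    obtain v m w x' k z where j': "j = ((v, m, w), (x', k, z))" by (cases j) auto
    have "(v, m, w) \<noteq> (tail Q a, [a], head Q a)" using j assms(3) unfolding j'
      by (clarsimp simp: factors_iff)
    then show "(case j of (q, p) \<Rightarrow> coef (ar a) q * coef X p) = 0" using assms by (auto simp: j' coef_ar)
  qed
  finally show ?thesis .
next
  case False then show ?thesis by (simp add: coef_def)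
qed

lemma coef_mult_ar_Cons:
  assumes "X \<in> carrier A" "a \<in> arcs Q" "nonzero_path (x, a # l, y)"
  shows "coef (X \<star> ar a) (x, a # l, y) = coef X (head Q a, l, y)"
proof -
  let ?i = "((head Q a, l, y), (tail Q a, [a], head Q a))"
  have i: "?i \<in> factors Q (x, a # l, y)"
    using assms(3) ar_path[OF assms(2)]
    unfolding factors_iff nonzero_Cons by (simp add: nonzero_path_def paths_iff)
  have "coef (X \<star> ar a) (x, a # l, y) =
      (\<Sum>(q, p)\<in>factors Q (x, a # l, y). coef X q * coef (ar a) p)"
    by (rule coef_mult) (use assms in simp_all)
  also have "\<dots> = (\<Sum>(q, p)\<in>{?i}. coef X q * coef (ar a) p)"
  proof (rule sum.mono_neutral_right)
    show "\<forall>j\<in>factors Q (x, a # l, y) - {?i}. (case j of (q, p) \<Rightarrow> coef X q * coef (ar a) p) = 0"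
    proof
      fix j assume j: "j \<in> factors Q (x, a # l, y) - {?i}"
      obtain v m w x' k z where j': "j = ((v, m, w), (x', k, z))" by (cases j) auto
      have "(x', k, z) \<noteq> (tail Q a, [a], head Q a)" using j unfolding j'
        by (clarsimp simp: factors_iff)
      then show "(case j of (q, p) \<Rightarrow> coef X q * coef (ar a) p) = 0" using assms by (auto simp: j' coef_ar)
    qed
  qed (use i in simp_all)
  also have "\<dots> = coef X (head Q a, l, y)" using assms by (simp add: coef_ar)
  finally show ?thesis .
qed

lemma coef_mult_ar_eq_0:
  assumes "X \<in> carrier A" "a \<in> arcs Q" "l = [] \<or> hd l \<noteq> a"
  shows "coef (X \<star> ar a) (x, l, y) = 0"
proof (cases "nonzero_path (x, l, y)")
  case True
  have "coef (X \<star> ar a) (x, l, y) = (\<Sum>(q, p)\<in>factors Q (x, l, y). coef X q * coef (ar a) p)"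
    by (rule coef_mult) (use assms True in simp_all)
  also have "\<dots> = 0"
  proof (rule sum.neutral, rule ballI)
    fix j assume j: "j \<in> factors Q (x, l, y)"
    obtain v m w x' k z where j': "j = ((v, m, w), (x', k, z))" by (cases j) auto
    have "(x', k, z) \<noteq> (tail Q a, [a], head Q a)" using j assms(3) unfolding j'
      by (clarsimp simp: factors_iff)
    then show "(case j of (q, p) \<Rightarrow> coef X q * coef (ar a) p) = 0" using assms by (auto simp: j' coef_ar)
  qed
  finally show ?thesis .
next
  case False then show ?thesis by (simp add: coef_def)
qed

end

context quadratic_monomial
begin

subsection \<open>Scalars and grading\<close>

lemma coef_minus: "X \<in> carrier A \<Longrightarrow> coef (\<ominus>\<^bsub>A\<^esub> X) r = - coef X r"
  using coef_add[of X "\<ominus>\<^bsub>A\<^esub> X" r] A.r_neg[of X] A.a_inv_closed[of X] coef_zero[of r]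
  by (metis eq_neg_iff_add_eq_0 add.commute)

lemma coef_eq_0: "\<not> nonzero_path r \<Longrightarrow> coef X r = 0"
  by (simp add: coef_def)

lemma sc_zero: "sc 0 = \<zero>\<^bsub>A\<^esub>"
  by (rule coef_eqI) (auto simp: coef_sc coef_zero)

lemma sc_add: "sc (c + d) = sc c \<oplus>\<^bsub>A\<^esub> sc d"
  by (rule coef_eqI) (auto simp: coef_sc coef_add)

lemma sc_mult: "sc (c * d) = sc c \<star> sc d"
  by (rule coef_eqI) (auto simp: coef_sc coef_sc_mult)

lemma sc_commute: "X \<in> carrier A \<Longrightarrow> X \<star> sc c = sc c \<star> X"
  by (rule coef_eqI) (simp_all add: coef_sc_mult coef_mult_sc)

lemma dg_iff:
  "X \<in> dg n \<longleftrightarrow> X \<in> carrier A \<and> (\<forall>r. coef X r \<noteq> 0 \<longrightarrow> int (path_length r) = n)"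
proof
  assume "X \<in> dg n"
  then obtain f where f: "X = cls f" "f \<in> carrier KQ" "\<forall>p. f p \<noteq> 0 \<longrightarrow> int (path_length p) = n"
    unfolding algebra_degree_def by blast
  then show "X \<in> carrier A \<and> (\<forall>r. coef X r \<noteq> 0 \<longrightarrow> int (path_length r) = n)"
    using cls_closed[OF f(2)] by (simp add: f(1) coef_cls[OF f(2)])
next
  assume X: "X \<in> carrier A \<and> (\<forall>r. coef X r \<noteq> 0 \<longrightarrow> int (path_length r) = n)"
  have "coef X \<in> carrier KQ"
    using X finite_coef[of X] coef_nonzero unfolding path_algebra_simps(1) nonzero_path_def by blast
  moreover have "X = cls (coef X)"
  proof -
    have "(\<lambda>r. if nonzero_path r then coef X r else 0) = coef X" using coef_nonzero by fastforce
    then show ?thesis using elt_coef[of X] X by (simp add: elt_def)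
  qed
  ultimately show "X \<in> dg n" using X unfolding algebra_degree_def by blast
qed

lemma dg_closed: "X \<in> dg n \<Longrightarrow> X \<in> carrier A"
  by (simp add: dg_iff)

lemma dgD: "X \<in> dg n \<Longrightarrow> coef X r \<noteq> 0 \<Longrightarrow> int (path_length r) = n"
  by (simp only: dg_iff) blast

lemma dgI: "X \<in> carrier A \<Longrightarrow> (\<And>r. coef X r \<noteq> 0 \<Longrightarrow> int (path_length r) = n) \<Longrightarrow> X \<in> dg n"
  by (simp only: dg_iff) blast

lemma dg_zero: "\<zero>\<^bsub>A\<^esub> \<in> dg n"
  by (simp add: dg_iff coef_zero)

lemma dg_add: "X \<in> dg n \<Longrightarrow> Y \<in> dg n \<Longrightarrow> X \<oplus>\<^bsub>A\<^esub> Y \<in> dg n"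
proof (rule dgI)
  fix r assume X: "X \<in> dg n" and Y: "Y \<in> dg n" and "coef (X \<oplus>\<^bsub>A\<^esub> Y) r \<noteq> 0"
  then have "coef X r \<noteq> 0 \<or> coef Y r \<noteq> 0" by (auto simp: coef_add[OF dg_closed[OF X] dg_closed[OF Y]])
  then show "int (path_length r) = n" using dgD[OF X] dgD[OF Y] by blast
qed (simp add: dg_closed)

lemma dg_minus: "X \<in> dg n \<Longrightarrow> \<ominus>\<^bsub>A\<^esub> X \<in> dg n"
proof (rule dgI)
  fix r assume X: "X \<in> dg n" and "coef (\<ominus>\<^bsub>A\<^esub> X) r \<noteq> 0"
  then have "coef X r \<noteq> 0" by (simp add: coef_minus[OF dg_closed[OF X]])
  then show "int (path_length r) = n" by (rule dgD[OF X])
qed (simp add: dg_closed)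

lemma dg_finsum:
  assumes "finite T" "\<And>t. t \<in> T \<Longrightarrow> f t \<in> dg n"
  shows "(\<Oplus>\<^bsub>A\<^esub>t\<in>T. f t) \<in> dg n"
  using assms
proof (induction T)
  case (insert t T)
  then have "f \<in> T \<rightarrow> carrier A" "f t \<in> carrier A" using dg_closed by auto
  with insert show ?case by (simp add: A.finsum_insert dg_add)
qed (simp add: dg_zero)

lemma dg_mult:
  assumes "X \<in> dg m" "Y \<in> dg n"
  shows "X \<star> Y \<in> dg (m + n)"
proof -
  note XY = dg_closed[OF assms(1)] dg_closed[OF assms(2)]
  have "int (path_length r) = m + n" if r: "coef (X \<star> Y) r \<noteq> 0" for r
  proof -
    have "(\<Sum>(q, p)\<in>factors Q r. coef X q * coef Y p) \<noteq> 0"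
      using r coef_mult[OF XY coef_nonzero[OF r]] by simp
    then obtain j where j: "j \<in> factors Q r" "(case j of (q, p) \<Rightarrow> coef X q * coef Y p) \<noteq> 0"
      by (rule sum.not_neutral_contains_not_neutral)
    obtain q p where qp: "j = (q, p)" by (cases j)
    have "coef X q \<noteq> 0" "coef Y p \<noteq> 0" using j(2) by (auto simp: qp)
    then have "int (path_length q) = m" "int (path_length p) = n" using assms dgD by blast+
    moreover have "path_comp q p = r" using j(1) by (simp add: qp factors_def)
    then have "path_length r = path_length p + path_length q" by (auto simp: path_comp_def path_length_def)
    ultimately show ?thesis by simp
  qed
  then show ?thesis using XY by (intro dgI) simp_all
qed

lemma dg_neg: "X \<in> dg n \<Longrightarrow> n < 0 \<Longrightarrow> X = \<zero>\<^bsub>A\<^esub>"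
  by (intro coef_eqI) (use dgD[of X n] in \<open>force simp: coef_zero dg_closed\<close>)+

lemma e_deg: "x \<in> verts Q \<Longrightarrow> e x \<in> dg 0"
  by (intro dgI) (auto simp: coef_e path_length_def split: if_splits)

lemma ar_deg: "a \<in> arcs Q \<Longrightarrow> ar a \<in> dg 1"
  by (intro dgI) (auto simp: coef_ar path_length_def split: if_splits)

lemma sc_deg: "sc c \<in> dg 0"
  by (intro dgI) (auto simp: coef_sc path_length_def split: if_splits)

lemma e_idem: "x \<in> verts Q \<Longrightarrow> e x \<star> e x = e x"
  by (rule coef_eqI) (auto simp: coef_e_mult coef_e path_target_def)

lemma e_head_ar: "a \<in> arcs Q \<Longrightarrow> e (head Q a) \<star> ar a = ar a"
  by (rule coef_eqI) (auto simp: coef_e_mult coef_ar path_target_def)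

lemma ar_e_tail: "a \<in> arcs Q \<Longrightarrow> ar a \<star> e (tail Q a) = ar a"
  by (rule coef_eqI) (auto simp: coef_mult_e coef_ar path_source_def)

lemma degree_0_right:
  assumes "X \<in> dg 0" "x \<in> verts Q" "X \<star> e x = X"
  shows "X = sc (coef X (x, [], x)) \<star> e x"
proof (rule coef_eqI)
  fix r assume r: "nonzero_path r"
  obtain u l v where r': "r = (u, l, v)" by (cases r)
  have "coef X r = (if u = x then coef X r else 0)"
    using coef_mult_e[OF dg_closed[OF assms(1)] assms(2), of r] by (simp add: assms(3) r' path_source_def)
  moreover have "coef X r \<noteq> 0 \<Longrightarrow> l = []" using dgD[OF assms(1), of r] by (simp add: r' path_length_def)
  ultimately show "coef X r = coef (sc (coef X (x, [], x)) \<star> e x) r"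
    using r assms(2) by (cases "l = []"; cases "u = x") (auto simp: coef_sc_mult coef_e r' nonzero_Nil)
qed (use assms dg_closed in auto)

lemma degree_0_left:
  assumes "X \<in> dg 0" "x \<in> verts Q" "e x \<star> X = X"
  shows "X = sc (coef X (x, [], x)) \<star> e x"
proof (rule coef_eqI)
  fix r assume r: "nonzero_path r"
  obtain u l v where r': "r = (u, l, v)" by (cases r)
  have "coef X r = (if v = x then coef X r else 0)"
    using coef_e_mult[OF dg_closed[OF assms(1)] assms(2), of r] by (simp add: assms(3) r' path_target_def)
  moreover have "coef X r \<noteq> 0 \<Longrightarrow> l = []" using dgD[OF assms(1), of r] by (simp add: r' path_length_def)
  ultimately show "coef X r = coef (sc (coef X (x, [], x)) \<star> e x) r"
    using r assms(2) by (cases "l = []"; cases "v = x") (auto simp: coef_sc_mult coef_e r' nonzero_Nil)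
qed (use assms dg_closed in auto)

definition pr :: "int \<Rightarrow> (('v, 'e) qpath \<Rightarrow> 'k) set \<Rightarrow> (('v, 'e) qpath \<Rightarrow> 'k) set" where
  "pr n X = elt (\<lambda>r. if int (path_length r) = n then coef X r else 0)"

lemma
  assumes "X \<in> carrier A"
  shows pr_carrier: "pr n X \<in> carrier A"
    and coef_pr: "coef (pr n X) r = (if int (path_length r) = n then coef X r else 0)"
proof -
  have "{r. (if int (path_length r) = n then coef X r else 0) \<noteq> 0} \<subseteq> {r. coef X r \<noteq> 0}" by auto
  then have *: "finite {r. (if int (path_length r) = n then coef X r else 0) \<noteq> 0}"
    using finite_coef[OF assms] by (rule finite_subset)
  show "pr n X \<in> carrier A" unfolding pr_def by (rule elt_closed[OF *])
  show "coef (pr n X) r = (if int (path_length r) = n then coef X r else 0)"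
    unfolding pr_def coef_elt[OF *] using coef_nonzero[of X r] by auto
qed

lemma pr_deg: "X \<in> carrier A \<Longrightarrow> pr n X \<in> dg n"
  by (intro dgI) (simp_all add: pr_carrier coef_pr split: if_splits)

lemma pr_add: "X \<in> carrier A \<Longrightarrow> Y \<in> carrier A \<Longrightarrow> pr n (X \<oplus>\<^bsub>A\<^esub> Y) = pr n X \<oplus>\<^bsub>A\<^esub> pr n Y"
  by (rule coef_eqI) (auto simp: pr_carrier coef_pr coef_add)

lemma pr_same: "X \<in> dg n \<Longrightarrow> pr n X = X"
  by (rule coef_eqI) (auto simp: pr_carrier coef_pr dg_closed dest: dgD)

lemma pr_other: "X \<in> dg k \<Longrightarrow> k \<noteq> n \<Longrightarrow> pr n X = \<zero>\<^bsub>A\<^esub>"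
  by (rule coef_eqI) (auto simp: pr_carrier coef_pr coef_zero dg_closed dest: dgD)

lemma pr_mult_e: "X \<in> carrier A \<Longrightarrow> x \<in> verts Q \<Longrightarrow> pr n (X \<star> e x) = pr n X \<star> e x"
  by (rule coef_eqI) (auto simp: pr_carrier coef_pr coef_mult_e)

lemma pr_e_mult: "X \<in> carrier A \<Longrightarrow> x \<in> verts Q \<Longrightarrow> pr n (e x \<star> X) = e x \<star> pr n X"
  by (rule coef_eqI) (auto simp: pr_carrier coef_pr coef_e_mult)

lemma pr_sc_mult: "X \<in> carrier A \<Longrightarrow> pr n (sc c \<star> X) = sc c \<star> pr n X"
  by (rule coef_eqI) (auto simp: pr_carrier coef_pr coef_sc_mult)

lemma pr_support:
  assumes "X \<in> carrier A"
  shows "{n. pr n X \<noteq> \<zero>\<^bsub>A\<^esub>} \<subseteq> (\<lambda>r. int (path_length r)) ` {r. coef X r \<noteq> 0}"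
proof
  fix n assume "n \<in> {n. pr n X \<noteq> \<zero>\<^bsub>A\<^esub>}"
  then obtain r where "coef (pr n X) r \<noteq> 0"
    using coef_eqI[of "pr n X" "\<zero>\<^bsub>A\<^esub>"] pr_carrier[OF assms] by (auto simp: coef_zero)
  then have "int (path_length r) = n \<and> coef X r \<noteq> 0" using coef_pr[OF assms, of n r] by (auto split: if_splits)
  then show "n \<in> (\<lambda>r. int (path_length r)) ` {r. coef X r \<noteq> 0}" by auto
qed

lemma pr_finite: "X \<in> carrier A \<Longrightarrow> finite {n. pr n X \<noteq> \<zero>\<^bsub>A\<^esub>}"
  using pr_support finite_coef by (meson finite_imageI finite_subset)

lemma pr_sum:
  assumes X: "X \<in> carrier A"
  shows "X = (\<Oplus>\<^bsub>A\<^esub>n\<in>{n. pr n X \<noteq> \<zero>\<^bsub>A\<^esub>}. pr n X)"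
proof (rule coef_eqI)
  fix r :: "('v, 'e) qpath"
  let ?N = "{n. pr n X \<noteq> \<zero>\<^bsub>A\<^esub>}" and ?m = "int (path_length r)"
  have "coef (\<Oplus>\<^bsub>A\<^esub>n\<in>?N. pr n X) r = (\<Sum>n\<in>?N. coef (pr n X) r)"
    by (rule coef_finsum) (simp_all add: pr_finite pr_carrier X)
  also have "\<dots> = (\<Sum>n\<in>?N. if n = ?m then coef X r else 0)" by (rule sum.cong) (auto simp: coef_pr X)
  also have "\<dots> = (if ?m \<in> ?N then coef X r else 0)" by (simp add: pr_finite X)
  also have "\<dots> = coef X r" using coef_pr[OF X, of ?m r] coef_zero[of r] by auto
  finally show "coef X r = coef (\<Oplus>\<^bsub>A\<^esub>n\<in>?N. pr n X) r" by simp
qed (use X in \<open>auto intro!: A.finsum_closed pr_carrier\<close>)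

subsection \<open>Stripping off an arrow\<close>

text \<open>\<open>ls a\<close> cancels \<open>a\<close> as the last arrow of a path and kills the paths that do not end in \<open>a\<close>;
  \<open>rs a\<close> does the same with the first arrow.\<close>

definition ls :: "'e \<Rightarrow> (('v, 'e) qpath \<Rightarrow> 'k) set \<Rightarrow> (('v, 'e) qpath \<Rightarrow> 'k) set" where
  "ls a X = elt (\<lambda>r. if path_target r = tail Q a
     then coef X (path_source r, fst (snd r) @ [a], head Q a) else 0)"

definition rs :: "'e \<Rightarrow> (('v, 'e) qpath \<Rightarrow> 'k) set \<Rightarrow> (('v, 'e) qpath \<Rightarrow> 'k) set" where
  "rs a X = elt (\<lambda>r. if path_source r = head Q a
     then coef X (tail Q a, a # fst (snd r), path_target r) else 0)"

lemma
  assumes X: "X \<in> carrier A"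
  shows ls_closed: "ls a X \<in> carrier A"
    and coef_ls: "coef (ls a X) (x, l, y) = (if y = tail Q a then coef X (x, l @ [a], head Q a) else 0)"
proof -
  let ?c = "\<lambda>r. if path_target r = tail Q a then coef X (path_source r, fst (snd r) @ [a], head Q a) else 0"
  have "{r. ?c r \<noteq> 0} \<subseteq> (\<lambda>(x, l, y). (x, butlast l, tail Q a)) ` {r. coef X r \<noteq> 0}"
  proof
    fix r assume "r \<in> {r. ?c r \<noteq> 0}"
    then have "path_target r = tail Q a" "coef X (path_source r, fst (snd r) @ [a], head Q a) \<noteq> 0"
      by (auto split: if_splits)
    then show "r \<in> (\<lambda>(x, l, y). (x, butlast l, tail Q a)) ` {r. coef X r \<noteq> 0}"
      by (intro image_eqI[where x = "(path_source r, fst (snd r) @ [a], head Q a)"])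
        (cases r, auto simp: path_source_def path_target_def)
  qed
  then have *: "finite {r. ?c r \<noteq> 0}" by (rule finite_subset) (simp add: finite_coef[OF X])
  show "ls a X \<in> carrier A" unfolding ls_def by (rule elt_closed[OF *])
  show "coef (ls a X) (x, l, y) = (if y = tail Q a then coef X (x, l @ [a], head Q a) else 0)"
    unfolding ls_def coef_elt[OF *] using coef_nonzero[of X "(x, l @ [a], head Q a)"]
    by (auto simp: path_source_def path_target_def nonzero_snoc)
qed

lemma
  assumes X: "X \<in> carrier A"
  shows rs_closed: "rs a X \<in> carrier A"
    and coef_rs: "coef (rs a X) (x, l, y) = (if x = head Q a then coef X (tail Q a, a # l, y) else 0)"
proof -
  let ?c = "\<lambda>r. if path_source r = head Q a then coef X (tail Q a, a # fst (snd r), path_target r) else 0"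
  have "{r. ?c r \<noteq> 0} \<subseteq> (\<lambda>(x, l, y). (head Q a, tl l, y)) ` {r. coef X r \<noteq> 0}"
  proof
    fix r assume "r \<in> {r. ?c r \<noteq> 0}"
    then have "path_source r = head Q a" "coef X (tail Q a, a # fst (snd r), path_target r) \<noteq> 0"
      by (auto split: if_splits)
    then show "r \<in> (\<lambda>(x, l, y). (head Q a, tl l, y)) ` {r. coef X r \<noteq> 0}"
      by (intro image_eqI[where x = "(tail Q a, a # fst (snd r), path_target r)"])
        (cases r, auto simp: path_source_def path_target_def)
  qed
  then have *: "finite {r. ?c r \<noteq> 0}" by (rule finite_subset) (simp add: finite_coef[OF X])
  show "rs a X \<in> carrier A" unfolding rs_def by (rule elt_closed[OF *])
  show "coef (rs a X) (x, l, y) = (if x = head Q a then coef X (tail Q a, a # l, y) else 0)"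
    unfolding rs_def coef_elt[OF *] using coef_nonzero[of X "(tail Q a, a # l, y)"]
    by (auto simp: path_source_def path_target_def nonzero_Cons)
qed

lemma coef_eqI':
  assumes "X \<in> carrier A" "Y \<in> carrier A"
    and "\<And>x l y. nonzero_path (x, l, y) \<Longrightarrow> coef X (x, l, y) = coef Y (x, l, y)"
  shows "X = Y"
  by (rule coef_eqI[OF assms(1,2)]) (metis assms(3) prod_cases3)

lemma ls_add: "X \<in> carrier A \<Longrightarrow> Y \<in> carrier A \<Longrightarrow> ls a (X \<oplus>\<^bsub>A\<^esub> Y) = ls a X \<oplus>\<^bsub>A\<^esub> ls a Y"
  by (rule coef_eqI') (simp_all add: ls_closed coef_ls coef_add)

lemma rs_add: "X \<in> carrier A \<Longrightarrow> Y \<in> carrier A \<Longrightarrow> rs a (X \<oplus>\<^bsub>A\<^esub> Y) = rs a X \<oplus>\<^bsub>A\<^esub> rs a Y"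
  by (rule coef_eqI') (simp_all add: rs_closed coef_rs coef_add)

lemma ls_sc: "X \<in> carrier A \<Longrightarrow> ls a (sc c \<star> X) = sc c \<star> ls a X"
  by (rule coef_eqI') (simp_all add: ls_closed coef_ls coef_sc_mult)

lemma rs_sc: "X \<in> carrier A \<Longrightarrow> rs a (sc c \<star> X) = sc c \<star> rs a X"
  by (rule coef_eqI') (simp_all add: rs_closed coef_rs coef_sc_mult)

lemma ls_mult_e: "X \<in> carrier A \<Longrightarrow> x \<in> verts Q \<Longrightarrow> ls a (X \<star> e x) = ls a X \<star> e x"
  by (rule coef_eqI') (simp_all add: ls_closed coef_ls coef_mult_e path_source_def)

lemma rs_e_mult: "X \<in> carrier A \<Longrightarrow> x \<in> verts Q \<Longrightarrow> rs a (e x \<star> X) = e x \<star> rs a X"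
  by (rule coef_eqI') (simp_all add: rs_closed coef_rs coef_e_mult path_target_def)

lemma e_ls: "X \<in> carrier A \<Longrightarrow> a \<in> arcs Q \<Longrightarrow> e (tail Q a) \<star> ls a X = ls a X"
  by (rule coef_eqI') (simp_all add: ls_closed coef_ls coef_e_mult path_target_def)

lemma rs_e: "X \<in> carrier A \<Longrightarrow> a \<in> arcs Q \<Longrightarrow> rs a X \<star> e (head Q a) = rs a X"
  by (rule coef_eqI') (simp_all add: rs_closed coef_rs coef_mult_e path_source_def)

lemma ls_deg: "X \<in> dg n \<Longrightarrow> ls a X \<in> dg (n - 1)"
proof (rule dgI)
  fix r assume X: "X \<in> dg n" and c: "coef (ls a X) r \<noteq> 0"
  obtain x l y where r: "r = (x, l, y)" by (cases r)
  have "coef X (x, l @ [a], head Q a) \<noteq> 0"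
    using c coef_ls[OF dg_closed[OF X], of a x l y] by (simp add: r split: if_splits)
  from dgD[OF X this] show "int (path_length r) = n - 1" by (simp add: path_length_def r)
qed (simp add: ls_closed dg_closed)

lemma rs_deg: "X \<in> dg n \<Longrightarrow> rs a X \<in> dg (n - 1)"
proof (rule dgI)
  fix r assume X: "X \<in> dg n" and c: "coef (rs a X) r \<noteq> 0"
  obtain x l y where r: "r = (x, l, y)" by (cases r)
  have "coef X (tail Q a, a # l, y) \<noteq> 0"
    using c coef_rs[OF dg_closed[OF X], of a x l y] by (simp add: r split: if_splits)
  from dgD[OF X this] show "int (path_length r) = n - 1" by (simp add: path_length_def r)
qed (simp add: rs_closed dg_closed)

text \<open>Stripping off an arrow and putting it back selects the paths that contain it at that end.\<close>

lemma coef_ar_ls: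
  assumes X: "X \<in> carrier A" and a: "a \<in> arcs Q"
  shows "coef (ar a \<star> ls a X) (x, l, y) = (if l \<noteq> [] \<and> last l = a then coef X (x, l, y) else 0)"
proof (cases "nonzero_path (x, l, y) \<and> l \<noteq> [] \<and> last l = a")
  case True
  then obtain k where l: "l = k @ [a]" by (metis append_butlast_last_id)
  have n: "nonzero_path (x, k @ [a], y)" using True by (simp add: l)
  then have "y = head Q a" by (simp add: nonzero_snoc)
  then show ?thesis
    unfolding l coef_ar_mult_snoc[OF ls_closed[OF X] a n] coef_ls[OF X] by simp
next
  case False
  then show ?thesis
    using coef_ar_mult_eq_0[OF ls_closed[OF X] a, where l = l and x = x and y = y] coef_eq_0
    by metis
qed

lemma coef_rs_ar:
  assumes X: "X \<in> carrier A" and a: "a \<in> arcs Q"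
  shows "coef (rs a X \<star> ar a) (x, l, y) = (if l \<noteq> [] \<and> hd l = a then coef X (x, l, y) else 0)"
proof (cases "nonzero_path (x, l, y) \<and> l \<noteq> [] \<and> hd l = a")
  case True
  then obtain k where l: "l = a # k" by (metis list.collapse)
  have n: "nonzero_path (x, a # k, y)" using True by (simp add: l)
  then have "x = tail Q a" by (simp add: nonzero_Cons)
  then show ?thesis
    unfolding l coef_mult_ar_Cons[OF rs_closed[OF X] a n] coef_rs[OF X] by simp
next
  case False
  then show ?thesis
    using coef_mult_ar_eq_0[OF rs_closed[OF X] a, where l = l and x = x and y = y] coef_eq_0
    by metis
qed

lemma ls_ar_other:
  assumes "X \<in> carrier A" "a \<in> arcs Q" "a \<noteq> b"
  shows "ls b (ar a \<star> X) = \<zero>\<^bsub>A\<^esub>"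
  by (rule coef_eqI') (simp_all add: ls_closed coef_ls coef_zero coef_ar_mult_eq_0 assms(1,2) assms(3)[symmetric])

lemma rs_ar_other:
  assumes "X \<in> carrier A" "a \<in> arcs Q" "a \<noteq> b"
  shows "rs b (X \<star> ar a) = \<zero>\<^bsub>A\<^esub>"
  by (rule coef_eqI') (simp_all add: rs_closed coef_rs coef_zero coef_mult_ar_eq_0 assms(1,2) assms(3)[symmetric])

lemma ar_ls_ar:
  assumes "X \<in> carrier A" "a \<in> arcs Q"
  shows "ar a \<star> ls a (ar a \<star> X) = ar a \<star> X"
  by (rule coef_eqI') (auto simp: ls_closed coef_ar_ls coef_ar_mult_eq_0 assms)

lemma rs_ar_ar:
  assumes "X \<in> carrier A" "a \<in> arcs Q"
  shows "rs a (X \<star> ar a) \<star> ar a = X \<star> ar a"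
  by (rule coef_eqI') (auto simp: rs_closed coef_rs_ar coef_mult_ar_eq_0 assms)

lemma sum_ar_ls:
  assumes X: "X \<in> carrier A" and T: "T \<subseteq> arcs Q"
    and sup: "\<And>x l y. coef X (x, l, y) \<noteq> 0 \<Longrightarrow> l \<noteq> [] \<and> last l \<in> T"
  shows "X = (\<Oplus>\<^bsub>A\<^esub>a\<in>T. ar a \<star> ls a X)"
proof (rule coef_eqI')
  have fT: "finite T" using T finite_arcs finite_subset by blast
  have cl: "ar a \<star> ls a X \<in> carrier A" if "a \<in> T" for a using that T X by (auto simp: ls_closed)
  show "(\<Oplus>\<^bsub>A\<^esub>a\<in>T. ar a \<star> ls a X) \<in> carrier A" using cl by (intro A.finsum_closed) auto
  fix x l y
  have "coef (\<Oplus>\<^bsub>A\<^esub>a\<in>T. ar a \<star> ls a X) (x, l, y) = (\<Sum>a\<in>T. coef (ar a \<star> ls a X) (x, l, y))"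
    by (rule coef_finsum[OF fT cl])
  also have "\<dots> = (\<Sum>a\<in>T. if a = last l then (if l \<noteq> [] then coef X (x, l, y) else 0) else 0)"
    by (rule sum.cong) (use T X in \<open>auto simp: coef_ar_ls\<close>)
  also have "\<dots> = coef X (x, l, y)" using fT sup[of x l y] by auto
  finally show "coef X (x, l, y) = coef (\<Oplus>\<^bsub>A\<^esub>a\<in>T. ar a \<star> ls a X) (x, l, y)" by simp
qed (rule X)

lemma sum_rs_ar:
  assumes X: "X \<in> carrier A" and T: "T \<subseteq> arcs Q"
    and sup: "\<And>x l y. coef X (x, l, y) \<noteq> 0 \<Longrightarrow> l \<noteq> [] \<and> hd l \<in> T"
  shows "X = (\<Oplus>\<^bsub>A\<^esub>a\<in>T. rs a X \<star> ar a)"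
proof (rule coef_eqI')
  have fT: "finite T" using T finite_arcs finite_subset by blast
  have cl: "rs a X \<star> ar a \<in> carrier A" if "a \<in> T" for a using that T X by (auto simp: rs_closed)
  show "(\<Oplus>\<^bsub>A\<^esub>a\<in>T. rs a X \<star> ar a) \<in> carrier A" using cl by (intro A.finsum_closed) auto
  fix x l y
  have "coef (\<Oplus>\<^bsub>A\<^esub>a\<in>T. rs a X \<star> ar a) (x, l, y) = (\<Sum>a\<in>T. coef (rs a X \<star> ar a) (x, l, y))"
    by (rule coef_finsum[OF fT cl])
  also have "\<dots> = (\<Sum>a\<in>T. if a = hd l then (if l \<noteq> [] then coef X (x, l, y) else 0) else 0)"
    by (rule sum.cong) (use T X in \<open>auto simp: coef_rs_ar\<close>)
  also have "\<dots> = coef X (x, l, y)" using fT sup[of x l y] by auto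
  finally show "coef X (x, l, y) = coef (\<Oplus>\<^bsub>A\<^esub>a\<in>T. rs a X \<star> ar a) (x, l, y)" by simp
qed (rule X)

lemma nonzero_path_arcs: "nonzero_path (x, l, y) \<Longrightarrow> set l \<subseteq> arcs Q"
  by (induction l arbitrary: x) (auto simp: nonzero_Cons)

lemma dg_pos_support:
  assumes "X \<in> dg n" "n > 0" "coef X (x, l, y) \<noteq> 0"
  shows "l \<noteq> [] \<and> last l \<in> arcs Q \<and> hd l \<in> arcs Q"
proof -
  have "l \<noteq> []" using dgD[OF assms(1,3)] assms(2) by (auto simp: path_length_def)
  moreover have "set l \<subseteq> arcs Q" using coef_nonzero[OF assms(3)] by (rule nonzero_path_arcs)
  ultimately show ?thesis by auto
qed

lemma dg_pos_left: "X \<in> dg n \<Longrightarrow> n > 0 \<Longrightarrow> X = (\<Oplus>\<^bsub>A\<^esub>a\<in>arcs Q. ar a \<star> ls a X)"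
  using dg_pos_support by (intro sum_ar_ls) (auto simp: dg_closed)

lemma dg_pos_right: "X \<in> dg n \<Longrightarrow> n > 0 \<Longrightarrow> X = (\<Oplus>\<^bsub>A\<^esub>a\<in>arcs Q. rs a X \<star> ar a)"
  using dg_pos_support by (intro sum_rs_ar) (auto simp: dg_closed)

text \<open>\<open>zr b a\<close> says that \<open>ab\<close>, first \<open>b\<close> and then \<open>a\<close>, is one of the relations.\<close>

definition zr :: "'e \<Rightarrow> 'e \<Rightarrow> bool" where
  "zr b a \<longleftrightarrow> a \<in> arcs Q \<and> b \<in> arcs Q \<and> head Q b = tail Q a \<and> \<not> compatible b a"

lemma zr_arcs: "zr b a \<Longrightarrow> a \<in> arcs Q" "zr b a \<Longrightarrow> b \<in> arcs Q"
  by (auto simp: zr_def)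

lemma finite_zr: "finite {b. zr b a}" "finite {b. zr a b}"
  by (rule finite_subset[OF _ finite_arcs]; auto simp: zr_def)+

lemma zr_zero:
  assumes "zr b a" shows "ar a \<star> ar b = \<zero>\<^bsub>A\<^esub>"
proof (rule coef_eqI')
  have ab: "a \<in> arcs Q" "b \<in> arcs Q" "\<not> compatible b a" using assms by (auto simp: zr_def)
  fix x l y assume n: "nonzero_path (x, l, y)"
  show "coef (ar a \<star> ar b) (x, l, y) = coef \<zero>\<^bsub>A\<^esub> (x, l, y)"
  proof (cases "l \<noteq> [] \<and> last l = a")
    case True
    then obtain k where l: "l = k @ [a]" by (metis append_butlast_last_id)
    have "coef (ar a \<star> ar b) (x, l, y) = coef (ar b) (x, k, tail Q a)"
      unfolding l by (rule coef_ar_mult_snoc) (use n l ab in auto)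
    also have "\<dots> = 0" using n ab by (auto simp: coef_ar l nonzero_snoc)
    finally show ?thesis by (simp add: coef_zero)
  qed (auto simp: coef_ar_mult_eq_0 ab coef_zero)
qed (use assms in \<open>auto simp: zr_def\<close>)

text \<open>The annihilator of an arrow is generated by the arrows that form a relation with it, because
  the relations are monomials of length two.\<close>

lemma ann_left:
  assumes X: "X \<in> carrier A" and a: "a \<in> arcs Q"
    and e: "e (tail Q a) \<star> X = X" and z: "ar a \<star> X = \<zero>\<^bsub>A\<^esub>"
  shows "X = (\<Oplus>\<^bsub>A\<^esub>b\<in>{b. zr b a}. ar b \<star> ls b X)"
proof (rule sum_ar_ls[OF X])
  show "{b. zr b a} \<subseteq> arcs Q" by (auto simp: zr_def)
  fix x l y assume c: "coef X (x, l, y) \<noteq> 0"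
  have y: "y = tail Q a"
    using coef_e_mult[OF X tail_in_verts[OF a], of "(x, l, y)"] c by (simp add: e path_target_def split: if_splits)
  have n: "nonzero_path (x, l, tail Q a)" using coef_nonzero[OF c] y by simp
  have "\<not> nonzero_path (x, l @ [a], head Q a)"
  proof
    assume "nonzero_path (x, l @ [a], head Q a)"
    from coef_ar_mult_snoc[OF X a this] c show False by (simp add: z coef_zero y)
  qed
  then have l: "l \<noteq> []" "\<not> compatible (last l) a" using n a by (auto simp: nonzero_snoc)
  then obtain k b where k: "l = k @ [b]" by (metis append_butlast_last_id)
  show "l \<noteq> [] \<and> last l \<in> {b. zr b a}" using n l a by (auto simp: k nonzero_snoc zr_def)
qed

lemma ann_right:
  assumes X: "X \<in> carrier A" and a: "a \<in> arcs Q"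
    and e: "X \<star> e (head Q a) = X" and z: "X \<star> ar a = \<zero>\<^bsub>A\<^esub>"
  shows "X = (\<Oplus>\<^bsub>A\<^esub>b\<in>{b. zr a b}. rs b X \<star> ar b)"
proof (rule sum_rs_ar[OF X])
  show "{b. zr a b} \<subseteq> arcs Q" by (auto simp: zr_def)
  fix x l y assume c: "coef X (x, l, y) \<noteq> 0"
  have y: "x = head Q a"
    using coef_mult_e[OF X head_in_verts[OF a], of "(x, l, y)"] c by (simp add: e path_source_def split: if_splits)
  have n: "nonzero_path (head Q a, l, y)" using coef_nonzero[OF c] y by simp
  have "\<not> nonzero_path (tail Q a, a # l, y)"
  proof
    assume "nonzero_path (tail Q a, a # l, y)"
    from coef_mult_ar_Cons[OF X a this] c show False by (simp add: z coef_zero y)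
  qed
  then have l: "l \<noteq> []" "\<not> compatible a (hd l)" using n a by (auto simp: nonzero_Cons)
  then obtain k b where k: "l = b # k" by (metis list.collapse)
  show "l \<noteq> [] \<and> hd l \<in> {b. zr a b}" using n l a by (auto simp: k nonzero_Cons zr_def)
qed

end

section \<open>Graded modules\<close>

subsection \<open>Finite sums in abelian groups\<close>

lemma additive_zero:
  assumes "abelian_group G" "abelian_group H" "f \<in> hom (add_monoid G) (add_monoid H)"
  shows "f \<zero>\<^bsub>G\<^esub> = \<zero>\<^bsub>H\<^esub>"
proof -
  interpret G: abelian_group G by fact
  interpret H: abelian_group H by fact
  have z: "f \<zero>\<^bsub>G\<^esub> \<in> carrier H" using assms(3) G.zero_closed by (auto simp: hom_def Pi_def)
  have add: "f (x \<oplus>\<^bsub>G\<^esub> y) = f x \<oplus>\<^bsub>H\<^esub> f y" if "x \<in> carrier G" "y \<in> carrier G" for x y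
    using assms(3) that by (auto simp: hom_def)
  from add[OF G.zero_closed G.zero_closed]
  have "f \<zero>\<^bsub>G\<^esub> \<oplus>\<^bsub>H\<^esub> f \<zero>\<^bsub>G\<^esub> = f \<zero>\<^bsub>G\<^esub>" by simp
  then show ?thesis by (metis H.r_neg1 H.l_neg z)
qed

lemma additive_minus:
  assumes "abelian_group G" "abelian_group H" "f \<in> hom (add_monoid G) (add_monoid H)" "x \<in> carrier G"
  shows "f (\<ominus>\<^bsub>G\<^esub> x) = \<ominus>\<^bsub>H\<^esub> f x"
proof -
  interpret G: abelian_group G by fact
  interpret H: abelian_group H by fact
  have "f (\<ominus>\<^bsub>G\<^esub> x) \<oplus>\<^bsub>H\<^esub> f x = f (\<ominus>\<^bsub>G\<^esub> x \<oplus>\<^bsub>G\<^esub> x)"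
    using assms(3,4) by (simp add: hom_def Pi_def)
  also have "\<dots> = \<zero>\<^bsub>H\<^esub>" using assms(4) additive_zero[OF assms(1,2,3)] by (simp add: G.l_neg)
  finally show ?thesis using assms(3,4) by (intro H.minus_equality[symmetric]) (auto simp: hom_def Pi_def)
qed

lemma additive_finsum:
  assumes "abelian_group G" "abelian_group H" "f \<in> hom (add_monoid G) (add_monoid H)"
    and "\<And>t. t \<in> T \<Longrightarrow> g t \<in> carrier G"
  shows "f (\<Oplus>\<^bsub>G\<^esub>t\<in>T. g t) = (\<Oplus>\<^bsub>H\<^esub>t\<in>T. f (g t))"
proof -
  interpret G: abelian_group G by fact
  interpret H: abelian_group H by fact
  have f: "f x \<in> carrier H" "f (x \<oplus>\<^bsub>G\<^esub> y) = f x \<oplus>\<^bsub>H\<^esub> f y" if "x \<in> carrier G" "y \<in> carrier G" for x y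
    using assms(3) that by (auto simp: hom_def Pi_def)
  show ?thesis using assms(4)
  proof (induction T rule: infinite_finite_induct)
    case (insert t T)
    then have "g \<in> T \<rightarrow> carrier G" "g t \<in> carrier G" "(\<lambda>t. f (g t)) \<in> T \<rightarrow> carrier H"
      "f (g t) \<in> carrier H" using f by auto
    with insert f show ?case by (simp add: G.finsum_insert H.finsum_insert)
  qed (simp_all add: additive_zero[OF assms(1,2,3)])
qed

lemma finsum_sub:
  assumes "abelian_group G" "abelian_group H" "carrier H \<subseteq> carrier G" "add H = add G" "zero H = zero G"
    and "\<And>t. t \<in> T \<Longrightarrow> g t \<in> carrier H"
  shows "(\<Oplus>\<^bsub>H\<^esub>t\<in>T. g t) = (\<Oplus>\<^bsub>G\<^esub>t\<in>T. g t)"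
  using additive_finsum[OF assms(2,1), of "\<lambda>x. x" T g] assms(3-6) by (auto simp: hom_def Pi_def)

lemma (in abelian_group) finsum_superset:
  assumes "finite N" "T \<subseteq> N" "\<And>n. n \<in> T \<Longrightarrow> f n \<in> carrier G" "\<And>n. n \<in> N - T \<Longrightarrow> f n = \<zero>\<^bsub>G\<^esub>"
  shows "finsum G f T = finsum G f N"
proof (rule add.finprod_mono_neutral_cong_left)
  show "f \<in> N \<rightarrow> carrier G" using assms(3,4) by (metis DiffI Pi_I zero_closed)
qed (use assms in auto)

lemma (in abelian_group) finsum_only:
  assumes "finite N" "k \<in> N" "f k \<in> carrier G" "\<And>n. n \<in> N \<Longrightarrow> n \<noteq> k \<Longrightarrow> f n = \<zero>\<^bsub>G\<^esub>"
  shows "finsum G f N = f k"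
  using finsum_superset[of N "{k}" f] assms by auto

lemma additive_subgroup_iff:
  assumes "abelian_group G"
  shows "additive_subgroup H G \<longleftrightarrow> H \<subseteq> carrier G \<and> \<zero>\<^bsub>G\<^esub> \<in> H \<and>
    (\<forall>x\<in>H. \<forall>y\<in>H. x \<oplus>\<^bsub>G\<^esub> y \<in> H) \<and> (\<forall>x\<in>H. \<ominus>\<^bsub>G\<^esub> x \<in> H)"
  unfolding additive_subgroup_def subgroup_def a_inv_def by auto

context left_module
begin

lemma smult_hom: "a \<in> carrier R \<Longrightarrow> (\<lambda>x. a \<odot>\<^bsub>M\<^esub> x) \<in> hom (add_monoid M) (add_monoid M)"
  by (auto simp: hom_def smult_closed smult_r_distr)

lemma smult_hom_l: "x \<in> carrier M \<Longrightarrow> (\<lambda>a. a \<odot>\<^bsub>M\<^esub> x) \<in> hom (add_monoid R) (add_monoid M)"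
  by (auto simp: hom_def smult_closed smult_l_distr)

lemmas smult_r_null = additive_zero[OF M.abelian_group_axioms M.abelian_group_axioms smult_hom]
lemmas smult_l_null = additive_zero[OF R.is_abelian_group M.abelian_group_axioms smult_hom_l]
lemmas smult_r_minus = additive_minus[OF M.abelian_group_axioms M.abelian_group_axioms smult_hom]
lemmas smult_r_finsum = additive_finsum[OF M.abelian_group_axioms M.abelian_group_axioms smult_hom]
lemmas smult_l_finsum = additive_finsum[OF R.is_abelian_group M.abelian_group_axioms smult_hom_l]

end

subsection \<open>Modules with chosen homogeneous components\<close>

text \<open>Keeping the projections \<open>cmp n\<close> onto the components as a parameter, the structural
  properties become equations.\<close>

locale graded_mod = quadratic_monomial Q S I + M: left_module "path_algebra Q Quot I" M
  for Q :: "('v, 'e) pre_digraph" and S and I :: "(('v, 'e) qpath \<Rightarrow> 'k::field) set"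
    and M :: "((('v, 'e) qpath \<Rightarrow> 'k) set, 'm) graded_module" (structure) +
  fixes cmp :: "int \<Rightarrow> 'm \<Rightarrow> 'm"
  assumes hc_subgroup: "additive_subgroup (hcomp M n) M"
    and smult_hc: "a \<in> algebra_degree Q I i \<Longrightarrow> m \<in> hcomp M j \<Longrightarrow> a \<odot> m \<in> hcomp M (i + j)"
    and cmp_hc: "m \<in> carrier M \<Longrightarrow> cmp n m \<in> hcomp M n"
    and cmp_add: "m \<in> carrier M \<Longrightarrow> m' \<in> carrier M \<Longrightarrow> cmp n (m \<oplus> m') = cmp n m \<oplus> cmp n m'"
    and cmp_same: "m \<in> hcomp M n \<Longrightarrow> cmp n m = m"
    and cmp_other: "m \<in> hcomp M k \<Longrightarrow> k \<noteq> n \<Longrightarrow> cmp n m = \<zero>"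
    and cmp_sum: "m \<in> carrier M \<Longrightarrow>
      \<exists>N. finite N \<and> (\<forall>n. n \<notin> N \<longrightarrow> cmp n m = \<zero>) \<and> m = (\<Oplus>n\<in>N. cmp n m)"
begin

lemma abelian: "abelian_group M"
  by (rule M.M.abelian_group_axioms)

lemma hc_closed: "m \<in> hcomp M n \<Longrightarrow> m \<in> carrier M"
  using hc_subgroup[of n] by (auto simp: additive_subgroup_iff[OF abelian])

lemma hc_zero: "\<zero> \<in> hcomp M n"
  using hc_subgroup[of n] by (auto simp: additive_subgroup_iff[OF abelian])

lemma hc_add: "x \<in> hcomp M n \<Longrightarrow> y \<in> hcomp M n \<Longrightarrow> x \<oplus> y \<in> hcomp M n"
  using hc_subgroup[of n] by (auto simp: additive_subgroup_iff[OF abelian])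

lemma hc_minus: "x \<in> hcomp M n \<Longrightarrow> \<ominus> x \<in> hcomp M n"
  using hc_subgroup[of n] by (auto simp: additive_subgroup_iff[OF abelian])

lemma hc_diff: "x \<in> hcomp M n \<Longrightarrow> y \<in> hcomp M n \<Longrightarrow> x \<ominus> y \<in> hcomp M n"
  by (simp add: M.M.minus_eq hc_add hc_minus)

lemma hc_finsum: "(\<And>t. t \<in> T \<Longrightarrow> f t \<in> hcomp M n) \<Longrightarrow> (\<Oplus>t\<in>T. f t) \<in> hcomp M n"
proof (induction T rule: infinite_finite_induct)
  case (insert t T)
  then have "f \<in> T \<rightarrow> carrier M" "f t \<in> carrier M" using hc_closed by auto
  with insert show ?case by (simp add: M.M.finsum_insert hc_add)
qed (simp_all add: hc_zero)

lemma cmp_closed: "m \<in> carrier M \<Longrightarrow> cmp n m \<in> carrier M"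
  using cmp_hc hc_closed by blast

lemma cmp_hom: "cmp n \<in> hom (add_monoid M) (add_monoid M)"
  by (auto simp: hom_def cmp_closed cmp_add)

lemmas cmp_zero = additive_zero[OF abelian abelian cmp_hom]
lemmas cmp_finsum = additive_finsum[OF abelian abelian cmp_hom]
lemmas cmp_minus = additive_minus[OF abelian abelian cmp_hom]

lemma cmp_eqI:
  assumes "m \<in> carrier M" "m' \<in> carrier M" "\<And>n. cmp n m = cmp n m'"
  shows "m = m'"
proof -
  obtain N where N: "finite N" "\<forall>n. n \<notin> N \<longrightarrow> cmp n m = \<zero>" "m = (\<Oplus>n\<in>N. cmp n m)"
    using cmp_sum[OF assms(1)] by blast
  obtain N' where N': "finite N'" "\<forall>n. n \<notin> N' \<longrightarrow> cmp n m' = \<zero>" "m' = (\<Oplus>n\<in>N'. cmp n m')"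
    using cmp_sum[OF assms(2)] by blast
  have "m = (\<Oplus>n\<in>N \<union> N'. cmp n m)"
    using M.M.finsum_superset[of "N \<union> N'" N "\<lambda>n. cmp n m"] N N'(1) assms(1) cmp_closed by auto
  also have "\<dots> = (\<Oplus>n\<in>N \<union> N'. cmp n m')" by (simp add: assms(3))
  also have "\<dots> = m'"
    using M.M.finsum_superset[of "N \<union> N'" N' "\<lambda>n. cmp n m'"] N' N(1) assms(2) cmp_closed by auto
  finally show ?thesis .
qed

lemma cmp_cmp: "m \<in> carrier M \<Longrightarrow> cmp n (cmp k m) = (if n = k then cmp k m else \<zero>)"
  using cmp_same[OF cmp_hc] cmp_other[OF cmp_hc, of m k n] by auto

lemma cmp_smult:
  assumes a: "a \<in> algebra_degree Q I i" and m: "m \<in> carrier M"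
  shows "cmp (i + n) (a \<odot> m) = a \<odot> cmp n m"
proof -
  have aA: "a \<in> carrier A" using dg_closed[OF a] .
  obtain N where N: "finite N" "\<forall>k. k \<notin> N \<longrightarrow> cmp k m = \<zero>" "m = (\<Oplus>k\<in>N. cmp k m)"
    using cmp_sum[OF m] by blast
  have "cmp (i + n) (a \<odot> m) = cmp (i + n) (\<Oplus>k\<in>N. a \<odot> cmp k m)"
    using M.smult_r_finsum[OF aA, of N "\<lambda>k. cmp k m"] N(3) cmp_closed[OF m] by simp
  also have "\<dots> = (\<Oplus>k\<in>N. cmp (i + n) (a \<odot> cmp k m))"
    by (rule cmp_finsum) (simp add: M.smult_closed aA cmp_closed m)
  also have "\<dots> = (\<Oplus>k\<in>insert n N. cmp (i + n) (a \<odot> cmp k m))"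
    by (rule M.M.finsum_superset)
      (use N aA m in \<open>auto simp: M.smult_closed cmp_closed cmp_zero M.smult_r_null\<close>)
  also have "\<dots> = cmp (i + n) (a \<odot> cmp n m)"
  proof (rule M.M.finsum_only)
    show "cmp (i + n) (a \<odot> cmp k m) = \<zero>" if "k \<noteq> n" for k
      by (rule cmp_other[OF smult_hc[OF a cmp_hc[OF m]]]) (use that in simp)
  qed (use N aA m in \<open>auto simp: M.smult_closed cmp_closed\<close>)
  also have "\<dots> = a \<odot> cmp n m" by (rule cmp_same[OF smult_hc[OF a cmp_hc[OF m]]])
  finally show ?thesis .
qed

lemma hc_decomposition:
  assumes m: "m \<in> carrier M"
  shows "\<exists>!f. (\<forall>n. f n \<in> hcomp M n) \<and> finite {n. f n \<noteq> \<zero>} \<and>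
           m = (\<Oplus>n\<in>{n. f n \<noteq> \<zero>}. f n)"
proof (rule ex1I[where a = "\<lambda>n. cmp n m"])
  obtain N where N: "finite N" "\<forall>k. k \<notin> N \<longrightarrow> cmp k m = \<zero>" "m = (\<Oplus>k\<in>N. cmp k m)"
    using cmp_sum[OF m] by blast
  have sub: "{n. cmp n m \<noteq> \<zero>} \<subseteq> N" using N(2) by auto
  have "(\<Oplus>n\<in>{n. cmp n m \<noteq> \<zero>}. cmp n m) = (\<Oplus>n\<in>N. cmp n m)"
    by (rule M.M.finsum_superset[OF N(1) sub]) (use cmp_closed[OF m] in auto)
  then have "m = (\<Oplus>n\<in>{n. cmp n m \<noteq> \<zero>}. cmp n m)"
    using N(3) by (simp only:)
  then show "(\<forall>n. cmp n m \<in> hcomp M n) \<and> finite {n. cmp n m \<noteq> \<zero>} \<and>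
     m = (\<Oplus>n\<in>{n. cmp n m \<noteq> \<zero>}. cmp n m)"
    using cmp_hc[OF m] finite_subset[OF sub N(1)] by simp
next
  fix f assume f: "(\<forall>n. f n \<in> hcomp M n) \<and> finite {n. f n \<noteq> \<zero>} \<and>
     m = (\<Oplus>n\<in>{n. f n \<noteq> \<zero>}. f n)"
  let ?N = "{n. f n \<noteq> \<zero>}"
  show "f = (\<lambda>n. cmp n m)"
  proof
    fix n
    have cl: "f k \<in> carrier M" for k using f hc_closed by blast
    have "cmp n m = (\<Oplus>k\<in>?N. cmp n (f k))"
      using cmp_finsum[of ?N f n] f cl by simp
    also have "\<dots> = (\<Oplus>k\<in>insert n ?N. cmp n (f k))"
      by (rule M.M.finsum_superset) (use f cl in \<open>auto simp: cmp_closed cmp_zero\<close>)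
    also have "\<dots> = cmp n (f n)"
    proof (rule M.M.finsum_only)
      show "cmp n (f k) = \<zero>" if "k \<noteq> n" for k
        by (rule cmp_other[where k = k]) (use f that in auto)
    qed (use f cl in \<open>auto simp: cmp_closed\<close>)
    also have "\<dots> = f n" using f cmp_same by blast
    finally show "f n = cmp n m" by simp
  qed
qed

lemma graded_left_module:
  assumes "\<And>n. fd_over_field Q I M (hcomp M n)"
  shows "graded_left_module Q I M"
  by (intro graded_left_module.intro graded_left_module_axioms.intro M.left_module_axioms
      hc_subgroup hc_decomposition smult_hc assms)

lemma sc_smult_hc: "m \<in> hcomp M n \<Longrightarrow> sc c \<odot> m \<in> hcomp M n"
  using smult_hc[OF sc_deg, of m n c] by simp

lemma ar_smult_hc: "a \<in> arcs Q \<Longrightarrow> m \<in> hcomp M n \<Longrightarrow> ar a \<odot> m \<in> hcomp M (n + 1)"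
  using smult_hc[OF ar_deg, of a m n] by (simp add: add.commute)

lemma e_smult_hc: "x \<in> verts Q \<Longrightarrow> m \<in> hcomp M n \<Longrightarrow> e x \<odot> m \<in> hcomp M n"
  using smult_hc[OF e_deg, of x m n] by simp

end

lemma graded_left_module_graded_mod:
  assumes "quadratic_monomial Q S I" "graded_left_module Q I M"
  obtains cmp where "graded_mod Q S I M cmp"
proof -
  interpret quadratic_monomial Q S I by fact
  interpret G: graded_left_module Q I M by fact
  define P where "P m f \<longleftrightarrow> (\<forall>n. f n \<in> hcomp M n) \<and> finite {n. f n \<noteq> \<zero>\<^bsub>M\<^esub>} \<and>
           m = (\<Oplus>\<^bsub>M\<^esub>n\<in>{n. f n \<noteq> \<zero>\<^bsub>M\<^esub>}. f n)" for m f
  have ex1: "\<exists>!f. P m f" if "m \<in> carrier M" for m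
    using G.hcomp_decomposition[OF that] unfolding P_def .
  note ab = G.M.abelian_group_axioms
  have sub: "hcomp M n \<subseteq> carrier M" "\<zero>\<^bsub>M\<^esub> \<in> hcomp M n"
    "\<And>x y. x \<in> hcomp M n \<Longrightarrow> y \<in> hcomp M n \<Longrightarrow> x \<oplus>\<^bsub>M\<^esub> y \<in> hcomp M n" for n
    using G.hcomp_subgroup[of n] by (auto simp: additive_subgroup_iff[OF ab])
  define cmp where "cmp n m = (THE f. P m f) n" for n m
  have P_cmp: "P m (\<lambda>n. cmp n m)" if "m \<in> carrier M" for m
    using theI'[of "P m", OF ex1[OF that]] by (simp add: cmp_def)
  have cmp_P: "cmp n m = f n" if "m \<in> carrier M" "P m f" for m f n
    using the1_equality[of "P m", OF ex1[OF that(1)] that(2)] by (simp add: cmp_def)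
  have PI: "P m f" if "finite N" "\<And>n. f n \<in> hcomp M n" "\<And>n. n \<notin> N \<Longrightarrow> f n = \<zero>\<^bsub>M\<^esub>"
      "m = (\<Oplus>\<^bsub>M\<^esub>n\<in>N. f n)" for N m f
  proof -
    have s: "{n. f n \<noteq> \<zero>\<^bsub>M\<^esub>} \<subseteq> N" using that(3) by auto
    have "(\<Oplus>\<^bsub>M\<^esub>n\<in>{n. f n \<noteq> \<zero>\<^bsub>M\<^esub>}. f n) = (\<Oplus>\<^bsub>M\<^esub>n\<in>N. f n)"
      by (rule G.M.finsum_superset) (use that(1,2,3) s sub(1) in blast)+
    then show ?thesis unfolding P_def using that finite_subset[OF s that(1)] by simp
  qed
  have "graded_mod Q S I M cmp"
  proof (intro graded_mod.intro graded_mod_axioms.intro)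
    fix m m' n assume m: "m \<in> carrier M" and m': "m' \<in> carrier M"
    show "cmp n (m \<oplus>\<^bsub>M\<^esub> m') = cmp n m \<oplus>\<^bsub>M\<^esub> cmp n m'"
    proof (rule cmp_P)
      let ?A = "{n. cmp n m \<noteq> \<zero>\<^bsub>M\<^esub>}" and ?B = "{n. cmp n m' \<noteq> \<zero>\<^bsub>M\<^esub>}"
      note p = P_cmp[OF m, unfolded P_def] and p' = P_cmp[OF m', unfolded P_def]
      have cl: "cmp k m \<in> carrier M" "cmp k m' \<in> carrier M" for k using p p' sub by blast+
      have fin: "finite (?A \<union> ?B)" using p p' by blast
      have "(\<Oplus>\<^bsub>M\<^esub>n\<in>?A. cmp n m) = (\<Oplus>\<^bsub>M\<^esub>n\<in>?A \<union> ?B. cmp n m)"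
        by (rule G.M.finsum_superset[OF fin]) (use cl in auto)
      then have "m = (\<Oplus>\<^bsub>M\<^esub>n\<in>?A \<union> ?B. cmp n m)" using p by metis
      moreover have "(\<Oplus>\<^bsub>M\<^esub>n\<in>?B. cmp n m') = (\<Oplus>\<^bsub>M\<^esub>n\<in>?A \<union> ?B. cmp n m')"
        by (rule G.M.finsum_superset[OF fin]) (use cl in auto)
      then have "m' = (\<Oplus>\<^bsub>M\<^esub>n\<in>?A \<union> ?B. cmp n m')" using p' by metis
      ultimately have eq: "m \<oplus>\<^bsub>M\<^esub> m' = (\<Oplus>\<^bsub>M\<^esub>n\<in>?A \<union> ?B. cmp n m \<oplus>\<^bsub>M\<^esub> cmp n m')"
        using G.M.finsum_addf[of "\<lambda>n. cmp n m" "?A \<union> ?B" "\<lambda>n. cmp n m'"] cl by auto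
      show "P (m \<oplus>\<^bsub>M\<^esub> m') (\<lambda>n. cmp n m \<oplus>\<^bsub>M\<^esub> cmp n m')"
        by (rule PI[OF _ _ _ eq]) (use p p' sub(3) in auto)
    qed (use m m' in simp)
  next
    fix m n assume m: "m \<in> hcomp M n"
    then have mc: "m \<in> carrier M" using sub by blast
    have P: "P m (\<lambda>k. if k = n then m else \<zero>\<^bsub>M\<^esub>)"
      by (rule PI[where N = "{n}"]) (use m mc sub in auto)
    show "cmp n m = m" using cmp_P[OF mc P] by simp
    fix k assume "n \<noteq> k"
    then show "cmp k m = \<zero>\<^bsub>M\<^esub>" using cmp_P[OF mc P] by simp
  next
    fix m assume m: "m \<in> carrier M"
    show "\<exists>N. finite N \<and> (\<forall>n. n \<notin> N \<longrightarrow> cmp n m = \<zero>\<^bsub>M\<^esub>) \<and> m = (\<Oplus>\<^bsub>M\<^esub>n\<in>N. cmp n m)"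
      using P_cmp[OF m] unfolding P_def by (intro exI[where x = "{n. cmp n m \<noteq> \<zero>\<^bsub>M\<^esub>}"]) auto
    fix n show "cmp n m \<in> hcomp M n" using P_cmp[OF m] unfolding P_def by blast
  qed (use assms(1) G.left_module_axioms G.hcomp_subgroup G.smult_hcomp in auto)
  then show ?thesis by (rule that)
qed

subsection \<open>Shifts and direct sums\<close>

lemma shift_sel [simp]:
  "carrier (shift i M) = carrier M" "add (shift i M) = add M" "zero (shift i M) = zero M"
  "smult (shift i M) = smult M" "hcomp (shift i M) n = hcomp M (n - i)"
  by (simp_all add: shift_def)

lemma shift_finsum [simp]: "finsum (shift i M) = finsum M"
  by (simp add: finsum_def fun_eq_iff)

lemma shift_a_inv [simp]: "a_inv (shift i M) = a_inv M"
  by (simp add: a_inv_def fun_eq_iff)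

lemma shift_abelian: "abelian_group M \<Longrightarrow> abelian_group (shift i M)"
  by (simp add: abelian_group_def abelian_monoid_def abelian_group_axioms_def)

lemma shift_left_module: "left_module R M \<Longrightarrow> left_module R (shift i M)"
  by (simp add: left_module_def left_module_axioms_def shift_abelian)

lemma graded_mod_shift:
  assumes "graded_mod Q S I M cmp"
  shows "graded_mod Q S I (shift i M) (\<lambda>n. cmp (n - i))"
proof -
  interpret graded_mod Q S I M cmp by fact
  show ?thesis
  proof (intro graded_mod.intro graded_mod_axioms.intro)
    show "additive_subgroup (hcomp (shift i M) n) (shift i M)" for n
      using hc_subgroup[of "n - i"]
      unfolding additive_subgroup_iff[OF abelian] additive_subgroup_iff[OF shift_abelian[OF abelian]]
      by simp
    fix m assume m: "m \<in> carrier (shift i M)"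
    then obtain N where N: "finite N" "\<forall>k. k \<notin> N \<longrightarrow> cmp k m = \<zero>\<^bsub>M\<^esub>" "m = (\<Oplus>\<^bsub>M\<^esub>k\<in>N. cmp k m)"
      using cmp_sum by auto
    have "(\<Oplus>\<^bsub>M\<^esub>n\<in>(\<lambda>k. k + i) ` N. cmp (n - i) m) = (\<Oplus>\<^bsub>M\<^esub>k\<in>N. cmp (k + i - i) m)"
      by (rule M.M.finsum_reindex) (use m cmp_closed in auto)
    then show "\<exists>N. finite N \<and> (\<forall>n. n \<notin> N \<longrightarrow> cmp (n - i) m = \<zero>\<^bsub>shift i M\<^esub>) \<and>
        m = (\<Oplus>\<^bsub>shift i M\<^esub>n\<in>N. cmp (n - i) m)"
      using N by (intro exI[where x = "(\<lambda>k. k + i) ` N"] conjI) (simp, force simp: image_iff, simp)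
    fix n show "cmp (n - i) m \<in> hcomp (shift i M) n" using cmp_hc m by simp
    fix m' assume "m' \<in> carrier (shift i M)"
    then show "cmp (n - i) (m \<oplus>\<^bsub>shift i M\<^esub> m') = cmp (n - i) m \<oplus>\<^bsub>shift i M\<^esub> cmp (n - i) m'"
      using m cmp_add by simp
  next
    fix a k m j assume "a \<in> dg k" "m \<in> hcomp (shift i M) j"
    then show "a \<odot>\<^bsub>shift i M\<^esub> m \<in> hcomp (shift i M) (k + j)"
      using smult_hc[of a k m "j - i"] by (simp add: algebra_simps)
  next
    fix m n assume m: "m \<in> hcomp (shift i M) n"
    then show "cmp (n - i) m = m" using cmp_same by simp
    fix k assume "n \<noteq> k"
    then show "cmp (k - i) m = \<zero>\<^bsub>shift i M\<^esub>" using cmp_other[of m "n - i" "k - i"] m by simp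
  qed (simp_all add: quadratic_monomial_axioms shift_left_module M.left_module_axioms)
qed

lemma direct_sum_sel [simp]:
  "carrier (direct_sum J M) = (\<Pi>\<^sub>E j\<in>J. carrier (M j))"
  "add (direct_sum J M) f g = (\<lambda>j\<in>J. f j \<oplus>\<^bsub>M j\<^esub> g j)" "zero (direct_sum J M) = (\<lambda>j\<in>J. \<zero>\<^bsub>M j\<^esub>)"
  "smult (direct_sum J M) a f = (\<lambda>j\<in>J. a \<odot>\<^bsub>M j\<^esub> f j)"
  "hcomp (direct_sum J M) n = (\<Pi>\<^sub>E j\<in>J. hcomp (M j) n)"
  by (simp_all add: direct_sum_def)

lemma direct_sum_abelian:
  assumes "\<And>j. j \<in> J \<Longrightarrow> abelian_group (M j)"
  shows "abelian_group (direct_sum J M)"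
proof (rule abelian_groupI)
  note G = abelian_groupE[OF assms]
  fix f g h assume f: "f \<in> carrier (direct_sum J M)" and g: "g \<in> carrier (direct_sum J M)"
    and h: "h \<in> carrier (direct_sum J M)"
  show "f \<oplus>\<^bsub>direct_sum J M\<^esub> g \<in> carrier (direct_sum J M)" using f g G(1) by (auto simp: PiE_iff)
  show "f \<oplus>\<^bsub>direct_sum J M\<^esub> g \<oplus>\<^bsub>direct_sum J M\<^esub> h = f \<oplus>\<^bsub>direct_sum J M\<^esub> (g \<oplus>\<^bsub>direct_sum J M\<^esub> h)"
    using f g h G(3) by (auto simp: PiE_iff intro!: restrict_ext)
  show "f \<oplus>\<^bsub>direct_sum J M\<^esub> g = g \<oplus>\<^bsub>direct_sum J M\<^esub> f"
    using f g G(4) by (auto simp: PiE_iff intro!: restrict_ext)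
next
  note G = abelian_groupE[OF assms]
  fix f assume f: "f \<in> carrier (direct_sum J M)"
  show "\<zero>\<^bsub>direct_sum J M\<^esub> \<oplus>\<^bsub>direct_sum J M\<^esub> f = f"
    using f G(5) by (auto simp: PiE_iff fun_eq_iff extensional_def)
  have "\<forall>j\<in>J. \<exists>y. y \<in> carrier (M j) \<and> y \<oplus>\<^bsub>M j\<^esub> f j = \<zero>\<^bsub>M j\<^esub>"
  proof
    fix j assume j: "j \<in> J"
    then have "f j \<in> carrier (M j)" using f by auto
    then show "\<exists>y. y \<in> carrier (M j) \<and> y \<oplus>\<^bsub>M j\<^esub> f j = \<zero>\<^bsub>M j\<^esub>" using G(6)[OF j] by blast
  qed
  then obtain y where "\<forall>j\<in>J. y j \<in> carrier (M j) \<and> y j \<oplus>\<^bsub>M j\<^esub> f j = \<zero>\<^bsub>M j\<^esub>" by metis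
  then show "\<exists>y\<in>carrier (direct_sum J M). y \<oplus>\<^bsub>direct_sum J M\<^esub> f = \<zero>\<^bsub>direct_sum J M\<^esub>"
    by (intro bexI[where x = "\<lambda>j\<in>J. y j"]) auto
qed (use abelian_groupE(2)[OF assms] in auto)

lemma direct_sum_left_module:
  assumes "ring R" "\<And>j. j \<in> J \<Longrightarrow> left_module R (M j)"
  shows "left_module R (direct_sum J M)"
proof (intro left_module.intro left_module_axioms.intro)
  show "abelian_group (direct_sum J M)"
    by (rule direct_sum_abelian) (use assms(2) left_module.axioms in blast)
  note G = left_module.smult_closed[OF assms(2)] left_module.smult_l_distr[OF assms(2)]
    left_module.smult_r_distr[OF assms(2)] left_module.smult_assoc[OF assms(2)]
  fix a x assume a: "a \<in> carrier R" and x: "x \<in> carrier (direct_sum J M)"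
  show "a \<odot>\<^bsub>direct_sum J M\<^esub> x \<in> carrier (direct_sum J M)" using G(1) a x by (auto simp: PiE_iff)
  fix b assume b: "b \<in> carrier R"
  show "(a \<oplus>\<^bsub>R\<^esub> b) \<odot>\<^bsub>direct_sum J M\<^esub> x = a \<odot>\<^bsub>direct_sum J M\<^esub> x \<oplus>\<^bsub>direct_sum J M\<^esub> b \<odot>\<^bsub>direct_sum J M\<^esub> x"
    using G(2) a b x by (auto simp: PiE_iff intro!: restrict_ext)
  show "(a \<otimes>\<^bsub>R\<^esub> b) \<odot>\<^bsub>direct_sum J M\<^esub> x = a \<odot>\<^bsub>direct_sum J M\<^esub> (b \<odot>\<^bsub>direct_sum J M\<^esub> x)"
    using G(4) a b x by (auto simp: PiE_iff intro!: restrict_ext)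
next
  fix a x y assume "a \<in> carrier R" "x \<in> carrier (direct_sum J M)" "y \<in> carrier (direct_sum J M)"
  then show "a \<odot>\<^bsub>direct_sum J M\<^esub> (x \<oplus>\<^bsub>direct_sum J M\<^esub> y) =
      a \<odot>\<^bsub>direct_sum J M\<^esub> x \<oplus>\<^bsub>direct_sum J M\<^esub> a \<odot>\<^bsub>direct_sum J M\<^esub> y"
    using left_module.smult_r_distr[OF assms(2)] by (auto simp: PiE_iff intro!: restrict_ext)
next
  fix x assume "x \<in> carrier (direct_sum J M)"
  then show "\<one>\<^bsub>R\<^esub> \<odot>\<^bsub>direct_sum J M\<^esub> x = x"
    using left_module.smult_one[OF assms(2)] by (auto simp: PiE_iff fun_eq_iff extensional_def)
qed (rule assms(1))

lemma direct_sum_finsum: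
  assumes "\<And>j. j \<in> J \<Longrightarrow> abelian_group (M j)"
    and "\<And>t. t \<in> T \<Longrightarrow> f t \<in> carrier (direct_sum J M)" "j \<in> J"
  shows "(\<Oplus>\<^bsub>direct_sum J M\<^esub>t\<in>T. f t) j = (\<Oplus>\<^bsub>M j\<^esub>t\<in>T. f t j)"
  by (rule additive_finsum[OF direct_sum_abelian assms(1), of J M j "\<lambda>f. f j"])
    (use assms in \<open>auto simp: hom_def PiE_iff\<close>)

lemma direct_sum_a_inv:
  assumes "\<And>j. j \<in> J \<Longrightarrow> abelian_group (M j)"
    and "f \<in> carrier (direct_sum J M)" "j \<in> J"
  shows "(\<ominus>\<^bsub>direct_sum J M\<^esub> f) j = \<ominus>\<^bsub>M j\<^esub> f j"
  by (rule additive_minus[OF direct_sum_abelian assms(1), of J M j "\<lambda>f. f j"])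
    (use assms in \<open>auto simp: hom_def PiE_iff\<close>)

lemma graded_mod_direct_sum:
  assumes J: "finite J" and qm: "quadratic_monomial Q S I"
    and M: "\<And>j. j \<in> J \<Longrightarrow> graded_mod Q S I (M j) (cmp j)"
  shows "graded_mod Q S I (direct_sum J M) (\<lambda>n f. \<lambda>j\<in>J. cmp j n (f j))"
proof -
  interpret quadratic_monomial Q S I by fact
  note ab = graded_mod.abelian[OF M]
  have dab: "abelian_group (direct_sum J M)" by (rule direct_sum_abelian) (rule ab)
  show ?thesis
  proof (intro graded_mod.intro graded_mod_axioms.intro qm)
    show "left_module A (direct_sum J M)"
      by (rule direct_sum_left_module[OF A.ring_axioms]) (use M in \<open>auto dest: graded_mod.axioms\<close>)
    show "additive_subgroup (hcomp (direct_sum J M) n) (direct_sum J M)" for n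
      unfolding additive_subgroup_iff[OF dab]
    proof (intro conjI ballI)
      show sub: "hcomp (direct_sum J M) n \<subseteq> carrier (direct_sum J M)"
        using graded_mod.hc_closed[OF M] by (auto simp: PiE_iff)
      show "\<zero>\<^bsub>direct_sum J M\<^esub> \<in> hcomp (direct_sum J M) n" using graded_mod.hc_zero[OF M] by auto
      fix x assume x: "x \<in> hcomp (direct_sum J M) n"
      have "\<ominus>\<^bsub>direct_sum J M\<^esub> x \<in> carrier (direct_sum J M)"
        using x sub abelian_group.a_inv_closed[OF dab] by blast
      moreover have "(\<ominus>\<^bsub>direct_sum J M\<^esub> x) j \<in> hcomp (M j) n" if "j \<in> J" for j
      proof -
        have "(\<ominus>\<^bsub>direct_sum J M\<^esub> x) j = \<ominus>\<^bsub>M j\<^esub> x j"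
          by (rule direct_sum_a_inv[OF ab _ that]) (use x sub in auto)
        then show ?thesis using graded_mod.hc_minus[OF M[OF that]] x that by (auto simp: PiE_iff)
      qed
      ultimately show "\<ominus>\<^bsub>direct_sum J M\<^esub> x \<in> hcomp (direct_sum J M) n" by (auto simp: PiE_iff)
      fix y assume "y \<in> hcomp (direct_sum J M) n"
      with x show "x \<oplus>\<^bsub>direct_sum J M\<^esub> y \<in> hcomp (direct_sum J M) n"
        using graded_mod.hc_add[OF M] by (auto simp: PiE_iff)
    qed
    fix m assume m: "m \<in> carrier (direct_sum J M)"
    then have "\<forall>j\<in>J. \<exists>N. finite N \<and> (\<forall>n. n \<notin> N \<longrightarrow> cmp j n (m j) = \<zero>\<^bsub>M j\<^esub>) \<and> m j = (\<Oplus>\<^bsub>M j\<^esub>n\<in>N. cmp j n (m j))"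
      using graded_mod.cmp_sum[OF M] by (auto simp: PiE_iff)
    then obtain N where N: "\<forall>j\<in>J. finite (N j) \<and> (\<forall>n. n \<notin> N j \<longrightarrow> cmp j n (m j) = \<zero>\<^bsub>M j\<^esub>) \<and>
        m j = (\<Oplus>\<^bsub>M j\<^esub>n\<in>N j. cmp j n (m j))" by metis
    let ?N = "\<Union>(N ` J)"
    have fN: "finite ?N" using N J by auto
    have cl: "(\<lambda>j\<in>J. cmp j n (m j)) \<in> carrier (direct_sum J M)" for n
      using m graded_mod.cmp_closed[OF M] by (auto simp: PiE_iff)
    have "m = (\<Oplus>\<^bsub>direct_sum J M\<^esub>n\<in>?N. (\<lambda>j\<in>J. cmp j n (m j)))"
    proof (rule PiE_ext[of _ J "\<lambda>j. carrier (M j)"])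
      show "m \<in> (\<Pi>\<^sub>E j\<in>J. carrier (M j))" using m by simp
      have "(\<Oplus>\<^bsub>direct_sum J M\<^esub>n\<in>?N. (\<lambda>j\<in>J. cmp j n (m j))) \<in> carrier (direct_sum J M)"
        by (rule abelian_monoid.finsum_closed[OF abelian_group.axioms(1)[OF dab]]) (rule Pi_I, rule cl)
      then show "(\<Oplus>\<^bsub>direct_sum J M\<^esub>n\<in>?N. (\<lambda>j\<in>J. cmp j n (m j))) \<in> (\<Pi>\<^sub>E j\<in>J. carrier (M j))" by simp
      fix j assume j: "j \<in> J"
      have "(\<Oplus>\<^bsub>direct_sum J M\<^esub>n\<in>?N. (\<lambda>j\<in>J. cmp j n (m j))) j = (\<Oplus>\<^bsub>M j\<^esub>n\<in>?N. cmp j n (m j))"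
        by (subst direct_sum_finsum[OF ab cl j]) (simp_all add: j)
      also have "\<dots> = (\<Oplus>\<^bsub>M j\<^esub>n\<in>N j. cmp j n (m j))"
        by (rule abelian_group.finsum_superset[OF ab[OF j], symmetric])
          (use fN N j m graded_mod.cmp_closed[OF M[OF j]] in \<open>auto simp: PiE_iff\<close>)
      finally show "m j = (\<Oplus>\<^bsub>direct_sum J M\<^esub>n\<in>?N. (\<lambda>j\<in>J. cmp j n (m j))) j" using N j by simp
    qed
    then show "\<exists>N. finite N \<and> (\<forall>n. n \<notin> N \<longrightarrow> (\<lambda>j\<in>J. cmp j n (m j)) = \<zero>\<^bsub>direct_sum J M\<^esub>) \<and>
       m = (\<Oplus>\<^bsub>direct_sum J M\<^esub>n\<in>N. (\<lambda>j\<in>J. cmp j n (m j)))"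
      using fN N by (intro exI[where x = ?N]) (auto intro!: restrict_ext)
    show "(\<lambda>j\<in>J. cmp j n (m j)) \<in> hcomp (direct_sum J M) n" for n
      using m graded_mod.cmp_hc[OF M] by (auto simp: PiE_iff)
    fix m' n assume m': "m' \<in> carrier (direct_sum J M)"
    show "(\<lambda>j\<in>J. cmp j n ((m \<oplus>\<^bsub>direct_sum J M\<^esub> m') j)) =
       (\<lambda>j\<in>J. cmp j n (m j)) \<oplus>\<^bsub>direct_sum J M\<^esub> (\<lambda>j\<in>J. cmp j n (m' j))"
      using m m' graded_mod.cmp_add[OF M] by (auto simp: PiE_iff intro!: restrict_ext)
  next
    fix m n assume m: "m \<in> hcomp (direct_sum J M) n"
    then show "(\<lambda>j\<in>J. cmp j n (m j)) = m"
      using graded_mod.cmp_same[OF M] by (auto simp: PiE_iff fun_eq_iff extensional_def)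
    fix k assume "n \<noteq> k"
    then show "(\<lambda>j\<in>J. cmp j k (m j)) = \<zero>\<^bsub>direct_sum J M\<^esub>"
      using m graded_mod.cmp_other[OF M] by (auto simp: PiE_iff intro!: restrict_ext)
  next
    fix a i m j assume "a \<in> dg i" "m \<in> hcomp (direct_sum J M) j"
    then show "a \<odot>\<^bsub>direct_sum J M\<^esub> m \<in> hcomp (direct_sum J M) (i + j)"
      using graded_mod.smult_hc[OF M] by (auto simp: PiE_iff)
  qed
qed

subsection \<open>Homomorphisms\<close>

lemma (in abelian_group) eq_if_diff_zero:
  "x \<in> carrier G \<Longrightarrow> y \<in> carrier G \<Longrightarrow> x \<oplus> \<ominus> y = \<zero> \<Longrightarrow> x = y"
  using minus_equality[of x "\<ominus> y"] minus_minus[of y] by simp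

lemma a_kernel_iff: "x \<in> a_kernel G H h \<longleftrightarrow> x \<in> carrier G \<and> h x = \<zero>\<^bsub>H\<^esub>"
  by (simp add: a_kernel_def kernel_def)

lemma graded_homD:
  assumes "f \<in> graded_hom Q I M N"
  shows "f \<in> hom (add_monoid M) (add_monoid N)"
    and "m \<in> carrier M \<Longrightarrow> f m \<in> carrier N"
    and "m \<in> carrier M \<Longrightarrow> m' \<in> carrier M \<Longrightarrow> f (m \<oplus>\<^bsub>M\<^esub> m') = f m \<oplus>\<^bsub>N\<^esub> f m'"
    and "a \<in> carrier (bound_algebra Q I) \<Longrightarrow> m \<in> carrier M \<Longrightarrow> f (a \<odot>\<^bsub>M\<^esub> m) = a \<odot>\<^bsub>N\<^esub> f m"
    and "m \<in> hcomp M n \<Longrightarrow> f m \<in> hcomp N n"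
proof -
  show "f \<in> hom (add_monoid M) (add_monoid N)"
    and "m \<in> carrier M \<Longrightarrow> f m \<in> carrier N"
    and "m \<in> carrier M \<Longrightarrow> m' \<in> carrier M \<Longrightarrow> f (m \<oplus>\<^bsub>M\<^esub> m') = f m \<oplus>\<^bsub>N\<^esub> f m'"
    and "a \<in> carrier (bound_algebra Q I) \<Longrightarrow> m \<in> carrier M \<Longrightarrow> f (a \<odot>\<^bsub>M\<^esub> m) = a \<odot>\<^bsub>N\<^esub> f m"
    using assms by (auto simp: graded_hom_def hom_def)
  have "f ` hcomp M n \<subseteq> hcomp N n" using assms unfolding graded_hom_def by blast
  then show "m \<in> hcomp M n \<Longrightarrow> f m \<in> hcomp N n" by blast
qed

lemma graded_homI:
  assumes "\<And>m. m \<in> carrier M \<Longrightarrow> f m \<in> carrier N"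
    and "\<And>m m'. m \<in> carrier M \<Longrightarrow> m' \<in> carrier M \<Longrightarrow> f (m \<oplus>\<^bsub>M\<^esub> m') = f m \<oplus>\<^bsub>N\<^esub> f m'"
    and "\<And>a m. a \<in> carrier (bound_algebra Q I) \<Longrightarrow> m \<in> carrier M \<Longrightarrow> f (a \<odot>\<^bsub>M\<^esub> m) = a \<odot>\<^bsub>N\<^esub> f m"
    and "\<And>m n. m \<in> hcomp M n \<Longrightarrow> f m \<in> hcomp N n"
  shows "f \<in> graded_hom Q I M N"
  using assms by (auto simp: graded_hom_def hom_def)

lemma graded_hom_cmp:
  assumes M: "graded_mod Q S I M c" and N: "graded_mod Q S I N c'" and f: "f \<in> graded_hom Q I M N"
    and m: "m \<in> carrier M"
  shows "f (c n m) = c' n (f m)"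
proof -
  interpret M: graded_mod Q S I M c by fact
  interpret N: graded_mod Q S I N c' by fact
  note fD = graded_homD[OF f]
  obtain T where T: "finite T" "\<forall>k. k \<notin> T \<longrightarrow> c k m = \<zero>\<^bsub>M\<^esub>" "m = (\<Oplus>\<^bsub>M\<^esub>k\<in>T. c k m)"
    using M.cmp_sum[OF m] by blast
  have cl: "f (c k m) \<in> carrier N" for k using fD(2) M.cmp_closed[OF m] by blast
  have "f m = (\<Oplus>\<^bsub>N\<^esub>k\<in>T. f (c k m))"
    using additive_finsum[OF M.abelian N.abelian fD(1), of T "\<lambda>k. c k m"] T(3) M.cmp_closed[OF m] by metis
  then have "c' n (f m) = (\<Oplus>\<^bsub>N\<^esub>k\<in>T. c' n (f (c k m)))"
    using N.cmp_finsum[of T "\<lambda>k. f (c k m)" n] cl by simp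
  also have "\<dots> = (\<Oplus>\<^bsub>N\<^esub>k\<in>insert n T. c' n (f (c k m)))"
    by (rule N.M.M.finsum_superset)
      (use T cl in \<open>auto simp: N.cmp_closed N.cmp_zero additive_zero[OF M.abelian N.abelian fD(1)]\<close>)
  also have "\<dots> = c' n (f (c n m))"
  proof (rule N.M.M.finsum_only)
    show "c' n (f (c k m)) = \<zero>\<^bsub>N\<^esub>" if "k \<noteq> n" for k
      by (rule N.cmp_other[OF fD(5)[OF M.cmp_hc[OF m]]]) (use that in simp)
  qed (use T cl in \<open>auto simp: N.cmp_closed\<close>)
  also have "\<dots> = f (c n m)" by (rule N.cmp_same[OF fD(5)[OF M.cmp_hc[OF m]]])
  finally show ?thesis by simp
qed

section \<open>How arrows act in one degree\<close>

context quadratic_monomial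
begin

text \<open>The first three properties describe a module whose component of degree \<open>n + 1\<close> is the direct sum of
  the images of the arrows, with kernels as small as the relations permit.  The other three are their
  duals: no socle in degree \<open>n\<close>, arrows that act independently of each other, and images as large as
  the relations permit.\<close>

definition arrows_generate :: "((('v, 'e) qpath \<Rightarrow> 'k) set, 'm) graded_module \<Rightarrow> int \<Rightarrow> bool" where
  "arrows_generate M n \<longleftrightarrow> (\<forall>m \<in> hcomp M (n + 1).
     \<exists>u. (\<forall>a\<in>arcs Q. u a \<in> hcomp M n) \<and> m = (\<Oplus>\<^bsub>M\<^esub>a\<in>arcs Q. ar a \<odot>\<^bsub>M\<^esub> u a))"

definition arrows_independent :: "((('v, 'e) qpath \<Rightarrow> 'k) set, 'm) graded_module \<Rightarrow> int \<Rightarrow> bool" where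
  "arrows_independent M n \<longleftrightarrow> (\<forall>u. (\<forall>a\<in>arcs Q. u a \<in> hcomp M n) \<longrightarrow>
     (\<Oplus>\<^bsub>M\<^esub>a\<in>arcs Q. ar a \<odot>\<^bsub>M\<^esub> u a) = \<zero>\<^bsub>M\<^esub> \<longrightarrow> (\<forall>a\<in>arcs Q. ar a \<odot>\<^bsub>M\<^esub> u a = \<zero>\<^bsub>M\<^esub>))"

definition arrow_kernels :: "((('v, 'e) qpath \<Rightarrow> 'k) set, 'm) graded_module \<Rightarrow> int \<Rightarrow> bool" where
  "arrow_kernels M n \<longleftrightarrow> (\<forall>a\<in>arcs Q. \<forall>u\<in>hcomp M n.
     e (tail Q a) \<odot>\<^bsub>M\<^esub> u = u \<longrightarrow> ar a \<odot>\<^bsub>M\<^esub> u = \<zero>\<^bsub>M\<^esub> \<longrightarrow>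
     (\<exists>w. (\<forall>b. zr b a \<longrightarrow> w b \<in> hcomp M (n - 1)) \<and> u = (\<Oplus>\<^bsub>M\<^esub>b\<in>{b. zr b a}. ar b \<odot>\<^bsub>M\<^esub> w b)))"

definition arrows_detect :: "((('v, 'e) qpath \<Rightarrow> 'k) set, 'm) graded_module \<Rightarrow> int \<Rightarrow> bool" where
  "arrows_detect M n \<longleftrightarrow> (\<forall>m\<in>hcomp M n. (\<forall>a\<in>arcs Q. ar a \<odot>\<^bsub>M\<^esub> m = \<zero>\<^bsub>M\<^esub>) \<longrightarrow> m = \<zero>\<^bsub>M\<^esub>)"

definition arrows_separate :: "((('v, 'e) qpath \<Rightarrow> 'k) set, 'm) graded_module \<Rightarrow> int \<Rightarrow> bool" where
  "arrows_separate M n \<longleftrightarrow> (\<forall>u\<in>hcomp M n. \<forall>a\<in>arcs Q.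
     \<exists>m\<in>hcomp M n. ar a \<odot>\<^bsub>M\<^esub> m = ar a \<odot>\<^bsub>M\<^esub> u \<and> (\<forall>b\<in>arcs Q. b \<noteq> a \<longrightarrow> ar b \<odot>\<^bsub>M\<^esub> m = \<zero>\<^bsub>M\<^esub>))"

definition arrow_images :: "((('v, 'e) qpath \<Rightarrow> 'k) set, 'm) graded_module \<Rightarrow> int \<Rightarrow> bool" where
  "arrow_images M n \<longleftrightarrow> (\<forall>a\<in>arcs Q. \<forall>v\<in>hcomp M n.
     e (head Q a) \<odot>\<^bsub>M\<^esub> v = v \<longrightarrow> (\<forall>b. zr a b \<longrightarrow> ar b \<odot>\<^bsub>M\<^esub> v = \<zero>\<^bsub>M\<^esub>) \<longrightarrow>
     (\<exists>m\<in>hcomp M (n - 1). ar a \<odot>\<^bsub>M\<^esub> m = v))"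

lemma arrows_shift:
  "arrows_generate (shift i M) n \<longleftrightarrow> arrows_generate M (n - i)"
  "arrows_independent (shift i M) n \<longleftrightarrow> arrows_independent M (n - i)"
  "arrow_kernels (shift i M) n \<longleftrightarrow> arrow_kernels M (n - i)"
  "arrows_detect (shift i M) n \<longleftrightarrow> arrows_detect M (n - i)"
  "arrows_separate (shift i M) n \<longleftrightarrow> arrows_separate M (n - i)"
  "arrow_images (shift i M) n \<longleftrightarrow> arrow_images M (n - i)"
  by (simp_all add: arrows_generate_def arrows_independent_def arrow_kernels_def arrows_detect_def
      arrows_separate_def arrow_images_def algebra_simps)

context
  fixes J :: "'j set" and M :: "'j \<Rightarrow> ((('v, 'e) qpath \<Rightarrow> 'k) set, 'm) graded_module" and cmp
  assumes M: "\<And>j. j \<in> J \<Longrightarrow> graded_mod Q S I (M j) (cmp j)"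
begin

lemma arrow_smult_direct_sum:
  assumes "a \<in> arcs Q" "u \<in> hcomp (direct_sum J M) n"
  shows "ar a \<odot>\<^bsub>direct_sum J M\<^esub> u \<in> carrier (direct_sum J M)"
proof -
  have "ar a \<odot>\<^bsub>M j\<^esub> u j \<in> carrier (M j)" if j: "j \<in> J" for j
    using assms j graded_mod.hc_closed[OF M[OF j]]
    by (auto intro!: left_module.smult_closed[OF graded_mod.axioms(2)[OF M[OF j]]])
  then show ?thesis by simp
qed

lemma arrow_sum_direct_sum_closed:
  assumes "T \<subseteq> arcs Q" "\<And>a. a \<in> T \<Longrightarrow> u a \<in> hcomp (direct_sum J M) n"
  shows "(\<Oplus>\<^bsub>direct_sum J M\<^esub>a\<in>T. ar a \<odot>\<^bsub>direct_sum J M\<^esub> u a) \<in> carrier (direct_sum J M)"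
proof (rule abelian_monoid.finsum_closed[OF abelian_group.axioms(1)[OF direct_sum_abelian]])
  show "\<And>j. j \<in> J \<Longrightarrow> abelian_group (M j)" by (rule graded_mod.abelian[OF M])
  show "(\<lambda>a. ar a \<odot>\<^bsub>direct_sum J M\<^esub> u a) \<in> T \<rightarrow> carrier (direct_sum J M)"
    by (rule Pi_I, rule arrow_smult_direct_sum) (use assms in blast)+
qed

lemma arrow_sum_direct_sum:
  assumes "T \<subseteq> arcs Q" "\<And>a. a \<in> T \<Longrightarrow> u a \<in> hcomp (direct_sum J M) n" "j \<in> J"
  shows "(\<Oplus>\<^bsub>direct_sum J M\<^esub>a\<in>T. ar a \<odot>\<^bsub>direct_sum J M\<^esub> u a) j = (\<Oplus>\<^bsub>M j\<^esub>a\<in>T. ar a \<odot>\<^bsub>M j\<^esub> u a j)"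
proof -
  have cl: "\<And>a. a \<in> T \<Longrightarrow> ar a \<odot>\<^bsub>direct_sum J M\<^esub> u a \<in> carrier (direct_sum J M)"
    by (rule arrow_smult_direct_sum) (use assms in blast)+
  have "(\<Oplus>\<^bsub>direct_sum J M\<^esub>a\<in>T. ar a \<odot>\<^bsub>direct_sum J M\<^esub> u a) j = (\<Oplus>\<^bsub>M j\<^esub>a\<in>T. (ar a \<odot>\<^bsub>direct_sum J M\<^esub> u a) j)"
    by (rule direct_sum_finsum[OF graded_mod.abelian[OF M] cl assms(3)])
  then show ?thesis using assms(3) by simp
qed

lemma hc_direct_sum_carrier: "m \<in> hcomp (direct_sum J M) n \<Longrightarrow> m \<in> carrier (direct_sum J M)"
  using graded_mod.hc_closed[OF M] by (auto simp: PiE_iff)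

lemma arrows_generate_direct_sum:
  assumes "\<And>j. j \<in> J \<Longrightarrow> arrows_generate (M j) n"
  shows "arrows_generate (direct_sum J M) n"
  unfolding arrows_generate_def
proof
  fix m assume m: "m \<in> hcomp (direct_sum J M) (n + 1)"
  have "\<forall>j\<in>J. \<exists>u. (\<forall>a\<in>arcs Q. u a \<in> hcomp (M j) n) \<and> m j = (\<Oplus>\<^bsub>M j\<^esub>a\<in>arcs Q. ar a \<odot>\<^bsub>M j\<^esub> u a)"
    using assms m unfolding arrows_generate_def by (auto simp: PiE_iff)
  then obtain u where "\<forall>j\<in>J. (\<forall>a\<in>arcs Q. u j a \<in> hcomp (M j) n) \<and> m j = (\<Oplus>\<^bsub>M j\<^esub>a\<in>arcs Q. ar a \<odot>\<^bsub>M j\<^esub> u j a)"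
    by (rule bchoice[THEN exE])
  then have u: "\<And>j a. j \<in> J \<Longrightarrow> a \<in> arcs Q \<Longrightarrow> u j a \<in> hcomp (M j) n"
    "\<And>j. j \<in> J \<Longrightarrow> m j = (\<Oplus>\<^bsub>M j\<^esub>a\<in>arcs Q. ar a \<odot>\<^bsub>M j\<^esub> u j a)" by blast+
  let ?U = "\<lambda>a. \<lambda>j\<in>J. u j a"
  have U: "?U a \<in> hcomp (direct_sum J M) n" if "a \<in> arcs Q" for a using u(1) that by auto
  have "m = (\<Oplus>\<^bsub>direct_sum J M\<^esub>a\<in>arcs Q. ar a \<odot>\<^bsub>direct_sum J M\<^esub> ?U a)"
  proof (rule PiE_ext[of _ J "\<lambda>j. carrier (M j)"])
    show "m \<in> (\<Pi>\<^sub>E j\<in>J. carrier (M j))" using hc_direct_sum_carrier[OF m] by simp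
    show "(\<Oplus>\<^bsub>direct_sum J M\<^esub>a\<in>arcs Q. ar a \<odot>\<^bsub>direct_sum J M\<^esub> ?U a) \<in> (\<Pi>\<^sub>E j\<in>J. carrier (M j))"
      using arrow_sum_direct_sum_closed[OF subset_refl U] by (simp only: direct_sum_sel(1))
    fix j assume j: "j \<in> J"
    have "(\<Oplus>\<^bsub>direct_sum J M\<^esub>a\<in>arcs Q. ar a \<odot>\<^bsub>direct_sum J M\<^esub> ?U a) j = (\<Oplus>\<^bsub>M j\<^esub>a\<in>arcs Q. ar a \<odot>\<^bsub>M j\<^esub> ?U a j)"
      by (rule arrow_sum_direct_sum[OF subset_refl U j])
    then show "m j = (\<Oplus>\<^bsub>direct_sum J M\<^esub>a\<in>arcs Q. ar a \<odot>\<^bsub>direct_sum J M\<^esub> ?U a) j"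
      using u(2) j by simp
  qed
  then show "\<exists>u. (\<forall>a\<in>arcs Q. u a \<in> hcomp (direct_sum J M) n) \<and>
      m = (\<Oplus>\<^bsub>direct_sum J M\<^esub>a\<in>arcs Q. ar a \<odot>\<^bsub>direct_sum J M\<^esub> u a)"
    using U by (intro exI[where x = ?U]) blast
qed

lemma arrows_independent_direct_sum:
  assumes "\<And>j. j \<in> J \<Longrightarrow> arrows_independent (M j) n"
  shows "arrows_independent (direct_sum J M) n"
  unfolding arrows_independent_def
proof (intro allI impI ballI)
  fix u a
  assume u: "\<forall>a\<in>arcs Q. u a \<in> hcomp (direct_sum J M) n"
    and z: "(\<Oplus>\<^bsub>direct_sum J M\<^esub>a\<in>arcs Q. ar a \<odot>\<^bsub>direct_sum J M\<^esub> u a) = \<zero>\<^bsub>direct_sum J M\<^esub>"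
    and a: "a \<in> arcs Q"
  have "ar a \<odot>\<^bsub>M j\<^esub> u a j = \<zero>\<^bsub>M j\<^esub>" if j: "j \<in> J" for j
  proof -
    have "(\<Oplus>\<^bsub>M j\<^esub>a\<in>arcs Q. ar a \<odot>\<^bsub>M j\<^esub> u a j) = \<zero>\<^bsub>M j\<^esub>"
      using arrow_sum_direct_sum[of "arcs Q" u n j] u z j by simp
    moreover have "\<forall>a\<in>arcs Q. u a j \<in> hcomp (M j) n" using u j by auto
    ultimately show ?thesis using assms[OF j] a unfolding arrows_independent_def
      by (elim allE[where x = "\<lambda>a. u a j"]) blast
  qed
  then show "ar a \<odot>\<^bsub>direct_sum J M\<^esub> u a = \<zero>\<^bsub>direct_sum J M\<^esub>" by (auto intro!: restrict_ext)
qed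

lemma arrow_kernels_direct_sum:
  assumes "\<And>j. j \<in> J \<Longrightarrow> arrow_kernels (M j) n"
  shows "arrow_kernels (direct_sum J M) n"
  unfolding arrow_kernels_def
proof (intro ballI impI)
  fix a m
  assume m: "m \<in> hcomp (direct_sum J M) n" and a: "a \<in> arcs Q"
    and em: "e (tail Q a) \<odot>\<^bsub>direct_sum J M\<^esub> m = m" and z: "ar a \<odot>\<^bsub>direct_sum J M\<^esub> m = \<zero>\<^bsub>direct_sum J M\<^esub>"
  have "\<forall>j\<in>J. \<exists>u. (\<forall>b. zr b a \<longrightarrow> u b \<in> hcomp (M j) (n - 1)) \<and>
      m j = (\<Oplus>\<^bsub>M j\<^esub>b\<in>{b. zr b a}. ar b \<odot>\<^bsub>M j\<^esub> u b)"
  proof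
    fix j assume j: "j \<in> J"
    have "m j \<in> hcomp (M j) n" using m j by auto
    moreover have "e (tail Q a) \<odot>\<^bsub>M j\<^esub> m j = m j" using fun_cong[OF em, of j] j by simp
    moreover have "ar a \<odot>\<^bsub>M j\<^esub> m j = \<zero>\<^bsub>M j\<^esub>" using fun_cong[OF z, of j] j by simp
    ultimately show "\<exists>u. (\<forall>b. zr b a \<longrightarrow> u b \<in> hcomp (M j) (n - 1)) \<and>
      m j = (\<Oplus>\<^bsub>M j\<^esub>b\<in>{b. zr b a}. ar b \<odot>\<^bsub>M j\<^esub> u b)"
      using assms[OF j] a unfolding arrow_kernels_def by blast
  qed
  then obtain u where "\<forall>j\<in>J. (\<forall>b. zr b a \<longrightarrow> u j b \<in> hcomp (M j) (n - 1)) \<and>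
      m j = (\<Oplus>\<^bsub>M j\<^esub>b\<in>{b. zr b a}. ar b \<odot>\<^bsub>M j\<^esub> u j b)"
    by (rule bchoice[THEN exE])
  then have u: "\<And>j b. j \<in> J \<Longrightarrow> zr b a \<Longrightarrow> u j b \<in> hcomp (M j) (n - 1)"
    "\<And>j. j \<in> J \<Longrightarrow> m j = (\<Oplus>\<^bsub>M j\<^esub>b\<in>{b. zr b a}. ar b \<odot>\<^bsub>M j\<^esub> u j b)" by blast+
  let ?U = "\<lambda>a. \<lambda>j\<in>J. u j a"
  have U: "?U b \<in> hcomp (direct_sum J M) (n - 1)" if "b \<in> {b. zr b a}" for b using u(1) that by auto
  have sub: "{b. zr b a} \<subseteq> arcs Q" by (auto simp: zr_def)
  have "m = (\<Oplus>\<^bsub>direct_sum J M\<^esub>b\<in>{b. zr b a}. ar b \<odot>\<^bsub>direct_sum J M\<^esub> ?U b)"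
  proof (rule PiE_ext[of _ J "\<lambda>j. carrier (M j)"])
    show "m \<in> (\<Pi>\<^sub>E j\<in>J. carrier (M j))" using hc_direct_sum_carrier[OF m] by simp
    show "(\<Oplus>\<^bsub>direct_sum J M\<^esub>b\<in>{b. zr b a}. ar b \<odot>\<^bsub>direct_sum J M\<^esub> ?U b) \<in> (\<Pi>\<^sub>E j\<in>J. carrier (M j))"
      using arrow_sum_direct_sum_closed[OF sub U] by (simp only: direct_sum_sel(1))
    fix j assume j: "j \<in> J"
    have "(\<Oplus>\<^bsub>direct_sum J M\<^esub>b\<in>{b. zr b a}. ar b \<odot>\<^bsub>direct_sum J M\<^esub> ?U b) j =
        (\<Oplus>\<^bsub>M j\<^esub>b\<in>{b. zr b a}. ar b \<odot>\<^bsub>M j\<^esub> ?U b j)"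
      by (rule arrow_sum_direct_sum[OF sub U j])
    then show "m j = (\<Oplus>\<^bsub>direct_sum J M\<^esub>b\<in>{b. zr b a}. ar b \<odot>\<^bsub>direct_sum J M\<^esub> ?U b) j"
      using u(2) j by simp
  qed
  then show "\<exists>u. (\<forall>b. zr b a \<longrightarrow> u b \<in> hcomp (direct_sum J M) (n - 1)) \<and>
      m = (\<Oplus>\<^bsub>direct_sum J M\<^esub>b\<in>{b. zr b a}. ar b \<odot>\<^bsub>direct_sum J M\<^esub> u b)"
    using U by (intro exI[where x = ?U]) blast
qed

lemma arrows_detect_direct_sum:
  assumes "\<And>j. j \<in> J \<Longrightarrow> arrows_detect (M j) n"
  shows "arrows_detect (direct_sum J M) n"
  unfolding arrows_detect_def
proof (intro ballI impI)
  fix m assume m: "m \<in> hcomp (direct_sum J M) n"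
    and z: "\<forall>a\<in>arcs Q. ar a \<odot>\<^bsub>direct_sum J M\<^esub> m = \<zero>\<^bsub>direct_sum J M\<^esub>"
  have "m j = \<zero>\<^bsub>M j\<^esub>" if j: "j \<in> J" for j
  proof -
    have "ar a \<odot>\<^bsub>M j\<^esub> m j = \<zero>\<^bsub>M j\<^esub>" if "a \<in> arcs Q" for a
      using fun_cong[OF z[rule_format, OF that], of j] j by simp
    moreover have "m j \<in> hcomp (M j) n" using m j by auto
    ultimately show ?thesis using assms[OF j] unfolding arrows_detect_def by blast
  qed
  then show "m = \<zero>\<^bsub>direct_sum J M\<^esub>" using m by (auto simp: PiE_iff extensional_def fun_eq_iff)
qed

lemma arrows_separate_direct_sum:
  assumes "\<And>j. j \<in> J \<Longrightarrow> arrows_separate (M j) n"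
  shows "arrows_separate (direct_sum J M) n"
  unfolding arrows_separate_def
proof (intro ballI)
  fix u a assume u: "u \<in> hcomp (direct_sum J M) n" and a: "a \<in> arcs Q"
  have "\<forall>j\<in>J. \<exists>m\<in>hcomp (M j) n. ar a \<odot>\<^bsub>M j\<^esub> m = ar a \<odot>\<^bsub>M j\<^esub> u j \<and> (\<forall>b\<in>arcs Q. b \<noteq> a \<longrightarrow> ar b \<odot>\<^bsub>M j\<^esub> m = \<zero>\<^bsub>M j\<^esub>)"
    using assms u a unfolding arrows_separate_def by (auto simp: PiE_iff)
  then obtain m where m: "\<forall>j\<in>J. m j \<in> hcomp (M j) n \<and> ar a \<odot>\<^bsub>M j\<^esub> m j = ar a \<odot>\<^bsub>M j\<^esub> u j \<and>
      (\<forall>b\<in>arcs Q. b \<noteq> a \<longrightarrow> ar b \<odot>\<^bsub>M j\<^esub> m j = \<zero>\<^bsub>M j\<^esub>)" by metis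
  show "\<exists>m\<in>hcomp (direct_sum J M) n. ar a \<odot>\<^bsub>direct_sum J M\<^esub> m = ar a \<odot>\<^bsub>direct_sum J M\<^esub> u \<and>
      (\<forall>b\<in>arcs Q. b \<noteq> a \<longrightarrow> ar b \<odot>\<^bsub>direct_sum J M\<^esub> m = \<zero>\<^bsub>direct_sum J M\<^esub>)"
    using m by (intro bexI[where x = "\<lambda>j\<in>J. m j"]) (auto intro!: restrict_ext)
qed

lemma arrow_images_direct_sum:
  assumes "\<And>j. j \<in> J \<Longrightarrow> arrow_images (M j) n"
  shows "arrow_images (direct_sum J M) n"
  unfolding arrow_images_def
proof (intro ballI impI)
  fix v a assume v: "v \<in> hcomp (direct_sum J M) n" and a: "a \<in> arcs Q"
    and ev: "e (head Q a) \<odot>\<^bsub>direct_sum J M\<^esub> v = v"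
    and z: "\<forall>b. zr a b \<longrightarrow> ar b \<odot>\<^bsub>direct_sum J M\<^esub> v = \<zero>\<^bsub>direct_sum J M\<^esub>"
  have "\<exists>m\<in>hcomp (M j) (n - 1). ar a \<odot>\<^bsub>M j\<^esub> m = v j" if j: "j \<in> J" for j
  proof -
    have "v j \<in> hcomp (M j) n" using v j by auto
    moreover have "e (head Q a) \<odot>\<^bsub>M j\<^esub> v j = v j" using fun_cong[OF ev, of j] j by simp
    moreover have "ar b \<odot>\<^bsub>M j\<^esub> v j = \<zero>\<^bsub>M j\<^esub>" if "zr a b" for b
      using fun_cong[OF z[rule_format, OF that], of j] j by simp
    ultimately show ?thesis using assms[OF j] a unfolding arrow_images_def by blast
  qed
  then obtain m where m: "\<forall>j\<in>J. m j \<in> hcomp (M j) (n - 1) \<and> ar a \<odot>\<^bsub>M j\<^esub> m j = v j" by metis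
  show "\<exists>m\<in>hcomp (direct_sum J M) (n - 1). ar a \<odot>\<^bsub>direct_sum J M\<^esub> m = v"
    using m v by (intro bexI[where x = "\<lambda>j\<in>J. m j"]) (auto simp: PiE_iff extensional_def fun_eq_iff)
qed

end

subsection \<open>Cokernels and kernels\<close>

text \<open>In degrees in which the relations are generated by arrows, a cokernel inherits the behaviour of
  the arrows from the module that it is a quotient of.\<close>

context
  fixes P1 :: "((('v, 'e) qpath \<Rightarrow> 'k) set, 'p) graded_module"
    and P0 :: "((('v, 'e) qpath \<Rightarrow> 'k) set, 'q) graded_module"
    and M :: "((('v, 'e) qpath \<Rightarrow> 'k) set, 'm) graded_module" and c1 c0 c d \<pi>
  assumes P1: "graded_mod Q S I P1 c1" and P0: "graded_mod Q S I P0 c0" and M: "graded_mod Q S I M c"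
    and d: "d \<in> graded_hom Q I P1 P0" and \<pi>: "\<pi> \<in> graded_hom Q I P0 M"
    and ex: "d ` carrier P1 = a_kernel P0 M \<pi>" and surj: "\<pi> ` carrier P0 = carrier M"
begin

interpretation P1: graded_mod Q S I P1 c1 by (rule P1)
interpretation P0: graded_mod Q S I P0 c0 by (rule P0)
interpretation M: graded_mod Q S I M c by (rule M)

lemma coker_lift:
  assumes "m \<in> hcomp M n" obtains v where "v \<in> hcomp P0 n" "\<pi> v = m"
proof -
  obtain v where v: "v \<in> carrier P0" "\<pi> v = m" using assms M.hc_closed surj by (metis image_iff)
  then have "\<pi> (c0 n v) = m" using graded_hom_cmp[OF P0 M \<pi>] M.cmp_same[OF assms] by simp
  then show ?thesis using that P0.cmp_hc[OF v(1)] by blast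
qed

lemma coker_kernel_lift:
  assumes "v \<in> hcomp P0 n" "\<pi> v = \<zero>\<^bsub>M\<^esub>" obtains w where "w \<in> hcomp P1 n" "d w = v"
proof -
  have "v \<in> d ` carrier P1" unfolding ex a_kernel_iff using assms P0.hc_closed by blast
  then obtain w where w: "w \<in> carrier P1" "d w = v" by blast
  then have "d (c1 n w) = v" using graded_hom_cmp[OF P1 P0 d] P0.cmp_same[OF assms(1)] by simp
  then show ?thesis using that P1.cmp_hc[OF w(1)] by blast
qed

lemma \<pi>_sum:
  assumes "T \<subseteq> arcs Q" "\<And>a. a \<in> T \<Longrightarrow> u a \<in> carrier P0"
  shows "\<pi> (\<Oplus>\<^bsub>P0\<^esub>a\<in>T. ar a \<odot>\<^bsub>P0\<^esub> u a) = (\<Oplus>\<^bsub>M\<^esub>a\<in>T. ar a \<odot>\<^bsub>M\<^esub> \<pi> (u a))"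
proof -
  have "\<pi> (\<Oplus>\<^bsub>P0\<^esub>a\<in>T. ar a \<odot>\<^bsub>P0\<^esub> u a) = (\<Oplus>\<^bsub>M\<^esub>a\<in>T. \<pi> (ar a \<odot>\<^bsub>P0\<^esub> u a))"
    by (rule additive_finsum[OF P0.abelian M.abelian graded_homD(1)[OF \<pi>]])
      (use assms in \<open>auto intro!: P0.M.smult_closed\<close>)
  also have "\<dots> = (\<Oplus>\<^bsub>M\<^esub>a\<in>T. ar a \<odot>\<^bsub>M\<^esub> \<pi> (u a))"
    by (rule M.M.M.finsum_cong')
      (use assms graded_homD(2,4)[OF \<pi>] in \<open>auto intro!: M.M.smult_closed\<close>)
  finally show ?thesis .
qed

lemma arrows_generate_coker: "arrows_generate P0 n \<Longrightarrow> arrows_generate M n"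
  unfolding arrows_generate_def
proof
  fix m assume P: "\<forall>m\<in>hcomp P0 (n + 1). \<exists>u. (\<forall>a\<in>arcs Q. u a \<in> hcomp P0 n) \<and> m = (\<Oplus>\<^bsub>P0\<^esub>a\<in>arcs Q. ar a \<odot>\<^bsub>P0\<^esub> u a)"
    and m: "m \<in> hcomp M (n + 1)"
  obtain v where v: "v \<in> hcomp P0 (n + 1)" "\<pi> v = m" using m by (rule coker_lift)
  then obtain u where u: "\<forall>a\<in>arcs Q. u a \<in> hcomp P0 n" "v = (\<Oplus>\<^bsub>P0\<^esub>a\<in>arcs Q. ar a \<odot>\<^bsub>P0\<^esub> u a)"
    using P by blast
  have "m = (\<Oplus>\<^bsub>M\<^esub>a\<in>arcs Q. ar a \<odot>\<^bsub>M\<^esub> \<pi> (u a))"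
    using \<pi>_sum[of "arcs Q" u] u P0.hc_closed v(2) by auto
  then show "\<exists>u. (\<forall>a\<in>arcs Q. u a \<in> hcomp M n) \<and> m = (\<Oplus>\<^bsub>M\<^esub>a\<in>arcs Q. ar a \<odot>\<^bsub>M\<^esub> u a)"
    using u(1) graded_homD(5)[OF \<pi>] by (intro exI[where x = "\<lambda>a. \<pi> (u a)"]) blast
qed

text \<open>A combination of arrows that vanishes in the cokernel is a relation, hence a combination of arrows
  applied to relations \<open>w a\<close>; since the images of different arrows are independent in \<open>P0\<close>, the
  two combinations agree term by term.\<close>

lemma coker_correction:
  assumes G: "arrows_generate P1 n" and D: "arrows_independent P0 n"
    and v: "\<And>a. a \<in> arcs Q \<Longrightarrow> v a \<in> hcomp P0 n"
    and z: "\<pi> (\<Oplus>\<^bsub>P0\<^esub>a\<in>arcs Q. ar a \<odot>\<^bsub>P0\<^esub> v a) = \<zero>\<^bsub>M\<^esub>"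
  obtains w where "\<And>a. a \<in> arcs Q \<Longrightarrow> w a \<in> hcomp P1 n"
    "\<And>a. a \<in> arcs Q \<Longrightarrow> ar a \<odot>\<^bsub>P0\<^esub> v a = ar a \<odot>\<^bsub>P0\<^esub> d (w a)"
proof -
  have "(\<Oplus>\<^bsub>P0\<^esub>a\<in>arcs Q. ar a \<odot>\<^bsub>P0\<^esub> v a) \<in> hcomp P0 (n + 1)"
    by (rule P0.hc_finsum) (rule P0.ar_smult_hc, auto intro: v)
  then obtain y where y: "y \<in> hcomp P1 (n + 1)" "d y = (\<Oplus>\<^bsub>P0\<^esub>a\<in>arcs Q. ar a \<odot>\<^bsub>P0\<^esub> v a)"
    using z by (rule coker_kernel_lift)
  then obtain w where w: "\<forall>a\<in>arcs Q. w a \<in> hcomp P1 n" "y = (\<Oplus>\<^bsub>P1\<^esub>a\<in>arcs Q. ar a \<odot>\<^bsub>P1\<^esub> w a)"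
    using G unfolding arrows_generate_def by blast
  have wc: "w a \<in> carrier P1" "d (w a) \<in> carrier P0" "v a \<in> carrier P0" if "a \<in> arcs Q" for a
    using w(1) v that P1.hc_closed P0.hc_closed graded_homD(2)[OF d] by blast+
  have s: "ar a \<odot>\<^bsub>P0\<^esub> v a \<in> carrier P0" "ar a \<odot>\<^bsub>P0\<^esub> d (w a) \<in> carrier P0" if "a \<in> arcs Q" for a
    using wc[OF that] that by (auto intro: P0.M.smult_closed)
  have "d y = (\<Oplus>\<^bsub>P0\<^esub>a\<in>arcs Q. d (ar a \<odot>\<^bsub>P1\<^esub> w a))"
    unfolding w(2) by (rule additive_finsum[OF P1.abelian P0.abelian graded_homD(1)[OF d]])
      (use wc in \<open>auto intro: P1.M.smult_closed\<close>)
  also have "\<dots> = (\<Oplus>\<^bsub>P0\<^esub>a\<in>arcs Q. ar a \<odot>\<^bsub>P0\<^esub> d (w a))"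
    by (rule P0.M.M.finsum_cong') (use wc s graded_homD(4)[OF d] in auto)
  finally have eq: "(\<Oplus>\<^bsub>P0\<^esub>a\<in>arcs Q. ar a \<odot>\<^bsub>P0\<^esub> v a) = (\<Oplus>\<^bsub>P0\<^esub>a\<in>arcs Q. ar a \<odot>\<^bsub>P0\<^esub> d (w a))"
    using y(2) by simp
  have diff: "ar a \<odot>\<^bsub>P0\<^esub> (v a \<ominus>\<^bsub>P0\<^esub> d (w a)) = ar a \<odot>\<^bsub>P0\<^esub> v a \<oplus>\<^bsub>P0\<^esub> \<ominus>\<^bsub>P0\<^esub> (ar a \<odot>\<^bsub>P0\<^esub> d (w a))"
    if "a \<in> arcs Q" for a
    using wc[OF that] that by (simp add: P0.M.M.minus_eq P0.M.smult_r_distr P0.M.smult_r_minus)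
  have "(\<Oplus>\<^bsub>P0\<^esub>a\<in>arcs Q. ar a \<odot>\<^bsub>P0\<^esub> (v a \<ominus>\<^bsub>P0\<^esub> d (w a))) =
      (\<Oplus>\<^bsub>P0\<^esub>a\<in>arcs Q. ar a \<odot>\<^bsub>P0\<^esub> v a \<oplus>\<^bsub>P0\<^esub> \<ominus>\<^bsub>P0\<^esub> (ar a \<odot>\<^bsub>P0\<^esub> d (w a)))"
    by (rule P0.M.M.finsum_cong') (use diff s in auto)
  also have "\<dots> = (\<Oplus>\<^bsub>P0\<^esub>a\<in>arcs Q. ar a \<odot>\<^bsub>P0\<^esub> v a) \<oplus>\<^bsub>P0\<^esub> (\<Oplus>\<^bsub>P0\<^esub>a\<in>arcs Q. \<ominus>\<^bsub>P0\<^esub> (ar a \<odot>\<^bsub>P0\<^esub> d (w a)))"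
    by (rule P0.M.M.finsum_addf) (use s in auto)
  also have "(\<Oplus>\<^bsub>P0\<^esub>a\<in>arcs Q. \<ominus>\<^bsub>P0\<^esub> (ar a \<odot>\<^bsub>P0\<^esub> d (w a))) = \<ominus>\<^bsub>P0\<^esub> (\<Oplus>\<^bsub>P0\<^esub>a\<in>arcs Q. ar a \<odot>\<^bsub>P0\<^esub> d (w a))"
    by (rule additive_finsum[OF P0.abelian P0.abelian, symmetric])
      (use s in \<open>auto simp: hom_def P0.M.M.minus_add\<close>)
  also have "(\<Oplus>\<^bsub>P0\<^esub>a\<in>arcs Q. ar a \<odot>\<^bsub>P0\<^esub> v a) \<oplus>\<^bsub>P0\<^esub> \<dots> = \<zero>\<^bsub>P0\<^esub>"
    unfolding eq by (rule P0.M.M.r_neg) (use s in \<open>auto intro!: P0.M.M.finsum_closed\<close>)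
  finally have zero: "(\<Oplus>\<^bsub>P0\<^esub>a\<in>arcs Q. ar a \<odot>\<^bsub>P0\<^esub> (v a \<ominus>\<^bsub>P0\<^esub> d (w a))) = \<zero>\<^bsub>P0\<^esub>" .
  have "v a \<ominus>\<^bsub>P0\<^esub> d (w a) \<in> hcomp P0 n" if "a \<in> arcs Q" for a
    using that v w(1) graded_homD(5)[OF d] by (auto intro: P0.hc_diff)
  then have z': "ar a \<odot>\<^bsub>P0\<^esub> (v a \<ominus>\<^bsub>P0\<^esub> d (w a)) = \<zero>\<^bsub>P0\<^esub>" if "a \<in> arcs Q" for a
    using D zero that unfolding arrows_independent_def by (elim allE[where x = "\<lambda>a. v a \<ominus>\<^bsub>P0\<^esub> d (w a)"]) blast
  have "ar a \<odot>\<^bsub>P0\<^esub> v a = ar a \<odot>\<^bsub>P0\<^esub> d (w a)" if a: "a \<in> arcs Q" for a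
    by (rule P0.M.M.eq_if_diff_zero[OF s[OF a] trans[OF diff[OF a, symmetric] z'[OF a]]])
  then show ?thesis using that w(1) by blast
qed

lemma \<pi>_d: "w \<in> carrier P1 \<Longrightarrow> \<pi> (d w) = \<zero>\<^bsub>M\<^esub>"
proof -
  assume "w \<in> carrier P1"
  then have "d w \<in> a_kernel P0 M \<pi>" unfolding ex[symmetric] by (rule imageI)
  then show ?thesis by (simp add: a_kernel_iff)
qed

lemma arrows_independent_coker:
  assumes G: "arrows_generate P1 n" and D: "arrows_independent P0 n"
  shows "arrows_independent M n"
  unfolding arrows_independent_def
proof (intro allI impI ballI)
  fix u a assume u: "\<forall>a\<in>arcs Q. u a \<in> hcomp M n"
    and z: "(\<Oplus>\<^bsub>M\<^esub>a\<in>arcs Q. ar a \<odot>\<^bsub>M\<^esub> u a) = \<zero>\<^bsub>M\<^esub>" and a: "a \<in> arcs Q"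
  have "\<forall>a\<in>arcs Q. \<exists>v. v \<in> hcomp P0 n \<and> \<pi> v = u a"
  proof
    fix a assume "a \<in> arcs Q"
    then have "u a \<in> hcomp M n" using u by blast
    then show "\<exists>v. v \<in> hcomp P0 n \<and> \<pi> v = u a" by (rule coker_lift) blast
  qed
  then obtain v where "\<forall>a\<in>arcs Q. v a \<in> hcomp P0 n \<and> \<pi> (v a) = u a" by (rule bchoice[THEN exE])
  then have v: "\<And>a. a \<in> arcs Q \<Longrightarrow> v a \<in> hcomp P0 n \<and> \<pi> (v a) = u a" by blast
  have "\<pi> (\<Oplus>\<^bsub>P0\<^esub>a\<in>arcs Q. ar a \<odot>\<^bsub>P0\<^esub> v a) = (\<Oplus>\<^bsub>M\<^esub>a\<in>arcs Q. ar a \<odot>\<^bsub>M\<^esub> \<pi> (v a))"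
    by (rule \<pi>_sum) (use v P0.hc_closed in auto)
  also have "\<dots> = (\<Oplus>\<^bsub>M\<^esub>a\<in>arcs Q. ar a \<odot>\<^bsub>M\<^esub> u a)"
    by (rule M.M.M.finsum_cong') (use v u M.hc_closed in \<open>auto intro!: M.M.smult_closed\<close>)
  finally have "\<pi> (\<Oplus>\<^bsub>P0\<^esub>a\<in>arcs Q. ar a \<odot>\<^bsub>P0\<^esub> v a) = \<zero>\<^bsub>M\<^esub>" using z by simp
  then obtain w where w: "\<And>a. a \<in> arcs Q \<Longrightarrow> w a \<in> hcomp P1 n"
    "\<And>a. a \<in> arcs Q \<Longrightarrow> ar a \<odot>\<^bsub>P0\<^esub> v a = ar a \<odot>\<^bsub>P0\<^esub> d (w a)"
    using coker_correction[OF G D, of v] v by blast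
  have wa: "w a \<in> carrier P1" "d (w a) \<in> carrier P0" "v a \<in> carrier P0"
    using w(1)[OF a] v[OF a] P1.hc_closed P0.hc_closed graded_homD(2)[OF d] by blast+
  have "ar a \<odot>\<^bsub>M\<^esub> u a = \<pi> (ar a \<odot>\<^bsub>P0\<^esub> v a)" using v[OF a] graded_homD(4)[OF \<pi>] wa a by simp
  also have "\<dots> = ar a \<odot>\<^bsub>M\<^esub> \<pi> (d (w a))" using w(2)[OF a] graded_homD(4)[OF \<pi>] wa a by simp
  also have "\<dots> = \<zero>\<^bsub>M\<^esub>" using \<pi>_d[OF wa(1)] a by (simp add: M.M.smult_r_null)
  finally show "ar a \<odot>\<^bsub>M\<^esub> u a = \<zero>\<^bsub>M\<^esub>" .
qed

text \<open>Let \<open>a\<close> kill the class of \<open>v\<close>.  By the correction lemma \<open>v\<close> may be changed by a relation so that \<open>a v\<close>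
  vanishes in the projective module, where the kernel of \<open>a\<close> is known.\<close>

lemma arrow_kernels_coker:
  assumes G: "arrows_generate P1 n" and D: "arrows_independent P0 n" and K: "arrow_kernels P0 n"
  shows "arrow_kernels M n"
  unfolding arrow_kernels_def
proof (intro ballI impI)
  fix a u assume a: "a \<in> arcs Q" and u: "u \<in> hcomp M n"
    and eu: "e (tail Q a) \<odot>\<^bsub>M\<^esub> u = u" and z: "ar a \<odot>\<^bsub>M\<^esub> u = \<zero>\<^bsub>M\<^esub>"
  obtain v where v: "v \<in> hcomp P0 n" "\<pi> v = u" using u by (rule coker_lift)
  have vc: "v \<in> carrier P0" using v P0.hc_closed by blast
  let ?v = "\<lambda>b. if b = a then v else \<zero>\<^bsub>P0\<^esub>"
  have "(\<Oplus>\<^bsub>P0\<^esub>b\<in>arcs Q. ar b \<odot>\<^bsub>P0\<^esub> ?v b) = ar a \<odot>\<^bsub>P0\<^esub> v"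
    using P0.M.M.finsum_only[of "arcs Q" a "\<lambda>b. ar b \<odot>\<^bsub>P0\<^esub> ?v b"] a vc
    by (simp add: P0.M.smult_closed P0.M.smult_r_null)
  then have "\<pi> (\<Oplus>\<^bsub>P0\<^esub>b\<in>arcs Q. ar b \<odot>\<^bsub>P0\<^esub> ?v b) = \<zero>\<^bsub>M\<^esub>"
    using graded_homD(4)[OF \<pi>] a vc v z by simp
  moreover have "?v b \<in> hcomp P0 n" for b using v P0.hc_zero by simp
  ultimately obtain w where w: "\<And>a. a \<in> arcs Q \<Longrightarrow> w a \<in> hcomp P1 n"
    "\<And>b. b \<in> arcs Q \<Longrightarrow> ar b \<odot>\<^bsub>P0\<^esub> ?v b = ar b \<odot>\<^bsub>P0\<^esub> d (w b)"
    using coker_correction[OF G D, of ?v] by blast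
  have wa: "w a \<in> carrier P1" "d (w a) \<in> hcomp P0 n" "d (w a) \<in> carrier P0" "ar a \<odot>\<^bsub>P0\<^esub> v = ar a \<odot>\<^bsub>P0\<^esub> d (w a)"
    using w[OF a] P1.hc_closed graded_homD(2,5)[OF d] by auto
  let ?x = "v \<ominus>\<^bsub>P0\<^esub> d (w a)" and ?e = "e (tail Q a)"
  have eA: "?e \<in> carrier A" "?e \<in> dg 0" using a e_deg by auto
  have x: "?x \<in> hcomp P0 n" using v(1) wa(2) by (rule P0.hc_diff)
  then have xc: "?x \<in> carrier P0" by (rule P0.hc_closed)
  let ?y = "?e \<odot>\<^bsub>P0\<^esub> ?x"
  have y: "?y \<in> hcomp P0 n" using a x by (intro P0.e_smult_hc) auto
  have ax: "ar a \<odot>\<^bsub>P0\<^esub> ?x = \<zero>\<^bsub>P0\<^esub>"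
    using vc wa a by (simp add: P0.M.M.minus_eq P0.M.smult_r_distr P0.M.smult_r_minus P0.M.smult_closed P0.M.M.r_neg)
  have "ar a \<odot>\<^bsub>P0\<^esub> ?y = (ar a \<star> ?e) \<odot>\<^bsub>P0\<^esub> ?x" using P0.M.smult_assoc[of "ar a" ?e ?x] a xc eA by simp
  then have ay: "ar a \<odot>\<^bsub>P0\<^esub> ?y = \<zero>\<^bsub>P0\<^esub>" using ax a by (simp add: ar_e_tail)
  have ey: "?e \<odot>\<^bsub>P0\<^esub> ?y = ?y"
    using P0.M.smult_assoc[of ?e ?e ?x] xc eA a by (simp add: e_idem)
  obtain t where t: "\<forall>b. zr b a \<longrightarrow> t b \<in> hcomp P0 (n - 1)" "?y = (\<Oplus>\<^bsub>P0\<^esub>b\<in>{b. zr b a}. ar b \<odot>\<^bsub>P0\<^esub> t b)"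
    using K a y ay ey unfolding arrow_kernels_def by blast
  have "\<pi> ?x = u"
  proof -
    have "\<pi> ?x = \<pi> v \<oplus>\<^bsub>M\<^esub> \<ominus>\<^bsub>M\<^esub> \<pi> (d (w a))"
      using vc wa graded_homD(3)[OF \<pi>] additive_minus[OF P0.abelian M.abelian graded_homD(1)[OF \<pi>]]
      by (simp add: P0.M.M.minus_eq)
    then show ?thesis using \<pi>_d[OF wa(1)] v(2) M.hc_closed[OF u] by simp
  qed
  then have "u = \<pi> ?y" using graded_homD(4)[OF \<pi> eA(1) xc] eu by simp
  also have "\<dots> = (\<Oplus>\<^bsub>M\<^esub>b\<in>{b. zr b a}. ar b \<odot>\<^bsub>M\<^esub> \<pi> (t b))"
    unfolding t(2) by (rule \<pi>_sum) (use t(1) P0.hc_closed zr_arcs in auto)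
  finally show "\<exists>w. (\<forall>b. zr b a \<longrightarrow> w b \<in> hcomp M (n - 1)) \<and> u = (\<Oplus>\<^bsub>M\<^esub>b\<in>{b. zr b a}. ar b \<odot>\<^bsub>M\<^esub> w b)"
    using t(1) graded_homD(5)[OF \<pi>] by (intro exI[where x = "\<lambda>b. \<pi> (t b)"]) blast
qed

end

text \<open>Dually, a kernel inherits the behaviour of the arrows in degrees in which they detect the
  elements of the target.\<close>

context
  fixes M :: "((('v, 'e) qpath \<Rightarrow> 'k) set, 'm) graded_module"
    and J0 :: "((('v, 'e) qpath \<Rightarrow> 'k) set, 'p) graded_module"
    and J1 :: "((('v, 'e) qpath \<Rightarrow> 'k) set, 'q) graded_module" and c c0 c1 d \<iota>
  assumes M: "graded_mod Q S I M c" and J0: "graded_mod Q S I J0 c0" and J1: "graded_mod Q S I J1 c1"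
    and \<iota>: "\<iota> \<in> graded_hom Q I M J0" and d: "d \<in> graded_hom Q I J0 J1"
    and inj: "inj_on \<iota> (carrier M)" and ex: "\<iota> ` carrier M = a_kernel J0 J1 d"
begin

interpretation M: graded_mod Q S I M c by (rule M)
interpretation J0: graded_mod Q S I J0 c0 by (rule J0)
interpretation J1: graded_mod Q S I J1 c1 by (rule J1)

lemma ker_lift:
  assumes "v \<in> hcomp J0 n" "d v = \<zero>\<^bsub>J1\<^esub>" obtains m where "m \<in> hcomp M n" "\<iota> m = v"
proof -
  have "v \<in> \<iota> ` carrier M" unfolding ex a_kernel_iff using assms J0.hc_closed by blast
  then obtain m where m: "m \<in> carrier M" "\<iota> m = v" by blast
  then have "\<iota> (c n m) = v" using graded_hom_cmp[OF M J0 \<iota>] J0.cmp_same[OF assms(1)] by simp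
  then show ?thesis using that M.cmp_hc[OF m(1)] by blast
qed

lemma d_\<iota>: "m \<in> carrier M \<Longrightarrow> d (\<iota> m) = \<zero>\<^bsub>J1\<^esub>"
proof -
  assume "m \<in> carrier M"
  then have "\<iota> m \<in> a_kernel J0 J1 d" unfolding ex[symmetric] by (rule imageI)
  then show ?thesis by (simp add: a_kernel_iff)
qed

lemma \<iota>_zero: "m \<in> carrier M \<Longrightarrow> \<iota> m = \<zero>\<^bsub>J0\<^esub> \<longleftrightarrow> m = \<zero>\<^bsub>M\<^esub>"
  using inj_onD[OF inj, of m "\<zero>\<^bsub>M\<^esub>"] additive_zero[OF M.abelian J0.abelian graded_homD(1)[OF \<iota>]] by auto

text \<open>The differential of such a \<open>v\<close> is killed by all arrows, hence vanishes.\<close>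

lemma ker_detect:
  assumes D: "arrows_detect J1 n" and v: "v \<in> hcomp J0 n"
    and a: "\<And>a. a \<in> arcs Q \<Longrightarrow> \<exists>m\<in>carrier M. ar a \<odot>\<^bsub>J0\<^esub> v = \<iota> m"
  obtains m where "m \<in> hcomp M n" "\<iota> m = v"
proof -
  have "ar a \<odot>\<^bsub>J1\<^esub> d v = \<zero>\<^bsub>J1\<^esub>" if "a \<in> arcs Q" for a
    using graded_homD(4)[OF d, of "ar a" v] a[OF that] d_\<iota> J0.hc_closed[OF v] that by force
  moreover have "d v \<in> hcomp J1 n" by (rule graded_homD(5)[OF d v])
  ultimately have "d v = \<zero>\<^bsub>J1\<^esub>" using D unfolding arrows_detect_def by blast
  with v show ?thesis using that by (rule ker_lift)
qed

lemma \<iota>_ar: "a \<in> arcs Q \<Longrightarrow> m \<in> hcomp M n \<Longrightarrow> \<iota> (ar a \<odot>\<^bsub>M\<^esub> m) = ar a \<odot>\<^bsub>J0\<^esub> \<iota> m"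
  using graded_homD(4)[OF \<iota>] M.hc_closed by simp

lemma arrows_detect_ker: "arrows_detect J0 n \<Longrightarrow> arrows_detect M n"
  unfolding arrows_detect_def
proof (intro ballI impI)
  fix m assume D: "\<forall>m\<in>hcomp J0 n. (\<forall>a\<in>arcs Q. ar a \<odot>\<^bsub>J0\<^esub> m = \<zero>\<^bsub>J0\<^esub>) \<longrightarrow> m = \<zero>\<^bsub>J0\<^esub>"
    and m: "m \<in> hcomp M n" and z: "\<forall>a\<in>arcs Q. ar a \<odot>\<^bsub>M\<^esub> m = \<zero>\<^bsub>M\<^esub>"
  have "ar a \<odot>\<^bsub>J0\<^esub> \<iota> m = \<zero>\<^bsub>J0\<^esub>" if "a \<in> arcs Q" for a
    using \<iota>_ar[OF that m] z that \<iota>_zero[of "\<zero>\<^bsub>M\<^esub>"] by simp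
  then have "\<iota> m = \<zero>\<^bsub>J0\<^esub>" using D graded_homD(5)[OF \<iota> m] by blast
  then show "m = \<zero>\<^bsub>M\<^esub>" using \<iota>_zero[OF M.hc_closed[OF m]] by simp
qed

lemma arrows_separate_ker:
  assumes D: "arrows_detect J1 n" and T: "arrows_separate J0 n"
  shows "arrows_separate M n"
  unfolding arrows_separate_def
proof (intro ballI)
  fix u a assume u: "u \<in> hcomp M n" and a: "a \<in> arcs Q"
  obtain v where v: "v \<in> hcomp J0 n" "ar a \<odot>\<^bsub>J0\<^esub> v = ar a \<odot>\<^bsub>J0\<^esub> \<iota> u"
    "\<forall>b\<in>arcs Q. b \<noteq> a \<longrightarrow> ar b \<odot>\<^bsub>J0\<^esub> v = \<zero>\<^bsub>J0\<^esub>"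
    using T graded_homD(5)[OF \<iota> u] a unfolding arrows_separate_def by blast
  have av: "ar b \<odot>\<^bsub>J0\<^esub> v = \<iota> (if b = a then ar a \<odot>\<^bsub>M\<^esub> u else \<zero>\<^bsub>M\<^esub>)" if "b \<in> arcs Q" for b
    using v that \<iota>_ar[OF a u] \<iota>_zero[of "\<zero>\<^bsub>M\<^esub>"] by auto
  have cl: "(if b = a then ar a \<odot>\<^bsub>M\<^esub> u else \<zero>\<^bsub>M\<^esub>) \<in> carrier M" for b
    using a M.hc_closed[OF u] by (auto intro: M.M.smult_closed)
  obtain m where m: "m \<in> hcomp M n" "\<iota> m = v"
  proof (rule ker_detect[OF D v(1)])
    show "\<exists>x\<in>carrier M. ar b \<odot>\<^bsub>J0\<^esub> v = \<iota> x" if "b \<in> arcs Q" for b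
      using av[OF that] cl[of b] by (rule bexI)
  qed
  have "ar b \<odot>\<^bsub>M\<^esub> m = (if b = a then ar a \<odot>\<^bsub>M\<^esub> u else \<zero>\<^bsub>M\<^esub>)" if b: "b \<in> arcs Q" for b
  proof (rule inj_onD[OF inj _ _ cl])
    show "\<iota> (ar b \<odot>\<^bsub>M\<^esub> m) = \<iota> (if b = a then ar a \<odot>\<^bsub>M\<^esub> u else \<zero>\<^bsub>M\<^esub>)"
      using \<iota>_ar[OF b m(1)] av[OF b] m(2) by simp
    show "ar b \<odot>\<^bsub>M\<^esub> m \<in> carrier M" using b M.hc_closed[OF m(1)] by (auto intro: M.M.smult_closed)
  qed
  then show "\<exists>m\<in>hcomp M n. ar a \<odot>\<^bsub>M\<^esub> m = ar a \<odot>\<^bsub>M\<^esub> u \<and> (\<forall>b\<in>arcs Q. b \<noteq> a \<longrightarrow> ar b \<odot>\<^bsub>M\<^esub> m = \<zero>\<^bsub>M\<^esub>)"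
    using m(1) a by (intro bexI[where x = m]) auto
qed

text \<open>A preimage in \<open>J0\<close> need not come from \<open>M\<close>.  Separating the arrows gives one that all other arrows
  kill, so that every arrow moves it into the image of \<open>M\<close>, and \<open>ker_detect\<close> applies.\<close>

lemma arrow_images_ker:
  assumes D: "arrows_detect J1 (n - 1)" and T: "arrows_separate J0 (n - 1)" and E: "arrow_images J0 n"
  shows "arrow_images M n"
  unfolding arrow_images_def
proof (intro ballI impI)
  fix u a assume u: "u \<in> hcomp M n" and a: "a \<in> arcs Q"
    and eu: "e (head Q a) \<odot>\<^bsub>M\<^esub> u = u" and z: "\<forall>b. zr a b \<longrightarrow> ar b \<odot>\<^bsub>M\<^esub> u = \<zero>\<^bsub>M\<^esub>"
  have "e (head Q a) \<odot>\<^bsub>J0\<^esub> \<iota> u = \<iota> u"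
    using graded_homD(4)[OF \<iota>, of "e (head Q a)" u] a M.hc_closed[OF u] eu by simp
  moreover have "ar b \<odot>\<^bsub>J0\<^esub> \<iota> u = \<zero>\<^bsub>J0\<^esub>" if "zr a b" for b
    using \<iota>_ar[OF zr_arcs(1)[OF that] u] z that \<iota>_zero[of "\<zero>\<^bsub>M\<^esub>"] by simp
  ultimately obtain v' where v': "v' \<in> hcomp J0 (n - 1)" "ar a \<odot>\<^bsub>J0\<^esub> v' = \<iota> u"
    using E a graded_homD(5)[OF \<iota> u] unfolding arrow_images_def by blast
  obtain v where v: "v \<in> hcomp J0 (n - 1)" "ar a \<odot>\<^bsub>J0\<^esub> v = \<iota> u"
    "\<forall>b\<in>arcs Q. b \<noteq> a \<longrightarrow> ar b \<odot>\<^bsub>J0\<^esub> v = \<zero>\<^bsub>J0\<^esub>"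
    using T v' a unfolding arrows_separate_def by metis
  have av: "\<exists>x\<in>carrier M. ar b \<odot>\<^bsub>J0\<^esub> v = \<iota> x" if b: "b \<in> arcs Q" for b
  proof (rule bexI)
    show "ar b \<odot>\<^bsub>J0\<^esub> v = \<iota> (if b = a then u else \<zero>\<^bsub>M\<^esub>)"
      using v b \<iota>_zero[of "\<zero>\<^bsub>M\<^esub>"] by auto
    show "(if b = a then u else \<zero>\<^bsub>M\<^esub>) \<in> carrier M" using M.hc_closed[OF u] by simp
  qed
  obtain m where m: "m \<in> hcomp M (n - 1)" "\<iota> m = v"
    by (rule ker_detect[OF D v(1) av])
  have "ar a \<odot>\<^bsub>M\<^esub> m = u"
  proof (rule inj_onD[OF inj])
    show "\<iota> (ar a \<odot>\<^bsub>M\<^esub> m) = \<iota> u" using \<iota>_ar[OF a m(1)] v m(2) by simp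
    show "ar a \<odot>\<^bsub>M\<^esub> m \<in> carrier M" using a M.hc_closed[OF m(1)] by (auto intro: M.M.smult_closed)
  qed (rule M.hc_closed[OF u])
  then show "\<exists>m\<in>hcomp M (n - 1). ar a \<odot>\<^bsub>M\<^esub> m = u" using m(1) by blast
qed

end

end

section \<open>Projective modules\<close>

context quadratic_monomial
begin

abbreviation Pr :: "'v \<Rightarrow> ((('v, 'e) qpath \<Rightarrow> 'k) set, (('v, 'e) qpath \<Rightarrow> 'k) set) graded_module" where
  "Pr \<equiv> projective Q I"

lemma Pr_sel [simp]:
  "add (Pr x) = add A" "zero (Pr x) = zero A" "smult (Pr x) = mult A"
  "hcomp (Pr x) n = carrier (Pr x) \<inter> dg n"
  by (simp_all add: projective_def Let_def)

lemma Pr_carrier: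
  assumes "x \<in> verts Q"
  shows "carrier (Pr x) = {X \<in> carrier A. X \<star> e x = X}"
proof (rule equalityI; rule subsetI)
  fix X assume "X \<in> carrier (Pr x)"
  then obtain Y where Y: "Y \<in> carrier A" "X = Y \<star> e x" by (auto simp: projective_def Let_def)
  then have "X \<star> e x = X" using A.m_assoc[OF Y(1), of "e x" "e x"] assms by (simp add: e_idem)
  then show "X \<in> {X \<in> carrier A. X \<star> e x = X}" using Y assms by simp
next
  fix X assume X: "X \<in> {X \<in> carrier A. X \<star> e x = X}"
  then have "X = X \<star> e x" by simp
  then show "X \<in> carrier (Pr x)" using X unfolding projective_def Let_def by auto
qed

lemma Pr_iff: "x \<in> verts Q \<Longrightarrow> X \<in> carrier (Pr x) \<longleftrightarrow> X \<in> carrier A \<and> X \<star> e x = X"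
  by (simp add: Pr_carrier)

lemma Pr_abelian:
  assumes x: "x \<in> verts Q"
  shows "abelian_group (Pr x)"
proof (rule abelian_groupI)
  fix X assume X: "X \<in> carrier (Pr x)"
  then have "\<ominus>\<^bsub>A\<^esub> X \<in> carrier (Pr x)" using x by (simp add: Pr_iff A.l_minus)
  moreover have "\<ominus>\<^bsub>A\<^esub> X \<oplus>\<^bsub>A\<^esub> X = \<zero>\<^bsub>A\<^esub>" using X x by (simp add: Pr_iff A.l_neg)
  ultimately show "\<exists>Y\<in>carrier (Pr x). Y \<oplus>\<^bsub>Pr x\<^esub> X = \<zero>\<^bsub>Pr x\<^esub>" by (simp add: bexI)
qed (use x in \<open>simp_all add: Pr_iff A.l_distr A.a_ac\<close>)

lemma Pr_left_module:
  assumes x: "x \<in> verts Q"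
  shows "left_module A (Pr x)"
  by (intro left_module.intro left_module_axioms.intro A.ring_axioms Pr_abelian x)
    (use x in \<open>simp_all add: Pr_iff A.l_distr A.r_distr A.m_assoc\<close>)

lemma Pr_finsum:
  assumes x: "x \<in> verts Q" and "\<And>t. t \<in> T \<Longrightarrow> f t \<in> carrier (Pr x)"
  shows "(\<Oplus>\<^bsub>Pr x\<^esub>t\<in>T. f t) = (\<Oplus>\<^bsub>A\<^esub>t\<in>T. f t)"
  by (rule finsum_sub[OF A.is_abelian_group Pr_abelian[OF x]])
    (use assms(2) in \<open>simp_all add: Pr_iff x subset_iff\<close>)

lemma graded_mod_Pr:
  assumes x: "x \<in> verts Q"
  shows "graded_mod Q S I (Pr x) pr"
proof (intro graded_mod.intro graded_mod_axioms.intro quadratic_monomial_axioms Pr_left_module x)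
  have minus: "\<ominus>\<^bsub>Pr x\<^esub> X = \<ominus>\<^bsub>A\<^esub> X" if "X \<in> carrier (Pr x)" for X
  proof (rule additive_minus[OF Pr_abelian[OF x] A.is_abelian_group, of "\<lambda>X. X" X])
    show "(\<lambda>X. X) \<in> hom (add_monoid (Pr x)) (add_monoid A)"
      using x by (simp add: hom_def Pi_iff Pr_iff)
  qed (rule that)
  show "additive_subgroup (hcomp (Pr x) n) (Pr x)" for n
    unfolding additive_subgroup_iff[OF Pr_abelian[OF x]]
    by (simp add: minus dg_zero dg_add dg_minus Pr_iff x A.l_distr A.l_minus)
  show "pr n X \<in> hcomp (Pr x) n" if "X \<in> carrier (Pr x)" for X n
    using that pr_mult_e[of X x n] by (simp add: Pr_iff x pr_deg pr_carrier)
  show "\<exists>N. finite N \<and> (\<forall>n. n \<notin> N \<longrightarrow> pr n X = \<zero>\<^bsub>Pr x\<^esub>) \<and> X = (\<Oplus>\<^bsub>Pr x\<^esub>n\<in>N. pr n X)"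
    if X: "X \<in> carrier (Pr x)" for X
  proof (intro exI conjI)
    have Xc: "X \<in> carrier A" using X x by (simp add: Pr_iff)
    show "finite {n. pr n X \<noteq> \<zero>\<^bsub>A\<^esub>}" by (rule pr_finite[OF Xc])
    have "(\<Oplus>\<^bsub>Pr x\<^esub>n\<in>{n. pr n X \<noteq> \<zero>\<^bsub>A\<^esub>}. pr n X) = (\<Oplus>\<^bsub>A\<^esub>n\<in>{n. pr n X \<noteq> \<zero>\<^bsub>A\<^esub>}. pr n X)"
      by (rule Pr_finsum[OF x]) (use X pr_mult_e[of X x] in \<open>simp add: Pr_iff x pr_carrier\<close>)
    then show "X = (\<Oplus>\<^bsub>Pr x\<^esub>n\<in>{n. pr n X \<noteq> \<zero>\<^bsub>A\<^esub>}. pr n X)" using pr_sum[OF Xc] by (simp only:)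
  qed simp
  fix a i X j assume a: "a \<in> dg i" and X: "X \<in> hcomp (Pr x) j"
  show "a \<odot>\<^bsub>Pr x\<^esub> X \<in> hcomp (Pr x) (i + j)"
    using X dg_closed[OF a] dg_mult[OF a, of X j] x by (simp add: Pr_iff A.m_assoc)
next
  fix X k n assume X: "X \<in> hcomp (Pr x) k" and k: "k \<noteq> n"
  have "X \<in> dg k" using X by simp
  from pr_other[OF this k] show "pr n X = \<zero>\<^bsub>Pr x\<^esub>" by simp
qed (use x in \<open>simp_all add: Pr_iff pr_add pr_same\<close>)

text \<open>Every path of positive length ends in an arrow.\<close>

lemma arrows_generate_Pr:
  assumes x: "x \<in> verts Q" and n: "n \<ge> 0"
  shows "arrows_generate (Pr x) n"
  unfolding arrows_generate_def
proof
  fix X assume X: "X \<in> hcomp (Pr x) (n + 1)"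
  then have Xc: "X \<in> carrier A" "X \<star> e x = X" "X \<in> dg (n + 1)" using x by (simp_all add: Pr_iff)
  have u: "ls a X \<in> hcomp (Pr x) n" for a
    using ls_mult_e[OF Xc(1) x, of a] ls_deg[OF Xc(3), of a] Xc by (simp add: Pr_iff x ls_closed)
  have "X = (\<Oplus>\<^bsub>A\<^esub>a\<in>arcs Q. ar a \<star> ls a X)" by (rule dg_pos_left[OF Xc(3)]) (use n in simp)
  also have "\<dots> = (\<Oplus>\<^bsub>Pr x\<^esub>a\<in>arcs Q. ar a \<star> ls a X)"
    by (rule Pr_finsum[OF x, symmetric]) (use u x in \<open>simp add: Pr_iff A.m_assoc\<close>)
  finally show "\<exists>u. (\<forall>a\<in>arcs Q. u a \<in> hcomp (Pr x) n) \<and> X = (\<Oplus>\<^bsub>Pr x\<^esub>a\<in>arcs Q. ar a \<odot>\<^bsub>Pr x\<^esub> u a)"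
    using u by (intro exI[where x = "\<lambda>a. ls a X"]) simp
qed

lemma ls_hom: "ls a \<in> hom (add_monoid A) (add_monoid A)"
  by (simp add: hom_def Pi_iff ls_closed ls_add)

lemma rs_hom: "rs a \<in> hom (add_monoid A) (add_monoid A)"
  by (simp add: hom_def Pi_iff rs_closed rs_add)

lemmas ls_zero = additive_zero[OF A.is_abelian_group A.is_abelian_group ls_hom]
lemmas rs_zero = additive_zero[OF A.is_abelian_group A.is_abelian_group rs_hom]

text \<open>Paths that end in different arrows are linearly independent.\<close>

lemma ar_sum_zero:
  assumes u: "\<And>a. a \<in> arcs Q \<Longrightarrow> u a \<in> carrier A"
    and z: "(\<Oplus>\<^bsub>A\<^esub>a\<in>arcs Q. ar a \<star> u a) = \<zero>\<^bsub>A\<^esub>" and a: "a \<in> arcs Q"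
  shows "ar a \<star> u a = \<zero>\<^bsub>A\<^esub>"
proof -
  have "\<zero>\<^bsub>A\<^esub> = ls a (\<Oplus>\<^bsub>A\<^esub>b\<in>arcs Q. ar b \<star> u b)" by (simp add: z ls_zero)
  also have "\<dots> = (\<Oplus>\<^bsub>A\<^esub>b\<in>arcs Q. ls a (ar b \<star> u b))"
    by (rule additive_finsum[OF A.is_abelian_group A.is_abelian_group ls_hom]) (use u in simp)
  also have "\<dots> = ls a (ar a \<star> u a)"
    by (rule A.finsum_only) (use u a in \<open>simp_all add: ls_closed ls_ar_other\<close>)
  finally show ?thesis using ar_ls_ar[OF u[OF a] a] A.r_null[OF ar_closed[OF a]] by metis
qed

lemma arrows_independent_Pr:
  assumes x: "x \<in> verts Q"
  shows "arrows_independent (Pr x) n"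
  unfolding arrows_independent_def
proof (intro allI impI ballI)
  fix u a assume u: "\<forall>a\<in>arcs Q. u a \<in> hcomp (Pr x) n" and a: "a \<in> arcs Q"
    and z: "(\<Oplus>\<^bsub>Pr x\<^esub>a\<in>arcs Q. ar a \<odot>\<^bsub>Pr x\<^esub> u a) = \<zero>\<^bsub>Pr x\<^esub>"
  have uc: "u a \<in> carrier A" "u a \<star> e x = u a" if "a \<in> arcs Q" for a using u that x by (simp_all add: Pr_iff)
  have "(\<Oplus>\<^bsub>Pr x\<^esub>a\<in>arcs Q. ar a \<star> u a) = (\<Oplus>\<^bsub>A\<^esub>a\<in>arcs Q. ar a \<star> u a)"
    by (rule Pr_finsum[OF x]) (use uc x in \<open>simp add: Pr_iff A.m_assoc\<close>)
  then have "(\<Oplus>\<^bsub>A\<^esub>a\<in>arcs Q. ar a \<star> u a) = \<zero>\<^bsub>A\<^esub>" using z by simp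
  then show "ar a \<odot>\<^bsub>Pr x\<^esub> u a = \<zero>\<^bsub>Pr x\<^esub>" using ar_sum_zero[of u a] uc(1) a by simp
qed

lemma arrow_kernels_Pr:
  assumes x: "x \<in> verts Q"
  shows "arrow_kernels (Pr x) n"
  unfolding arrow_kernels_def
proof (intro ballI impI)
  fix a X assume a: "a \<in> arcs Q" and X: "X \<in> hcomp (Pr x) n"
    and eX: "e (tail Q a) \<odot>\<^bsub>Pr x\<^esub> X = X" and z: "ar a \<odot>\<^bsub>Pr x\<^esub> X = \<zero>\<^bsub>Pr x\<^esub>"
  have Xc: "X \<in> carrier A" "X \<star> e x = X" "X \<in> dg n" using x X by (simp_all add: Pr_iff)
  have u: "ls b X \<in> hcomp (Pr x) (n - 1)" for b
    using ls_mult_e[OF Xc(1) x, of b] ls_deg[OF Xc(3), of b] Xc by (simp add: Pr_iff x ls_closed)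
  have "X = (\<Oplus>\<^bsub>A\<^esub>b\<in>{b. zr b a}. ar b \<star> ls b X)"
    by (rule ann_left[OF Xc(1) a]) (use eX z in simp_all)
  also have "\<dots> = (\<Oplus>\<^bsub>Pr x\<^esub>b\<in>{b. zr b a}. ar b \<star> ls b X)"
    by (rule Pr_finsum[OF x, symmetric]) (use u x in \<open>simp add: Pr_iff A.m_assoc zr_arcs\<close>)
  finally show "\<exists>w. (\<forall>b. zr b a \<longrightarrow> w b \<in> hcomp (Pr x) (n - 1)) \<and>
      X = (\<Oplus>\<^bsub>Pr x\<^esub>b\<in>{b. zr b a}. ar b \<odot>\<^bsub>Pr x\<^esub> w b)"
    using u by (intro exI[where x = "\<lambda>b. ls b X"]) simp
qed

abbreviation Prs :: "('v \<times> int) list \<Rightarrow> _" where "Prs \<equiv> projective_sum Q I"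

definition prs :: "('v \<times> int) list \<Rightarrow> int \<Rightarrow> (nat \<Rightarrow> (('v, 'e) qpath \<Rightarrow> 'k) set) \<Rightarrow> nat \<Rightarrow> (('v, 'e) qpath \<Rightarrow> 'k) set"
  where "prs xs = (\<lambda>n f. \<lambda>j\<in>{..<length xs}. pr (n - snd (xs ! j)) (f j))"

context
  fixes xs :: "('v \<times> int) list"
  assumes xs: "fst ` set xs \<subseteq> verts Q"
begin

lemma nth_verts: "j < length xs \<Longrightarrow> fst (xs ! j) \<in> verts Q"
  using xs by (metis image_subset_iff nth_mem)

lemma Prs_summand:
  "j \<in> {..<length xs} \<Longrightarrow> graded_mod Q S I (shift (snd (xs ! j)) (Pr (fst (xs ! j)))) (\<lambda>n. pr (n - snd (xs ! j)))"
  by (rule graded_mod_shift[OF graded_mod_Pr]) (simp add: nth_verts)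

lemma graded_mod_Prs: "graded_mod Q S I (Prs xs) (prs xs)"
  unfolding projective_sum_def prs_def
  by (rule graded_mod_direct_sum[OF finite_lessThan quadratic_monomial_axioms Prs_summand])

lemma arrows_generate_Prs:
  assumes "\<And>x i. (x, i) \<in> set xs \<Longrightarrow> i \<le> n"
  shows "arrows_generate (Prs xs) n"
  unfolding projective_sum_def
proof (rule arrows_generate_direct_sum[OF Prs_summand])
  fix j assume j: "j \<in> {..<length xs}"
  then have "snd (xs ! j) \<le> n" using assms[of "fst (xs ! j)" "snd (xs ! j)"] by simp
  then show "arrows_generate (shift (snd (xs ! j)) (Pr (fst (xs ! j)))) n"
    unfolding arrows_shift using j by (intro arrows_generate_Pr nth_verts) simp_all
qed

lemma arrows_independent_Prs: "arrows_independent (Prs xs) n"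
  unfolding projective_sum_def
  by (rule arrows_independent_direct_sum[OF Prs_summand])
    (auto simp: arrows_shift intro!: arrows_independent_Pr nth_verts)

lemma arrow_kernels_Prs: "arrow_kernels (Prs xs) n"
  unfolding projective_sum_def
  by (rule arrow_kernels_direct_sum[OF Prs_summand])
    (auto simp: arrows_shift intro!: arrow_kernels_Pr nth_verts)

lemma Prs_bounded_below:
  assumes "\<And>x i. (x, i) \<in> set xs \<Longrightarrow> n < i" and m: "m \<in> hcomp (Prs xs) n"
  shows "m = \<zero>\<^bsub>Prs xs\<^esub>"
proof -
  have "m j = \<zero>\<^bsub>A\<^esub>" if j: "j < length xs" for j
  proof -
    have "m j \<in> dg (n - snd (xs ! j))" using m j by (auto simp: projective_sum_def)
    moreover have "n < snd (xs ! j)" using assms(1)[of "fst (xs ! j)" "snd (xs ! j)"] j by simp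
    ultimately show ?thesis using dg_neg by auto
  qed
  then show ?thesis using m by (auto simp: projective_sum_def PiE_iff extensional_def fun_eq_iff)
qed

end

section \<open>Injective modules\<close>

abbreviation In :: "'v \<Rightarrow> ((('v, 'e) qpath \<Rightarrow> 'k) set, (('v, 'e) qpath \<Rightarrow> 'k) set \<Rightarrow> 'k) graded_module" where
  "In \<equiv> injective Q I"
abbreviation eA :: "'v \<Rightarrow> (('v, 'e) qpath \<Rightarrow> 'k) set set" where "eA \<equiv> right_ideal_at Q I"
abbreviation DF :: "'v \<Rightarrow> ((('v, 'e) qpath \<Rightarrow> 'k) set \<Rightarrow> 'k) set" where "DF \<equiv> dual_functionals Q I"

lemma eA_iff:
  assumes x: "x \<in> verts Q"
  shows "X \<in> eA x \<longleftrightarrow> X \<in> carrier A \<and> e x \<star> X = X"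
proof
  assume "X \<in> eA x"
  then obtain Y where Y: "Y \<in> carrier A" "X = e x \<star> Y" by (auto simp: right_ideal_at_def)
  then have "e x \<star> X = X" using A.m_assoc[of "e x" "e x" Y] x by (simp add: e_idem)
  then show "X \<in> carrier A \<and> e x \<star> X = X" using Y x by simp
next
  assume X: "X \<in> carrier A \<and> e x \<star> X = X"
  then have "X = e x \<star> X" by simp
  then show "X \<in> eA x" using X unfolding right_ideal_at_def by blast
qed

lemma eA_closed:
  assumes "x \<in> verts Q"
  shows "\<zero>\<^bsub>A\<^esub> \<in> eA x" "X \<in> eA x \<Longrightarrow> Y \<in> eA x \<Longrightarrow> X \<oplus>\<^bsub>A\<^esub> Y \<in> eA x"
    "X \<in> eA x \<Longrightarrow> a \<in> carrier A \<Longrightarrow> X \<star> a \<in> eA x"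
    "X \<in> eA x \<Longrightarrow> sc c \<star> X \<in> eA x" "X \<in> eA x \<Longrightarrow> \<ominus>\<^bsub>A\<^esub> X \<in> eA x"
    "X \<in> eA x \<Longrightarrow> pr n X \<in> eA x" "X \<in> eA x \<Longrightarrow> rs b X \<in> eA x" "X \<in> eA x \<Longrightarrow> X \<in> carrier A"
proof -
  note ex = e_closed[OF assms]
  show "\<zero>\<^bsub>A\<^esub> \<in> eA x" "X \<in> eA x \<Longrightarrow> Y \<in> eA x \<Longrightarrow> X \<oplus>\<^bsub>A\<^esub> Y \<in> eA x"
    "X \<in> eA x \<Longrightarrow> \<ominus>\<^bsub>A\<^esub> X \<in> eA x" "X \<in> eA x \<Longrightarrow> X \<in> carrier A"
    using assms by (simp_all add: eA_iff A.r_distr A.r_minus)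
  show "X \<star> a \<in> eA x" if "X \<in> eA x" "a \<in> carrier A"
    using that A.m_assoc[OF ex, of X a] by (simp add: eA_iff assms)
  show "sc c \<star> X \<in> eA x" if "X \<in> eA x"
  proof -
    have "e x \<star> (sc c \<star> X) = (e x \<star> sc c) \<star> X"
      using that by (simp add: eA_iff assms A.m_assoc)
    also have "\<dots> = sc c \<star> (e x \<star> X)"
      using that by (simp add: sc_commute[OF ex] eA_iff assms A.m_assoc)
    finally show ?thesis using that by (simp add: eA_iff assms)
  qed
  show "pr n X \<in> eA x" if "X \<in> eA x"
    using that pr_e_mult[of X x n] by (simp add: eA_iff assms pr_carrier)
  show "rs b X \<in> eA x" if "X \<in> eA x"
    using that rs_e_mult[of X x b] by (simp add: eA_iff assms rs_closed)
qed

lemma DF_iff: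
  assumes x: "x \<in> verts Q"
  shows "\<phi> \<in> DF x \<longleftrightarrow> \<phi> \<in> extensional (eA x) \<and>
     (\<forall>X\<in>eA x. \<forall>Y\<in>eA x. \<phi> (X \<oplus>\<^bsub>A\<^esub> Y) = \<phi> X + \<phi> Y) \<and>
     (\<forall>c. \<forall>X\<in>eA x. \<phi> (sc c \<star> X) = c * \<phi> X) \<and>
     (\<exists>d. \<forall>n>d. \<forall>X\<in>eA x \<inter> dg n. \<phi> X = 0)"
  by (simp add: dual_functionals_def Let_def)

lemma DFI:
  assumes "x \<in> verts Q" "\<phi> \<in> extensional (eA x)"
    "\<And>X Y. X \<in> eA x \<Longrightarrow> Y \<in> eA x \<Longrightarrow> \<phi> (X \<oplus>\<^bsub>A\<^esub> Y) = \<phi> X + \<phi> Y"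
    "\<And>c X. X \<in> eA x \<Longrightarrow> \<phi> (sc c \<star> X) = c * \<phi> X"
    "\<And>n X. n > d \<Longrightarrow> X \<in> eA x \<Longrightarrow> X \<in> dg n \<Longrightarrow> \<phi> X = 0"
  shows "\<phi> \<in> DF x"
proof -
  have "\<forall>n>d. \<forall>X\<in>eA x \<inter> dg n. \<phi> X = 0" using assms(5) by blast
  then show ?thesis unfolding DF_iff[OF assms(1)] using assms(2-4) by blast
qed

lemma DFD:
  assumes "x \<in> verts Q" "\<phi> \<in> DF x"
  shows "\<phi> \<in> extensional (eA x)"
    "X \<in> eA x \<Longrightarrow> Y \<in> eA x \<Longrightarrow> \<phi> (X \<oplus>\<^bsub>A\<^esub> Y) = \<phi> X + \<phi> Y"
    "X \<in> eA x \<Longrightarrow> \<phi> (sc c \<star> X) = c * \<phi> X"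
    "\<exists>d. \<forall>n>d. \<forall>X\<in>eA x. X \<in> dg n \<longrightarrow> \<phi> X = 0"
  using assms(2) unfolding DF_iff[OF assms(1)] by blast+

lemma DF_zero:
  assumes "x \<in> verts Q" "\<phi> \<in> DF x" shows "\<phi> \<zero>\<^bsub>A\<^esub> = 0"
proof -
  have "\<phi> \<zero>\<^bsub>A\<^esub> + \<phi> \<zero>\<^bsub>A\<^esub> = \<phi> \<zero>\<^bsub>A\<^esub>"
    using DFD(2)[OF assms eA_closed(1)[OF assms(1)] eA_closed(1)[OF assms(1)]] A.l_zero[OF A.zero_closed]
    by simp
  then show ?thesis by (metis add_cancel_right_right)
qed

lemma DF_minus:
  assumes "x \<in> verts Q" "\<phi> \<in> DF x" "X \<in> eA x" shows "\<phi> (\<ominus>\<^bsub>A\<^esub> X) = - \<phi> X"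
  using DFD(2)[OF assms(1,2,3) eA_closed(5)[OF assms(1,3)]] DF_zero[OF assms(1,2)]
    eA_closed(8)[OF assms(1,3)]
  by (simp add: A.r_neg eq_neg_iff_add_eq_0 add.commute)

lemma DF_finsum:
  assumes x: "x \<in> verts Q" and \<phi>: "\<phi> \<in> DF x" and f: "\<And>t. t \<in> T \<Longrightarrow> f t \<in> eA x" and T: "finite T"
  shows "\<phi> (\<Oplus>\<^bsub>A\<^esub>t\<in>T. f t) = (\<Sum>t\<in>T. \<phi> (f t)) \<and> (\<Oplus>\<^bsub>A\<^esub>t\<in>T. f t) \<in> eA x"
  using T f
proof (induction T)
  case empty then show ?case using DF_zero[OF x \<phi>] eA_closed(1)[OF x] by simp
next
  case (insert t T)
  then have "f \<in> T \<rightarrow> carrier A" "f t \<in> carrier A" using eA_closed(8)[OF x] by blast+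
  with insert show ?case by (simp add: A.finsum_insert DFD(2)[OF x \<phi>] eA_closed(2)[OF x])
qed

lemma In_sel [simp]:
  "carrier (In x) = DF x" "add (In x) \<phi> \<psi> = (\<lambda>b\<in>eA x. \<phi> b + \<psi> b)" "zero (In x) = (\<lambda>b\<in>eA x. 0)"
  "smult (In x) a \<phi> = (\<lambda>b\<in>eA x. \<phi> (b \<star> a))"
  by (simp_all add: injective_def Let_def)

lemma In_hcomp:
  "\<phi> \<in> hcomp (In x) n \<longleftrightarrow> \<phi> \<in> DF x \<and> (\<forall>m. m \<noteq> - n \<longrightarrow> (\<forall>X\<in>eA x. X \<in> dg m \<longrightarrow> \<phi> X = 0))"
  by (auto simp: injective_def Let_def)

lemma DF_eqI:
  assumes "x \<in> verts Q" "\<phi> \<in> DF x" "\<psi> \<in> DF x" "\<And>X. X \<in> eA x \<Longrightarrow> \<phi> X = \<psi> X"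
  shows "\<phi> = \<psi>"
  using assms DFD(1) extensionalityI by blast

lemma DF_pr_sum:
  assumes x: "x \<in> verts Q" and \<phi>: "\<phi> \<in> DF x" and X: "X \<in> eA x"
  shows "\<phi> X = (\<Sum>n\<in>{n. pr n X \<noteq> \<zero>\<^bsub>A\<^esub>}. \<phi> (pr n X))"
proof -
  have Xc: "X \<in> carrier A" using eA_closed(8)[OF x X] .
  have "\<phi> X = \<phi> (\<Oplus>\<^bsub>A\<^esub>n\<in>{n. pr n X \<noteq> \<zero>\<^bsub>A\<^esub>}. pr n X)" by (rule arg_cong[OF pr_sum[OF Xc]])
  also have "\<dots> = (\<Sum>n\<in>{n. pr n X \<noteq> \<zero>\<^bsub>A\<^esub>}. \<phi> (pr n X))"
    using DF_finsum[OF x \<phi>, of "{n. pr n X \<noteq> \<zero>\<^bsub>A\<^esub>}" "\<lambda>n. pr n X"] eA_closed(6)[OF x X] pr_finite[OF Xc]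
    by blast
  finally show ?thesis .
qed

lemma hcomp_In_pr:
  assumes x: "x \<in> verts Q" and \<phi>: "\<phi> \<in> hcomp (In x) n" and X: "X \<in> eA x"
  shows "\<phi> X = \<phi> (pr (- n) X)"
proof -
  have \<phi>': "\<phi> \<in> DF x" using \<phi> by (simp add: In_hcomp)
  have Xc: "X \<in> carrier A" using eA_closed(8)[OF x X] .
  let ?N = "{n. pr n X \<noteq> \<zero>\<^bsub>A\<^esub>}"
  have "\<phi> X = (\<Sum>m\<in>?N. \<phi> (pr m X))" by (rule DF_pr_sum[OF x \<phi>' X])
  also have "\<dots> = (\<Sum>m\<in>?N. if m = - n then \<phi> (pr (- n) X) else 0)"
  proof (rule sum.cong[OF refl])
    fix m
    have "m \<noteq> - n \<Longrightarrow> \<phi> (pr m X) = 0"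
      using \<phi> eA_closed(6)[OF x X] pr_deg[OF Xc] unfolding In_hcomp by blast
    then show "\<phi> (pr m X) = (if m = - n then \<phi> (pr (- n) X) else 0)" by simp
  qed
  also have "\<dots> = (if - n \<in> ?N then \<phi> (pr (- n) X) else 0)" by (simp add: pr_finite Xc)
  also have "\<dots> = \<phi> (pr (- n) X)" using DF_zero[OF x \<phi>'] by auto
  finally show ?thesis .
qed

text \<open>Linear maps between the right ideals \<open>eA x\<close> that shift degrees induce maps of functionals.\<close>

lemma DF_compose:
  assumes x: "x \<in> verts Q" and y: "y \<in> verts Q" and \<phi>: "\<phi> \<in> DF y"
    and F: "\<And>X. X \<in> eA x \<Longrightarrow> F X \<in> eA y"
    and add: "\<And>X Y. X \<in> eA x \<Longrightarrow> Y \<in> eA x \<Longrightarrow> F (X \<oplus>\<^bsub>A\<^esub> Y) = F X \<oplus>\<^bsub>A\<^esub> F Y"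
    and sc: "\<And>c X. X \<in> eA x \<Longrightarrow> F (sc c \<star> X) = sc c \<star> F X"
    and deg: "\<And>n X. X \<in> eA x \<Longrightarrow> X \<in> dg n \<Longrightarrow> F X \<in> dg (n + s)"
  shows "(\<lambda>X\<in>eA x. \<phi> (F X)) \<in> DF x"
    and "\<phi> \<in> hcomp (In y) n \<Longrightarrow> (\<lambda>X\<in>eA x. \<phi> (F X)) \<in> hcomp (In x) (n + s)"
proof -
  obtain d where d: "\<And>n X. n > d \<Longrightarrow> X \<in> eA y \<Longrightarrow> X \<in> dg n \<Longrightarrow> \<phi> X = 0" using DFD(4)[OF y \<phi>] by blast
  show *: "(\<lambda>X\<in>eA x. \<phi> (F X)) \<in> DF x"
  proof (rule DFI[OF x, where d = "d - s"])
    fix n X assume n: "d - s < n" and X: "X \<in> eA x" "X \<in> dg n"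
    show "(\<lambda>X\<in>eA x. \<phi> (F X)) X = 0" using d[OF _ F[OF X(1)] deg[OF X]] n X(1) by simp
  qed (use F add sc eA_closed[OF x] DFD[OF y \<phi>] in auto)
  assume h: "\<phi> \<in> hcomp (In y) n"
  show "(\<lambda>X\<in>eA x. \<phi> (F X)) \<in> hcomp (In x) (n + s)"
    unfolding In_hcomp
  proof (intro conjI allI impI ballI *)
    fix m X assume m: "m \<noteq> - (n + s)" and X: "X \<in> eA x" "X \<in> dg m"
    have "m + s \<noteq> - n" using m by simp
    then show "(\<lambda>X\<in>eA x. \<phi> (F X)) X = 0"
      using h F[OF X(1)] deg[OF X] X(1) unfolding In_hcomp by simp
  qed
qed

end

context quadratic_monomial
begin

lemma DF_restrict: "x \<in> verts Q \<Longrightarrow> \<phi> \<in> DF x \<Longrightarrow> (\<lambda>X\<in>eA x. \<phi> X) = \<phi>"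
  using DFD(1) extensional_restrict by metis

lemma DF_smult:
  assumes x: "x \<in> verts Q" and a: "a \<in> carrier A" and \<phi>: "\<phi> \<in> DF x"
  shows "(\<lambda>X\<in>eA x. \<phi> (X \<star> a)) \<in> DF x"
proof -
  obtain d where d: "\<And>n X. n > d \<Longrightarrow> X \<in> eA x \<Longrightarrow> X \<in> dg n \<Longrightarrow> \<phi> X = 0" using DFD(4)[OF x \<phi>] by blast
  show ?thesis
  proof (rule DFI[OF x, where d = d])
    fix n X assume n: "d < n" and X: "X \<in> eA x" "X \<in> dg n"
    have Xc: "X \<in> carrier A" using X(2) by (rule dg_closed)
    let ?N = "{n. pr n a \<noteq> \<zero>\<^bsub>A\<^esub>}"
    have "X \<star> a = X \<star> (\<Oplus>\<^bsub>A\<^esub>k\<in>?N. pr k a)" by (rule arg_cong[OF pr_sum[OF a]])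
    also have "\<dots> = (\<Oplus>\<^bsub>A\<^esub>k\<in>?N. X \<star> pr k a)"
      by (rule additive_finsum[OF A.is_abelian_group A.is_abelian_group])
        (use Xc a in \<open>simp_all add: hom_def Pi_iff A.r_distr pr_carrier\<close>)
    finally have "\<phi> (X \<star> a) = (\<Sum>k\<in>?N. \<phi> (X \<star> pr k a))"
      using DF_finsum[OF x \<phi>, of ?N "\<lambda>k. X \<star> pr k a"] eA_closed(3)[OF x X(1)] pr_carrier[OF a] pr_finite[OF a]
      by simp
    also have "\<dots> = 0"
    proof (rule sum.neutral, rule ballI)
      fix k assume "k \<in> ?N"
      then have "k \<ge> 0" using dg_neg[OF pr_deg[OF a, of k]] by force
      then have "n + k > d" using n by simp
      then show "\<phi> (X \<star> pr k a) = 0"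
        by (rule d[OF _ eA_closed(3)[OF x X(1) pr_carrier[OF a]] dg_mult[OF X(2) pr_deg[OF a]]])
    qed
    finally show "(\<lambda>X\<in>eA x. \<phi> (X \<star> a)) X = 0" using X(1) by simp
  next
    fix X Y assume "X \<in> eA x" "Y \<in> eA x"
    then show "(\<lambda>X\<in>eA x. \<phi> (X \<star> a)) (X \<oplus>\<^bsub>A\<^esub> Y) =
       (\<lambda>X\<in>eA x. \<phi> (X \<star> a)) X + (\<lambda>X\<in>eA x. \<phi> (X \<star> a)) Y"
      using eA_closed(2,3)[OF x] a eA_closed(8)[OF x] by (simp add: A.l_distr DFD(2)[OF x \<phi>])
  next
    fix c X assume "X \<in> eA x"
    then show "(\<lambda>X\<in>eA x. \<phi> (X \<star> a)) (sc c \<star> X) = c * (\<lambda>X\<in>eA x. \<phi> (X \<star> a)) X"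
      using eA_closed(3,4)[OF x] a eA_closed(8)[OF x] by (simp add: A.m_assoc DFD(3)[OF x \<phi>])
  qed simp
qed

lemma In_abelian:
  assumes x: "x \<in> verts Q"
  shows "abelian_group (In x)"
proof (rule abelian_groupI)
  fix \<phi> \<psi> assume \<phi>: "\<phi> \<in> carrier (In x)" and \<psi>: "\<psi> \<in> carrier (In x)"
  then have \<phi>': "\<phi> \<in> DF x" and \<psi>': "\<psi> \<in> DF x" by simp_all
  obtain d where d: "\<forall>n>d. \<forall>X\<in>eA x. X \<in> dg n \<longrightarrow> \<phi> X = 0" using DFD(4)[OF x \<phi>'] by blast
  obtain d' where d': "\<forall>n>d'. \<forall>X\<in>eA x. X \<in> dg n \<longrightarrow> \<psi> X = 0" using DFD(4)[OF x \<psi>'] by blast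
  have "(\<lambda>b\<in>eA x. \<phi> b + \<psi> b) \<in> DF x"
  proof (rule DFI[OF x, where d = "max d d'"])
    fix n X assume n: "max d d' < n" and X: "X \<in> eA x" "X \<in> dg n"
    have "\<phi> X = 0" "\<psi> X = 0" using d d' n X by auto
    then show "(\<lambda>b\<in>eA x. \<phi> b + \<psi> b) X = 0" using X(1) by simp
  qed (simp_all add: DFD(2,3)[OF x \<phi>'] DFD(2,3)[OF x \<psi>'] eA_closed(2,4)[OF x] distrib_left)
  then show "\<phi> \<oplus>\<^bsub>In x\<^esub> \<psi> \<in> carrier (In x)" by simp
next
  have "(\<lambda>b\<in>eA x. 0) \<in> DF x"
    by (rule DFI[OF x, where d = 0]) (simp_all add: eA_closed(2,4)[OF x])
  then show "\<zero>\<^bsub>In x\<^esub> \<in> carrier (In x)" by simp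
next
  fix \<phi> assume \<phi>: "\<phi> \<in> carrier (In x)"
  then have \<phi>': "\<phi> \<in> DF x" by simp
  show "\<zero>\<^bsub>In x\<^esub> \<oplus>\<^bsub>In x\<^esub> \<phi> = \<phi>"
    using DF_restrict[OF x \<phi>'] by (simp cong: restrict_cong)
  obtain d where d: "\<forall>n>d. \<forall>X\<in>eA x. X \<in> dg n \<longrightarrow> \<phi> X = 0" using DFD(4)[OF x \<phi>'] by blast
  have "(\<lambda>b\<in>eA x. - \<phi> b) \<in> DF x"
  proof (rule DFI[OF x, where d = d])
    fix n X assume n: "d < n" and X: "X \<in> eA x" "X \<in> dg n"
    have "\<phi> X = 0" using d n X by blast
    then show "(\<lambda>b\<in>eA x. - \<phi> b) X = 0" using X(1) by simp
  qed (simp_all add: DFD(2,3)[OF x \<phi>'] eA_closed(2,4)[OF x])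
  moreover have "(\<lambda>b\<in>eA x. - \<phi> b) \<oplus>\<^bsub>In x\<^esub> \<phi> = \<zero>\<^bsub>In x\<^esub>" by (simp cong: restrict_cong)
  ultimately show "\<exists>\<psi>\<in>carrier (In x). \<psi> \<oplus>\<^bsub>In x\<^esub> \<phi> = \<zero>\<^bsub>In x\<^esub>" by (metis In_sel(1))
qed (simp_all add: add_ac cong: restrict_cong)

lemma In_left_module:
  assumes x: "x \<in> verts Q"
  shows "left_module A (In x)"
proof (intro left_module.intro left_module_axioms.intro A.ring_axioms In_abelian x)
  fix a \<phi> assume a: "a \<in> carrier A" and \<phi>: "\<phi> \<in> carrier (In x)"
  then have \<phi>': "\<phi> \<in> DF x" by simp
  show "a \<odot>\<^bsub>In x\<^esub> \<phi> \<in> carrier (In x)" using DF_smult[OF x a \<phi>'] by simp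
  fix b assume b: "b \<in> carrier A"
  show "(a \<oplus>\<^bsub>A\<^esub> b) \<odot>\<^bsub>In x\<^esub> \<phi> = a \<odot>\<^bsub>In x\<^esub> \<phi> \<oplus>\<^bsub>In x\<^esub> b \<odot>\<^bsub>In x\<^esub> \<phi>"
    using a b by (simp add: eA_closed[OF x] A.r_distr DFD(2)[OF x \<phi>'] cong: restrict_cong)
  show "(a \<star> b) \<odot>\<^bsub>In x\<^esub> \<phi> = a \<odot>\<^bsub>In x\<^esub> (b \<odot>\<^bsub>In x\<^esub> \<phi>)"
    using a b by (simp add: eA_closed[OF x] A.m_assoc cong: restrict_cong)
next
  fix a \<phi> \<psi> assume a: "a \<in> carrier A" and \<phi>: "\<phi> \<in> carrier (In x)" and \<psi>: "\<psi> \<in> carrier (In x)"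
  then show "a \<odot>\<^bsub>In x\<^esub> (\<phi> \<oplus>\<^bsub>In x\<^esub> \<psi>) = a \<odot>\<^bsub>In x\<^esub> \<phi> \<oplus>\<^bsub>In x\<^esub> a \<odot>\<^bsub>In x\<^esub> \<psi>"
    by (simp add: eA_closed[OF x] cong: restrict_cong)
next
  fix \<phi> assume \<phi>: "\<phi> \<in> carrier (In x)"
  then show "\<one>\<^bsub>A\<^esub> \<odot>\<^bsub>In x\<^esub> \<phi> = \<phi>"
    using DF_restrict[OF x, of \<phi>] by (simp add: eA_closed(8)[OF x] cong: restrict_cong)
qed

lemma In_finsum:
  assumes x: "x \<in> verts Q" and T: "finite T" and f: "\<And>t. t \<in> T \<Longrightarrow> f t \<in> DF x" and X: "X \<in> eA x"
  shows "(\<Oplus>\<^bsub>In x\<^esub>t\<in>T. f t) X = (\<Sum>t\<in>T. f t X)"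
proof -
  interpret In: abelian_group "In x" by (rule In_abelian[OF x])
  show ?thesis using T f
  proof (induction T)
    case (insert t T)
    then have "f \<in> T \<rightarrow> carrier (In x)" "f t \<in> carrier (In x)" by simp_all
    then show ?case using insert X by (simp add: In.finsum_insert)
  qed (simp add: X)
qed

definition inpr :: "'v \<Rightarrow> int \<Rightarrow> ((('v, 'e) qpath \<Rightarrow> 'k) set \<Rightarrow> 'k) \<Rightarrow> (('v, 'e) qpath \<Rightarrow> 'k) set \<Rightarrow> 'k" where
  "inpr x n \<phi> = (\<lambda>X\<in>eA x. \<phi> (pr (- n) X))"

lemma inpr_hc:
  assumes x: "x \<in> verts Q" and \<phi>: "\<phi> \<in> DF x"
  shows "inpr x n \<phi> \<in> hcomp (In x) n"
proof -
  have eAc: "X \<in> eA x \<Longrightarrow> X \<in> carrier A" for X by (rule eA_closed(8)[OF x])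
  have vanish: "\<phi> (pr (- n) X) = 0" if "X \<in> eA x" "X \<in> dg m" "m \<noteq> - n" for X m
    using pr_other[OF that(2,3)] DF_zero[OF x \<phi>] by simp
  have "inpr x n \<phi> \<in> DF x"
    unfolding inpr_def
  proof (rule DFI[OF x, where d = "- n"])
    fix m X assume "- n < m" "X \<in> eA x" "X \<in> dg m"
    then show "(\<lambda>X\<in>eA x. \<phi> (pr (- n) X)) X = 0" using vanish[of X m] by simp
  qed (simp_all add: eAc pr_add pr_sc_mult eA_closed(2,4,6)[OF x] DFD(2,3)[OF x \<phi>])
  then show ?thesis unfolding In_hcomp using vanish by (simp add: inpr_def)
qed

lemma graded_mod_In:
  assumes x: "x \<in> verts Q"
  shows "graded_mod Q S I (In x) (inpr x)"
proof (intro graded_mod.intro graded_mod_axioms.intro quadratic_monomial_axioms In_left_module x)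
  interpret In: abelian_group "In x" by (rule In_abelian[OF x])
  note eAc = eA_closed(8)[OF x]
  have minus: "(\<ominus>\<^bsub>In x\<^esub> \<phi>) X = - \<phi> X" if \<phi>: "\<phi> \<in> DF x" and X: "X \<in> eA x" for \<phi> X
  proof -
    have "(\<ominus>\<^bsub>In x\<^esub> \<phi> \<oplus>\<^bsub>In x\<^esub> \<phi>) X = \<zero>\<^bsub>In x\<^esub> X" using \<phi> In.l_neg[of \<phi>] by (simp del: In_sel(2,3))
    then show ?thesis using X by (simp add: eq_neg_iff_add_eq_0)
  qed
  show "additive_subgroup (hcomp (In x) n) (In x)" for n
    unfolding additive_subgroup_iff[OF In_abelian[OF x]]
  proof (intro conjI ballI subsetI)
    fix \<phi> assume \<phi>: "\<phi> \<in> hcomp (In x) n"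
    then show "\<phi> \<in> carrier (In x)" by (simp add: In_hcomp)
    have "\<ominus>\<^bsub>In x\<^esub> \<phi> \<in> DF x" using \<phi> In.a_inv_closed[of \<phi>] by (simp add: In_hcomp)
    then show "\<ominus>\<^bsub>In x\<^esub> \<phi> \<in> hcomp (In x) n" using \<phi> minus by (simp add: In_hcomp)
    fix \<psi> assume \<psi>: "\<psi> \<in> hcomp (In x) n"
    have "\<phi> \<oplus>\<^bsub>In x\<^esub> \<psi> \<in> DF x" using \<phi> \<psi> In.a_closed[of \<phi> \<psi>] by (simp add: In_hcomp)
    then show "\<phi> \<oplus>\<^bsub>In x\<^esub> \<psi> \<in> hcomp (In x) n" using \<phi> \<psi> by (simp add: In_hcomp)
  next
    show "\<zero>\<^bsub>In x\<^esub> \<in> hcomp (In x) n" using In.zero_closed by (simp add: In_hcomp)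
  qed
  show "inpr x n \<phi> \<in> hcomp (In x) n" if "\<phi> \<in> carrier (In x)" for \<phi> n
    using inpr_hc[OF x] that by simp
  show "inpr x n (\<phi> \<oplus>\<^bsub>In x\<^esub> \<psi>) = inpr x n \<phi> \<oplus>\<^bsub>In x\<^esub> inpr x n \<psi>" for n \<phi> \<psi>
    by (simp add: inpr_def eA_closed(6)[OF x] cong: restrict_cong)
  show "inpr x n \<phi> = \<phi>" if "\<phi> \<in> hcomp (In x) n" for \<phi> n
    using hcomp_In_pr[OF x that] DF_restrict[OF x, of \<phi>] that
    by (simp add: inpr_def In_hcomp cong: restrict_cong)
  show "inpr x n \<phi> = \<zero>\<^bsub>In x\<^esub>" if \<phi>: "\<phi> \<in> hcomp (In x) k" and k: "k \<noteq> n" for \<phi> k n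
  proof -
    have "\<phi> (pr (- n) X) = 0" if "X \<in> eA x" for X
    proof -
      have "- n \<noteq> - k" using k by simp
      then show ?thesis
        using \<phi> eA_closed(6)[OF x that, of "- n"] pr_deg[OF eAc[OF that], of "- n"] unfolding In_hcomp by blast
    qed
    then show ?thesis by (simp add: inpr_def cong: restrict_cong)
  qed
  show "a \<odot>\<^bsub>In x\<^esub> \<phi> \<in> hcomp (In x) (i + j)" if a: "a \<in> dg i" and \<phi>: "\<phi> \<in> hcomp (In x) j" for a i \<phi> j
  proof -
    have \<phi>': "\<phi> \<in> DF x" using \<phi> by (simp add: In_hcomp)
    have "\<phi> (X \<star> a) = 0" if "m \<noteq> - (i + j)" "X \<in> eA x" "X \<in> dg m" for m X
    proof -
      have "m + i \<noteq> - j" using that(1) by simp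
      then show ?thesis
        using \<phi> eA_closed(3)[OF x that(2) dg_closed[OF a]] dg_mult[OF that(3) a] unfolding In_hcomp by blast
    qed
    then show ?thesis using DF_smult[OF x dg_closed[OF a] \<phi>'] by (simp add: In_hcomp)
  qed
  show "\<exists>N. finite N \<and> (\<forall>n. n \<notin> N \<longrightarrow> inpr x n \<phi> = \<zero>\<^bsub>In x\<^esub>) \<and> \<phi> = (\<Oplus>\<^bsub>In x\<^esub>n\<in>N. inpr x n \<phi>)"
    if "\<phi> \<in> carrier (In x)" for \<phi>
  proof -
    have \<phi>: "\<phi> \<in> DF x" using that by simp
    obtain d where d: "\<And>n X. n > d \<Longrightarrow> X \<in> eA x \<Longrightarrow> X \<in> dg n \<Longrightarrow> \<phi> X = 0" using DFD(4)[OF x \<phi>] by blast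
    have zero: "\<phi> (pr (- n) X) = 0" if X: "X \<in> eA x" and n: "n \<notin> {- d..0}" for n X
    proof (cases "n < - d")
      case True
      then show ?thesis using d[OF _ eA_closed(6)[OF x X] pr_deg[OF eAc[OF X]], of "- n"] by simp
    next
      case False
      then have "- n < 0" using n by simp
      then have "pr (- n) X = \<zero>\<^bsub>A\<^esub>" using dg_neg[OF pr_deg[OF eAc[OF X]]] by blast
      then show ?thesis using DF_zero[OF x \<phi>] by simp
    qed
    have cl: "inpr x n \<phi> \<in> DF x" for n using inpr_hc[OF x \<phi>] by (simp add: In_hcomp)
    have sumc: "(\<Oplus>\<^bsub>In x\<^esub>n\<in>{- d..0}. inpr x n \<phi>) \<in> DF x"
      using In.finsum_closed[of "\<lambda>n. inpr x n \<phi>" "{- d..0}"] cl by simp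
    have "\<phi> = (\<Oplus>\<^bsub>In x\<^esub>n\<in>{- d..0}. inpr x n \<phi>)"
    proof (rule DF_eqI[OF x \<phi> sumc])
      fix X assume X: "X \<in> eA x"
      have fin: "finite ({n. pr (- n) X \<noteq> \<zero>\<^bsub>A\<^esub>})"
        using finite_vimageI[OF pr_finite[OF eAc[OF X]], of uminus] by (simp add: inj_def vimage_def)
      have "\<phi> X = (\<Sum>n\<in>{n. pr n X \<noteq> \<zero>\<^bsub>A\<^esub>}. \<phi> (pr n X))" by (rule DF_pr_sum[OF x \<phi> X])
      also have "\<dots> = (\<Sum>n\<in>{n. pr (- n) X \<noteq> \<zero>\<^bsub>A\<^esub>}. \<phi> (pr (- n) X))"
        by (rule sum.reindex_bij_witness[where i = uminus and j = uminus]) simp_all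
      also have "\<dots> = (\<Sum>n\<in>{n. pr (- n) X \<noteq> \<zero>\<^bsub>A\<^esub>} \<union> {- d..0}. \<phi> (pr (- n) X))"
        by (rule sum.mono_neutral_left) (use fin DF_zero[OF x \<phi>] in auto)
      also have "\<dots> = (\<Sum>n\<in>{- d..0}. \<phi> (pr (- n) X))"
        by (rule sum.mono_neutral_right) (use fin zero[OF X] in auto)
      also have "\<dots> = (\<Sum>n\<in>{- d..0}. inpr x n \<phi> X)" using X by (simp add: inpr_def)
      also have "\<dots> = (\<Oplus>\<^bsub>In x\<^esub>n\<in>{- d..0}. inpr x n \<phi>) X"
        by (rule In_finsum[OF x _ cl X, symmetric]) simp
      finally show "\<phi> X = (\<Oplus>\<^bsub>In x\<^esub>n\<in>{- d..0}. inpr x n \<phi>) X" .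
    qed
    moreover have "inpr x n \<phi> = \<zero>\<^bsub>In x\<^esub>" if "n \<notin> {- d..0}" for n
      using zero that by (simp add: inpr_def cong: restrict_cong)
    ultimately show ?thesis by (intro exI[where x = "{- d..0}"]) simp
  qed
qed

text \<open>Every path of positive length begins with an arrow, so a functional on such paths vanishes once all
  arrows kill it.\<close>

lemma arrows_detect_In:
  assumes x: "x \<in> verts Q" and n: "n \<noteq> 0"
  shows "arrows_detect (In x) n"
  unfolding arrows_detect_def
proof (intro ballI impI)
  fix \<phi> assume \<phi>: "\<phi> \<in> hcomp (In x) n" and z: "\<forall>a\<in>arcs Q. ar a \<odot>\<^bsub>In x\<^esub> \<phi> = \<zero>\<^bsub>In x\<^esub>"
  have \<phi>': "\<phi> \<in> DF x" using \<phi> by (simp add: In_hcomp)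
  interpret In: abelian_group "In x" by (rule In_abelian[OF x])
  show "\<phi> = \<zero>\<^bsub>In x\<^esub>"
  proof (rule DF_eqI[OF x \<phi>'])
    show "\<zero>\<^bsub>In x\<^esub> \<in> DF x" using In.zero_closed by simp
    fix X assume X: "X \<in> eA x"
    let ?Y = "pr (- n) X"
    have Y: "?Y \<in> eA x" "?Y \<in> dg (- n)" using eA_closed(6)[OF x X] pr_deg[OF eA_closed(8)[OF x X]] by simp_all
    have "\<phi> ?Y = 0"
    proof (cases "- n < 0")
      case True
      then have "?Y = \<zero>\<^bsub>A\<^esub>" using dg_neg[OF Y(2)] by simp
      then show ?thesis using DF_zero[OF x \<phi>'] by simp
    next
      case False
      then have "?Y = (\<Oplus>\<^bsub>A\<^esub>a\<in>arcs Q. rs a ?Y \<star> ar a)" using n by (intro dg_pos_right[OF Y(2)]) simp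
      then have "\<phi> ?Y = \<phi> (\<Oplus>\<^bsub>A\<^esub>a\<in>arcs Q. rs a ?Y \<star> ar a)" by (rule arg_cong)
      also have "\<dots> = (\<Sum>a\<in>arcs Q. \<phi> (rs a ?Y \<star> ar a))"
        using DF_finsum[OF x \<phi>', of "arcs Q" "\<lambda>a. rs a ?Y \<star> ar a"] eA_closed(3,7)[OF x] Y(1) by simp
      also have "\<dots> = 0"
      proof (rule sum.neutral, rule ballI)
        fix a assume "a \<in> arcs Q"
        then have "(ar a \<odot>\<^bsub>In x\<^esub> \<phi>) (rs a ?Y) = \<zero>\<^bsub>In x\<^esub> (rs a ?Y)" using z by simp
        then show "\<phi> (rs a ?Y \<star> ar a) = 0" using eA_closed(7)[OF x Y(1)] by simp
      qed
      finally show ?thesis .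
    qed
    then show "\<phi> X = \<zero>\<^bsub>In x\<^esub> X" using hcomp_In_pr[OF x \<phi> X] X by simp
  qed
qed

text \<open>Restricting a functional to the paths that begin with one arrow leaves the action of that arrow
  unchanged and makes all other arrows act as 0.\<close>

lemma arrows_separate_In:
  assumes x: "x \<in> verts Q"
  shows "arrows_separate (In x) n"
  unfolding arrows_separate_def
proof (intro ballI)
  fix u a assume u: "u \<in> hcomp (In x) n" and a: "a \<in> arcs Q"
  have u': "u \<in> DF x" using u by (simp add: In_hcomp)
  note eAc = eA_closed(8)[OF x]
  let ?m = "\<lambda>X\<in>eA x. u (rs a X \<star> ar a)"
  have "?m \<in> hcomp (In x) (n + 0)"
  proof (rule DF_compose(2)[OF x x u' _ _ _ _ u])
    fix k X assume X: "X \<in> eA x" "X \<in> dg k"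
    show "rs a X \<star> ar a \<in> dg (k + 0)" using dg_mult[OF rs_deg[OF X(2), of a] ar_deg[OF a]] by simp
  qed (use a in \<open>simp_all add: eA_closed(3,7)[OF x] eAc rs_add rs_sc rs_closed A.l_distr A.m_assoc\<close>)
  then have "?m \<in> hcomp (In x) n" by simp
  moreover have "ar b \<odot>\<^bsub>In x\<^esub> ?m = (if b = a then ar a \<odot>\<^bsub>In x\<^esub> u else \<zero>\<^bsub>In x\<^esub>)" if b: "b \<in> arcs Q" for b
    using b a rs_ar_ar[OF eAc a] rs_ar_other[OF eAc b, of _ a] DF_zero[OF x u']
    by (simp add: eA_closed(3)[OF x] cong: restrict_cong)
  ultimately show "\<exists>m\<in>hcomp (In x) n. ar a \<odot>\<^bsub>In x\<^esub> m = ar a \<odot>\<^bsub>In x\<^esub> u \<and>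
      (\<forall>b\<in>arcs Q. b \<noteq> a \<longrightarrow> ar b \<odot>\<^bsub>In x\<^esub> m = \<zero>\<^bsub>In x\<^esub>)"
    using a by (intro bexI[where x = ?m]) simp_all
qed

text \<open>Multiplying by \<open>a\<close> and cancelling it again changes an element only by elements that \<open>a\<close> kills.\<close>

lemma rs_ar_diff:
  assumes X: "X \<in> carrier A" and a: "a \<in> arcs Q"
  defines "Y \<equiv> X \<star> e (head Q a) \<oplus>\<^bsub>A\<^esub> \<ominus>\<^bsub>A\<^esub> rs a (X \<star> ar a)"
  shows "Y = (\<Oplus>\<^bsub>A\<^esub>b\<in>{b. zr a b}. rs b Y \<star> ar b)"
proof (rule ann_right[OF _ a])
  have h: "head Q a \<in> verts Q" using a by simp
  have Xa: "X \<star> ar a \<in> carrier A" using X a by simp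
  note R = rs_closed[OF Xa, of a]
  show "Y \<in> carrier A" using X a R h by (simp add: Y_def)
  show "Y \<star> e (head Q a) = Y"
    using X a R h by (simp add: Y_def A.l_distr A.l_minus A.m_assoc e_idem rs_e)
  have "X \<star> e (head Q a) \<star> ar a = X \<star> ar a" using X a h by (simp add: A.m_assoc e_head_ar)
  moreover have "rs a (X \<star> ar a) \<star> ar a = X \<star> ar a" by (rule rs_ar_ar[OF X a])
  ultimately show "Y \<star> ar a = \<zero>\<^bsub>A\<^esub>"
    using X a R h Xa by (simp add: Y_def A.l_distr A.l_minus A.r_neg)
qed

text \<open>The preimage of \<open>v\<close> under \<open>a\<close> is \<open>v\<close> composed with cancelling \<open>a\<close>; that this is a preimage only
  requires \<open>v\<close> to vanish on the difference described by \<open>rs_ar_diff\<close>.\<close>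

lemma arrow_images_In:
  assumes x: "x \<in> verts Q"
  shows "arrow_images (In x) n"
  unfolding arrow_images_def
proof (intro ballI impI)
  fix a v assume a: "a \<in> arcs Q" and v: "v \<in> hcomp (In x) n"
    and ev: "e (head Q a) \<odot>\<^bsub>In x\<^esub> v = v" and z: "\<forall>b. zr a b \<longrightarrow> ar b \<odot>\<^bsub>In x\<^esub> v = \<zero>\<^bsub>In x\<^esub>"
  have v': "v \<in> DF x" using v by (simp add: In_hcomp)
  have h: "head Q a \<in> verts Q" using a by simp
  note eAc = eA_closed(8)[OF x]
  let ?m = "\<lambda>X\<in>eA x. v (rs a X)"
  have "?m \<in> hcomp (In x) (n + - 1)"
  proof (rule DF_compose(2)[OF x x v' _ _ _ _ v])
    fix k X assume X: "X \<in> eA x" "X \<in> dg k"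
    show "rs a X \<in> dg (k + - 1)" using rs_deg[OF X(2), of a] by simp
  qed (simp_all add: eA_closed(7)[OF x] eAc rs_add rs_sc)
  then have m: "?m \<in> hcomp (In x) (n - 1)" by simp
  moreover have "ar a \<odot>\<^bsub>In x\<^esub> ?m = v"
  proof (rule DF_eqI[OF x _ v'])
    show "ar a \<odot>\<^bsub>In x\<^esub> ?m \<in> DF x"
      using DF_smult[OF x ar_closed[OF a], of ?m] m by (simp add: In_hcomp)
    fix X assume X: "X \<in> eA x"
    let ?Y = "X \<star> e (head Q a) \<oplus>\<^bsub>A\<^esub> \<ominus>\<^bsub>A\<^esub> rs a (X \<star> ar a)"
    have cl: "X \<star> e (head Q a) \<in> eA x" "rs a (X \<star> ar a) \<in> eA x"
      using X a h by (simp_all add: eA_closed(3,7)[OF x])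
    have Y: "?Y \<in> eA x" using cl by (simp add: eA_closed(2,5)[OF x])
    have "v ?Y = v (\<Oplus>\<^bsub>A\<^esub>b\<in>{b. zr a b}. rs b ?Y \<star> ar b)" by (rule arg_cong[OF rs_ar_diff[OF eAc[OF X] a]])
    also have "\<dots> = (\<Sum>b\<in>{b. zr a b}. v (rs b ?Y \<star> ar b))"
      using DF_finsum[OF x v', of "{b. zr a b}" "\<lambda>b. rs b ?Y \<star> ar b"] Y finite_zr
      by (simp add: eA_closed(3,7)[OF x] zr_arcs)
    also have "\<dots> = 0"
    proof (rule sum.neutral, rule ballI)
      fix b assume "b \<in> {b. zr a b}"
      then have "(ar b \<odot>\<^bsub>In x\<^esub> v) (rs b ?Y) = \<zero>\<^bsub>In x\<^esub> (rs b ?Y)" using z by simp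
      then show "v (rs b ?Y \<star> ar b) = 0" using eA_closed(7)[OF x Y] by simp
    qed
    finally have "v (X \<star> e (head Q a)) = v (rs a (X \<star> ar a))"
      using cl by (simp add: DFD(2)[OF x v'] DF_minus[OF x v'] eA_closed(5)[OF x])
    moreover have "v (X \<star> e (head Q a)) = v X" using fun_cong[OF ev, of X] X by simp
    ultimately show "(ar a \<odot>\<^bsub>In x\<^esub> ?m) X = v X"
      using X a by (simp add: eA_closed(3)[OF x])
  qed
  ultimately show "\<exists>m\<in>hcomp (In x) (n - 1). ar a \<odot>\<^bsub>In x\<^esub> m = v" by (intro bexI[where x = ?m])
qed

abbreviation Ins :: "('v \<times> int) list \<Rightarrow> _" where "Ins \<equiv> injective_sum Q I"

definition ins :: "('v \<times> int) list \<Rightarrow> int \<Rightarrow> (nat \<Rightarrow> (('v, 'e) qpath \<Rightarrow> 'k) set \<Rightarrow> 'k) \<Rightarrow>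
    nat \<Rightarrow> (('v, 'e) qpath \<Rightarrow> 'k) set \<Rightarrow> 'k"
  where "ins xs = (\<lambda>n f. \<lambda>j\<in>{..<length xs}. inpr (fst (xs ! j)) (n - snd (xs ! j)) (f j))"

context
  fixes xs :: "('v \<times> int) list"
  assumes xs: "fst ` set xs \<subseteq> verts Q"
begin

lemma Ins_summand:
  "j \<in> {..<length xs} \<Longrightarrow> graded_mod Q S I (shift (snd (xs ! j)) (In (fst (xs ! j))))
     (\<lambda>n. inpr (fst (xs ! j)) (n - snd (xs ! j)))"
  by (rule graded_mod_shift[OF graded_mod_In]) (simp add: nth_verts[OF xs])

lemma graded_mod_Ins: "graded_mod Q S I (Ins xs) (ins xs)"
  unfolding injective_sum_def ins_def
  by (rule graded_mod_direct_sum[OF finite_lessThan quadratic_monomial_axioms Ins_summand])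

lemma arrows_detect_Ins:
  assumes "\<And>x i. (x, i) \<in> set xs \<Longrightarrow> n < i"
  shows "arrows_detect (Ins xs) n"
  unfolding injective_sum_def
proof (rule arrows_detect_direct_sum[OF Ins_summand])
  fix j assume j: "j \<in> {..<length xs}"
  then have "n < snd (xs ! j)" using assms[of "fst (xs ! j)" "snd (xs ! j)"] by simp
  then show "arrows_detect (shift (snd (xs ! j)) (In (fst (xs ! j)))) n"
    unfolding arrows_shift using j by (intro arrows_detect_In nth_verts[OF xs]) simp_all
qed

lemma arrows_separate_Ins: "arrows_separate (Ins xs) n"
  unfolding injective_sum_def
  by (rule arrows_separate_direct_sum[OF Ins_summand])
    (auto simp: arrows_shift intro!: arrows_separate_In nth_verts[OF xs])

lemma arrow_images_Ins: "arrow_images (Ins xs) n"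
  unfolding injective_sum_def
  by (rule arrow_images_direct_sum[OF Ins_summand])
    (auto simp: arrows_shift intro!: arrow_images_In nth_verts[OF xs])

lemma Ins_bounded_above:
  assumes "\<And>x i. (x, i) \<in> set xs \<Longrightarrow> i < n" and m: "m \<in> hcomp (Ins xs) n"
  shows "m = \<zero>\<^bsub>Ins xs\<^esub>"
proof -
  have "m j = \<zero>\<^bsub>In (fst (xs ! j))\<^esub>" if j: "j < length xs" for j
  proof -
    let ?x = "fst (xs ! j)" and ?n = "n - snd (xs ! j)"
    have x: "?x \<in> verts Q" using nth_verts[OF xs j] .
    have mj: "m j \<in> hcomp (In ?x) ?n" using m j by (auto simp: injective_sum_def)
    then have mD: "m j \<in> DF ?x" by (simp add: In_hcomp)
    have n: "snd (xs ! j) < n" using assms(1)[of "fst (xs ! j)" "snd (xs ! j)"] j by simp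
    show ?thesis
    proof (rule DF_eqI[OF x mD])
      show "\<zero>\<^bsub>In ?x\<^esub> \<in> DF ?x" using abelian_groupE(2)[OF In_abelian[OF x]] by simp
      fix X assume X: "X \<in> eA ?x"
      have "pr (- ?n) X = \<zero>\<^bsub>A\<^esub>"
        using dg_neg[OF pr_deg[OF eA_closed(8)[OF x X]], of "- ?n"] n by simp
      then have "m j X = m j \<zero>\<^bsub>A\<^esub>" using hcomp_In_pr[OF x mj X] by simp
      then show "m j X = \<zero>\<^bsub>In ?x\<^esub> X" using DF_zero[OF x mD] X by simp
    qed
  qed
  then show ?thesis using m by (auto simp: injective_sum_def PiE_iff extensional_def fun_eq_iff)
qed

end

end

section \<open>Truncations\<close>

context graded_mod
begin

definition part_ge :: "int \<Rightarrow> 'm set" where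
  "part_ge c = {m \<in> carrier M. \<forall>n<c. cmp n m = \<zero>}"

definition part_lt :: "int \<Rightarrow> 'm set" where
  "part_lt c = {m \<in> carrier M. \<forall>n\<ge>c. cmp n m = \<zero>}"

definition low :: "int \<Rightarrow> 'm \<Rightarrow> 'm" where
  "low c m = (\<Oplus>n\<in>{n. n < c \<and> cmp n m \<noteq> \<zero>}. cmp n m)"

definition trunc_ge :: "int \<Rightarrow> ((('v, 'e) qpath \<Rightarrow> 'k) set, 'm) graded_module" where
  "trunc_ge c = M\<lparr>carrier := part_ge c, hcomp := (\<lambda>n. if n < c then {\<zero>} else hcomp M n)\<rparr>"

text \<open>The quotient by \<open>trunc_ge c\<close> is modelled on the elements whose components all lie below \<open>c\<close>, so that
  it has elements of the same type; products are cut off after they are formed.\<close>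

definition trunc_lt :: "int \<Rightarrow> ((('v, 'e) qpath \<Rightarrow> 'k) set, 'm) graded_module" where
  "trunc_lt c = M\<lparr>carrier := part_lt c, smult := (\<lambda>a m. low c (a \<odot> m)),
     hcomp := (\<lambda>n. if n < c then hcomp M n else {\<zero>})\<rparr>"

lemma trunc_ge_sel [simp]:
  "carrier (trunc_ge c) = part_ge c" "add (trunc_ge c) = add M" "zero (trunc_ge c) = zero M"
  "smult (trunc_ge c) = smult M" "hcomp (trunc_ge c) n = (if n < c then {\<zero>} else hcomp M n)"
  by (simp_all add: trunc_ge_def)

lemma trunc_lt_sel [simp]:
  "carrier (trunc_lt c) = part_lt c" "add (trunc_lt c) = add M" "zero (trunc_lt c) = zero M"
  "smult (trunc_lt c) a m = low c (a \<odot> m)"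
  "hcomp (trunc_lt c) n = (if n < c then hcomp M n else {\<zero>})"
  by (simp_all add: trunc_lt_def)

lemma finite_support: "m \<in> carrier M \<Longrightarrow> finite {n. cmp n m \<noteq> \<zero>}"
proof -
  assume "m \<in> carrier M"
  then obtain N where N: "finite N" "\<forall>n. n \<notin> N \<longrightarrow> cmp n m = \<zero>" using cmp_sum by blast
  have "{n. cmp n m \<noteq> \<zero>} \<subseteq> N" using N(2) by blast
  then show ?thesis using N(1) by (rule finite_subset)
qed

lemma low_closed: "m \<in> carrier M \<Longrightarrow> low c m \<in> carrier M"
  unfolding low_def by (rule M.M.finsum_closed) (simp add: cmp_closed)

lemma cmp_low:
  assumes m: "m \<in> carrier M"
  shows "cmp n (low c m) = (if n < c then cmp n m else \<zero>)"
proof -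
  let ?N = "{n. n < c \<and> cmp n m \<noteq> \<zero>}"
  have fin: "finite ?N" by (rule finite_subset[OF _ finite_support[OF m]]) auto
  have "cmp n (low c m) = (\<Oplus>k\<in>?N. cmp n (cmp k m))"
    unfolding low_def by (rule cmp_finsum) (simp add: cmp_closed m)
  also have "\<dots> = (\<Oplus>k\<in>insert n ?N. if k = n \<and> n < c then cmp n m else \<zero>)"
  proof -
    have "(\<Oplus>k\<in>?N. cmp n (cmp k m)) = (\<Oplus>k\<in>?N. if k = n \<and> n < c then cmp n m else \<zero>)"
      by (rule M.M.finsum_cong') (auto simp: cmp_cmp m cmp_closed)
    also have "\<dots> = (\<Oplus>k\<in>insert n ?N. if k = n \<and> n < c then cmp n m else \<zero>)"
      by (rule M.M.finsum_superset) (use fin in \<open>auto simp: m cmp_closed\<close>)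
    finally show ?thesis .
  qed
  also have "\<dots> = (if n < c then cmp n m else \<zero>)"
    by (subst M.M.finsum_only[where k = n]) (use fin in \<open>auto simp: m cmp_closed\<close>)
  finally show ?thesis .
qed

lemma low_part: "m \<in> carrier M \<Longrightarrow> low c m \<in> part_lt c"
  by (simp add: part_lt_def low_closed cmp_low)

lemma low_eqI:
  assumes "m \<in> carrier M" "x \<in> carrier M" "\<And>n. cmp n x = (if n < c then cmp n m else \<zero>)"
  shows "low c m = x"
  by (rule cmp_eqI) (use assms in \<open>simp_all add: low_closed cmp_low\<close>)

lemma low_id: "m \<in> part_lt c \<Longrightarrow> low c m = m"
  by (rule low_eqI) (auto simp: part_lt_def)

lemma low_add: "m \<in> carrier M \<Longrightarrow> m' \<in> carrier M \<Longrightarrow> low c (m \<oplus> m') = low c m \<oplus> low c m'"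
  by (rule low_eqI) (auto simp: low_closed cmp_low cmp_add)

lemma low_zero_iff: "m \<in> carrier M \<Longrightarrow> low c m = \<zero> \<longleftrightarrow> m \<in> part_ge c"
proof
  assume m: "m \<in> carrier M" and "low c m = \<zero>"
  then have "cmp n m = \<zero>" if "n < c" for n using cmp_low[OF m, of n c] that by (simp add: cmp_zero)
  then show "m \<in> part_ge c" using m by (simp add: part_ge_def)
next
  assume m: "m \<in> carrier M" and "m \<in> part_ge c"
  then show "low c m = \<zero>" by (intro low_eqI) (auto simp: part_ge_def cmp_zero)
qed

lemma part_ge_closed:
  "\<zero> \<in> part_ge c" "x \<in> part_ge c \<Longrightarrow> y \<in> part_ge c \<Longrightarrow> x \<oplus> y \<in> part_ge c"
  "x \<in> part_ge c \<Longrightarrow> \<ominus> x \<in> part_ge c"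
  by (auto simp: part_ge_def cmp_zero cmp_add cmp_minus)

lemma part_lt_closed:
  "\<zero> \<in> part_lt c" "x \<in> part_lt c \<Longrightarrow> y \<in> part_lt c \<Longrightarrow> x \<oplus> y \<in> part_lt c"
  "x \<in> part_lt c \<Longrightarrow> \<ominus> x \<in> part_lt c"
  by (auto simp: part_lt_def cmp_zero cmp_add cmp_minus)

text \<open>Elements of the algebra have components of nonnegative degree only, so they do not lower degrees.\<close>

lemma cmp_smult_sum:
  assumes a: "a \<in> carrier A" and m: "m \<in> carrier M"
  shows "cmp n (a \<odot> m) = (\<Oplus>i\<in>{i. pr i a \<noteq> \<zero>\<^bsub>A\<^esub>}. pr i a \<odot> cmp (n - i) m)"
proof -
  let ?N = "{i. pr i a \<noteq> \<zero>\<^bsub>A\<^esub>}"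
  have cl: "pr i a \<odot> m \<in> carrier M" for i using a m by (simp add: M.smult_closed pr_carrier)
  have "a \<odot> m = (\<Oplus>\<^bsub>A\<^esub>i\<in>?N. pr i a) \<odot> m" by (rule arg_cong[OF pr_sum[OF a]])
  also have "\<dots> = (\<Oplus>i\<in>?N. pr i a \<odot> m)"
    by (rule M.smult_l_finsum[OF m]) (simp add: pr_carrier a)
  finally have "cmp n (a \<odot> m) = (\<Oplus>i\<in>?N. cmp n (pr i a \<odot> m))"
    using cmp_finsum[of ?N "\<lambda>i. pr i a \<odot> m" n] cl by simp
  also have "\<dots> = (\<Oplus>i\<in>?N. pr i a \<odot> cmp (n - i) m)"
  proof (rule M.M.finsum_cong'[OF refl])
    fix i show "cmp n (pr i a \<odot> m) = pr i a \<odot> cmp (n - i) m"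
      using cmp_smult[OF pr_deg[OF a] m, of i "n - i"] by simp
  qed (use a m in \<open>simp add: M.smult_closed pr_carrier cmp_closed\<close>)
  finally show ?thesis .
qed

lemma cmp_smult_cong:
  assumes a: "a \<in> carrier A" and m: "m \<in> carrier M" "m' \<in> carrier M"
    and eq: "\<And>k. k \<le> n \<Longrightarrow> cmp k m = cmp k m'"
  shows "cmp n (a \<odot> m) = cmp n (a \<odot> m')"
  unfolding cmp_smult_sum[OF a m(1)] cmp_smult_sum[OF a m(2)]
proof (rule M.M.finsum_cong'[OF refl])
  fix i assume "i \<in> {i. pr i a \<noteq> \<zero>\<^bsub>A\<^esub>}"
  then have "i \<ge> 0" using dg_neg[OF pr_deg[OF a, of i]] by force
  then show "pr i a \<odot> cmp (n - i) m = pr i a \<odot> cmp (n - i) m'" using eq[of "n - i"] by simp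
qed (use a m in \<open>simp add: M.smult_closed pr_carrier cmp_closed\<close>)

lemma low_smult_low:
  assumes a: "a \<in> carrier A" and m: "m \<in> carrier M"
  shows "low c (a \<odot> low c m) = low c (a \<odot> m)"
proof (rule low_eqI)
  fix n
  have "n < c \<Longrightarrow> cmp n (a \<odot> low c m) = cmp n (a \<odot> m)"
    by (rule cmp_smult_cong) (use a m in \<open>simp_all add: low_closed cmp_low\<close>)
  then show "cmp n (low c (a \<odot> m)) = (if n < c then cmp n (a \<odot> low c m) else \<zero>)"
    using a m by (simp add: cmp_low M.smult_closed)
qed (use a m in \<open>simp_all add: low_closed M.smult_closed\<close>)

lemma part_ge_smult:
  assumes a: "a \<in> carrier A" and m: "m \<in> part_ge c"
  shows "a \<odot> m \<in> part_ge c"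
proof -
  have mc: "m \<in> carrier M" using m by (simp add: part_ge_def)
  have "cmp n (a \<odot> m) = cmp n (a \<odot> \<zero>)" if "n < c" for n
    by (rule cmp_smult_cong) (use a m that in \<open>simp_all add: part_ge_def cmp_zero\<close>)
  then show ?thesis using a mc by (simp add: part_ge_def M.smult_closed M.smult_r_null cmp_zero)
qed

lemma part_abelian:
  assumes "carrier N = P" "add N = add M" "zero N = zero M" "P \<subseteq> carrier M" "\<zero> \<in> P"
    "\<And>x y. x \<in> P \<Longrightarrow> y \<in> P \<Longrightarrow> x \<oplus> y \<in> P" "\<And>x. x \<in> P \<Longrightarrow> \<ominus> x \<in> P"
  shows "abelian_group N"
proof (rule abelian_groupI)
  fix x assume x: "x \<in> carrier N"
  then show "\<exists>y\<in>carrier N. y \<oplus>\<^bsub>N\<^esub> x = \<zero>\<^bsub>N\<^esub>"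
    using assms(4,7) by (intro bexI[where x = "\<ominus> x"]) (auto simp: assms(1-3) M.M.l_neg)
next
  fix x y z assume "x \<in> carrier N" "y \<in> carrier N" "z \<in> carrier N"
  then have "x \<in> carrier M" "y \<in> carrier M" "z \<in> carrier M" using assms(1,4) by auto
  then show "x \<oplus>\<^bsub>N\<^esub> y \<oplus>\<^bsub>N\<^esub> z = x \<oplus>\<^bsub>N\<^esub> (y \<oplus>\<^bsub>N\<^esub> z)" by (simp add: assms(2) M.M.a_assoc)
next
  fix x y assume "x \<in> carrier N" "y \<in> carrier N"
  then have "x \<in> carrier M" "y \<in> carrier M" using assms(1,4) by auto
  then show "x \<oplus>\<^bsub>N\<^esub> y = y \<oplus>\<^bsub>N\<^esub> x" by (simp add: assms(2) M.M.a_comm)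
qed (use assms in auto)

lemma part_finsum:
  assumes "abelian_group N" "carrier N \<subseteq> carrier M" "add N = add M" "zero N = zero M"
    and "\<And>t. t \<in> T \<Longrightarrow> g t \<in> carrier N"
  shows "(\<Oplus>\<^bsub>N\<^esub>t\<in>T. g t) = (\<Oplus>t\<in>T. g t)"
  by (rule finsum_sub[OF abelian assms])

lemma part_a_inv:
  assumes "abelian_group N" "carrier N \<subseteq> carrier M" "add N = add M" "zero N = zero M" "x \<in> carrier N"
  shows "\<ominus>\<^bsub>N\<^esub> x = \<ominus> x"
  by (rule additive_minus[OF assms(1) abelian, of "\<lambda>x. x"])
    (use assms in \<open>auto simp: hom_def\<close>)

lemma trunc_ge_abelian: "abelian_group (trunc_ge c)"
  by (rule part_abelian[where P = "part_ge c"]) (simp_all add: part_ge_closed, simp add: part_ge_def)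

lemma trunc_lt_abelian: "abelian_group (trunc_lt c)"
  by (rule part_abelian[where P = "part_lt c"]) (simp_all add: part_lt_closed, simp add: part_lt_def)

lemma hc_part_ge: "m \<in> hcomp M n \<Longrightarrow> n \<ge> c \<Longrightarrow> m \<in> part_ge c"
  using cmp_other[of m n] by (auto simp: part_ge_def hc_closed)

lemma hc_part_lt: "m \<in> hcomp M n \<Longrightarrow> n < c \<Longrightarrow> m \<in> part_lt c"
  using cmp_other[of m n] by (auto simp: part_lt_def hc_closed)

lemma part_ge_cmp: "m \<in> part_ge c \<Longrightarrow> cmp n m \<in> part_ge c"
  by (auto simp: part_ge_def cmp_closed cmp_cmp)

lemma part_lt_cmp: "m \<in> part_lt c \<Longrightarrow> cmp n m \<in> part_lt c"
  by (auto simp: part_lt_def cmp_closed cmp_cmp)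

lemma graded_mod_trunc_ge: "graded_mod Q S I (trunc_ge c) cmp"
proof (intro graded_mod.intro graded_mod_axioms.intro quadratic_monomial_axioms left_module.intro
    left_module_axioms.intro A.ring_axioms trunc_ge_abelian)
  have sub: "part_ge c \<subseteq> carrier M" by (auto simp: part_ge_def)
  note ab = trunc_ge_abelian[of c]
  show "additive_subgroup (hcomp (trunc_ge c) n) (trunc_ge c)" for n
    unfolding additive_subgroup_iff[OF ab]
    using hc_part_ge part_a_inv[OF ab, simplified, OF sub] part_ge_closed(1)
    by (auto simp: hc_zero hc_add hc_minus)
  show "\<exists>N. finite N \<and> (\<forall>n. n \<notin> N \<longrightarrow> cmp n m = \<zero>\<^bsub>trunc_ge c\<^esub>) \<and> m = (\<Oplus>\<^bsub>trunc_ge c\<^esub>n\<in>N. cmp n m)"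
    if m: "m \<in> carrier (trunc_ge c)" for m
  proof -
    have "m \<in> carrier M" using m sub by auto
    then obtain N where N: "finite N" "\<forall>n. n \<notin> N \<longrightarrow> cmp n m = \<zero>" "m = (\<Oplus>n\<in>N. cmp n m)"
      using cmp_sum by blast
    have "(\<Oplus>\<^bsub>trunc_ge c\<^esub>n\<in>N. cmp n m) = (\<Oplus>n\<in>N. cmp n m)"
      by (rule part_finsum[OF ab]) (use m sub part_ge_cmp in auto)
    then show ?thesis using N by auto
  qed
  show "a \<odot>\<^bsub>trunc_ge c\<^esub> m \<in> hcomp (trunc_ge c) (i + j)"
    if "a \<in> dg i" "m \<in> hcomp (trunc_ge c) j" for a i m j
  proof (cases "j < c \<or> i < 0")
    case True
    have "a \<odot> m = \<zero>"
    proof (cases "j < c")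
      case True
      then show ?thesis using that dg_closed[OF that(1)] by (simp add: M.smult_r_null)
    next
      case False
      then show ?thesis using True that dg_neg[OF that(1)] M.smult_l_null[OF hc_closed, of m j] by simp
    qed
    then show ?thesis by (simp add: hc_zero)
  next
    case False
    then show ?thesis using smult_hc[OF that(1), of m j] that(2) by simp
  qed
  show "a \<odot>\<^bsub>trunc_ge c\<^esub> m \<in> carrier (trunc_ge c)" if "a \<in> carrier A" "m \<in> carrier (trunc_ge c)" for a m
    using part_ge_smult[OF that(1), of m c] that(2) by simp
qed (auto simp: M.smult_l_distr M.smult_r_distr M.smult_assoc M.smult_one
      part_ge_def[of c] cmp_add cmp_same cmp_other cmp_zero cmp_hc split: if_splits
      dest: subsetD[of "part_ge c" "carrier M"] hc_closed)

lemma graded_mod_trunc_lt: "graded_mod Q S I (trunc_lt c) cmp"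
proof (intro graded_mod.intro graded_mod_axioms.intro quadratic_monomial_axioms left_module.intro
    left_module_axioms.intro A.ring_axioms trunc_lt_abelian)
  have sub: "part_lt c \<subseteq> carrier M" by (auto simp: part_lt_def)
  note ab = trunc_lt_abelian[of c]
  show "additive_subgroup (hcomp (trunc_lt c) n) (trunc_lt c)" for n
    unfolding additive_subgroup_iff[OF ab]
    using hc_part_lt part_a_inv[OF ab, simplified, OF sub] part_lt_closed(1)
    by (auto simp: hc_zero hc_add hc_minus)
  show "\<exists>N. finite N \<and> (\<forall>n. n \<notin> N \<longrightarrow> cmp n m = \<zero>\<^bsub>trunc_lt c\<^esub>) \<and> m = (\<Oplus>\<^bsub>trunc_lt c\<^esub>n\<in>N. cmp n m)"
    if m: "m \<in> carrier (trunc_lt c)" for m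
  proof -
    have "m \<in> carrier M" using m sub by auto
    then obtain N where N: "finite N" "\<forall>n. n \<notin> N \<longrightarrow> cmp n m = \<zero>" "m = (\<Oplus>n\<in>N. cmp n m)"
      using cmp_sum by blast
    have "(\<Oplus>\<^bsub>trunc_lt c\<^esub>n\<in>N. cmp n m) = (\<Oplus>n\<in>N. cmp n m)"
      by (rule part_finsum[OF ab]) (use m sub part_lt_cmp in auto)
    then show ?thesis using N by auto
  qed
  fix a assume a: "a \<in> carrier A"
  {
    fix m assume m: "m \<in> carrier (trunc_lt c)"
    then have mc: "m \<in> carrier M" using sub by auto
    show "a \<odot>\<^bsub>trunc_lt c\<^esub> m \<in> carrier (trunc_lt c)" using a mc by (simp add: low_part M.smult_closed)
    fix m' assume "m' \<in> carrier (trunc_lt c)"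
    then have "m' \<in> carrier M" using sub by auto
    then show "a \<odot>\<^bsub>trunc_lt c\<^esub> (m \<oplus>\<^bsub>trunc_lt c\<^esub> m') =
        a \<odot>\<^bsub>trunc_lt c\<^esub> m \<oplus>\<^bsub>trunc_lt c\<^esub> a \<odot>\<^bsub>trunc_lt c\<^esub> m'"
      using a mc by (simp add: low_add M.smult_closed M.smult_r_distr)
  }
  fix b m assume b: "b \<in> carrier A" and m: "m \<in> carrier (trunc_lt c)"
  then have mc: "m \<in> carrier M" using sub by auto
  show "(a \<oplus>\<^bsub>A\<^esub> b) \<odot>\<^bsub>trunc_lt c\<^esub> m = a \<odot>\<^bsub>trunc_lt c\<^esub> m \<oplus>\<^bsub>trunc_lt c\<^esub> b \<odot>\<^bsub>trunc_lt c\<^esub> m"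
    using a b mc by (simp add: low_add M.smult_closed M.smult_l_distr)
  show "(a \<star> b) \<odot>\<^bsub>trunc_lt c\<^esub> m = a \<odot>\<^bsub>trunc_lt c\<^esub> (b \<odot>\<^bsub>trunc_lt c\<^esub> m)"
    using a b mc by (simp add: low_smult_low M.smult_closed M.smult_assoc)
next
  fix a i m j assume a: "a \<in> dg i" and m: "m \<in> hcomp (trunc_lt c) j"
  have m': "m \<in> hcomp M j" using m by (auto simp: hc_zero split: if_splits)
  note h = smult_hc[OF a m']
  have "low c (a \<odot> m) = (if i + j < c then a \<odot> m else \<zero>)"
    by (rule low_eqI[OF hc_closed[OF h]])
      (use h cmp_same[OF h] cmp_other[OF h] in \<open>auto simp: hc_closed[OF h] cmp_zero\<close>)
  then show "a \<odot>\<^bsub>trunc_lt c\<^esub> m \<in> hcomp (trunc_lt c) (i + j)" using h by simp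
next
  fix m assume "m \<in> carrier (trunc_lt c)"
  then show "\<one>\<^bsub>A\<^esub> \<odot>\<^bsub>trunc_lt c\<^esub> m = m" using low_id[of m c] by (simp add: M.smult_one part_lt_def)
qed (auto simp: part_lt_def[of c] cmp_add cmp_same cmp_other cmp_zero cmp_hc split: if_splits)

lemma low_sc:
  assumes m: "m \<in> part_lt c"
  shows "low c (sc k \<odot> m) = sc k \<odot> m"
proof (rule low_id)
  have mc: "m \<in> carrier M" using m by (simp add: part_lt_def)
  have "cmp n (sc k \<odot> m) = sc k \<odot> cmp n m" for n using cmp_smult[OF sc_deg mc, of n k] by simp
  then show "sc k \<odot> m \<in> part_lt c"
    using m mc by (simp add: part_lt_def M.smult_closed M.smult_r_null)
qed

end

subsection \<open>Spans and bases\<close>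

context graded_mod
begin

definition lin :: "'m set \<Rightarrow> ('m \<Rightarrow> 'k) \<Rightarrow> 'm" where
  "lin B c = (\<Oplus>b\<in>B. sc (c b) \<odot> b)"

lemma sc_smult_closed [simp]: "m \<in> carrier M \<Longrightarrow> sc c \<odot> m \<in> carrier M"
  by (simp add: M.smult_closed)

lemma sc_zero_smult: "m \<in> carrier M \<Longrightarrow> sc 0 \<odot> m = \<zero>"
  by (simp add: sc_zero M.smult_l_null)

lemma lin_closed: "B \<subseteq> carrier M \<Longrightarrow> lin B c \<in> carrier M"
  unfolding lin_def by (rule M.M.finsum_closed) auto

lemma lin_add:
  assumes "B \<subseteq> carrier M"
  shows "lin B (\<lambda>b. c b + d b) = lin B c \<oplus> lin B d"
proof -
  have "lin B (\<lambda>b. c b + d b) = (\<Oplus>b\<in>B. sc (c b) \<odot> b \<oplus> sc (d b) \<odot> b)"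
    unfolding lin_def by (rule M.M.finsum_cong') (use assms in \<open>auto simp: sc_add M.smult_l_distr\<close>)
  also have "\<dots> = lin B c \<oplus> lin B d"
    unfolding lin_def by (rule M.M.finsum_addf) (use assms in auto)
  finally show ?thesis .
qed

lemma lin_scale:
  assumes "B \<subseteq> carrier M"
  shows "lin B (\<lambda>b. k * c b) = sc k \<odot> lin B c"
proof -
  have "sc k \<odot> lin B c = (\<Oplus>b\<in>B. sc k \<odot> (sc (c b) \<odot> b))"
    unfolding lin_def by (rule M.smult_r_finsum) (use assms in auto)
  also have "\<dots> = lin B (\<lambda>b. k * c b)"
    unfolding lin_def by (rule M.M.finsum_cong') (use assms in \<open>auto simp: sc_mult M.smult_assoc\<close>)
  finally show ?thesis by simp
qed

lemma lin_superset:
  assumes "finite B" "B \<subseteq> carrier M" "B' \<subseteq> B" "\<And>b. b \<in> B - B' \<Longrightarrow> c b = 0"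
  shows "lin B' c = lin B c"
  unfolding lin_def
  by (rule M.M.finsum_superset) (use assms in \<open>auto simp: sc_zero_smult subset_iff\<close>)

lemma lin_single:
  assumes "finite B" "B \<subseteq> carrier M" "b \<in> B"
  shows "lin B (\<lambda>x. if x = b then k else 0) = sc k \<odot> b"
  unfolding lin_def
  by (subst M.M.finsum_only[of B b]) (use assms in \<open>auto simp: sc_zero_smult subset_iff\<close>)

definition spn :: "'m set \<Rightarrow> 'm set" where "spn B = range (lin B)"

lemma spn_zero: "B \<subseteq> carrier M \<Longrightarrow> \<zero> \<in> spn B"
proof -
  assume B: "B \<subseteq> carrier M"
  have "lin B (\<lambda>b. 0) = (\<Oplus>b\<in>B. \<zero>)"
    unfolding lin_def by (rule M.M.finsum_cong') (use B in \<open>auto simp: sc_zero_smult\<close>)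
  then have "lin B (\<lambda>b. 0) = \<zero>" by simp
  then show ?thesis unfolding spn_def by (metis rangeI)
qed

lemma spn_add: "B \<subseteq> carrier M \<Longrightarrow> x \<in> spn B \<Longrightarrow> y \<in> spn B \<Longrightarrow> x \<oplus> y \<in> spn B"
proof -
  assume B: "B \<subseteq> carrier M" and "x \<in> spn B" "y \<in> spn B"
  then obtain c d where "x = lin B c" "y = lin B d" unfolding spn_def by blast
  then have "x \<oplus> y = lin B (\<lambda>b. c b + d b)" by (simp add: lin_add[OF B])
  then show ?thesis unfolding spn_def by (simp only: rangeI)
qed

lemma spn_closed: "B \<subseteq> carrier M \<Longrightarrow> x \<in> spn B \<Longrightarrow> x \<in> carrier M"
  unfolding spn_def using lin_closed by auto

lemma spn_finsum:
  assumes "B \<subseteq> carrier M" "\<And>t. t \<in> T \<Longrightarrow> f t \<in> spn B"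
  shows "(\<Oplus>t\<in>T. f t) \<in> spn B"
  using assms(2)
proof (induction T rule: infinite_finite_induct)
  case (insert t T)
  then have "f \<in> T \<rightarrow> carrier M" "f t \<in> carrier M" using spn_closed[OF assms(1)] by auto
  with insert show ?case by (simp add: M.M.finsum_insert spn_add[OF assms(1)])
qed (simp_all add: spn_zero assms(1))

lemma spn_mono:
  assumes "finite B" "B \<subseteq> carrier M" "B' \<subseteq> B"
  shows "spn B' \<subseteq> spn B"
proof
  fix x assume "x \<in> spn B'"
  then obtain c where c: "x = lin B' c" unfolding spn_def by blast
  let ?c = "\<lambda>b. if b \<in> B' then c b else 0"
  have "lin B' c = lin B' ?c"
    unfolding lin_def by (rule M.M.finsum_cong') (use assms in auto)
  also have "\<dots> = lin B ?c" by (rule lin_superset) (use assms in auto)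
  finally show "x \<in> spn B" unfolding spn_def c by blast
qed

lemma spn_single:
  assumes "finite B" "B \<subseteq> carrier M" "b \<in> B"
  shows "sc k \<odot> b \<in> spn B"
  unfolding spn_def using lin_single[OF assms, of k] by (metis rangeI)

text \<open>A finite spanning set of least cardinality is a basis.\<close>

lemma basis_exists:
  assumes V: "V \<subseteq> carrier M" and B0: "finite B0" "B0 \<subseteq> V" "V \<subseteq> spn B0"
  obtains B where "finite B" "B \<subseteq> V" "V \<subseteq> spn B"
    "\<And>c b. lin B c = \<zero> \<Longrightarrow> b \<in> B \<Longrightarrow> c b = 0"
proof -
  let ?P = "\<lambda>B. finite B \<and> B \<subseteq> V \<and> V \<subseteq> spn B"
  obtain B where B: "?P B" "\<And>B'. ?P B' \<Longrightarrow> card B \<le> card B'"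
    using ex_has_least_nat[of ?P B0 card] B0 by blast
  have BM: "B \<subseteq> carrier M" using B V by blast
  have "c b = 0" if l: "lin B c = \<zero>" and b: "b \<in> B" for c b
  proof (rule ccontr)
    assume cb: "c b \<noteq> 0"
    have "V \<subseteq> spn (B - {b})"
    proof
      fix v assume "v \<in> V"
      then obtain d where d: "v = lin B d" using B(1) unfolding spn_def by blast
      let ?k = "- (d b / c b)"
      let ?f = "\<lambda>x. d x + ?k * c x"
      have "lin B ?f = v \<oplus> sc ?k \<odot> lin B c"
        using lin_add[OF BM, of d "\<lambda>x. ?k * c x"] lin_scale[OF BM, of ?k c] d by simp
      also have "\<dots> = v" using l d lin_closed[OF BM] by (simp add: M.smult_r_null)
      finally have "v = lin B ?f" by simp
      also have "\<dots> = lin (B - {b}) ?f"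
        by (rule lin_superset[symmetric]) (use B BM cb in auto)
      finally show "v \<in> spn (B - {b})" unfolding spn_def by blast
    qed
    then have "card B \<le> card (B - {b})" using B by (intro B(2)) auto
    then show False using b B(1) by (meson card_Diff1_less leD)
  qed
  then show ?thesis using that B(1) by blast
qed

lemma fd_iff:
  assumes "V \<subseteq> carrier M"
  shows "fd_over_field Q I M V \<longleftrightarrow> (\<exists>B. finite B \<and> B \<subseteq> V \<and> V \<subseteq> spn B)"
  unfolding finite_dim_def spn_def lin_def by (auto simp: subset_iff image_iff)

lemma ar_lin:
  assumes "B \<subseteq> carrier M" "a \<in> arcs Q"
  shows "ar a \<odot> lin B c = (\<Oplus>b\<in>B. sc (c b) \<odot> (ar a \<odot> b))"
proof -
  have "ar a \<odot> lin B c = (\<Oplus>b\<in>B. ar a \<odot> (sc (c b) \<odot> b))"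
    unfolding lin_def by (rule M.smult_r_finsum) (use assms in auto)
  also have "\<dots> = (\<Oplus>b\<in>B. sc (c b) \<odot> (ar a \<odot> b))"
  proof (rule M.M.finsum_cong'[OF refl])
    fix b assume b: "b \<in> B"
    then have bM: "b \<in> carrier M" using assms by blast
    show "ar a \<odot> (sc (c b) \<odot> b) = sc (c b) \<odot> (ar a \<odot> b)"
      using M.smult_assoc[of "ar a" "sc (c b)" b] M.smult_assoc[of "sc (c b)" "ar a" b]
        sc_commute[of "ar a" "c b"] bM assms(2) by simp
  qed (use assms in \<open>auto intro!: M.smult_closed\<close>)
  finally show ?thesis .
qed

lemma arrow_image_basis:
  assumes a: "a \<in> arcs Q" and fd: "fd_over_field Q I M (hcomp M n)"
  obtains B where "finite B" "B \<subseteq> (\<lambda>u. ar a \<odot> u) ` hcomp M n" "(\<lambda>u. ar a \<odot> u) ` hcomp M n \<subseteq> spn B"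
    "\<And>c b. lin B c = \<zero> \<Longrightarrow> b \<in> B \<Longrightarrow> c b = 0"
proof -
  have sub: "hcomp M n \<subseteq> carrier M" using hc_closed by blast
  obtain B0 where B0: "finite B0" "B0 \<subseteq> hcomp M n" "hcomp M n \<subseteq> spn B0" using fd fd_iff[OF sub] by blast
  have im: "(\<lambda>u. ar a \<odot> u) ` hcomp M n \<subseteq> carrier M" using sub a by (auto intro!: M.smult_closed)
  have iB: "(\<lambda>u. ar a \<odot> u) ` B0 \<subseteq> carrier M" using im B0(2) by blast
  have "(\<lambda>u. ar a \<odot> u) ` hcomp M n \<subseteq> spn ((\<lambda>u. ar a \<odot> u) ` B0)"
  proof (rule image_subsetI)
    fix u assume "u \<in> hcomp M n"
    then obtain c where c: "u = lin B0 c" using B0(3) unfolding spn_def by blast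
    have "B0 \<subseteq> carrier M" using B0(2) sub by blast
    then have "ar a \<odot> u = (\<Oplus>b\<in>B0. sc (c b) \<odot> (ar a \<odot> b))" unfolding c by (rule ar_lin[OF _ a])
    also have "\<dots> \<in> spn ((\<lambda>u. ar a \<odot> u) ` B0)"
      by (rule spn_finsum[OF iB]) (rule spn_single, use B0(1) iB in auto)
    finally show "ar a \<odot> u \<in> spn ((\<lambda>u. ar a \<odot> u) ` B0)" .
  qed
  then show ?thesis
    using basis_exists[OF im finite_imageI[OF B0(1)] image_mono[OF B0(2)]] that by blast
qed

lemma fd_bounded:
  assumes fd: "\<And>n. fd_over_field Q I M (hcomp M n)"
    and N: "finite N" "\<And>n. n \<notin> N \<Longrightarrow> hcomp M n = {\<zero>}"
  shows "fd_over_field Q I M (carrier M)"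
proof -
  have sub: "hcomp M n \<subseteq> carrier M" for n using hc_closed by blast
  have "\<forall>n. \<exists>B. finite B \<and> B \<subseteq> hcomp M n \<and> hcomp M n \<subseteq> spn B" using fd fd_iff[OF sub] by blast
  then obtain B where B: "\<forall>n. finite (B n) \<and> B n \<subseteq> hcomp M n \<and> hcomp M n \<subseteq> spn (B n)" by (rule choice[THEN exE])
  let ?B = "\<Union>n\<in>N. B n"
  have fin: "finite ?B" using B N(1) by blast
  have Bc: "?B \<subseteq> carrier M" using B sub by blast
  have "m \<in> spn ?B" if m: "m \<in> carrier M" for m
  proof -
    obtain T where T: "finite T" "\<forall>n. n \<notin> T \<longrightarrow> cmp n m = \<zero>" "m = (\<Oplus>n\<in>T. cmp n m)"
      using cmp_sum[OF m] by blast
    have "(\<Oplus>n\<in>T. cmp n m) \<in> spn ?B"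
    proof (rule spn_finsum[OF Bc])
      fix n
      show "cmp n m \<in> spn ?B"
      proof (cases "n \<in> N")
        case True
        then have "spn (B n) \<subseteq> spn ?B" by (intro spn_mono[OF fin Bc]) blast
        then show ?thesis using B cmp_hc[OF m, of n] by blast
      next
        case False
        then have "cmp n m = \<zero>" using N(2) cmp_hc[OF m] by blast
        then show ?thesis using spn_zero[OF Bc] by simp
      qed
    qed
    then show ?thesis using T(3) by (simp only:)
  qed
  then show ?thesis using fd_iff[OF subset_refl] fin Bc by blast
qed

subsection \<open>The truncation sequence\<close>

lemma fd_transfer:
  assumes N: "abelian_group N" "carrier N \<subseteq> carrier M" "add N = add M" "zero N = zero M"
    and sc: "\<And>k m. m \<in> carrier N \<Longrightarrow> sc k \<odot>\<^bsub>N\<^esub> m = sc k \<odot> m"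
    and scc: "\<And>k m. m \<in> carrier N \<Longrightarrow> sc k \<odot>\<^bsub>N\<^esub> m \<in> carrier N"
    and V: "V \<subseteq> carrier N" and fd: "fd_over_field Q I M V"
  shows "fd_over_field Q I N V"
proof -
  have eq: "(\<Oplus>\<^bsub>N\<^esub>b\<in>B. sc (c b) \<odot>\<^bsub>N\<^esub> b) = (\<Oplus>b\<in>B. sc (c b) \<odot> b)" if B: "B \<subseteq> V" for B c
  proof -
    have "(\<Oplus>\<^bsub>N\<^esub>b\<in>B. sc (c b) \<odot>\<^bsub>N\<^esub> b) = (\<Oplus>b\<in>B. sc (c b) \<odot>\<^bsub>N\<^esub> b)"
      by (rule part_finsum[OF N]) (use B V scc in blast)
    also have "\<dots> = (\<Oplus>b\<in>B. sc (c b) \<odot> b)"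
      by (rule M.M.finsum_cong'[OF refl]) (use B V sc N(2) in \<open>auto simp: subset_iff\<close>)
    finally show ?thesis .
  qed
  obtain B where "finite B" "B \<subseteq> V" "\<forall>v\<in>V. \<exists>c. v = (\<Oplus>b\<in>B. sc (c b) \<odot> b)"
    using fd unfolding finite_dim_def by blast
  then show ?thesis unfolding finite_dim_def using eq by (intro exI[where x = B]) auto
qed

lemma fd_zero: "zero N = zero M \<Longrightarrow> add N = add M \<Longrightarrow> abelian_group N \<Longrightarrow> fd_over_field Q I N {\<zero>}"
  unfolding finite_dim_def
  by (rule exI[where x = "{}"])
    (simp add: abelian_monoid.finsum_empty[OF abelian_group.axioms(1)])

lemma part_subset: "part_ge c \<subseteq> carrier M" "part_lt c \<subseteq> carrier M"
  by (auto simp: part_ge_def part_lt_def)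

lemma trunc_ge_fd:
  assumes fd: "\<And>n. fd_over_field Q I M (hcomp M n)"
  shows "fd_over_field Q I (trunc_ge c) (hcomp (trunc_ge c) n)"
proof (cases "n < c")
  case True
  then show ?thesis using fd_zero[OF _ _ trunc_ge_abelian] by simp
next
  case False
  then show ?thesis
    using hc_part_ge[of _ n c] part_ge_smult[OF sc_closed]
    by (intro fd_transfer[OF trunc_ge_abelian]) (auto simp: part_subset fd)
qed

lemma trunc_lt_fd:
  assumes fd: "\<And>n. fd_over_field Q I M (hcomp M n)"
  shows "fd_over_field Q I (trunc_lt c) (hcomp (trunc_lt c) n)"
proof (cases "n < c")
  case True
  have "sc k \<odot> m \<in> part_lt c" if "m \<in> part_lt c" for k m
    using low_part[OF sc_smult_closed[OF subsetD[OF part_subset(2) that]], of c k] low_sc[OF that, of k] by simp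
  with True show ?thesis
    using hc_part_lt[of _ n c]
    by (intro fd_transfer[OF trunc_lt_abelian]) (auto simp: part_subset low_sc fd)
next
  case False
  then show ?thesis using fd_zero[OF _ _ trunc_lt_abelian] by simp
qed

lemma trunc_short_exact:
  assumes fd: "\<And>n. fd_over_field Q I M (hcomp M n)"
  shows "short_exact Q I (trunc_ge c) (\<lambda>m. m) M (low c) (trunc_lt c)"
  unfolding short_exact_def
proof (intro conjI)
  show "graded_left_module Q I (trunc_ge c)"
    by (rule graded_mod.graded_left_module[OF graded_mod_trunc_ge trunc_ge_fd[OF fd]])
  show "graded_left_module Q I (trunc_lt c)"
    by (rule graded_mod.graded_left_module[OF graded_mod_trunc_lt trunc_lt_fd[OF fd]])
  show "graded_left_module Q I M" by (rule graded_left_module[OF fd])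
  show "(\<lambda>m. m) \<in> graded_hom Q I (trunc_ge c) M"
    by (rule graded_homI) (use part_subset hc_zero in \<open>auto split: if_splits\<close>)
  show "low c \<in> graded_hom Q I M (trunc_lt c)"
  proof (rule graded_homI)
    fix m n assume m: "m \<in> hcomp M n"
    have "low c m = (if n < c then m else \<zero>)"
      by (rule low_eqI[OF hc_closed[OF m]])
        (use m cmp_same[OF m] cmp_other[OF m] in \<open>auto simp: hc_closed[OF m] cmp_zero\<close>)
    then show "low c m \<in> hcomp (trunc_lt c) n" using m by simp
  qed (simp_all add: low_part low_add low_smult_low)
  show "inj_on (\<lambda>m. m) (carrier (trunc_ge c))" by simp
  show "(\<lambda>m. m) ` carrier (trunc_ge c) = a_kernel M (trunc_lt c) (low c)"
  proof (rule equalityI; rule subsetI)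
    fix m assume "m \<in> (\<lambda>m. m) ` carrier (trunc_ge c)"
    then have m: "m \<in> part_ge c" by simp
    then have "m \<in> carrier M" using part_subset(1) by blast
    then show "m \<in> a_kernel M (trunc_lt c) (low c)" using m low_zero_iff by (simp add: a_kernel_iff)
  next
    fix m assume "m \<in> a_kernel M (trunc_lt c) (low c)"
    then have "m \<in> carrier M" "low c m = \<zero>" by (simp_all add: a_kernel_iff)
    then show "m \<in> (\<lambda>m. m) ` carrier (trunc_ge c)" using low_zero_iff[of m c] by simp
  qed
  show "low c ` carrier M = carrier (trunc_lt c)"
  proof (rule equalityI; rule subsetI)
    fix m assume "m \<in> carrier (trunc_lt c)"
    then have m: "m \<in> part_lt c" by simp
    then have "m \<in> carrier M" using part_subset(2) by blast
    then show "m \<in> low c ` carrier M" using low_id[OF m] by (metis imageI)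
  next
    fix m assume "m \<in> low c ` carrier M"
    then show "m \<in> carrier (trunc_lt c)" using low_part by auto
  qed
qed

end

section \<open>Linear resolutions\<close>

context quadratic_monomial
begin

text \<open>The summands of the next term of a linear resolution or coresolution.  Each carries an arrow and the
  index of the summand of the previous term to which multiplication by that arrow connects it.\<close>

definition next_arrows :: "('e \<Rightarrow> 'e \<Rightarrow> bool) \<Rightarrow> 'e list \<Rightarrow> (nat \<times> 'e) list" where
  "next_arrows R bs = (SOME l. distinct l \<and> set l = {(i, g). i < length bs \<and> g \<in> arcs Q \<and> R (bs ! i) g})"

lemma next_arrows:
  "distinct (next_arrows R bs) \<and> set (next_arrows R bs) = {(i, g). i < length bs \<and> g \<in> arcs Q \<and> R (bs ! i) g}"
  unfolding next_arrows_def
proof (rule someI_ex)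
  have "{(i, g). i < length bs \<and> g \<in> arcs Q \<and> R (bs ! i) g} \<subseteq> {..<length bs} \<times> arcs Q" by auto
  then have "finite {(i, g). i < length bs \<and> g \<in> arcs Q \<and> R (bs ! i) g}" by (rule finite_subset) simp
  then show "\<exists>l. distinct l \<and> set l = {(i, g). i < length bs \<and> g \<in> arcs Q \<and> R (bs ! i) g}"
    using finite_distinct_list by blast
qed

definition fibre :: "(nat \<times> 'e) list \<Rightarrow> nat \<Rightarrow> nat set" where
  "fibre ps i = {k. k < length ps \<and> fst (ps ! k) = i}"

lemma finite_fibre: "finite (fibre ps i)"
  by (rule finite_subset[of _ "{..<length ps}"]) (auto simp: fibre_def)

lemma fibre_self: "k < length ps \<Longrightarrow> k \<in> fibre ps (fst (ps ! k))"
  by (simp add: fibre_def)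

lemma fibre_next:
  assumes "k \<in> fibre (next_arrows R bs) i"
  shows "k < length (next_arrows R bs)" "i < length bs" "R (bs ! i) (snd (next_arrows R bs ! k))"
    "snd (next_arrows R bs ! k) \<in> arcs Q"
proof -
  show k: "k < length (next_arrows R bs)" using assms by (simp add: fibre_def)
  then have "next_arrows R bs ! k \<in> set (next_arrows R bs)" by simp
  then have "next_arrows R bs ! k \<in> {(i, g). i < length bs \<and> g \<in> arcs Q \<and> R (bs ! i) g}"
    by (simp only: conjunct2[OF next_arrows])
  then show "i < length bs" "R (bs ! i) (snd (next_arrows R bs ! k))" "snd (next_arrows R bs ! k) \<in> arcs Q"
    using assms by (auto simp: fibre_def)
qed

lemma fibre_inj: "inj_on (\<lambda>k. snd (next_arrows R bs ! k)) (fibre (next_arrows R bs) i)"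
proof (rule inj_onI)
  fix k k' assume k: "k \<in> fibre (next_arrows R bs) i" "k' \<in> fibre (next_arrows R bs) i"
    and "snd (next_arrows R bs ! k) = snd (next_arrows R bs ! k')"
  then have eq: "next_arrows R bs ! k = next_arrows R bs ! k'" by (simp add: fibre_def prod_eq_iff)
  have "k < length (next_arrows R bs)" "k' < length (next_arrows R bs)" using k by (simp_all add: fibre_def)
  then show "k = k'" using iffD1[OF nth_eq_iff_index_eq[OF conjunct1[OF next_arrows]] eq] by simp
qed

lemma fibre_image:
  assumes "i < length bs"
  shows "(\<lambda>k. snd (next_arrows R bs ! k)) ` fibre (next_arrows R bs) i = {g \<in> arcs Q. R (bs ! i) g}"
proof (rule equalityI; rule subsetI)
  fix g assume "g \<in> (\<lambda>k. snd (next_arrows R bs ! k)) ` fibre (next_arrows R bs) i"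
  then show "g \<in> {g \<in> arcs Q. R (bs ! i) g}" using fibre_next(3,4)[of _ R bs i] by blast
next
  fix g assume "g \<in> {g \<in> arcs Q. R (bs ! i) g}"
  then have "(i, g) \<in> set (next_arrows R bs)" using assms next_arrows[of R bs] by blast
  then obtain k where "k < length (next_arrows R bs)" "next_arrows R bs ! k = (i, g)" by (auto simp: in_set_conv_nth)
  then show "g \<in> (\<lambda>k. snd (next_arrows R bs ! k)) ` fibre (next_arrows R bs) i"
    by (intro image_eqI[where x = k]) (simp_all add: fibre_def)
qed

lemma next_arrows_arcs: "set (map snd (next_arrows R bs)) \<subseteq> arcs Q"
  using next_arrows[of R bs] by force

text \<open>The arrows that occur at stage \<open>n\<close> end chains of \<open>n + 1\<close> arrows in which neighbours are
  related.\<close>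

primrec stage :: "('e \<Rightarrow> 'e \<Rightarrow> bool) \<Rightarrow> 'e list \<Rightarrow> nat \<Rightarrow> 'e list" where
  "stage R bs 0 = bs"
| "stage R bs (Suc n) = map snd (next_arrows R (stage R bs n))"

lemma stage_arcs: "set bs \<subseteq> arcs Q \<Longrightarrow> set (stage R bs n) \<subseteq> arcs Q"
  by (cases n) (simp_all add: next_arrows_arcs del: set_map)

lemma stage_chain:
  assumes "set bs \<subseteq> arcs Q" "b \<in> set (stage R bs n)"
  shows "\<exists>l. length l = Suc n \<and> set l \<subseteq> arcs Q \<and> last l = b \<and> successively R l"
  using assms(2)
proof (induction n arbitrary: b)
  case 0
  then show ?case using assms(1) by (intro exI[where x = "[b]"]) auto
next
  case (Suc n)
  then obtain i where i: "(i, b) \<in> set (next_arrows R (stage R bs n))" by auto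
  then have z: "i < length (stage R bs n)" "b \<in> arcs Q" "R (stage R bs n ! i) b" using next_arrows by blast+
  then obtain l where l: "length l = Suc n" "set l \<subseteq> arcs Q" "last l = stage R bs n ! i" "successively R l"
    using Suc.IH[of "stage R bs n ! i"] nth_mem[OF z(1)] by blast
  have "successively R (l @ [b])" using l z(3) by (auto simp: successively_append_iff)
  then show ?case using l z(2) by (intro exI[where x = "l @ [b]"]) auto
qed

lemma stage_empty:
  assumes bs: "set bs \<subseteq> arcs Q" and bound: "\<And>l. set l \<subseteq> arcs Q \<Longrightarrow> successively R l \<Longrightarrow> length l < N"
    and n: "n \<ge> N"
  shows "stage R bs n = []"
proof (rule ccontr)
  assume "stage R bs n \<noteq> []"
  then have "hd (stage R bs n) \<in> set (stage R bs n)" by simp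
  then obtain l where "length l = Suc n" "set l \<subseteq> arcs Q" "successively R l"
    using stage_chain[OF bs] by blast
  then show False using bound[of l] n by simp
qed

lemma zr_arcs_iff: "{g \<in> arcs Q. zr b g} = {g. zr b g}" "{g \<in> arcs Q. zr g b} = {g. zr g b}"
  using zr_arcs by blast+

definition PB :: "int \<Rightarrow> 'e list \<Rightarrow>
    ((('v, 'e) qpath \<Rightarrow> 'k) set, nat \<Rightarrow> (('v, 'e) qpath \<Rightarrow> 'k) set) graded_module" where
  "PB s bs = Prs (map (\<lambda>b. (head Q b, s)) bs)"

lemma PB_carrier: "carrier (PB s bs) = (\<Pi>\<^sub>E i\<in>{..<length bs}. carrier (Pr (head Q (bs ! i))))"
  by (auto simp: PB_def projective_sum_def intro!: PiE_cong)

lemma PB_hcomp: "hcomp (PB s bs) n = (\<Pi>\<^sub>E i\<in>{..<length bs}. carrier (Pr (head Q (bs ! i))) \<inter> dg (n - s))"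
  by (auto simp: PB_def projective_sum_def intro!: PiE_cong)

lemma PB_ops:
  "f \<oplus>\<^bsub>PB s bs\<^esub> g = (\<lambda>i\<in>{..<length bs}. f i \<oplus>\<^bsub>A\<^esub> g i)"
  "a \<odot>\<^bsub>PB s bs\<^esub> f = (\<lambda>i\<in>{..<length bs}. a \<star> f i)"
  "\<zero>\<^bsub>PB s bs\<^esub> = (\<lambda>i\<in>{..<length bs}. \<zero>\<^bsub>A\<^esub>)"
  by (simp_all add: PB_def projective_sum_def cong: restrict_cong)

text \<open>The direct sum of the left annihilators of the arrows \<open>b\<^sub>i\<close> in \<open>bs\<close>, that is, the module of relations
  of the sum of the \<open>A b\<^sub>i\<close>.\<close>

definition killed :: "'e list \<Rightarrow> (nat \<Rightarrow> (('v, 'e) qpath \<Rightarrow> 'k) set) set" where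
  "killed bs = {f \<in> (\<Pi>\<^sub>E i\<in>{..<length bs}. carrier (Pr (head Q (bs ! i)))).
     \<forall>i<length bs. f i \<star> ar (bs ! i) = \<zero>\<^bsub>A\<^esub>}"

definition step :: "'e list \<Rightarrow> (nat \<Rightarrow> (('v, 'e) qpath \<Rightarrow> 'k) set) \<Rightarrow> nat \<Rightarrow> (('v, 'e) qpath \<Rightarrow> 'k) set" where
  "step bs f = (\<lambda>i\<in>{..<length bs}. \<Oplus>\<^bsub>A\<^esub>k\<in>fibre (next_arrows zr bs) i. f k \<star> ar (snd (next_arrows zr bs ! k)))"

lemma PB_summand:
  assumes "f \<in> carrier (PB s (map snd (next_arrows zr bs)))" "k \<in> fibre (next_arrows zr bs) i"
  shows "f k \<in> carrier A" "f k \<star> ar (snd (next_arrows zr bs ! k)) \<in> carrier A"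
    "f k \<star> e (head Q (snd (next_arrows zr bs ! k))) = f k"
    "f k \<star> ar (snd (next_arrows zr bs ! k)) \<star> e (head Q (bs ! i)) = f k \<star> ar (snd (next_arrows zr bs ! k))"
proof -
  note k = fibre_next[OF assms(2)]
  let ?g = "snd (next_arrows zr bs ! k)"
  have g: "?g \<in> arcs Q" "head Q (bs ! i) = tail Q ?g" using k(3) by (auto simp: zr_def)
  have "f k \<in> carrier (Pr (head Q ?g))" using assms(1) k(1) by (auto simp: PB_carrier PiE_iff)
  then show f: "f k \<in> carrier A" and "f k \<star> e (head Q ?g) = f k" using g by (simp_all add: Pr_iff)
  show "f k \<star> ar ?g \<in> carrier A" using f g by simp
  show "f k \<star> ar ?g \<star> e (head Q (bs ! i)) = f k \<star> ar ?g"
    using f g by (simp add: A.m_assoc ar_e_tail)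
qed

lemma right_mult_hom: "a \<in> carrier A \<Longrightarrow> (\<lambda>x. x \<star> a) \<in> hom (add_monoid A) (add_monoid A)"
  by (simp add: hom_def Pi_iff A.l_distr)

lemma left_mult_hom: "a \<in> carrier A \<Longrightarrow> (\<lambda>x. a \<star> x) \<in> hom (add_monoid A) (add_monoid A)"
  by (simp add: hom_def Pi_iff A.r_distr)

lemmas finsum_mult_right = additive_finsum[OF A.is_abelian_group A.is_abelian_group right_mult_hom]
lemmas finsum_mult_left = additive_finsum[OF A.is_abelian_group A.is_abelian_group left_mult_hom]

lemma step_closed:
  assumes bs: "set bs \<subseteq> arcs Q" and f: "f \<in> carrier (PB s' (map snd (next_arrows zr bs)))"
  shows "step bs f \<in> carrier (PB s bs)"
  unfolding PB_carrier step_def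
proof (rule restrict_PiE_iff[THEN iffD2], rule ballI)
  fix i assume "i \<in> {..<length bs}"
  then have h: "head Q (bs ! i) \<in> verts Q" using bs by (auto simp: subset_iff)
  note S = PB_summand[OF f, of _ i]
  have "(\<Oplus>\<^bsub>A\<^esub>k\<in>fibre (next_arrows zr bs) i. f k \<star> ar (snd (next_arrows zr bs ! k))) \<star> e (head Q (bs ! i)) =
      (\<Oplus>\<^bsub>A\<^esub>k\<in>fibre (next_arrows zr bs) i. f k \<star> ar (snd (next_arrows zr bs ! k)) \<star> e (head Q (bs ! i)))"
    by (rule finsum_mult_right) (use h S in simp_all)
  also have "\<dots> = (\<Oplus>\<^bsub>A\<^esub>k\<in>fibre (next_arrows zr bs) i. f k \<star> ar (snd (next_arrows zr bs ! k)))"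
    by (rule A.finsum_cong'[OF refl]) (use S in simp_all)
  finally show "(\<Oplus>\<^bsub>A\<^esub>k\<in>fibre (next_arrows zr bs) i. f k \<star> ar (snd (next_arrows zr bs ! k))) \<in> carrier (Pr (head Q (bs ! i)))"
    using h S by (simp add: Pr_iff A.finsum_closed)
qed

lemma step_hom:
  assumes bs: "set bs \<subseteq> arcs Q"
  shows "step bs \<in> graded_hom Q I (PB (s + 1) (map snd (next_arrows zr bs))) (PB s bs)"
proof (rule graded_homI)
  let ?ps = "next_arrows zr bs"
  show "step bs f \<in> carrier (PB s bs)" if "f \<in> carrier (PB (s + 1) (map snd ?ps))" for f
    by (rule step_closed[OF bs that])
  fix f assume f: "f \<in> carrier (PB (s + 1) (map snd ?ps))"
  note S = PB_summand[OF f]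
  {
    fix g assume g: "g \<in> carrier (PB (s + 1) (map snd ?ps))"
    note S' = PB_summand[OF g]
    have "(\<Oplus>\<^bsub>A\<^esub>k\<in>fibre ?ps i. (f \<oplus>\<^bsub>PB (s + 1) (map snd ?ps)\<^esub> g) k \<star> ar (snd (?ps ! k))) =
       (\<Oplus>\<^bsub>A\<^esub>k\<in>fibre ?ps i. f k \<star> ar (snd (?ps ! k))) \<oplus>\<^bsub>A\<^esub> (\<Oplus>\<^bsub>A\<^esub>k\<in>fibre ?ps i. g k \<star> ar (snd (?ps ! k)))" for i
    proof -
      have "(\<Oplus>\<^bsub>A\<^esub>k\<in>fibre ?ps i. (f \<oplus>\<^bsub>PB (s + 1) (map snd ?ps)\<^esub> g) k \<star> ar (snd (?ps ! k))) =
        (\<Oplus>\<^bsub>A\<^esub>k\<in>fibre ?ps i. f k \<star> ar (snd (?ps ! k)) \<oplus>\<^bsub>A\<^esub> g k \<star> ar (snd (?ps ! k)))"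
      proof (rule A.finsum_cong'[OF refl])
        fix k assume k: "k \<in> fibre ?ps i"
        note kn = fibre_next[OF k]
        show "(f \<oplus>\<^bsub>PB (s + 1) (map snd ?ps)\<^esub> g) k \<star> ar (snd (?ps ! k)) =
            f k \<star> ar (snd (?ps ! k)) \<oplus>\<^bsub>A\<^esub> g k \<star> ar (snd (?ps ! k))"
          using S(1)[OF k] S'(1)[OF k] kn(1) zr_arcs(1)[OF kn(3)] by (simp add: PB_ops A.l_distr)
      qed (use S S' in simp)
      also have "\<dots> = (\<Oplus>\<^bsub>A\<^esub>k\<in>fibre ?ps i. f k \<star> ar (snd (?ps ! k))) \<oplus>\<^bsub>A\<^esub> (\<Oplus>\<^bsub>A\<^esub>k\<in>fibre ?ps i. g k \<star> ar (snd (?ps ! k)))"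
        by (rule A.finsum_addf) (use S S' in simp_all)
      finally show ?thesis .
    qed
    then show "step bs (f \<oplus>\<^bsub>PB (s + 1) (map snd ?ps)\<^esub> g) = step bs f \<oplus>\<^bsub>PB s bs\<^esub> step bs g"
      unfolding step_def by (simp add: PB_ops(1)[where s = s and bs = bs] cong: restrict_cong)
  }
  fix a assume a: "a \<in> carrier A"
  have "(\<Oplus>\<^bsub>A\<^esub>k\<in>fibre ?ps i. (a \<odot>\<^bsub>PB (s + 1) (map snd ?ps)\<^esub> f) k \<star> ar (snd (?ps ! k))) =
     a \<star> (\<Oplus>\<^bsub>A\<^esub>k\<in>fibre ?ps i. f k \<star> ar (snd (?ps ! k)))" for i
  proof -
    have "a \<star> (\<Oplus>\<^bsub>A\<^esub>k\<in>fibre ?ps i. f k \<star> ar (snd (?ps ! k))) =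
       (\<Oplus>\<^bsub>A\<^esub>k\<in>fibre ?ps i. a \<star> (f k \<star> ar (snd (?ps ! k))))"
      by (rule finsum_mult_left[OF a]) (use S in simp)
    also have "\<dots> = (\<Oplus>\<^bsub>A\<^esub>k\<in>fibre ?ps i. (a \<odot>\<^bsub>PB (s + 1) (map snd ?ps)\<^esub> f) k \<star> ar (snd (?ps ! k)))"
    proof (rule A.finsum_cong'[OF refl])
      fix k assume k: "k \<in> fibre ?ps i"
      note kn = fibre_next[OF k]
      show "a \<star> (f k \<star> ar (snd (?ps ! k))) =
          (a \<odot>\<^bsub>PB (s + 1) (map snd ?ps)\<^esub> f) k \<star> ar (snd (?ps ! k))"
        using a S(1)[OF k] kn(1) zr_arcs(1)[OF kn(3)] by (simp add: PB_ops A.m_assoc)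
    next
      show "(\<lambda>k. (a \<odot>\<^bsub>PB (s + 1) (map snd ?ps)\<^esub> f) k \<star> ar (snd (?ps ! k))) \<in> fibre ?ps i \<rightarrow> carrier A"
      proof
        fix k assume k: "k \<in> fibre ?ps i"
        note kn = fibre_next[OF k]
        show "(a \<odot>\<^bsub>PB (s + 1) (map snd ?ps)\<^esub> f) k \<star> ar (snd (?ps ! k)) \<in> carrier A"
          using a S(1)[OF k] kn(1) zr_arcs(1)[OF kn(3)] by (simp add: PB_ops)
      qed
    qed
    finally show ?thesis by simp
  qed
  then show "step bs (a \<odot>\<^bsub>PB (s + 1) (map snd ?ps)\<^esub> f) = a \<odot>\<^bsub>PB s bs\<^esub> step bs f"
    unfolding step_def by (simp add: PB_ops(2)[where s = s and bs = bs] cong: restrict_cong)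
next
  let ?ps = "next_arrows zr bs"
  fix f n assume f: "f \<in> hcomp (PB (s + 1) (map snd ?ps)) n"
  then have fc: "f \<in> carrier (PB (s + 1) (map snd ?ps))" by (auto simp: PB_hcomp PB_carrier PiE_iff)
  have deg: "f k \<star> ar (snd (?ps ! k)) \<in> dg (n - s)" if k: "k \<in> fibre ?ps i" for k i
  proof -
    have "f k \<in> dg (n - (s + 1))" using f fibre_next(1)[OF k] by (auto simp: PB_hcomp PiE_iff)
    from dg_mult[OF this ar_deg[OF zr_arcs(1)[OF fibre_next(3)[OF k]]]] show ?thesis by simp
  qed
  have "step bs f i \<in> dg (n - s)" if "i < length bs" for i
    using that dg_finsum[OF finite_fibre deg] by (simp add: step_def)
  then show "step bs f \<in> hcomp (PB s bs) n"
    using step_closed[OF bs fc, of s] by (simp add: PB_hcomp PB_carrier PiE_iff)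
qed

lemma step_kernel:
  assumes bs: "set bs \<subseteq> arcs Q"
  shows "a_kernel (PB s' (map snd (next_arrows zr bs))) (PB s bs) (step bs) = killed (map snd (next_arrows zr bs))"
proof (rule equalityI; rule subsetI)
  let ?ps = "next_arrows zr bs"
  fix f assume "f \<in> a_kernel (PB s' (map snd ?ps)) (PB s bs) (step bs)"
  then have f: "f \<in> carrier (PB s' (map snd ?ps))" "step bs f = \<zero>\<^bsub>PB s bs\<^esub>" by (simp_all add: a_kernel_iff)
  note S = PB_summand[OF f(1)]
  have "f k \<star> ar (snd (?ps ! k)) = \<zero>\<^bsub>A\<^esub>" if k: "k < length ?ps" for k
  proof -
    let ?i = "fst (?ps ! k)" and ?g = "snd (?ps ! k)"
    have k': "k \<in> fibre ?ps ?i" using k by (simp add: fibre_def)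
    note kn = fibre_next[OF k']
    have g: "?g \<in> arcs Q" using kn(3) by (rule zr_arcs)
    note inj = fibre_inj[of zr bs ?i]
    have "\<zero>\<^bsub>A\<^esub> = rs ?g (step bs f ?i)" using f(2) kn(2) by (simp add: PB_ops rs_zero)
    also have "\<dots> = rs ?g (\<Oplus>\<^bsub>A\<^esub>l\<in>fibre ?ps ?i. f l \<star> ar (snd (?ps ! l)))" using kn(2) by (simp add: step_def)
    also have "\<dots> = (\<Oplus>\<^bsub>A\<^esub>l\<in>fibre ?ps ?i. rs ?g (f l \<star> ar (snd (?ps ! l))))"
      by (rule additive_finsum[OF A.is_abelian_group A.is_abelian_group rs_hom]) (use S in blast)
    also have "\<dots> = rs ?g (f k \<star> ar ?g)"
    proof (rule A.finsum_only[OF finite_fibre k'])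
      show "rs ?g (f k \<star> ar ?g) \<in> carrier A" using S(2)[OF k'] by (rule rs_closed)
      fix l assume l: "l \<in> fibre ?ps ?i" "l \<noteq> k"
      have "snd (?ps ! l) \<noteq> ?g" using inj_onD[OF inj _ l(1) k'] l(2) by blast
      then show "rs ?g (f l \<star> ar (snd (?ps ! l))) = \<zero>\<^bsub>A\<^esub>"
        by (intro rs_ar_other S(1)[OF l(1)] zr_arcs(1)[OF fibre_next(3)[OF l(1)]])
    qed
    finally have "rs ?g (f k \<star> ar ?g) = \<zero>\<^bsub>A\<^esub>" by simp
    then show ?thesis using rs_ar_ar[OF S(1)[OF k'] g] A.l_null[OF ar_closed[OF g]] by simp
  qed
  then show "f \<in> killed (map snd ?ps)" using f(1) by (simp add: killed_def PB_carrier)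
next
  let ?ps = "next_arrows zr bs"
  fix f assume f: "f \<in> killed (map snd ?ps)"
  then have fc: "f \<in> carrier (PB s' (map snd ?ps))" by (simp add: killed_def PB_carrier)
  have "(\<Oplus>\<^bsub>A\<^esub>k\<in>fibre ?ps i. f k \<star> ar (snd (?ps ! k))) = \<zero>\<^bsub>A\<^esub>" for i
  proof -
    have "(\<Oplus>\<^bsub>A\<^esub>k\<in>fibre ?ps i. f k \<star> ar (snd (?ps ! k))) = (\<Oplus>\<^bsub>A\<^esub>k\<in>fibre ?ps i. \<zero>\<^bsub>A\<^esub>)"
      by (rule A.finsum_cong'[OF refl]) (use f in \<open>simp_all add: killed_def fibre_def\<close>)
    then show ?thesis by simp
  qed
  then have "step bs f = \<zero>\<^bsub>PB s bs\<^esub>" by (simp add: step_def PB_ops)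
  with fc show "f \<in> a_kernel (PB s' (map snd ?ps)) (PB s bs) (step bs)" by (simp add: a_kernel_iff)
qed

lemma step_image:
  assumes bs: "set bs \<subseteq> arcs Q"
  shows "step bs ` carrier (PB s' (map snd (next_arrows zr bs))) = killed bs"
proof (rule equalityI; rule subsetI)
  let ?ps = "next_arrows zr bs"
  fix h assume "h \<in> step bs ` carrier (PB s' (map snd ?ps))"
  then obtain f where f: "f \<in> carrier (PB s' (map snd ?ps))" "h = step bs f" by blast
  note S = PB_summand[OF f(1)]
  have "h i \<star> ar (bs ! i) = \<zero>\<^bsub>A\<^esub>" if i: "i < length bs" for i
  proof -
    have b: "bs ! i \<in> arcs Q" using bs i by auto
    have "h i \<star> ar (bs ! i) = (\<Oplus>\<^bsub>A\<^esub>k\<in>fibre ?ps i. f k \<star> ar (snd (?ps ! k))) \<star> ar (bs ! i)"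
      using i by (simp add: f(2) step_def)
    also have "\<dots> = (\<Oplus>\<^bsub>A\<^esub>k\<in>fibre ?ps i. f k \<star> ar (snd (?ps ! k)) \<star> ar (bs ! i))"
      by (rule finsum_mult_right) (use b S in simp_all)
    also have "\<dots> = (\<Oplus>\<^bsub>A\<^esub>k\<in>fibre ?ps i. \<zero>\<^bsub>A\<^esub>)"
    proof (rule A.finsum_cong'[OF refl])
      fix k assume k: "k \<in> fibre ?ps i"
      note z = fibre_next(3)[OF k]
      show "f k \<star> ar (snd (?ps ! k)) \<star> ar (bs ! i) = \<zero>\<^bsub>A\<^esub>"
        using S(1)[OF k] zr_arcs[OF z] zr_zero[OF z] by (simp add: A.m_assoc)
    qed simp
    finally show ?thesis by simp
  qed
  then show "h \<in> killed bs" using step_closed[OF bs f(1)] by (simp add: killed_def PB_carrier f(2))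
next
  let ?ps = "next_arrows zr bs"
  fix h assume h: "h \<in> killed bs"
  let ?f = "\<lambda>k\<in>{..<length ?ps}. rs (snd (?ps ! k)) (h (fst (?ps ! k)))"
  have hc: "h i \<in> carrier A" "h i \<star> e (head Q (bs ! i)) = h i" "h i \<star> ar (bs ! i) = \<zero>\<^bsub>A\<^esub>"
    "bs ! i \<in> arcs Q" if i: "i < length bs" for i
  proof -
    show b: "bs ! i \<in> arcs Q" using bs i by auto
    have "h i \<in> carrier (Pr (head Q (bs ! i)))" using h i by (auto simp: killed_def PiE_iff)
    then show "h i \<in> carrier A" "h i \<star> e (head Q (bs ! i)) = h i" using b by (simp_all add: Pr_iff)
    show "h i \<star> ar (bs ! i) = \<zero>\<^bsub>A\<^esub>" using h i by (simp add: killed_def)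
  qed
  have kf: "k \<in> fibre ?ps (fst (?ps ! k))" if "k < length ?ps" for k using that by (simp add: fibre_def)
  have fc: "?f \<in> carrier (PB s' (map snd ?ps))"
    unfolding PB_carrier length_map
  proof (rule restrict_PiE_iff[THEN iffD2], rule ballI)
    fix k assume "k \<in> {..<length ?ps}"
    then have k: "k < length ?ps" by simp
    note kn = fibre_next[OF kf[OF k]]
    have g: "snd (?ps ! k) \<in> arcs Q" using zr_arcs(1)[OF kn(3)] .
    show "rs (snd (?ps ! k)) (h (fst (?ps ! k))) \<in> carrier (Pr (head Q (map snd ?ps ! k)))"
      using k g hc(1)[OF kn(2)] by (simp add: Pr_iff rs_closed rs_e)
  qed
  have "step bs ?f = h"
  proof (rule PiE_ext[of _ "{..<length bs}" "\<lambda>i. carrier (Pr (head Q (bs ! i)))"])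
    show "step bs ?f \<in> (\<Pi>\<^sub>E i\<in>{..<length bs}. carrier (Pr (head Q (bs ! i))))"
      using step_closed[OF bs fc] by (simp add: PB_carrier)
    show "h \<in> (\<Pi>\<^sub>E i\<in>{..<length bs}. carrier (Pr (head Q (bs ! i))))" using h by (simp add: killed_def)
    fix i assume "i \<in> {..<length bs}"
    then have i: "i < length bs" by simp
    note H = hc[OF i]
    have "h i = (\<Oplus>\<^bsub>A\<^esub>g\<in>{g. zr (bs ! i) g}. rs g (h i) \<star> ar g)"
      by (rule ann_right[OF H(1,4,2,3)])
    also have "\<dots> = (\<Oplus>\<^bsub>A\<^esub>g\<in>(\<lambda>k. snd (?ps ! k)) ` fibre ?ps i. rs g (h i) \<star> ar g)"
      unfolding fibre_image[OF i] zr_arcs_iff ..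
    also have "\<dots> = (\<Oplus>\<^bsub>A\<^esub>k\<in>fibre ?ps i. rs (snd (?ps ! k)) (h i) \<star> ar (snd (?ps ! k)))"
    proof (rule A.finsum_reindex)
      show "inj_on (\<lambda>k. snd (?ps ! k)) (fibre ?ps i)" by (rule fibre_inj)
      show "(\<lambda>g. rs g (h i) \<star> ar g) \<in> (\<lambda>k. snd (?ps ! k)) ` fibre ?ps i \<rightarrow> carrier A"
      proof
        fix g assume "g \<in> (\<lambda>k. snd (?ps ! k)) ` fibre ?ps i"
        then have "zr (bs ! i) g" using fibre_next(3) by blast
        then show "rs g (h i) \<star> ar g \<in> carrier A" using H(1) zr_arcs(1) by (simp add: rs_closed)
      qed
    qed
    also have "\<dots> = (\<Oplus>\<^bsub>A\<^esub>k\<in>fibre ?ps i. ?f k \<star> ar (snd (?ps ! k)))"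
    proof (rule A.finsum_cong'[OF refl])
      fix k assume k: "k \<in> fibre ?ps i"
      note kn = fibre_next[OF k]
      have "fst (?ps ! k) = i" using k by (simp add: fibre_def)
      then show "rs (snd (?ps ! k)) (h i) \<star> ar (snd (?ps ! k)) = ?f k \<star> ar (snd (?ps ! k))"
        using kn(1) by simp
    qed (use PB_summand(2)[OF fc] in blast)
    finally show "step bs ?f i = h i" using i by (simp add: step_def)
  qed
  then show "h \<in> step bs ` carrier (PB s' (map snd ?ps))" using imageI[OF fc, of "step bs"] by simp
qed

text \<open>Iterating \<open>step\<close> resolves any module whose relations are \<open>killed bs\<close>; the terms vanish when the
  chains of relations end.\<close>

lemma koszulI:
  assumes bs: "set bs \<subseteq> arcs Q" and \<pi>: "\<pi> \<in> graded_hom Q I (PB 0 bs) M"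
    and surj: "\<pi> ` carrier (PB 0 bs) = carrier M" and ker: "a_kernel (PB 0 bs) M \<pi> = killed bs"
    and bound: "\<And>l. set l \<subseteq> arcs Q \<Longrightarrow> successively zr l \<Longrightarrow> length l < N"
  shows "koszul Q I M"
proof -
  let ?xs = "\<lambda>n. map (head Q) (stage zr bs n)"
  have P: "projective_sum Q I (map (\<lambda>x. (x, int n)) (?xs n)) = PB (int n) (stage zr bs n)" for n
    by (simp add: comp_def PB_def)
  have arcs: "set (stage zr bs n) \<subseteq> arcs Q" for n by (rule stage_arcs[OF bs])
  have empty: "stage zr bs n = []" if "n \<ge> N" for n
    by (rule stage_empty[OF bs bound that])
  show ?thesis
    unfolding koszul_def Let_def
  proof (intro exI[where x = ?xs] exI[where x = "\<lambda>n. step (stage zr bs n)"] exI[where x = \<pi>] conjI, unfold P)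
    show "\<forall>n. set (?xs n) \<subseteq> verts Q" using arcs by (auto simp: subset_iff)
    show "\<exists>N. \<forall>n\<ge>N. ?xs n = []" using empty by (intro exI[where x = N]) simp
    show "\<pi> \<in> graded_hom Q I (PB (int 0) (stage zr bs 0)) M" using \<pi> by simp
    show "\<forall>n. step (stage zr bs n) \<in> graded_hom Q I (PB (int (Suc n)) (stage zr bs (Suc n))) (PB (int n) (stage zr bs n))"
    proof
      fix n show "step (stage zr bs n) \<in> graded_hom Q I (PB (int (Suc n)) (stage zr bs (Suc n))) (PB (int n) (stage zr bs n))"
        using step_hom[OF arcs[of n], where s = "int n"] by (simp add: add.commute)
    qed
    show "\<pi> ` carrier (PB (int 0) (stage zr bs 0)) = carrier M" using surj by simp
    show "step (stage zr bs 0) ` carrier (PB (int 1) (stage zr bs 1)) = a_kernel (PB (int 0) (stage zr bs 0)) M \<pi>"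
      using step_image[OF bs, of "int 1"] ker by simp
    show "\<forall>n. step (stage zr bs (Suc n)) ` carrier (PB (int (Suc (Suc n))) (stage zr bs (Suc (Suc n)))) =
        a_kernel (PB (int (Suc n)) (stage zr bs (Suc n))) (PB (int n) (stage zr bs n)) (step (stage zr bs n))"
    proof
      fix n
      show "step (stage zr bs (Suc n)) ` carrier (PB (int (Suc (Suc n))) (stage zr bs (Suc (Suc n)))) =
          a_kernel (PB (int (Suc n)) (stage zr bs (Suc n))) (PB (int n) (stage zr bs n)) (step (stage zr bs n))"
        using step_image[OF arcs[of "Suc n"], of "int (Suc (Suc n))"]
          step_kernel[OF arcs[of n], of "int (Suc n)" "int n"] by simp
    qed
  qed
qed

end

section \<open>Truncations of finitely presented modules are linear\<close>

lemma (in abelian_group) finsum_group: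
  assumes "finite J" "finite E" "\<And>j. j \<in> J \<Longrightarrow> h j \<in> E" "\<And>j. j \<in> J \<Longrightarrow> f j \<in> carrier G"
  shows "finsum G f J = (\<Oplus>a\<in>E. finsum G f {j \<in> J. h j = a})"
proof -
  have "J = (\<Union>a\<in>E. {j \<in> J. h j = a})" using assms(3) by auto
  then have "finsum G f J = finsum G f (\<Union>a\<in>E. {j \<in> J. h j = a})" by (rule arg_cong)
  also have "\<dots> = (\<Oplus>a\<in>E. finsum G f {j \<in> J. h j = a})"
    by (rule add.finprod_UN_disjoint) (use assms in \<open>auto simp: pairwise_def disjnt_def\<close>)
  finally show ?thesis .
qed

lemma (in abelian_group) finsum_swap:
  assumes "finite J" "\<And>j a. j \<in> J \<Longrightarrow> a \<in> E \<Longrightarrow> f j a \<in> carrier G"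
  shows "(\<Oplus>j\<in>J. \<Oplus>a\<in>E. f j a) = (\<Oplus>a\<in>E. \<Oplus>j\<in>J. f j a)"
  using assms
proof (induction J)
  case (insert j J)
  have c: "(\<lambda>j. \<Oplus>a\<in>E. f j a) \<in> J \<rightarrow> carrier G" "(\<Oplus>a\<in>E. f j a) \<in> carrier G"
    using insert.prems by (auto intro!: finsum_closed)
  have "(\<Oplus>j\<in>insert j J. \<Oplus>a\<in>E. f j a) = (\<Oplus>a\<in>E. f j a) \<oplus> (\<Oplus>a\<in>E. \<Oplus>j\<in>J. f j a)"
    using finsum_insert[OF insert.hyps c] insert.IH insert.prems by simp
  also have "\<dots> = (\<Oplus>a\<in>E. f j a \<oplus> (\<Oplus>j\<in>J. f j a))"
    by (rule finsum_addf[symmetric]) (use insert.prems in \<open>auto intro!: finsum_closed\<close>)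
  also have "\<dots> = (\<Oplus>a\<in>E. \<Oplus>j\<in>insert j J. f j a)"
    by (rule finsum_cong'[OF refl])
      (use insert in \<open>auto intro!: finsum_closed finsum_insert[symmetric]\<close>)
  finally show ?case .
qed simp

context graded_mod
begin

lemma arrows_independent_subset:
  assumes D: "arrows_independent M n" and T: "T \<subseteq> arcs Q"
    and y: "\<And>a. a \<in> arcs Q \<Longrightarrow> y a \<in> hcomp M n" and w: "\<And>b. b \<in> T \<Longrightarrow> w b \<in> hcomp M n"
    and eq: "(\<Oplus>a\<in>arcs Q. ar a \<odot> y a) = (\<Oplus>b\<in>T. ar b \<odot> w b)"
    and a: "a \<in> arcs Q" "a \<notin> T"
  shows "ar a \<odot> y a = \<zero>"
proof -
  let ?w = "\<lambda>a. if a \<in> T then w a else \<zero>"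
  let ?z = "\<lambda>a. y a \<oplus> \<ominus> ?w a"
  have w': "?w a \<in> hcomp M n" for a using w hc_zero by simp
  have z: "?z a \<in> hcomp M n" if "a \<in> arcs Q" for a using y[OF that] w'[of a] hc_add hc_minus by blast
  have wc: "?w a \<in> carrier M" for a using w' by (rule hc_closed)
  have yc: "y a \<in> carrier M" if "a \<in> arcs Q" for a using y[OF that] by (rule hc_closed)
  have c: "ar a \<odot> y a \<in> carrier M" "ar a \<odot> ?w a \<in> carrier M" if "a \<in> arcs Q" for a
    using that yc wc by (simp_all add: M.smult_closed del: if_split)
  have "(\<Oplus>b\<in>T. ar b \<odot> w b) = (\<Oplus>b\<in>T. ar b \<odot> ?w b)"
    by (rule M.M.finsum_cong'[OF refl]) (use c(2) T in \<open>auto simp del: if_split\<close>)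
  also have "\<dots> = (\<Oplus>a\<in>arcs Q. ar a \<odot> ?w a)"
  proof (rule M.M.finsum_superset[OF finite_arcs T])
    show "ar a \<odot> ?w a \<in> carrier M" if "a \<in> T" for a using c(2) that T by blast
    show "ar a \<odot> ?w a = \<zero>" if "a \<in> arcs Q - T" for a
      using that by (simp add: M.smult_r_null)
  qed
  finally have eq': "(\<Oplus>a\<in>arcs Q. ar a \<odot> y a) = (\<Oplus>a\<in>arcs Q. ar a \<odot> ?w a)" using eq by simp
  have "(\<Oplus>a\<in>arcs Q. ar a \<odot> ?z a) =
      (\<Oplus>a\<in>arcs Q. ar a \<odot> y a \<oplus> \<ominus> (ar a \<odot> ?w a))"
    by (rule M.M.finsum_cong'[OF refl])
      (use yc wc c in \<open>simp_all add: M.smult_r_distr M.smult_r_minus del: if_split\<close>)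
  also have "\<dots> = (\<Oplus>a\<in>arcs Q. ar a \<odot> y a) \<oplus> (\<Oplus>a\<in>arcs Q. \<ominus> (ar a \<odot> ?w a))"
    by (rule M.M.finsum_addf) (use c in \<open>simp_all del: if_split\<close>)
  also have "(\<Oplus>a\<in>arcs Q. \<ominus> (ar a \<odot> ?w a)) = \<ominus> (\<Oplus>a\<in>arcs Q. ar a \<odot> ?w a)"
    by (rule additive_finsum[OF abelian abelian, symmetric])
      (use c in \<open>auto simp: hom_def M.M.minus_add\<close>)
  also have "(\<Oplus>a\<in>arcs Q. ar a \<odot> y a) \<oplus> \<dots> = \<zero>"
    unfolding eq' by (rule M.M.r_neg) (use c in \<open>simp add: M.M.finsum_closed del: if_split\<close>)
  finally have "ar a \<odot> ?z a = \<zero>"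
    using D z a(1) unfolding arrows_independent_def by (elim allE[where x = ?z]) blast
  moreover have "?z a = y a"
    using a(2) M.M.minus_equality[of "\<zero>" "\<zero>"] yc[OF a(1)] by simp
  ultimately show ?thesis by simp
qed

end

text \<open>Generators of the component \<open>d\<close> that lie in the images of the arrows and restrict to a basis of
  each of these images.\<close>

locale arrow_basis = graded_mod Q S I M cmp for Q :: "('v, 'e) pre_digraph" and S
    and I :: "(('v, 'e) qpath \<Rightarrow> 'k::field) set"
    and M :: "((('v, 'e) qpath \<Rightarrow> 'k) set, 'm) graded_module" (structure) and cmp +
  fixes d :: int and B :: "'e \<Rightarrow> 'm set" and gs :: "('e \<times> 'm) list"
  assumes B_finite: "a \<in> arcs Q \<Longrightarrow> finite (B a)"
    and B_sub: "a \<in> arcs Q \<Longrightarrow> B a \<subseteq> (\<lambda>u. ar a \<odot> u) ` hcomp M (d - 1)"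
    and B_span: "a \<in> arcs Q \<Longrightarrow> (\<lambda>u. ar a \<odot> u) ` hcomp M (d - 1) \<subseteq> spn (B a)"
    and B_indep: "a \<in> arcs Q \<Longrightarrow> lin (B a) c = \<zero> \<Longrightarrow> b \<in> B a \<Longrightarrow> c b = 0"
    and gs: "distinct gs" "set gs = Sigma (arcs Q) B"
begin

abbreviation r :: nat where "r \<equiv> length gs"
abbreviation bt :: "nat \<Rightarrow> 'e" where "bt j \<equiv> fst (gs ! j)"
abbreviation v :: "nat \<Rightarrow> 'm" where "v j \<equiv> snd (gs ! j)"

lemma gs_nth:
  assumes "j < r"
  shows "bt j \<in> arcs Q" "v j \<in> B (bt j)" "v j \<in> hcomp M d" "v j \<in> carrier M" "e (head Q (bt j)) \<odot> v j = v j"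
    and "\<exists>u \<in> hcomp M (d - 1). v j = ar (bt j) \<odot> u"
proof -
  have "gs ! j \<in> Sigma (arcs Q) B" using assms gs(2) nth_mem by blast
  then show b: "bt j \<in> arcs Q" and vB: "v j \<in> B (bt j)" by (auto simp: mem_Sigma_iff split_beta)
  then obtain u where u: "u \<in> hcomp M (d - 1)" "v j = ar (bt j) \<odot> u" using B_sub by blast
  then show "\<exists>u \<in> hcomp M (d - 1). v j = ar (bt j) \<odot> u" by blast
  show h: "v j \<in> hcomp M d" using ar_smult_hc[OF b u(1)] by (simp add: u(2))
  then show "v j \<in> carrier M" by (rule hc_closed)
  show "e (head Q (bt j)) \<odot> v j = v j"
    using M.smult_assoc[of "e (head Q (bt j))" "ar (bt j)" u] b hc_closed[OF u(1)]
    by (simp add: u(2) e_head_ar)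
qed

lemma gs_index: "a \<in> arcs Q \<Longrightarrow> b \<in> B a \<Longrightarrow> \<exists>j<r. gs ! j = (a, b)"
  using gs(2) by (metis in_set_conv_nth mem_Sigma_iff)

lemma sum_over_arrow:
  assumes a: "a \<in> arcs Q"
  shows "(\<Oplus>j\<in>{j \<in> {..<r}. bt j = a}. sc (c (v j)) \<odot> v j) = lin (B a) c"
proof -
  let ?J = "{j \<in> {..<r}. bt j = a}"
  have inj: "inj_on v ?J"
  proof (rule inj_onI)
    fix i j assume ij: "i \<in> ?J" "j \<in> ?J" "v i = v j"
    then have "gs ! i = gs ! j" by (simp add: prod_eq_iff)
    then show "i = j" using ij gs(1) by (simp add: nth_eq_iff_index_eq)
  qed
  have im: "v ` ?J = B a"
  proof (rule equalityI; rule subsetI)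
    fix b assume "b \<in> B a"
    then obtain j where "j < r" "gs ! j = (a, b)" using gs_index[OF a] by blast
    then show "b \<in> v ` ?J" by (intro image_eqI[where x = j]) simp_all
  next
    fix b assume "b \<in> v ` ?J"
    then show "b \<in> B a" using gs_nth(2) by auto
  qed
  have "lin (B a) c = (\<Oplus>b\<in>v ` ?J. sc (c b) \<odot> b)" unfolding lin_def im ..
  also have "\<dots> = (\<Oplus>j\<in>?J. sc (c (v j)) \<odot> v j)"
    by (rule M.M.finsum_reindex[OF _ inj]) (use gs_nth(4) in auto)
  finally show ?thesis by simp
qed

lemma coefficients_of_family:
  fixes c :: "nat \<Rightarrow> 'k"
  obtains C where "\<And>j. j < r \<Longrightarrow> C (bt j) (v j) = c j"
proof -
  define C where "C a b = c (THE j. j < r \<and> gs ! j = (a, b))" for a b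
  have "C (bt j) (v j) = c j" if "j < r" for j
  proof -
    have "(THE i. i < r \<and> gs ! i = (bt j, v j)) = j"
    proof (rule the_equality)
      fix i assume i: "i < r \<and> gs ! i = (bt j, v j)"
      then have "gs ! i = gs ! j" by simp
      then show "i = j" using nth_eq_iff_index_eq[OF gs(1)] i that by blast
    qed (use that in simp)
    then show ?thesis by (simp add: C_def)
  qed
  then show ?thesis by (rule that)
qed

text \<open>The basis elements are images of an arrow, so their combinations are as well.\<close>

lemma lin_in_image:
  assumes a: "a \<in> arcs Q"
  shows "\<exists>y \<in> hcomp M (d - 1). lin (B a) c = ar a \<odot> y"
proof -
  have "\<forall>b\<in>B a. \<exists>u. u \<in> hcomp M (d - 1) \<and> b = ar a \<odot> u" using B_sub[OF a] by blast
  then obtain u where u: "\<forall>b\<in>B a. u b \<in> hcomp M (d - 1) \<and> b = ar a \<odot> u b" by (rule bchoice[THEN exE])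
  have uc: "u b \<in> carrier M" if "b \<in> B a" for b using u that hc_closed by blast
  let ?y = "\<Oplus>b\<in>B a. sc (c b) \<odot> u b"
  have "ar a \<odot> ?y = (\<Oplus>b\<in>B a. ar a \<odot> (sc (c b) \<odot> u b))"
    by (rule M.smult_r_finsum[OF ar_closed[OF a]]) (simp add: uc)
  also have "\<dots> = lin (B a) c"
    unfolding lin_def
  proof (rule M.M.finsum_cong'[OF refl])
    fix b assume b: "b \<in> B a"
    have "ar a \<odot> (sc (c b) \<odot> u b) = sc (c b) \<odot> (ar a \<odot> u b)"
      using M.smult_assoc[of "ar a" "sc (c b)" "u b"] M.smult_assoc[of "sc (c b)" "ar a" "u b"]
        sc_commute[of "ar a" "c b"] uc[OF b] a by simp
    then show "ar a \<odot> (sc (c b) \<odot> u b) = sc (c b) \<odot> b" using u b by metis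
  next
    show "(\<lambda>b. sc (c b) \<odot> b) \<in> B a \<rightarrow> carrier M"
      using B_sub[OF a] a hc_closed by (auto intro!: M.smult_closed)
  qed
  finally show ?thesis using u sc_smult_hc by (intro bexI[where x = ?y] hc_finsum) auto
qed

text \<open>In degree \<open>d\<close> the images of different arrows are independent and the generators form bases of
  these images.\<close>

lemma scalar_relation:
  assumes D: "arrows_independent M (d - 1)" and T: "T \<subseteq> arcs Q"
    and w: "\<And>b. b \<in> T \<Longrightarrow> w b \<in> hcomp M (d - 1)"
    and eq: "(\<Oplus>j\<in>{..<r}. sc (c j) \<odot> v j) = (\<Oplus>b\<in>T. ar b \<odot> w b)"
    and j: "j < r" "bt j \<notin> T"
  shows "c j = 0"
proof -
  obtain C where C: "\<And>j. j < r \<Longrightarrow> C (bt j) (v j) = c j" by (rule coefficients_of_family[of c]) blast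
  have "\<exists>y. y \<in> hcomp M (d - 1) \<and> lin (B a) (C a) = ar a \<odot> y" if "a \<in> arcs Q" for a
    using lin_in_image[OF that, of "C a"] by blast
  then have "\<forall>a\<in>arcs Q. \<exists>y. y \<in> hcomp M (d - 1) \<and> lin (B a) (C a) = ar a \<odot> y" by blast
  then obtain y where y: "\<forall>a\<in>arcs Q. y a \<in> hcomp M (d - 1) \<and> lin (B a) (C a) = ar a \<odot> y a"
    by (rule bchoice[THEN exE])
  have "(\<Oplus>j\<in>{..<r}. sc (c j) \<odot> v j) =
      (\<Oplus>a\<in>arcs Q. \<Oplus>j\<in>{j \<in> {..<r}. bt j = a}. sc (c j) \<odot> v j)"
    by (rule M.M.finsum_group) (use gs_nth(1,4) in simp_all)
  also have "\<dots> = (\<Oplus>a\<in>arcs Q. ar a \<odot> y a)"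
  proof (rule M.M.finsum_cong'[OF refl])
    fix a assume a: "a \<in> arcs Q"
    have "(\<Oplus>j\<in>{j \<in> {..<r}. bt j = a}. sc (c j) \<odot> v j) =
        (\<Oplus>j\<in>{j \<in> {..<r}. bt j = a}. sc (C a (v j)) \<odot> v j)"
      by (rule M.M.finsum_cong'[OF refl]) (use C gs_nth(4) in auto)
    then show "(\<Oplus>j\<in>{j \<in> {..<r}. bt j = a}. sc (c j) \<odot> v j) = ar a \<odot> y a"
      using sum_over_arrow[OF a, of "C a"] y a by simp
  qed (use y hc_closed in \<open>auto intro!: M.smult_closed\<close>)
  finally have eq': "(\<Oplus>a\<in>arcs Q. ar a \<odot> y a) = (\<Oplus>b\<in>T. ar b \<odot> w b)" using eq by simp
  note G = gs_nth[OF j(1)]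
  have "ar (bt j) \<odot> y (bt j) = \<zero>"
    by (rule arrows_independent_subset[OF D T _ w eq' G(1) j(2)]) (use y in blast)
  then have "lin (B (bt j)) (C (bt j)) = \<zero>" using y G(1) by simp
  then have "C (bt j) (v j) = 0" by (rule B_indep[OF G(1) _ G(2)])
  then show ?thesis using C[OF j(1)] by simp
qed

text \<open>In all degrees, the relations between the generators come from relations between arrows.  The
  induction on the degree \<open>l\<close> strips off the last arrow; the set \<open>T\<close> of arrows that may remain
  unbalanced has to be arbitrary for that.\<close>

lemma generator_relation:
  assumes D: "\<And>n. n \<ge> d - 1 \<Longrightarrow> arrows_independent M n" and K: "\<And>n. n \<ge> d \<Longrightarrow> arrow_kernels M n"
    and T: "T \<subseteq> arcs Q"
    and f: "\<And>j. j < r \<Longrightarrow> f j \<in> carrier (Pr (head Q (bt j))) \<inter> dg (int l)"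
    and w: "\<And>b. b \<in> T \<Longrightarrow> w b \<in> hcomp M (d + int l - 1)"
    and eq: "(\<Oplus>j\<in>{..<r}. f j \<odot> v j) = (\<Oplus>b\<in>T. ar b \<odot> w b)"
    and j: "j < r"
  shows "\<exists>u. (\<forall>b\<in>T. u b \<in> carrier A) \<and> f j \<star> ar (bt j) = (\<Oplus>\<^bsub>A\<^esub>b\<in>T. ar b \<star> u b)"
  using T f w eq j
proof (induction l arbitrary: T f w j)
  case 0
  note fT = finite_subset[OF 0(1) finite_arcs]
  define c where "c i = coef (f i) (head Q (bt i), [], head Q (bt i))" for i
  have fc: "f i = sc (c i) \<star> e (head Q (bt i))" if "i < r" for i
    unfolding c_def using 0(2)[OF that] gs_nth(1)[OF that] by (intro degree_0_right) (simp_all add: Pr_iff)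
  have fv: "f i \<odot> v i = sc (c i) \<odot> v i" if "i < r" for i
    using M.smult_assoc[of "sc (c i)" "e (head Q (bt i))" "v i"] gs_nth[OF that] by (simp add: fc[OF that])
  have "(\<Oplus>j\<in>{..<r}. sc (c j) \<odot> v j) = (\<Oplus>j\<in>{..<r}. f j \<odot> v j)"
    by (rule M.M.finsum_cong'[OF refl]) (use fv gs_nth(4) in auto)
  also have "\<dots> = (\<Oplus>b\<in>T. ar b \<odot> w b)" by (rule 0(4))
  finally have eq: "(\<Oplus>j\<in>{..<r}. sc (c j) \<odot> v j) = (\<Oplus>b\<in>T. ar b \<odot> w b)" .
  note b = gs_nth(1)[OF 0(5)]
  have fj: "f j \<star> ar (bt j) = ar (bt j) \<star> sc (c j)"
    using b by (simp add: fc[OF 0(5)] A.m_assoc e_head_ar sc_commute)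
  show ?case
  proof (cases "bt j \<in> T")
    case True
    let ?u = "\<lambda>b. if b = bt j then sc (c j) else \<zero>\<^bsub>A\<^esub>"
    have "(\<Oplus>\<^bsub>A\<^esub>b\<in>T. ar b \<star> ?u b) = ar (bt j) \<star> ?u (bt j)"
      by (rule A.finsum_only[OF fT True]) (use b 0(1) in \<open>auto simp: subset_iff\<close>)
    then show ?thesis using fj by (intro exI[where x = ?u]) simp
  next
    case False
    have "c j = 0"
    proof (rule scalar_relation[OF D 0(1) _ eq 0(5) False])
      show "w b \<in> hcomp M (d - 1)" if "b \<in> T" for b using 0(3)[OF that] by simp
    qed simp
    then have "f j \<star> ar (bt j) = \<zero>\<^bsub>A\<^esub>" using fj b by (simp add: sc_zero)
    moreover have "(\<Oplus>\<^bsub>A\<^esub>b\<in>T. ar b \<star> \<zero>\<^bsub>A\<^esub>) = (\<Oplus>\<^bsub>A\<^esub>b\<in>T. \<zero>\<^bsub>A\<^esub>)"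
      by (rule A.finsum_cong'[OF refl]) (use 0(1) in \<open>simp_all add: subset_iff\<close>)
    ultimately show ?thesis by (intro exI[where x = "\<lambda>b. \<zero>\<^bsub>A\<^esub>"]) simp
  qed
next
  case (Suc l)
  let ?n = "d + int l"
  have fc: "f i \<in> carrier A" "f i \<in> dg (int (Suc l))" "f i \<star> e (head Q (bt i)) = f i" if "i < r" for i
    using Suc.prems(2)[OF that] gs_nth(1)[OF that] by (simp_all add: Pr_iff)
  have lsP: "ls a (f i) \<in> carrier (Pr (head Q (bt i))) \<inter> dg (int l)" if i: "i < r" for a i
    using ls_deg[OF fc(2)[OF i], of a] ls_mult_e[OF fc(1)[OF i], of "head Q (bt i)" a] fc[OF i] gs_nth(1)[OF i]
    by (simp add: Pr_iff ls_closed)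
  have lsv: "ls a (f i) \<odot> v i \<in> hcomp M ?n" if i: "i < r" for a i
    using smult_hc[of "ls a (f i)" "int l" "v i" d] lsP[OF i, of a] gs_nth(3)[OF i] by (simp add: add.commute)
  have lsvc: "ls a (f i) \<odot> v i \<in> carrier M" if i: "i < r" for a i using lsv[OF i] by (rule hc_closed)
  have fdec: "f i = (\<Oplus>\<^bsub>A\<^esub>a\<in>arcs Q. ar a \<star> ls a (f i))" if "i < r" for i
    by (rule dg_pos_left[OF fc(2)[OF that]]) simp
  \<comment> \<open>The relation, sorted by the last arrows of the coefficients.\<close>
  define y where "y a = (\<Oplus>i\<in>{..<r}. ls a (f i) \<odot> v i)" for a
  have y: "y a \<in> hcomp M ?n" for a unfolding y_def by (rule hc_finsum) (simp add: lsv)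
  have arls: "ar a \<odot> (ls a (f i) \<odot> v i) \<in> carrier M" if "i < r" "a \<in> arcs Q" for a i
    using lsvc[OF that(1)] that by (simp add: M.smult_closed)
  have "(\<Oplus>i\<in>{..<r}. f i \<odot> v i) = (\<Oplus>i\<in>{..<r}. \<Oplus>a\<in>arcs Q. ar a \<odot> (ls a (f i) \<odot> v i))"
  proof (rule M.M.finsum_cong'[OF refl])
    fix i assume "i \<in> {..<r}"
    then have i: "i < r" by simp
    have "f i \<odot> v i = (\<Oplus>\<^bsub>A\<^esub>a\<in>arcs Q. ar a \<star> ls a (f i)) \<odot> v i"
      by (rule arg_cong[OF fdec[OF i]])
    also have "\<dots> = (\<Oplus>a\<in>arcs Q. (ar a \<star> ls a (f i)) \<odot> v i)"
      by (rule M.smult_l_finsum[OF gs_nth(4)[OF i]]) (simp add: ls_closed fc(1)[OF i])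
    also have "\<dots> = (\<Oplus>a\<in>arcs Q. ar a \<odot> (ls a (f i) \<odot> v i))"
      by (rule M.M.finsum_cong'[OF refl])
        (use arls[OF i] gs_nth(4)[OF i] fc(1)[OF i] in \<open>simp_all add: M.smult_assoc ls_closed\<close>)
    finally show "f i \<odot> v i = (\<Oplus>a\<in>arcs Q. ar a \<odot> (ls a (f i) \<odot> v i))" .
  qed (use arls in \<open>auto intro!: M.M.finsum_closed\<close>)
  also have "\<dots> = (\<Oplus>a\<in>arcs Q. \<Oplus>i\<in>{..<r}. ar a \<odot> (ls a (f i) \<odot> v i))"
    by (rule M.M.finsum_swap) (use arls in auto)
  also have "\<dots> = (\<Oplus>a\<in>arcs Q. ar a \<odot> y a)"
  proof (rule M.M.finsum_cong'[OF refl])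
    show "(\<lambda>a. ar a \<odot> y a) \<in> arcs Q \<rightarrow> carrier M"
      using hc_closed[OF y] by (auto intro!: M.smult_closed)
    fix a assume a: "a \<in> arcs Q"
    show "(\<Oplus>i\<in>{..<r}. ar a \<odot> (ls a (f i) \<odot> v i)) = ar a \<odot> y a"
      unfolding y_def by (rule M.smult_r_finsum[OF ar_closed[OF a], symmetric]) (simp add: lsvc)
  qed
  finally have eq: "(\<Oplus>a\<in>arcs Q. ar a \<odot> y a) = (\<Oplus>b\<in>T. ar b \<odot> w b)" using Suc.prems(4) by simp
  have w: "w b \<in> hcomp M ?n" if "b \<in> T" for b using Suc.prems(3)[OF that] by (simp add: add.commute)
  note jr = Suc.prems(5)
  note bj = gs_nth(1)[OF jr]
  have zero: "ar a \<star> (ls a (f j) \<star> ar (bt j)) = \<zero>\<^bsub>A\<^esub>" if a: "a \<in> arcs Q" "a \<notin> T" for a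
  proof -
    have z: "ar a \<odot> y a = \<zero>"
      by (rule arrows_independent_subset[OF D Suc.prems(1) y w eq a]) simp
    have "e (tail Q a) \<odot> y a = (\<Oplus>i\<in>{..<r}. e (tail Q a) \<odot> (ls a (f i) \<odot> v i))"
      unfolding y_def by (rule M.smult_r_finsum) (use a lsvc in simp_all)
    also have "\<dots> = y a"
      unfolding y_def
    proof (rule M.M.finsum_cong'[OF refl])
      fix i assume "i \<in> {..<r}"
      then have i: "i < r" by simp
      show "e (tail Q a) \<odot> (ls a (f i) \<odot> v i) = ls a (f i) \<odot> v i"
        using M.smult_assoc[of "e (tail Q a)" "ls a (f i)" "v i"] gs_nth(4)[OF i] fc(1)[OF i] a
        by (simp add: ls_closed e_ls)
    qed (use lsvc in simp)
    finally have ey: "e (tail Q a) \<odot> y a = y a" .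
    obtain t where t: "\<forall>b. zr b a \<longrightarrow> t b \<in> hcomp M (?n - 1)" "y a = (\<Oplus>b\<in>{b. zr b a}. ar b \<odot> t b)"
    proof -
      have "arrow_kernels M ?n" by (rule K) simp
      then show ?thesis using a y[of a] ey z that unfolding arrow_kernels_def by blast
    qed
    have "\<exists>u. (\<forall>b\<in>{b. zr b a}. u b \<in> carrier A) \<and>
        ls a (f j) \<star> ar (bt j) = (\<Oplus>\<^bsub>A\<^esub>b\<in>{b. zr b a}. ar b \<star> u b)"
    proof (rule Suc.IH[of "{b. zr b a}" "\<lambda>i. ls a (f i)" t j, OF _ _ _ _ jr])
      show "{b. zr b a} \<subseteq> arcs Q" using zr_arcs by blast
      show "ls a (f i) \<in> carrier (Pr (head Q (bt i))) \<inter> dg (int l)" if "i < r" for i by (rule lsP[OF that])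
      show "t b \<in> hcomp M (d + int l - 1)" if "b \<in> {b. zr b a}" for b using t(1) that by simp
      show "(\<Oplus>j\<in>{..<r}. ls a (f j) \<odot> v j) = (\<Oplus>b\<in>{b. zr b a}. ar b \<odot> t b)"
        using t(2) by (simp add: y_def)
    qed
    then obtain u where u: "\<And>b. zr b a \<Longrightarrow> u b \<in> carrier A"
      "ls a (f j) \<star> ar (bt j) = (\<Oplus>\<^bsub>A\<^esub>b\<in>{b. zr b a}. ar b \<star> u b)" by blast
    have "ar a \<star> (ls a (f j) \<star> ar (bt j)) = (\<Oplus>\<^bsub>A\<^esub>b\<in>{b. zr b a}. ar a \<star> (ar b \<star> u b))"
      unfolding u(2) by (rule finsum_mult_left) (use a u(1) zr_arcs in auto)
    also have "\<dots> = (\<Oplus>\<^bsub>A\<^esub>b\<in>{b. zr b a}. \<zero>\<^bsub>A\<^esub>)"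
    proof (rule A.finsum_cong'[OF refl])
      fix b assume "b \<in> {b. zr b a}"
      then have zb: "zr b a" by simp
      show "ar a \<star> (ar b \<star> u b) = \<zero>\<^bsub>A\<^esub>"
        using A.m_assoc[of "ar a" "ar b" "u b"] zr_zero[OF zb] zr_arcs[OF zb] u(1)[OF zb] by simp
    qed simp
    finally show ?thesis by simp
  qed
  let ?u = "\<lambda>a. ls a (f j) \<star> ar (bt j)"
  have uc: "?u a \<in> carrier A" for a using fc(1)[OF jr] bj by (simp add: ls_closed)
  have "f j \<star> ar (bt j) = (\<Oplus>\<^bsub>A\<^esub>a\<in>arcs Q. ar a \<star> ls a (f j)) \<star> ar (bt j)"
    by (rule arg_cong[OF fdec[OF jr]])
  also have "\<dots> = (\<Oplus>\<^bsub>A\<^esub>a\<in>arcs Q. ar a \<star> ls a (f j) \<star> ar (bt j))"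
    by (rule finsum_mult_right) (use bj fc(1)[OF jr] in \<open>simp_all add: ls_closed\<close>)
  also have "\<dots> = (\<Oplus>\<^bsub>A\<^esub>a\<in>arcs Q. ar a \<star> ?u a)"
    by (rule A.finsum_cong'[OF refl]) (use bj fc(1)[OF jr] in \<open>simp_all add: A.m_assoc ls_closed\<close>)
  also have "\<dots> = (\<Oplus>\<^bsub>A\<^esub>a\<in>T. ar a \<star> ?u a)"
    by (rule A.finsum_superset[symmetric, OF finite_arcs Suc.prems(1)])
      (use zero uc Suc.prems(1) in \<open>auto simp: subset_iff\<close>)
  finally show ?case using uc by (intro exI[where x = ?u]) simp
qed

end

lemma finite_int_bound:
  fixes xs ys :: "('v \<times> int) list"
  obtains b :: int where "\<And>x i. (x, i) \<in> set xs \<union> set ys \<Longrightarrow> i \<le> b \<and> - b \<le> i"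
proof -
  have "\<exists>b::int. \<forall>p\<in>set xs \<union> set ys. snd p \<le> b \<and> - b \<le> snd p"
    by (rule exI[where x = "\<Sum>p\<in>set xs \<union> set ys. \<bar>snd p\<bar>"])
      (metis (no_types, lifting) List.finite_set abs_ge_zero abs_le_D1 abs_le_D2 finite_Un member_le_sum minus_le_iff)
  then show ?thesis using that by force
qed

context arrow_basis
begin

abbreviation bs :: "'e list" where "bs \<equiv> map fst gs"

text \<open>The projective cover: the generator of the summand \<open>j\<close> is sent to \<open>v j\<close>, which is fixed by the
  idempotent at the head of its arrow.\<close>

definition cover :: "(nat \<Rightarrow> (('v, 'e) qpath \<Rightarrow> 'k) set) \<Rightarrow> 'm" where
  "cover f = (\<Oplus>j\<in>{..<r}. f j \<odot> v j)"

lemma bs_arcs: "set bs \<subseteq> arcs Q"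
  using gs(2) by auto

lemma PB_gs:
  assumes "f \<in> carrier (PB 0 bs)" "j < r"
  shows "f j \<in> carrier A" "f j \<star> e (head Q (bt j)) = f j" "f j \<odot> v j \<in> carrier M"
proof -
  have "f j \<in> carrier (Pr (head Q (bt j)))" using assms by (auto simp: PB_carrier PiE_iff)
  then show "f j \<in> carrier A" "f j \<star> e (head Q (bt j)) = f j" using gs_nth(1)[OF assms(2)] by (simp_all add: Pr_iff)
  then show "f j \<odot> v j \<in> carrier M" using gs_nth(4)[OF assms(2)] by (simp add: M.smult_closed)
qed

lemma cover_closed:
  assumes f: "f \<in> carrier (PB 0 bs)"
  shows "cover f \<in> part_ge d"
proof -
  have s: "f j \<odot> v j \<in> carrier (trunc_ge d)" if "j < r" for j
    using part_ge_smult[OF PB_gs(1)[OF f that] hc_part_ge[OF gs_nth(3)[OF that] order_refl]] by simp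
  have "(\<Oplus>\<^bsub>trunc_ge d\<^esub>j\<in>{..<r}. f j \<odot> v j) \<in> carrier (trunc_ge d)"
    by (rule abelian_monoid.finsum_closed[OF abelian_group.axioms(1)[OF trunc_ge_abelian]]) (use s in auto)
  moreover have "(\<Oplus>\<^bsub>trunc_ge d\<^esub>j\<in>{..<r}. f j \<odot> v j) = cover f"
    unfolding cover_def by (rule part_finsum[OF trunc_ge_abelian]) (use s part_subset in auto)
  ultimately show ?thesis by simp
qed

lemma cover_hom: "cover \<in> graded_hom Q I (PB 0 bs) (shift (- d) (trunc_ge d))"
proof (rule graded_homI)
  fix f assume f: "f \<in> carrier (PB 0 bs)"
  show "cover f \<in> carrier (shift (- d) (trunc_ge d))" using cover_closed[OF f] by simp
  fix g assume g: "g \<in> carrier (PB 0 bs)"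
  have "cover (f \<oplus>\<^bsub>PB 0 bs\<^esub> g) = (\<Oplus>j\<in>{..<r}. f j \<odot> v j \<oplus> g j \<odot> v j)"
    unfolding cover_def
    by (rule M.M.finsum_cong'[OF refl])
      (use PB_gs[OF f] PB_gs[OF g] gs_nth(4) in \<open>simp_all add: PB_ops M.smult_l_distr\<close>)
  also have "\<dots> = cover f \<oplus> cover g"
    unfolding cover_def by (rule M.M.finsum_addf) (use PB_gs[OF f] PB_gs[OF g] in auto)
  finally show "cover (f \<oplus>\<^bsub>PB 0 bs\<^esub> g) = cover f \<oplus>\<^bsub>shift (- d) (trunc_ge d)\<^esub> cover g" by simp
next
  fix a f assume a: "a \<in> carrier A" and f: "f \<in> carrier (PB 0 bs)"
  have "a \<odot> cover f = (\<Oplus>j\<in>{..<r}. a \<odot> (f j \<odot> v j))"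
    unfolding cover_def by (rule M.smult_r_finsum[OF a]) (use PB_gs[OF f] in simp)
  also have "\<dots> = cover (a \<odot>\<^bsub>PB 0 bs\<^esub> f)"
    unfolding cover_def
    by (rule M.M.finsum_cong'[OF refl])
      (use PB_gs[OF f] gs_nth(4) a in \<open>simp_all add: PB_ops M.smult_assoc M.smult_closed\<close>)
  finally show "cover (a \<odot>\<^bsub>PB 0 bs\<^esub> f) = a \<odot>\<^bsub>shift (- d) (trunc_ge d)\<^esub> cover f" by simp
next
  fix f n assume f: "f \<in> hcomp (PB 0 bs) n"
  have fj: "f j \<in> dg n" if "j < r" for j using f that by (auto simp: PB_hcomp PiE_iff)
  show "cover f \<in> hcomp (shift (- d) (trunc_ge d)) n"
  proof (cases "n < 0")
    case True
    have "cover f = (\<Oplus>j\<in>{..<r}. \<zero>)"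
      unfolding cover_def
    proof (rule M.M.finsum_cong'[OF refl])
      fix j assume "j \<in> {..<r}"
      then have j: "j < r" by simp
      show "f j \<odot> v j = \<zero>"
        using dg_neg[OF fj[OF j] True] M.smult_l_null[OF gs_nth(4)[OF j]] by simp
    qed simp
    then show ?thesis using True by simp
  next
    case False
    have "cover f \<in> hcomp M (n + d)"
      unfolding cover_def
    proof (rule hc_finsum)
      fix j assume "j \<in> {..<r}"
      then have j: "j < r" by simp
      show "f j \<odot> v j \<in> hcomp M (n + d)" by (rule smult_hc[OF fj[OF j] gs_nth(3)[OF j]])
    qed
    then show ?thesis using False by simp
  qed
qed

text \<open>For a homogeneous family this is \<open>generator_relation\<close> with \<open>T = {}\<close>; a general family is split into
  its homogeneous components.\<close>

lemma cover_kernel: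
  assumes D: "\<And>n. n \<ge> d - 1 \<Longrightarrow> arrows_independent M n" and K: "\<And>n. n \<ge> d \<Longrightarrow> arrow_kernels M n"
  shows "a_kernel (PB 0 bs) (shift (- d) (trunc_ge d)) cover = killed bs"
proof (rule equalityI; rule subsetI)
  fix f assume "f \<in> a_kernel (PB 0 bs) (shift (- d) (trunc_ge d)) cover"
  then have f: "f \<in> carrier (PB 0 bs)" and z: "cover f = \<zero>" by (simp_all add: a_kernel_iff)
  have "f j \<star> ar (bt j) = \<zero>\<^bsub>A\<^esub>" if j: "j < r" for j
  proof -
    note F = PB_gs[OF f]
    have comp: "pr n (f j) \<star> ar (bt j) = \<zero>\<^bsub>A\<^esub>" if n: "n \<ge> 0" for n
    proof -
      obtain l where l: "n = int l" by (rule nonneg_int_cases[OF n])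
      have p: "pr (int l) (f i) \<in> carrier (Pr (head Q (bt i))) \<inter> dg (int l)" if i: "i < r" for i
        using pr_deg[OF F(1)[OF i]] pr_mult_e[OF F(1)[OF i], of "head Q (bt i)"] F(1,2)[OF i] gs_nth(1)[OF i]
        by (simp add: Pr_iff pr_carrier)
      have "(\<Oplus>i\<in>{..<r}. pr (int l) (f i) \<odot> v i) = (\<Oplus>i\<in>{..<r}. cmp (int l + d) (f i \<odot> v i))"
      proof (rule M.M.finsum_cong'[OF refl])
        fix i assume "i \<in> {..<r}"
        then have i: "i < r" by simp
        let ?N = "{k. pr k (f i) \<noteq> \<zero>\<^bsub>A\<^esub>}"
        have t: "pr k (f i) \<odot> cmp (int l + d - k) (v i) = (if k = int l then pr (int l) (f i) \<odot> v i else \<zero>)" for k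
          using cmp_same[OF gs_nth(3)[OF i]] cmp_other[OF gs_nth(3)[OF i], of "int l + d - k"]
            M.smult_r_null[OF pr_carrier[OF F(1)[OF i]]] by auto
        have c: "pr (int l) (f i) \<odot> v i \<in> carrier M"
          using pr_carrier[OF F(1)[OF i]] gs_nth(4)[OF i] by (rule M.smult_closed)
        have "cmp (int l + d) (f i \<odot> v i) =
            (\<Oplus>k\<in>?N. if k = int l then pr (int l) (f i) \<odot> v i else \<zero>)"
          unfolding cmp_smult_sum[OF F(1)[OF i] gs_nth(4)[OF i]] t ..
        also have "\<dots> = (\<Oplus>k\<in>insert (int l) ?N. if k = int l then pr (int l) (f i) \<odot> v i else \<zero>)"
          by (rule M.M.finsum_superset)
            (use c pr_finite[OF F(1)[OF i]] M.smult_l_null[OF gs_nth(4)[OF i]] in auto)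
        also have "\<dots> = pr (int l) (f i) \<odot> v i"
          by (subst M.M.finsum_only[where k = "int l"]) (use c pr_finite[OF F(1)[OF i]] in auto)
        finally show "pr (int l) (f i) \<odot> v i = cmp (int l + d) (f i \<odot> v i)" by simp
      qed (use F(3) in \<open>simp add: cmp_closed\<close>)
      also have "\<dots> = cmp (int l + d) (cover f)"
        unfolding cover_def by (rule cmp_finsum[symmetric]) (use F(3) in simp)
      also have "\<dots> = (\<Oplus>b\<in>{}. ar b \<odot> \<zero>)" by (simp add: z cmp_zero)
      finally have "\<exists>u. (\<forall>b\<in>{}. u b \<in> carrier A) \<and> pr (int l) (f j) \<star> ar (bt j) = (\<Oplus>\<^bsub>A\<^esub>b\<in>{}. ar b \<star> u b)"
        by (intro generator_relation[OF D K, where f = "\<lambda>i. pr (int l) (f i)" and w = "\<lambda>b. \<zero>"])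
          (use p j in auto)
      then show ?thesis by (simp add: l)
    qed
    have "f j \<star> ar (bt j) = (\<Oplus>\<^bsub>A\<^esub>n\<in>{n. pr n (f j) \<noteq> \<zero>\<^bsub>A\<^esub>}. pr n (f j)) \<star> ar (bt j)"
      by (rule arg_cong[OF pr_sum[OF F(1)[OF j]]])
    also have "\<dots> = (\<Oplus>\<^bsub>A\<^esub>n\<in>{n. pr n (f j) \<noteq> \<zero>\<^bsub>A\<^esub>}. pr n (f j) \<star> ar (bt j))"
      by (rule finsum_mult_right) (use gs_nth(1)[OF j] F(1)[OF j] in \<open>simp_all add: pr_carrier\<close>)
    also have "\<dots> = (\<Oplus>\<^bsub>A\<^esub>n\<in>{n. pr n (f j) \<noteq> \<zero>\<^bsub>A\<^esub>}. \<zero>\<^bsub>A\<^esub>)"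
    proof (rule A.finsum_cong'[OF refl])
      fix n assume "n \<in> {n. pr n (f j) \<noteq> \<zero>\<^bsub>A\<^esub>}"
      then have "n \<ge> 0" using dg_neg[OF pr_deg[OF F(1)[OF j], of n]] by force
      then show "pr n (f j) \<star> ar (bt j) = \<zero>\<^bsub>A\<^esub>" by (rule comp)
    qed simp
    finally show ?thesis by simp
  qed
  then show "f \<in> killed bs" using f by (simp add: killed_def PB_carrier)
next
  fix f assume "f \<in> killed bs"
  then have f: "f \<in> carrier (PB 0 bs)" and z: "\<And>j. j < r \<Longrightarrow> f j \<star> ar (bt j) = \<zero>\<^bsub>A\<^esub>"
    by (auto simp: killed_def PB_carrier)
  have "cover f = (\<Oplus>j\<in>{..<r}. \<zero>)"
    unfolding cover_def
  proof (rule M.M.finsum_cong'[OF refl])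
    fix j assume "j \<in> {..<r}"
    then have j: "j < r" by simp
    obtain u where u: "u \<in> carrier M" "v j = ar (bt j) \<odot> u" using gs_nth(6)[OF j] hc_closed by blast
    have "f j \<odot> v j = (f j \<star> ar (bt j)) \<odot> u"
      using M.smult_assoc[OF PB_gs(1)[OF f j] ar_closed[OF gs_nth(1)[OF j]] u(1)] u(2) by simp
    then show "f j \<odot> v j = \<zero>" using z[OF j] M.smult_l_null[OF u(1)] by simp
  qed simp
  then show "f \<in> a_kernel (PB 0 bs) (shift (- d) (trunc_ge d)) cover" using f by (simp add: a_kernel_iff)
qed

text \<open>In degree \<open>d\<close> the generators span the images of the arrows, and these span everything; higher degrees
  are reached by arrows from lower ones.\<close>

lemma cover_surj:
  assumes G: "\<And>n. n \<ge> d - 1 \<Longrightarrow> arrows_generate M n"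
  shows "cover ` carrier (PB 0 bs) = carrier (shift (- d) (trunc_ge d))"
proof (rule equalityI; rule subsetI)
  fix m assume "m \<in> cover ` carrier (PB 0 bs)"
  then show "m \<in> carrier (shift (- d) (trunc_ge d))" using cover_closed by auto
next
  let ?Im = "cover ` carrier (PB 0 bs)"
  have bv: "fst ` set (map (\<lambda>b. (head Q b, 0)) bs) \<subseteq> verts Q" using bs_arcs by auto
  interpret PB: graded_mod Q S I "PB 0 bs" "prs (map (\<lambda>b. (head Q b, 0)) bs)"
    unfolding PB_def by (rule graded_mod_Prs[OF bv])
  note hom = graded_homD[OF cover_hom]
  have Im_sub: "x \<in> carrier M" if "x \<in> ?Im" for x using that cover_closed part_subset by blast
  have Im_add: "x \<oplus> y \<in> ?Im" if xy: "x \<in> ?Im" "y \<in> ?Im" for x y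
  proof -
    obtain f g where fg: "f \<in> carrier (PB 0 bs)" "g \<in> carrier (PB 0 bs)" "x = cover f" "y = cover g"
      using xy by blast
    have "cover (f \<oplus>\<^bsub>PB 0 bs\<^esub> g) = x \<oplus> y" using hom(3)[OF fg(1,2)] fg by simp
    then show ?thesis using imageI[OF PB.M.M.a_closed[OF fg(1,2)], of cover] by simp
  qed
  have Im_zero: "\<zero> \<in> ?Im"
  proof -
    have "cover \<zero>\<^bsub>PB 0 bs\<^esub> = \<zero>\<^bsub>shift (- d) (trunc_ge d)\<^esub>"
      by (rule additive_zero[OF PB.abelian shift_abelian[OF trunc_ge_abelian] hom(1)])
    then show ?thesis using imageI[OF PB.M.M.zero_closed, of cover] by simp
  qed
  have Im_smult: "a \<odot> x \<in> ?Im" if a: "a \<in> carrier A" and x: "x \<in> ?Im" for a x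
  proof -
    obtain f where f: "f \<in> carrier (PB 0 bs)" "x = cover f" using x by blast
    have "cover (a \<odot>\<^bsub>PB 0 bs\<^esub> f) = a \<odot> x" using hom(4)[OF a f(1)] f by simp
    then show ?thesis using imageI[OF PB.M.smult_closed[OF a f(1)], of cover] by simp
  qed
  have Im_sum: "(\<Oplus>t\<in>T. g t) \<in> ?Im" if "\<And>t. t \<in> T \<Longrightarrow> g t \<in> ?Im" for T and g :: "'t \<Rightarrow> 'm"
    using that
  proof (induction T rule: infinite_finite_induct)
    case (insert t T)
    then have "g \<in> T \<rightarrow> carrier M" "g t \<in> carrier M" using Im_sub by blast+
    with insert show ?case by (simp add: M.M.finsum_insert Im_add)
  qed (simp_all add: Im_zero)
  have Im_v: "v j \<in> ?Im" if j: "j < r" for j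
  proof -
    note Gj = gs_nth[OF j]
    let ?f = "\<lambda>i\<in>{..<r}. if i = j then e (head Q (bt j)) else \<zero>\<^bsub>A\<^esub>"
    have f: "?f \<in> carrier (PB 0 bs)"
      unfolding PB_carrier length_map
    proof (rule restrict_PiE_iff[THEN iffD2], rule ballI)
      fix i assume "i \<in> {..<r}"
      then have i: "i < r" by simp
      show "(if i = j then e (head Q (bt j)) else \<zero>\<^bsub>A\<^esub>) \<in> carrier (Pr (head Q (bs ! i)))"
        using i gs_nth(1)[OF i] Gj(1) by (simp add: Pr_iff e_idem)
    qed
    have "cover ?f = (\<Oplus>i\<in>{..<r}. if i = j then v j else \<zero>)"
      unfolding cover_def
      by (rule M.M.finsum_cong'[OF refl]) (use Gj gs_nth(4) M.smult_l_null in auto)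
    also have "\<dots> = v j" by (subst M.M.finsum_only[where k = j]) (use j Gj in auto)
    finally show ?thesis using imageI[OF f, of cover] by simp
  qed
  have hc: "hcomp M n \<subseteq> ?Im" if "n \<ge> d" for n
    using that
  proof (induction n rule: int_ge_induct)
    case base
    show ?case
    proof
      fix m assume "m \<in> hcomp M d"
      then obtain u where u: "\<forall>a\<in>arcs Q. u a \<in> hcomp M (d - 1)" "m = (\<Oplus>a\<in>arcs Q. ar a \<odot> u a)"
        using G[of "d - 1"] unfolding arrows_generate_def by auto
      have "ar a \<odot> u a \<in> ?Im" if a: "a \<in> arcs Q" for a
      proof -
        obtain c where c: "ar a \<odot> u a = lin (B a) c" using B_span[OF a] u(1) a unfolding spn_def by blast
        have "lin (B a) c \<in> ?Im"
          unfolding lin_def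
        proof (rule Im_sum)
          fix b assume "b \<in> B a"
          then obtain j where "j < r" "gs ! j = (a, b)" using gs_index[OF a] by blast
          then have "b \<in> ?Im" using Im_v[of j] by simp
          then show "sc (c b) \<odot> b \<in> ?Im" by (rule Im_smult[OF sc_closed])
        qed
        then show ?thesis by (simp add: c)
      qed
      then show "m \<in> ?Im" unfolding u(2) by (rule Im_sum)
    qed
  next
    case (step n)
    show ?case
    proof
      fix m assume "m \<in> hcomp M (n + 1)"
      moreover have "arrows_generate M n" using G step.hyps by simp
      ultimately obtain u where u: "\<forall>a\<in>arcs Q. u a \<in> hcomp M n" "m = (\<Oplus>a\<in>arcs Q. ar a \<odot> u a)"
        unfolding arrows_generate_def by blast
      have "ar a \<odot> u a \<in> ?Im" if a: "a \<in> arcs Q" for a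
        by (rule Im_smult[OF ar_closed[OF a]]) (use u(1) a step.IH in blast)
      then show "m \<in> ?Im" unfolding u(2) by (rule Im_sum)
    qed
  qed
  fix m assume "m \<in> carrier (shift (- d) (trunc_ge d))"
  then have m: "m \<in> part_ge d" by simp
  then have mc: "m \<in> carrier M" using part_subset by blast
  obtain N where N: "m = (\<Oplus>n\<in>N. cmp n m)" using cmp_sum[OF mc] by blast
  have "(\<Oplus>n\<in>N. cmp n m) \<in> ?Im"
  proof (rule Im_sum)
    fix n
    show "cmp n m \<in> ?Im"
    proof (cases "n < d")
      case True
      then show ?thesis using m Im_zero by (simp add: part_ge_def)
    next
      case False
      then show ?thesis using hc[of n] cmp_hc[OF mc, of n] by auto
    qed
  qed
  then show "m \<in> ?Im" using N by (simp only:)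
qed

end

context graded_mod
begin

lemma arrow_basis_exists:
  assumes fd: "fd_over_field Q I M (hcomp M (d - 1))"
  obtains B gs where "arrow_basis Q S I M cmp d B gs"
proof -
  have "\<forall>a\<in>arcs Q. \<exists>B. finite B \<and> B \<subseteq> (\<lambda>u. ar a \<odot> u) ` hcomp M (d - 1) \<and>
     (\<lambda>u. ar a \<odot> u) ` hcomp M (d - 1) \<subseteq> spn B \<and> (\<forall>c b. lin B c = \<zero> \<longrightarrow> b \<in> B \<longrightarrow> c b = 0)"
  proof
    fix a assume "a \<in> arcs Q"
    then show "\<exists>B. finite B \<and> B \<subseteq> (\<lambda>u. ar a \<odot> u) ` hcomp M (d - 1) \<and>
     (\<lambda>u. ar a \<odot> u) ` hcomp M (d - 1) \<subseteq> spn B \<and> (\<forall>c b. lin B c = \<zero> \<longrightarrow> b \<in> B \<longrightarrow> c b = 0)"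
      by (rule arrow_image_basis[OF _ fd]) blast
  qed
  then obtain B where B: "\<forall>a\<in>arcs Q. finite (B a) \<and> B a \<subseteq> (\<lambda>u. ar a \<odot> u) ` hcomp M (d - 1) \<and>
     (\<lambda>u. ar a \<odot> u) ` hcomp M (d - 1) \<subseteq> spn (B a) \<and> (\<forall>c b. lin (B a) c = \<zero> \<longrightarrow> b \<in> B a \<longrightarrow> c b = 0)"
    by (rule bchoice[THEN exE])
  have "finite (Sigma (arcs Q) B)" using B by (intro finite_SigmaI) auto
  then obtain gs where gs: "set gs = Sigma (arcs Q) B" "distinct gs" using finite_distinct_list by blast
  have "arrow_basis Q S I M cmp d B gs"
    by (intro arrow_basis.intro arrow_basis_axioms.intro graded_mod_axioms) (use B gs in blast)+
  then show ?thesis by (rule that)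
qed

end

context quadratic_monomial
begin

text \<open>The bound \<open>b\<close> on the degrees of generators and relations gives the properties of the arrows from
  degree \<open>b\<close> on, so that the truncation at \<open>b + 1\<close> has a linear resolution.\<close>

theorem finitely_presented_truncation:
  fixes M :: "((('v, 'e) qpath \<Rightarrow> 'k) set, 'm) graded_module"
  assumes M: "graded_left_module Q I M" and fp: "finitely_presented Q I M"
    and bound: "\<And>l. set l \<subseteq> arcs Q \<Longrightarrow> successively zr l \<Longrightarrow> length l < N"
  shows "\<exists>(N :: ((('v, 'e) qpath \<Rightarrow> 'k) set, 'm) graded_module)
      (L :: ((('v, 'e) qpath \<Rightarrow> 'k) set, 'm) graded_module) f g.
    short_exact Q I N f M g L \<and> linear_module Q I N \<and> finite_dim_module Q I L"
proof -
  obtain cmp where gm: "graded_mod Q S I M cmp"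
    by (rule graded_left_module_graded_mod[OF quadratic_monomial_axioms M])
  interpret gm: graded_mod Q S I M cmp by (rule gm)
  have fd: "\<And>n. fd_over_field Q I M (hcomp M n)" by (rule graded_left_module.hcomp_finite_dim[OF M])
  obtain xs0 xs1 d \<pi> where xs: "fst ` set xs0 \<subseteq> verts Q" "fst ` set xs1 \<subseteq> verts Q"
    and d: "d \<in> graded_hom Q I (Prs xs1) (Prs xs0)" and \<pi>: "\<pi> \<in> graded_hom Q I (Prs xs0) M"
    and ex: "d ` carrier (Prs xs1) = a_kernel (Prs xs0) M \<pi>" and surj: "\<pi> ` carrier (Prs xs0) = carrier M"
    using fp unfolding finitely_presented_def by (elim exE conjE) (rule that)
  note pres = graded_mod_Prs[OF xs(2)] graded_mod_Prs[OF xs(1)] gm d \<pi> ex surj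
  obtain b where b: "\<And>x i. (x, i) \<in> set xs0 \<union> set xs1 \<Longrightarrow> i \<le> b \<and> - b \<le> i"
    by (rule finite_int_bound[of xs0 xs1]) blast
  have P0: "arrows_generate (Prs xs0) n" if "n \<ge> b" for n
    by (rule arrows_generate_Prs[OF xs(1)]) (use b that in \<open>meson UnI1 order_trans\<close>)
  have P1: "arrows_generate (Prs xs1) n" if "n \<ge> b" for n
    by (rule arrows_generate_Prs[OF xs(2)]) (use b that in \<open>meson UnI2 order_trans\<close>)
  have gen: "arrows_generate M n" if "n \<ge> b" for n
    by (rule arrows_generate_coker[OF pres P0[OF that]])
  have ind: "arrows_independent M n" if "n \<ge> b" for n
    by (rule arrows_independent_coker[OF pres P1[OF that] arrows_independent_Prs[OF xs(1)]])
  have ker: "arrow_kernels M n" if "n \<ge> b" for n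
    by (rule arrow_kernels_coker[OF pres P1[OF that] arrows_independent_Prs[OF xs(1)] arrow_kernels_Prs[OF xs(1)]])
  have low: "hcomp M n = {\<zero>\<^bsub>M\<^esub>}" if "n < - b" for n
  proof (rule equalityI; rule subsetI)
    fix m assume "m \<in> hcomp M n"
    then obtain v where v: "v \<in> hcomp (Prs xs0) n" "\<pi> v = m" by (rule coker_lift[OF pres])
    have "v = \<zero>\<^bsub>Prs xs0\<^esub>" by (rule Prs_bounded_below[OF xs(1) _ v(1)]) (use b that in force)
    then have "m = \<zero>\<^bsub>M\<^esub>"
      using v(2) additive_zero[OF graded_mod.abelian[OF pres(2)] gm.abelian graded_homD(1)[OF \<pi>]] by simp
    then show "m \<in> {\<zero>\<^bsub>M\<^esub>}" by simp
  qed (use gm.hc_zero in simp)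
  let ?d = "b + 1"
  obtain B gs where "arrow_basis Q S I M cmp ?d B gs" by (rule gm.arrow_basis_exists[OF fd])
  then interpret ab: arrow_basis Q S I M cmp ?d B gs .
  have "koszul Q I (shift (- ?d) (gm.trunc_ge ?d))"
    by (rule koszulI[OF ab.bs_arcs ab.cover_hom ab.cover_surj ab.cover_kernel bound])
      (use gen ind ker in auto)
  then have lin: "linear_module Q I (gm.trunc_ge ?d)" unfolding linear_module_def by blast
  have "hcomp (gm.trunc_lt ?d) n = {\<zero>\<^bsub>gm.trunc_lt ?d\<^esub>}" if "n \<notin> {- b..b}" for n
    using that low by auto
  then have "finite_dim_module Q I (gm.trunc_lt ?d)"
    unfolding finite_dim_module_def
    by (rule graded_mod.fd_bounded[OF gm.graded_mod_trunc_lt gm.trunc_lt_fd[OF fd] finite_atLeastAtMost_int])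
  then show ?thesis using gm.trunc_short_exact[OF fd] lin by blast
qed

end

section \<open>Colinear coresolutions\<close>

context quadratic_monomial
begin

definition IB :: "int \<Rightarrow> 'e list \<Rightarrow>
    ((('v, 'e) qpath \<Rightarrow> 'k) set, nat \<Rightarrow> (('v, 'e) qpath \<Rightarrow> 'k) set \<Rightarrow> 'k) graded_module" where
  "IB s bs = Ins (map (\<lambda>b. (tail Q b, s)) bs)"

lemma IB_carrier: "carrier (IB s bs) = (\<Pi>\<^sub>E i\<in>{..<length bs}. DF (tail Q (bs ! i)))"
  by (auto simp: IB_def injective_sum_def intro!: PiE_cong)

lemma IB_hcomp: "hcomp (IB s bs) n = (\<Pi>\<^sub>E i\<in>{..<length bs}. hcomp (In (tail Q (bs ! i))) (n - s))"
  by (auto simp: IB_def injective_sum_def intro!: PiE_cong)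

lemma IB_ops:
  "\<phi> \<oplus>\<^bsub>IB s bs\<^esub> \<psi> = (\<lambda>i\<in>{..<length bs}. \<lambda>X\<in>eA (tail Q (bs ! i)). \<phi> i X + \<psi> i X)"
  "a \<odot>\<^bsub>IB s bs\<^esub> \<phi> = (\<lambda>i\<in>{..<length bs}. \<lambda>X\<in>eA (tail Q (bs ! i)). \<phi> i (X \<star> a))"
  "\<zero>\<^bsub>IB s bs\<^esub> = (\<lambda>i\<in>{..<length bs}. \<lambda>X\<in>eA (tail Q (bs ! i)). 0)"
  by (simp_all add: IB_def injective_sum_def cong: restrict_cong)

text \<open>Functionals that vanish on the right ideals generated by the arrows \<open>g\<close> with \<open>b\<^sub>i g = 0\<close> are the
  functionals on \<open>b\<^sub>i A\<close>, just as \<open>killed bs\<close> is the module of relations of the \<open>A b\<^sub>i\<close>.\<close>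

definition vanishing :: "'e list \<Rightarrow> (nat \<Rightarrow> (('v, 'e) qpath \<Rightarrow> 'k) set \<Rightarrow> 'k) set" where
  "vanishing bs = {\<phi> \<in> (\<Pi>\<^sub>E i\<in>{..<length bs}. DF (tail Q (bs ! i))).
     \<forall>i<length bs. \<forall>g. zr g (bs ! i) \<longrightarrow> (\<forall>X\<in>eA (tail Q g). \<phi> i (ar g \<star> X) = 0)}"

abbreviation prev_arrows :: "'e list \<Rightarrow> (nat \<times> 'e) list" where
  "prev_arrows \<equiv> next_arrows (\<lambda>b g. zr g b)"

text \<open>Restriction of functionals along left multiplication by the arrows that precede those of \<open>bs\<close> in a
  relation.\<close>

definition costep :: "'e list \<Rightarrow> (nat \<Rightarrow> (('v, 'e) qpath \<Rightarrow> 'k) set \<Rightarrow> 'k) \<Rightarrow>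
    nat \<Rightarrow> (('v, 'e) qpath \<Rightarrow> 'k) set \<Rightarrow> 'k" where
  "costep bs \<phi> = (\<lambda>k\<in>{..<length (prev_arrows bs)}. \<lambda>X\<in>eA (tail Q (snd (prev_arrows bs ! k))).
     \<phi> (fst (prev_arrows bs ! k)) (ar (snd (prev_arrows bs ! k)) \<star> X))"

lemma prev_nth:
  assumes "k < length (prev_arrows bs)"
  shows "fst (prev_arrows bs ! k) < length bs" "zr (snd (prev_arrows bs ! k)) (bs ! fst (prev_arrows bs ! k))"
    "snd (prev_arrows bs ! k) \<in> arcs Q" "tail Q (snd (prev_arrows bs ! k)) \<in> verts Q"
  using fibre_next[OF fibre_self[OF assms]] by simp_all

lemma IB_summand:
  assumes "\<phi> \<in> carrier (IB s bs)" "i < length bs"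
  shows "\<phi> i \<in> DF (tail Q (bs ! i))"
  using assms by (auto simp: IB_carrier PiE_iff)

lemma ar_mult_eA:
  assumes "a \<in> arcs Q" "X \<in> eA (tail Q a)"
  shows "ar a \<star> X \<in> eA (head Q a)"
proof -
  have t: "tail Q a \<in> verts Q" and h: "head Q a \<in> verts Q" using assms(1) by simp_all
  have X: "X \<in> carrier A" by (rule eA_closed(8)[OF t assms(2)])
  have "e (head Q a) \<star> (ar a \<star> X) = ar a \<star> X"
    using A.m_assoc[of "e (head Q a)" "ar a" X] X assms(1) h by (simp add: e_head_ar)
  then show ?thesis using X assms(1) by (simp add: eA_iff[OF h])
qed

lemma ls_eA: "a \<in> arcs Q \<Longrightarrow> X \<in> carrier A \<Longrightarrow> ls a X \<in> eA (tail Q a)"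
  by (simp add: eA_iff ls_closed e_ls)

lemma DF_ar:
  assumes a: "a \<in> arcs Q" and \<phi>: "\<phi> \<in> DF (head Q a)"
  shows "(\<lambda>X\<in>eA (tail Q a). \<phi> (ar a \<star> X)) \<in> DF (tail Q a)"
    and "\<phi> \<in> hcomp (In (head Q a)) n \<Longrightarrow> (\<lambda>X\<in>eA (tail Q a). \<phi> (ar a \<star> X)) \<in> hcomp (In (tail Q a)) (n + 1)"
proof -
  have t: "tail Q a \<in> verts Q" and h: "head Q a \<in> verts Q" using a by simp_all
  have add: "ar a \<star> (X \<oplus>\<^bsub>A\<^esub> Y) = ar a \<star> X \<oplus>\<^bsub>A\<^esub> ar a \<star> Y"
    if "X \<in> eA (tail Q a)" "Y \<in> eA (tail Q a)" for X Y
    using eA_closed(8)[OF t that(1)] eA_closed(8)[OF t that(2)] a by (simp add: A.r_distr)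
  have sc: "ar a \<star> (sc c \<star> X) = sc c \<star> (ar a \<star> X)" if "X \<in> eA (tail Q a)" for c X
    using A.m_assoc[of "ar a" "sc c" X] A.m_assoc[of "sc c" "ar a" X] sc_commute[of "ar a" c]
      eA_closed(8)[OF t that] a by simp
  have deg: "ar a \<star> X \<in> dg (n + 1)" if "X \<in> eA (tail Q a)" "X \<in> dg n" for n X
    using dg_mult[OF ar_deg[OF a] that(2)] by (simp add: add.commute)
  show "(\<lambda>X\<in>eA (tail Q a). \<phi> (ar a \<star> X)) \<in> DF (tail Q a)"
    by (rule DF_compose(1)[OF t h \<phi> ar_mult_eA[OF a] add sc deg])
  show "\<phi> \<in> hcomp (In (head Q a)) n \<Longrightarrow> (\<lambda>X\<in>eA (tail Q a). \<phi> (ar a \<star> X)) \<in> hcomp (In (tail Q a)) (n + 1)"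
    by (rule DF_compose(2)[OF t h \<phi> ar_mult_eA[OF a] add sc deg])
qed

lemma costep_closed:
  assumes \<phi>: "\<phi> \<in> carrier (IB s bs)"
  shows "costep bs \<phi> \<in> carrier (IB s' (map snd (prev_arrows bs)))"
  unfolding IB_carrier costep_def length_map
proof (rule restrict_PiE_iff[THEN iffD2], rule ballI)
  fix k assume "k \<in> {..<length (prev_arrows bs)}"
  then have k: "k < length (prev_arrows bs)" by simp
  note P = prev_nth[OF k]
  have "\<phi> (fst (prev_arrows bs ! k)) \<in> DF (head Q (snd (prev_arrows bs ! k)))"
    using IB_summand[OF \<phi> P(1)] P(2) by (simp add: zr_def)
  from DF_ar(1)[OF P(3) this]
  show "(\<lambda>X\<in>eA (tail Q (snd (prev_arrows bs ! k))).
      \<phi> (fst (prev_arrows bs ! k)) (ar (snd (prev_arrows bs ! k)) \<star> X))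
     \<in> DF (tail Q (map snd (prev_arrows bs) ! k))"
    using k by simp
qed

lemma costep_nth:
  assumes "k < length (prev_arrows bs)" "X \<in> eA (tail Q (snd (prev_arrows bs ! k)))"
  shows "costep bs \<phi> k X = \<phi> (fst (prev_arrows bs ! k)) (ar (snd (prev_arrows bs ! k)) \<star> X)"
  using assms by (simp add: costep_def)

lemma prev_ar_eA:
  assumes "k < length (prev_arrows bs)" "X \<in> eA (tail Q (snd (prev_arrows bs ! k)))"
  shows "ar (snd (prev_arrows bs ! k)) \<star> X \<in> eA (tail Q (bs ! fst (prev_arrows bs ! k)))"
  using ar_mult_eA[OF prev_nth(3)[OF assms(1)] assms(2)] prev_nth(2)[OF assms(1)] by (simp add: zr_def)

lemma IB_eqI:
  assumes "\<phi> \<in> carrier (IB s bs)" "\<psi> \<in> carrier (IB s bs)" "set bs \<subseteq> arcs Q"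
    and "\<And>i X. i < length bs \<Longrightarrow> X \<in> eA (tail Q (bs ! i)) \<Longrightarrow> \<phi> i X = \<psi> i X"
  shows "\<phi> = \<psi>"
proof (rule PiE_ext[of _ "{..<length bs}" "\<lambda>i. DF (tail Q (bs ! i))"])
  show "\<phi> \<in> (\<Pi>\<^sub>E i\<in>{..<length bs}. DF (tail Q (bs ! i)))" "\<psi> \<in> (\<Pi>\<^sub>E i\<in>{..<length bs}. DF (tail Q (bs ! i)))"
    using assms(1,2) by (simp_all add: IB_carrier)
  fix i assume "i \<in> {..<length bs}"
  then have i: "i < length bs" by simp
  have "tail Q (bs ! i) \<in> verts Q" using i assms(3) by (auto simp: subset_iff)
  then show "\<phi> i = \<psi> i"
    by (rule DF_eqI[OF _ IB_summand[OF assms(1) i] IB_summand[OF assms(2) i] assms(4)[OF i]])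
qed

lemma graded_mod_IB: "set bs \<subseteq> arcs Q \<Longrightarrow> \<exists>c. graded_mod Q S I (IB s bs) c"
  unfolding IB_def by (rule exI, rule graded_mod_Ins) (auto simp: subset_iff)

lemma costep_hom:
  assumes bs: "set bs \<subseteq> arcs Q"
  shows "costep bs \<in> graded_hom Q I (IB s bs) (IB (s - 1) (map snd (prev_arrows bs)))"
proof (rule graded_homI)
  let ?ps = "prev_arrows bs"
  obtain c where "graded_mod Q S I (IB s bs) c" using graded_mod_IB[OF bs] by blast
  then interpret B: graded_mod Q S I "IB s bs" c .
  obtain c' where "graded_mod Q S I (IB (s - 1) (map snd ?ps)) c'" using graded_mod_IB[OF next_arrows_arcs] by blast
  then interpret C: graded_mod Q S I "IB (s - 1) (map snd ?ps)" c' .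
  show cl: "costep bs \<phi> \<in> carrier (IB (s - 1) (map snd ?ps))" if "\<phi> \<in> carrier (IB s bs)" for \<phi>
    by (rule costep_closed[OF that])
  fix \<phi> assume \<phi>: "\<phi> \<in> carrier (IB s bs)"
  {
    fix \<psi> assume \<psi>: "\<psi> \<in> carrier (IB s bs)"
    show "costep bs (\<phi> \<oplus>\<^bsub>IB s bs\<^esub> \<psi>) = costep bs \<phi> \<oplus>\<^bsub>IB (s - 1) (map snd ?ps)\<^esub> costep bs \<psi>"
    proof (rule IB_eqI[OF cl[OF B.M.M.a_closed[OF \<phi> \<psi>]] C.M.M.a_closed[OF cl[OF \<phi>] cl[OF \<psi>]] next_arrows_arcs])
      fix k X assume k: "k < length (map snd ?ps)" and X: "X \<in> eA (tail Q (map snd ?ps ! k))"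
      then have k': "k < length ?ps" and X': "X \<in> eA (tail Q (snd (?ps ! k)))" by simp_all
      show "costep bs (\<phi> \<oplus>\<^bsub>IB s bs\<^esub> \<psi>) k X = (costep bs \<phi> \<oplus>\<^bsub>IB (s - 1) (map snd ?ps)\<^esub> costep bs \<psi>) k X"
        using k' X' prev_nth(1)[OF k'] prev_ar_eA[OF k' X'] by (simp add: costep_nth IB_ops(1))
    qed
  }
  fix a assume a: "a \<in> carrier A"
  show "costep bs (a \<odot>\<^bsub>IB s bs\<^esub> \<phi>) = a \<odot>\<^bsub>IB (s - 1) (map snd ?ps)\<^esub> costep bs \<phi>"
  proof (rule IB_eqI[OF cl[OF B.M.smult_closed[OF a \<phi>]] C.M.smult_closed[OF a cl[OF \<phi>]] next_arrows_arcs])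
    fix k X assume k: "k < length (map snd ?ps)" and X: "X \<in> eA (tail Q (map snd ?ps ! k))"
    then have k': "k < length ?ps" and X': "X \<in> eA (tail Q (snd (?ps ! k)))" by simp_all
    note P = prev_nth[OF k']
    have "ar (snd (?ps ! k)) \<star> X \<star> a = ar (snd (?ps ! k)) \<star> (X \<star> a)"
      using eA_closed(8)[OF P(4) X'] P(3) a by (simp add: A.m_assoc)
    then show "costep bs (a \<odot>\<^bsub>IB s bs\<^esub> \<phi>) k X = (a \<odot>\<^bsub>IB (s - 1) (map snd ?ps)\<^esub> costep bs \<phi>) k X"
      using k' X' P(1) prev_ar_eA[OF k' X'] eA_closed(3)[OF P(4) X' a] by (simp add: costep_nth IB_ops(2))
  qed
next
  let ?ps = "prev_arrows bs"
  fix \<phi> n assume \<phi>: "\<phi> \<in> hcomp (IB s bs) n"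
  show "costep bs \<phi> \<in> hcomp (IB (s - 1) (map snd ?ps)) n"
    unfolding IB_hcomp costep_def length_map
  proof (rule restrict_PiE_iff[THEN iffD2], rule ballI)
    fix k assume "k \<in> {..<length ?ps}"
    then have k: "k < length ?ps" by simp
    note P = prev_nth[OF k]
    have shift_eq: "n - (s - 1) = n - s + 1" by simp
    have "\<phi> (fst (?ps ! k)) \<in> hcomp (In (tail Q (bs ! fst (?ps ! k)))) (n - s)"
      using \<phi> P(1) by (auto simp: IB_hcomp PiE_iff)
    then have h: "\<phi> (fst (?ps ! k)) \<in> hcomp (In (head Q (snd (?ps ! k)))) (n - s)"
      using P(2) by (simp add: zr_def)
    then have "\<phi> (fst (?ps ! k)) \<in> DF (head Q (snd (?ps ! k)))" by (simp add: In_hcomp)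
    from DF_ar(2)[OF P(3) this h]
    show "(\<lambda>X\<in>eA (tail Q (snd (?ps ! k))). \<phi> (fst (?ps ! k)) (ar (snd (?ps ! k)) \<star> X))
       \<in> hcomp (In (tail Q (map snd ?ps ! k))) (n - (s - 1))"
      unfolding shift_eq using k by simp
  qed
qed

lemma costep_kernel:
  assumes bs: "set bs \<subseteq> arcs Q"
  shows "a_kernel (IB s bs) (IB s' (map snd (prev_arrows bs))) (costep bs) = vanishing bs"
proof (rule equalityI; rule subsetI)
  let ?ps = "prev_arrows bs"
  fix \<phi> assume "\<phi> \<in> a_kernel (IB s bs) (IB s' (map snd ?ps)) (costep bs)"
  then have \<phi>: "\<phi> \<in> carrier (IB s bs)" and z: "costep bs \<phi> = \<zero>\<^bsub>IB s' (map snd ?ps)\<^esub>" by (simp_all add: a_kernel_iff)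
  have "\<phi> i (ar g \<star> X) = 0" if i: "i < length bs" and g: "zr g (bs ! i)" and X: "X \<in> eA (tail Q g)" for i g X
  proof -
    have "g \<in> {g \<in> arcs Q. zr g (bs ! i)}" using g zr_arcs by blast
    then obtain k where k: "k \<in> fibre ?ps i" "g = snd (?ps ! k)" unfolding fibre_image[OF i, where R = "\<lambda>b g. zr g b", symmetric] by blast
    then have k': "k < length ?ps" "fst (?ps ! k) = i" by (simp_all add: fibre_def)
    have "costep bs \<phi> k X = 0" using k' X k(2) by (simp add: z IB_ops(3))
    then show ?thesis using costep_nth[OF k'(1), of X \<phi>] X k(2) k'(2) by simp
  qed
  then show "\<phi> \<in> vanishing bs" using \<phi> by (simp add: vanishing_def IB_carrier)
next
  let ?ps = "prev_arrows bs"
  fix \<phi> assume \<phi>: "\<phi> \<in> vanishing bs"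
  then have c: "\<phi> \<in> carrier (IB s bs)" by (simp add: vanishing_def IB_carrier)
  obtain c' where "graded_mod Q S I (IB s' (map snd ?ps)) c'" using graded_mod_IB[OF next_arrows_arcs] by blast
  then interpret C: graded_mod Q S I "IB s' (map snd ?ps)" c' .
  have "costep bs \<phi> = \<zero>\<^bsub>IB s' (map snd ?ps)\<^esub>"
  proof (rule IB_eqI[OF costep_closed[OF c] C.M.M.zero_closed next_arrows_arcs])
    fix k X assume k: "k < length (map snd ?ps)" and X: "X \<in> eA (tail Q (map snd ?ps ! k))"
    then have k': "k < length ?ps" and X': "X \<in> eA (tail Q (snd (?ps ! k)))" by simp_all
    have "\<phi> (fst (?ps ! k)) (ar (snd (?ps ! k)) \<star> X) = 0"
      using \<phi> prev_nth(1,2)[OF k'] X' unfolding vanishing_def by blast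
    then show "costep bs \<phi> k X = \<zero>\<^bsub>IB s' (map snd ?ps)\<^esub> k X"
      using k' X' by (simp add: costep_nth IB_ops(3))
  qed
  then show "\<phi> \<in> a_kernel (IB s bs) (IB s' (map snd ?ps)) (costep bs)" using c by (simp add: a_kernel_iff)
qed

text \<open>A functional that vanishes on \<open>bY\<close> whenever \<open>ab = 0\<close> does not see the difference
  between \<open>X\<close> and what remains of \<open>aX\<close> after stripping \<open>a\<close>: by \<open>ann_left\<close> that difference,
  being killed by \<open>a\<close>, is a combination of such elements.\<close>

lemma vanishing_ls_ar:
  assumes a: "a \<in> arcs Q" and \<phi>: "\<phi> \<in> DF (tail Q a)" and X: "X \<in> eA (tail Q a)"
    and z: "\<And>b Y. zr b a \<Longrightarrow> Y \<in> eA (tail Q b) \<Longrightarrow> \<phi> (ar b \<star> Y) = 0"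
  shows "\<phi> (ls a (ar a \<star> X)) = \<phi> X"
proof -
  have t: "tail Q a \<in> verts Q" using a by simp
  have Xc: "X \<in> carrier A" by (rule eA_closed(8)[OF t X])
  let ?Z = "ls a (ar a \<star> X)"
  let ?Y = "X \<oplus>\<^bsub>A\<^esub> \<ominus>\<^bsub>A\<^esub> ?Z"
  have Z: "?Z \<in> eA (tail Q a)" using ls_eA[OF a] Xc a by simp
  have Zc: "?Z \<in> carrier A" by (rule eA_closed(8)[OF t Z])
  have Y: "?Y \<in> eA (tail Q a)" using X Z by (simp add: eA_closed(2,5)[OF t])
  then have Yc: "?Y \<in> carrier A" "e (tail Q a) \<star> ?Y = ?Y" by (simp_all only: eA_iff[OF t])
  have aX: "ar a \<star> X \<in> carrier A" using a Xc by simp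
  have "ar a \<star> ?Y = ar a \<star> X \<oplus>\<^bsub>A\<^esub> \<ominus>\<^bsub>A\<^esub> (ar a \<star> ?Z)"
    using a Xc Zc by (simp add: A.r_distr A.r_minus)
  also have "\<dots> = \<zero>\<^bsub>A\<^esub>" unfolding ar_ls_ar[OF Xc a] by (rule A.r_neg[OF aX])
  finally have aY: "ar a \<star> ?Y = \<zero>\<^bsub>A\<^esub>" .
  have S: "ar b \<star> ls b ?Y \<in> eA (tail Q a)" if b: "zr b a" for b
    using ar_mult_eA[OF zr_arcs(2)[OF b] ls_eA[OF zr_arcs(2)[OF b] Yc(1)]] b by (simp add: zr_def)
  have "\<phi> ?Y = \<phi> (\<Oplus>\<^bsub>A\<^esub>b\<in>{b. zr b a}. ar b \<star> ls b ?Y)"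
    by (rule arg_cong[OF ann_left[OF Yc(1) a Yc(2) aY]])
  also have "\<dots> = (\<Sum>b\<in>{b. zr b a}. \<phi> (ar b \<star> ls b ?Y))"
    by (rule DF_finsum[OF t \<phi> _ finite_zr(1), THEN conjunct1]) (rule S, simp)
  also have "\<dots> = 0"
    by (rule sum.neutral) (use z[OF _ ls_eA[OF zr_arcs(2) Yc(1)]] in blast)
  finally have "\<phi> ?Y = 0" .
  moreover have "\<phi> ?Y = \<phi> X - \<phi> ?Z"
    using DFD(2)[OF t \<phi> X eA_closed(5)[OF t Z]] DF_minus[OF t \<phi> Z] by simp
  ultimately show ?thesis by simp
qed

lemma DF_ls:
  assumes a: "a \<in> arcs Q" and x: "x \<in> verts Q" and \<phi>: "\<phi> \<in> DF (tail Q a)"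
  shows "(\<lambda>X\<in>eA x. \<phi> (ls a X)) \<in> DF x"
proof (rule DF_compose(1)[OF x _ \<phi>])
  show "tail Q a \<in> verts Q" using a by simp
  note c = eA_closed(8)[OF x]
  show "ls a X \<in> eA (tail Q a)" if "X \<in> eA x" for X by (rule ls_eA[OF a c[OF that]])
  show "ls a (X \<oplus>\<^bsub>A\<^esub> Y) = ls a X \<oplus>\<^bsub>A\<^esub> ls a Y" if "X \<in> eA x" "Y \<in> eA x" for X Y
    by (rule ls_add[OF c[OF that(1)] c[OF that(2)]])
  show "ls a (sc k \<star> X) = sc k \<star> ls a X" if "X \<in> eA x" for k X by (rule ls_sc[OF c[OF that]])
  show "ls a X \<in> dg (n + - 1)" if "X \<in> dg n" for n X using ls_deg[OF that, of a] by simp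
qed

text \<open>To extend a vanishing family, compose with cancelling an arrow and add up; the summand belonging to
  another arrow contributes nothing, and \<open>vanishing_ls_ar\<close> evaluates the remaining one.\<close>

lemma costep_image:
  assumes bs: "set bs \<subseteq> arcs Q"
  shows "costep bs ` carrier (IB s bs) = vanishing (map snd (prev_arrows bs))"
proof (rule equalityI; rule subsetI)
  let ?ps = "prev_arrows bs"
  fix \<psi> assume "\<psi> \<in> costep bs ` carrier (IB s bs)"
  then obtain \<phi> where \<phi>: "\<phi> \<in> carrier (IB s bs)" "\<psi> = costep bs \<phi>" by blast
  have "\<psi> k (ar g \<star> X) = 0"
    if k: "k < length (map snd ?ps)" and g: "zr g (map snd ?ps ! k)" and X: "X \<in> eA (tail Q g)" for k g X
  proof -
    have k': "k < length ?ps" and g': "zr g (snd (?ps ! k))" using k g by simp_all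
    note P = prev_nth[OF k']
    have t: "tail Q g \<in> verts Q" using zr_arcs(2)[OF g'] by simp
    have Xc: "X \<in> carrier A" by (rule eA_closed(8)[OF t X])
    have gX: "ar g \<star> X \<in> eA (tail Q (snd (?ps ! k)))"
      using ar_mult_eA[OF zr_arcs(2)[OF g'] X] g' by (simp add: zr_def)
    have "ar (snd (?ps ! k)) \<star> (ar g \<star> X) = \<zero>\<^bsub>A\<^esub>"
      using A.m_assoc[of "ar (snd (?ps ! k))" "ar g" X] P(3) zr_arcs(2)[OF g'] Xc zr_zero[OF g'] by simp
    moreover have "tail Q (bs ! fst (?ps ! k)) \<in> verts Q" using P(1) bs by (auto simp: subset_iff)
    ultimately show ?thesis
      using costep_nth[OF k' gX, of \<phi>] DF_zero[OF _ IB_summand[OF \<phi>(1) P(1)]] by (simp add: \<phi>(2))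
  qed
  then show "\<psi> \<in> vanishing (map snd ?ps)"
    using costep_closed[OF \<phi>(1)] by (simp add: vanishing_def IB_carrier \<phi>(2) del: length_map nth_map)
next
  let ?ps = "prev_arrows bs"
  fix \<psi> assume \<psi>: "\<psi> \<in> vanishing (map snd ?ps)"
  then have \<psi>c: "\<psi> \<in> carrier (IB s (map snd ?ps))" by (simp add: vanishing_def IB_carrier)
  have \<psi>k: "\<psi> k \<in> DF (tail Q (snd (?ps ! k)))" if "k < length ?ps" for k
    using IB_summand[OF \<psi>c, of k] that by simp
  let ?F = "\<lambda>i k. \<lambda>X\<in>eA (tail Q (bs ! i)). \<psi> k (ls (snd (?ps ! k)) X)"
  let ?\<phi> = "\<lambda>i\<in>{..<length bs}. \<Oplus>\<^bsub>In (tail Q (bs ! i))\<^esub>k\<in>fibre ?ps i. ?F i k"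
  have b: "tail Q (bs ! i) \<in> verts Q" if "i < length bs" for i using that bs by (auto simp: subset_iff)
  have F: "?F i k \<in> DF (tail Q (bs ! i))" if i: "i < length bs" and k: "k \<in> fibre ?ps i" for i k
    by (rule DF_ls[OF fibre_next(4)[OF k] b[OF i] \<psi>k[OF fibre_next(1)[OF k]]])
  have \<phi>: "?\<phi> \<in> carrier (IB s bs)"
    unfolding IB_carrier
  proof (rule restrict_PiE_iff[THEN iffD2], rule ballI)
    fix i assume "i \<in> {..<length bs}"
    then have i: "i < length bs" by simp
    have "(\<Oplus>\<^bsub>In (tail Q (bs ! i))\<^esub>k\<in>fibre ?ps i. ?F i k) \<in> carrier (In (tail Q (bs ! i)))"
      by (rule abelian_monoid.finsum_closed[OF abelian_group.axioms(1)[OF In_abelian[OF b[OF i]]]])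
        (use F[OF i] in simp)
    then show "(\<Oplus>\<^bsub>In (tail Q (bs ! i))\<^esub>k\<in>fibre ?ps i. ?F i k) \<in> DF (tail Q (bs ! i))" by simp
  qed
  have "costep bs ?\<phi> = \<psi>"
  proof (rule IB_eqI[OF costep_closed[OF \<phi>] \<psi>c next_arrows_arcs])
    fix k X assume k: "k < length (map snd ?ps)" and X: "X \<in> eA (tail Q (map snd ?ps ! k))"
    then have k': "k < length ?ps" and X': "X \<in> eA (tail Q (snd (?ps ! k)))" by simp_all
    note P = prev_nth[OF k']
    let ?i = "fst (?ps ! k)" and ?g = "snd (?ps ! k)"
    have Xc: "X \<in> carrier A" by (rule eA_closed(8)[OF P(4) X'])
    note gX = prev_ar_eA[OF k' X']
    note kf = fibre_self[OF k']
    have "costep bs ?\<phi> k X = (\<Oplus>\<^bsub>In (tail Q (bs ! ?i))\<^esub>l\<in>fibre ?ps ?i. ?F ?i l) (ar ?g \<star> X)"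
      using costep_nth[OF k' X', of ?\<phi>] P(1) by simp
    also have "\<dots> = (\<Sum>l\<in>fibre ?ps ?i. ?F ?i l (ar ?g \<star> X))"
      by (rule In_finsum[OF b[OF P(1)] finite_fibre F[OF P(1)] gX])
    also have "\<dots> = (\<Sum>l\<in>{k}. ?F ?i l (ar ?g \<star> X))"
    proof (rule sum.mono_neutral_right[OF finite_fibre])
      show "{k} \<subseteq> fibre ?ps ?i" using kf by simp
      show "\<forall>l\<in>fibre ?ps ?i - {k}. ?F ?i l (ar ?g \<star> X) = 0"
      proof
        fix l assume l: "l \<in> fibre ?ps ?i - {k}"
        then have lf: "l \<in> fibre ?ps ?i" by simp
        have "?g \<noteq> snd (?ps ! l)" using inj_onD[OF fibre_inj _ kf lf] l by blast
        then have "ls (snd (?ps ! l)) (ar ?g \<star> X) = \<zero>\<^bsub>A\<^esub>" by (intro ls_ar_other Xc P(3))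
        then show "?F ?i l (ar ?g \<star> X) = 0"
          using gX DF_zero[OF prev_nth(4) \<psi>k, OF fibre_next(1)[OF lf] fibre_next(1)[OF lf]] by simp
      qed
    qed
    also have "\<dots> = \<psi> k (ls ?g (ar ?g \<star> X))" using gX by simp
    also have "\<dots> = \<psi> k X"
    proof (rule vanishing_ls_ar[OF P(3) \<psi>k[OF k'] X'])
      fix b Y assume z: "zr b ?g" and Y: "Y \<in> eA (tail Q b)"
      have "zr b (map snd ?ps ! k)" using z k' by simp
      then show "\<psi> k (ar b \<star> Y) = 0" using \<psi> k Y unfolding vanishing_def by blast
    qed
    finally show "costep bs ?\<phi> k X = \<psi> k X" .
  qed
  then show "\<psi> \<in> costep bs ` carrier (IB s bs)" using imageI[OF \<phi>, of "costep bs"] by simp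
qed

lemma cokoszulI:
  assumes bs: "set bs \<subseteq> arcs Q" and \<iota>: "\<iota> \<in> graded_hom Q I M (IB 0 bs)"
    and inj: "inj_on \<iota> (carrier M)" and im: "\<iota> ` carrier M = vanishing bs"
    and bound: "\<And>l. set l \<subseteq> arcs Q \<Longrightarrow> successively zr l \<Longrightarrow> length l < N"
  shows "cokoszul Q I M"
proof -
  let ?R = "\<lambda>b g. zr g b"
  let ?st = "stage ?R bs"
  let ?xs = "\<lambda>n. map (tail Q) (?st n)"
  have P: "injective_sum Q I (map (\<lambda>x. (x, - int n)) (?xs n)) = IB (- int n) (?st n)" for n
    by (simp add: comp_def IB_def)
  have arcs: "set (?st n) \<subseteq> arcs Q" for n by (rule stage_arcs[OF bs])
  have empty: "?st n = []" if "n \<ge> N" for n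
  proof (rule stage_empty[OF bs _ that])
    fix l assume "set l \<subseteq> arcs Q" "successively ?R l"
    then show "length l < N" using bound[of "rev l"] by (simp add: successively_rev)
  qed
  show ?thesis
    unfolding cokoszul_def Let_def
  proof (intro exI[where x = ?xs] exI[where x = "\<lambda>n. costep (?st n)"] exI[where x = \<iota>] conjI, unfold P)
    show "\<forall>n. set (?xs n) \<subseteq> verts Q" using arcs by (auto simp: subset_iff)
    show "\<exists>N. \<forall>n\<ge>N. ?xs n = []" using empty by (intro exI[where x = N]) simp
    show "\<iota> \<in> graded_hom Q I M (IB (- int 0) (?st 0))" using \<iota> by simp
    show "\<forall>n. costep (?st n) \<in> graded_hom Q I (IB (- int n) (?st n)) (IB (- int (Suc n)) (?st (Suc n)))"
    proof
      fix n
      have eq: "- int (Suc n) = - int n - 1" by simp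
      show "costep (?st n) \<in> graded_hom Q I (IB (- int n) (?st n)) (IB (- int (Suc n)) (?st (Suc n)))"
        unfolding eq stage.simps by (rule costep_hom[OF arcs])
    qed
    show "inj_on \<iota> (carrier M)" by (rule inj)
    show "\<iota> ` carrier M = a_kernel (IB (- int 0) (?st 0)) (IB (- int 1) (?st 1)) (costep (?st 0))"
      using costep_kernel[OF bs, of "- int 0" "- int 1"] im by simp
    show "\<forall>n. costep (?st n) ` carrier (IB (- int n) (?st n)) =
        a_kernel (IB (- int (Suc n)) (?st (Suc n))) (IB (- int (Suc (Suc n))) (?st (Suc (Suc n)))) (costep (?st (Suc n)))"
    proof
      fix n
      show "costep (?st n) ` carrier (IB (- int n) (?st n)) =
        a_kernel (IB (- int (Suc n)) (?st (Suc n))) (IB (- int (Suc (Suc n))) (?st (Suc (Suc n)))) (costep (?st (Suc n)))"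
        using costep_image[OF arcs[of n], of "- int n"]
          costep_kernel[OF arcs[of "Suc n"], of "- int (Suc n)" "- int (Suc (Suc n))"] by simp
    qed
  qed
qed

end

section \<open>Truncations of finitely copresented modules are colinear\<close>

context quadratic_monomial
begin

lemma DF_eq_degrees:
  assumes x: "x \<in> verts Q" and \<phi>: "\<phi> \<in> DF x" and \<psi>: "\<psi> \<in> DF x"
    and eq: "\<And>l X. X \<in> eA x \<Longrightarrow> X \<in> dg (int l) \<Longrightarrow> \<phi> X = \<psi> X"
  shows "\<phi> = \<psi>"
proof (rule DF_eqI[OF x \<phi> \<psi>])
  fix X assume X: "X \<in> eA x"
  note Xc = eA_closed(8)[OF x X]
  have "\<phi> (pr n X) = \<psi> (pr n X)" for n
  proof (cases "n < 0")
    case True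
    then show ?thesis using dg_neg[OF pr_deg[OF Xc]] DF_zero[OF x \<phi>] DF_zero[OF x \<psi>] by simp
  next
    case False
    then show ?thesis using eq[OF eA_closed(6)[OF x X], of n "nat n"] pr_deg[OF Xc, of n] by simp
  qed
  then show "\<phi> X = \<psi> X" unfolding DF_pr_sum[OF x \<phi> X] DF_pr_sum[OF x \<psi> X] by simp
qed

lemma vanishing_smult:
  assumes bs: "set bs \<subseteq> arcs Q" and a: "a \<in> carrier A" and \<phi>: "\<phi> \<in> vanishing bs"
  shows "a \<odot>\<^bsub>IB s bs\<^esub> \<phi> \<in> vanishing bs"
proof -
  obtain c where "graded_mod Q S I (IB s bs) c" using graded_mod_IB[OF bs] by blast
  then interpret B: graded_mod Q S I "IB s bs" c .
  have "\<phi> \<in> carrier (IB s bs)" using \<phi> by (simp add: vanishing_def IB_carrier)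
  then have cl: "a \<odot>\<^bsub>IB s bs\<^esub> \<phi> \<in> carrier (IB s bs)" by (rule B.M.smult_closed[OF a])
  have "(a \<odot>\<^bsub>IB s bs\<^esub> \<phi>) i (ar g \<star> X) = 0"
    if i: "i < length bs" and z: "zr g (bs ! i)" and X: "X \<in> eA (tail Q g)" for i g X
  proof -
    note g = zr_arcs(2)[OF z]
    have t: "tail Q g \<in> verts Q" using g by simp
    have gX: "ar g \<star> X \<in> eA (tail Q (bs ! i))" using ar_mult_eA[OF g X] z by (simp add: zr_def)
    have "\<phi> i (ar g \<star> (X \<star> a)) = 0"
      using \<phi> i z eA_closed(3)[OF t X a] unfolding vanishing_def by blast
    then show ?thesis using i gX g a eA_closed(8)[OF t X] by (simp add: IB_ops(2) A.m_assoc)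
  qed
  then show ?thesis using cl by (simp add: vanishing_def IB_carrier)
qed

end

context graded_mod
begin

lemma arrows_glue:
  assumes sep: "arrows_separate M n" and w: "\<And>a. a \<in> arcs Q \<Longrightarrow> w a \<in> hcomp M n"
  obtains u where "u \<in> hcomp M n" "\<And>a. a \<in> arcs Q \<Longrightarrow> ar a \<odot> u = ar a \<odot> w a"
proof -
  have "\<forall>a\<in>arcs Q. \<exists>m. m \<in> hcomp M n \<and> ar a \<odot> m = ar a \<odot> w a \<and>
      (\<forall>b\<in>arcs Q. b \<noteq> a \<longrightarrow> ar b \<odot> m = \<zero>)"
    using sep w unfolding arrows_separate_def by blast
  then obtain m where m: "\<forall>a\<in>arcs Q. m a \<in> hcomp M n \<and> ar a \<odot> m a = ar a \<odot> w a \<and>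
      (\<forall>b\<in>arcs Q. b \<noteq> a \<longrightarrow> ar b \<odot> m a = \<zero>)" by (rule bchoice[THEN exE])
  have mc: "m a \<in> carrier M" if "a \<in> arcs Q" for a using m that hc_closed by blast
  let ?u = "\<Oplus>b\<in>arcs Q. m b"
  have "ar a \<odot> ?u = ar a \<odot> w a" if a: "a \<in> arcs Q" for a
  proof -
    have "ar a \<odot> ?u = (\<Oplus>b\<in>arcs Q. ar a \<odot> m b)"
      by (rule M.smult_r_finsum[OF ar_closed[OF a]]) (rule mc)
    also have "\<dots> = ar a \<odot> m a"
    proof (rule M.M.finsum_only[OF finite_arcs a])
      show "ar a \<odot> m a \<in> carrier M" by (rule M.smult_closed[OF ar_closed[OF a] mc[OF a]])
      show "ar a \<odot> m b = \<zero>" if "b \<in> arcs Q" "b \<noteq> a" for b using m that a by metis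
    qed
    finally show ?thesis using m a by simp
  qed
  moreover have "?u \<in> hcomp M n" by (rule hc_finsum) (use m in blast)
  ultimately show ?thesis by (rule that[rotated])
qed

end

context arrow_basis
begin

lemma B_carrier: "a \<in> arcs Q \<Longrightarrow> B a \<subseteq> carrier M"
  using subset_trans[OF B_sub] hc_closed M.smult_closed[OF ar_closed] by (metis image_subsetI)

lemma lin_unique:
  assumes a: "a \<in> arcs Q" and eq: "lin (B a) c = lin (B a) c'" and b: "b \<in> B a"
  shows "c b = c' b"
proof -
  note BM = B_carrier[OF a]
  have *: "lin (B a) (\<lambda>b. c b + - 1 * f b) = lin (B a) c \<oplus> sc (- 1) \<odot> lin (B a) f" for f
    using lin_add[OF BM, of c "\<lambda>b. - 1 * f b"] lin_scale[OF BM, of "- 1" f] by simp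
  have "lin (B a) (\<lambda>b. c b + - 1 * c' b) = lin (B a) (\<lambda>b. c b + - 1 * c b)" unfolding * eq ..
  also have "\<dots> = lin (B a) (\<lambda>b. 0 * c b)" by (rule arg_cong[where f = "lin (B a)"]) simp
  also have "\<dots> = \<zero>" unfolding lin_scale[OF BM] by (rule sc_zero_smult[OF lin_closed[OF BM]])
  finally have "c b + - 1 * c' b = 0" by (rule B_indep[OF a _ b])
  then show ?thesis by simp
qed

text \<open>Functionals on the component \<open>d - 1\<close>: the coordinate of \<open>b\<^sub>j u\<close> with respect to \<open>v j\<close>.  There the
  coefficients exist and are unique, elsewhere the value is arbitrary.\<close>

definition coord :: "nat \<Rightarrow> 'm \<Rightarrow> 'k" where
  "coord j u = (SOME c. ar (bt j) \<odot> u = lin (B (bt j)) c) (v j)"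

lemma coord_eq:
  assumes j: "j < r" and eq: "ar (bt j) \<odot> u = lin (B (bt j)) c"
  shows "coord j u = c (v j)"
  unfolding coord_def
proof (rule lin_unique[OF gs_nth(1)[OF j] _ gs_nth(2)[OF j]])
  show "lin (B (bt j)) (SOME c. ar (bt j) \<odot> u = lin (B (bt j)) c) = lin (B (bt j)) c"
    using someI[where P = "\<lambda>c. ar (bt j) \<odot> u = lin (B (bt j)) c", OF eq] eq by simp
qed

lemma coord_cong: "ar (bt j) \<odot> u = ar (bt j) \<odot> u' \<Longrightarrow> coord j u = coord j u'"
  by (simp add: coord_def)

lemma arrow_lin:
  assumes "a \<in> arcs Q" "u \<in> hcomp M (d - 1)"
  obtains c where "ar a \<odot> u = lin (B a) c"
  using B_span[OF assms(1)] assms(2) unfolding spn_def by blast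

lemma coord_add:
  assumes j: "j < r" and u: "u \<in> hcomp M (d - 1)" "u' \<in> hcomp M (d - 1)"
  shows "coord j (u \<oplus> u') = coord j u + coord j u'"
proof -
  note b = gs_nth(1)[OF j]
  obtain c where c: "ar (bt j) \<odot> u = lin (B (bt j)) c" by (rule arrow_lin[OF b u(1)])
  obtain c' where c': "ar (bt j) \<odot> u' = lin (B (bt j)) c'" by (rule arrow_lin[OF b u(2)])
  have "ar (bt j) \<odot> (u \<oplus> u') = lin (B (bt j)) (\<lambda>b. c b + c' b)"
    using hc_closed[OF u(1)] hc_closed[OF u(2)] b by (simp add: M.smult_r_distr c c' lin_add[OF B_carrier])
  then show ?thesis using coord_eq[OF j c] coord_eq[OF j c'] coord_eq[OF j] by simp
qed

lemma ar_sc_smult: "a \<in> arcs Q \<Longrightarrow> u \<in> carrier M \<Longrightarrow> ar a \<odot> (sc k \<odot> u) = sc k \<odot> (ar a \<odot> u)"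
  using M.smult_assoc[of "ar a" "sc k" u] M.smult_assoc[of "sc k" "ar a" u] sc_commute[of "ar a" k] by simp

lemma coord_sc:
  assumes j: "j < r" and u: "u \<in> hcomp M (d - 1)"
  shows "coord j (sc k \<odot> u) = k * coord j u"
proof -
  note b = gs_nth(1)[OF j]
  obtain c where c: "ar (bt j) \<odot> u = lin (B (bt j)) c" by (rule arrow_lin[OF b u])
  have "ar (bt j) \<odot> (sc k \<odot> u) = lin (B (bt j)) (\<lambda>b. k * c b)"
    unfolding ar_sc_smult[OF b hc_closed[OF u]] c by (rule lin_scale[OF B_carrier[OF b], symmetric])
  then show ?thesis using coord_eq[OF j c] coord_eq[OF j] by simp
qed

lemma coord_zero: "j < r \<Longrightarrow> coord j \<zero> = 0"
  using coord_sc[OF _ hc_zero, of j 0] sc_zero_smult[OF M.M.zero_closed] by simp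

lemma coord_finsum:
  assumes j: "j < r" and f: "\<And>t. t \<in> T \<Longrightarrow> f t \<in> hcomp M (d - 1)"
  shows "coord j (\<Oplus>t\<in>T. f t) = (\<Sum>t\<in>T. coord j (f t))"
  using f
proof (induction T rule: infinite_finite_induct)
  case (insert t T)
  then have "f \<in> T \<rightarrow> carrier M" "f t \<in> carrier M" using hc_closed by auto
  moreover have "(\<Oplus>t\<in>T. f t) \<in> hcomp M (d - 1)" by (rule hc_finsum) (simp add: insert.prems)
  ultimately show ?case using insert by (simp add: M.M.finsum_insert coord_add[OF j])
qed (simp_all add: coord_zero[OF j])

lemma coord_e:
  assumes j: "j < r" and u: "u \<in> carrier M"
  shows "coord j (e (tail Q (bt j)) \<odot> u) = coord j u"
  by (rule coord_cong)
    (use M.smult_assoc[of "ar (bt j)" "e (tail Q (bt j))" u] gs_nth(1)[OF j] u in \<open>simp add: ar_e_tail\<close>)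

lemma arrow_zero_coord:
  assumes a: "a \<in> arcs Q" and u: "u \<in> hcomp M (d - 1)" and z: "\<And>j. j < r \<Longrightarrow> bt j = a \<Longrightarrow> coord j u = 0"
  shows "ar a \<odot> u = \<zero>"
proof -
  obtain c where c: "ar a \<odot> u = lin (B a) c" by (rule arrow_lin[OF a u])
  have "lin (B a) c = (\<Oplus>b\<in>B a. \<zero>)"
    unfolding lin_def
  proof (rule M.M.finsum_cong'[OF refl])
    fix b assume b: "b \<in> B a"
    then obtain j where j: "j < r" "gs ! j = (a, b)" using gs_index[OF a] by blast
    have "c b = 0" using coord_eq[OF j(1), of u c] z[OF j(1)] j(2) c by simp
    then show "sc (c b) \<odot> b = \<zero>" using sc_zero_smult[OF subsetD[OF B_carrier[OF a] b]] by simp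
  qed simp
  then show ?thesis by (simp add: c)
qed

text \<open>Prescribed coordinates are realised separately for each arrow and then glued.\<close>

lemma coord_surj:
  assumes sep: "arrows_separate M (d - 1)"
  shows "\<exists>u\<in>hcomp M (d - 1). \<forall>j<r. coord j u = c j"
proof -
  obtain C where C: "\<And>j. j < r \<Longrightarrow> C (bt j) (v j) = c j" by (rule coefficients_of_family[of c]) blast
  have "\<forall>a\<in>arcs Q. \<exists>y. y \<in> hcomp M (d - 1) \<and> lin (B a) (C a) = ar a \<odot> y" using lin_in_image by blast
  then obtain y where y: "\<forall>a\<in>arcs Q. y a \<in> hcomp M (d - 1) \<and> lin (B a) (C a) = ar a \<odot> y a"
    by (rule bchoice[THEN exE])
  obtain u where u: "u \<in> hcomp M (d - 1)" "\<And>a. a \<in> arcs Q \<Longrightarrow> ar a \<odot> u = ar a \<odot> y a"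
    by (rule arrows_glue[OF sep, of y]) (use y in blast)+
  have "coord j u = c j" if j: "j < r" for j
  proof -
    have "ar (bt j) \<odot> u = lin (B (bt j)) (C (bt j))" using u(2)[OF gs_nth(1)[OF j]] y gs_nth(1)[OF j] by simp
    from coord_eq[OF j this] show ?thesis using C[OF j] by simp
  qed
  then show ?thesis using u(1) by blast
qed

text \<open>The image of \<open>m\<close> under the adjunction that turns the functionals \<open>coord j\<close> on the component \<open>d - 1\<close>
  into maps of graded modules to injective ones.\<close>

definition envelope :: "'m \<Rightarrow> nat \<Rightarrow> (('v, 'e) qpath \<Rightarrow> 'k) set \<Rightarrow> 'k" where
  "envelope m = (\<lambda>j\<in>{..<r}. \<lambda>X\<in>eA (tail Q (bt j)). coord j (cmp (d - 1) (X \<odot> m)))"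

lemma tail_bt: "j < r \<Longrightarrow> tail Q (bt j) \<in> verts Q"
  using gs_nth(1) by simp

lemma envelope_degree:
  assumes "m \<in> carrier M" "j < r" "X \<in> eA (tail Q (bt j))" "X \<in> dg n"
  shows "envelope m j X = coord j (X \<odot> cmp (d - 1 - n) m)"
  using cmp_smult[OF assms(4,1), of "d - 1 - n"] assms(2,3) by (simp add: envelope_def)

lemma IB_bs_carrier: "carrier (IB s bs) = (\<Pi>\<^sub>E j\<in>{..<r}. DF (tail Q (bt j)))"
  by (auto simp: IB_carrier intro!: PiE_cong)

lemma envelope_DF:
  assumes m: "m \<in> carrier M" and j: "j < r"
  shows "envelope m j \<in> DF (tail Q (bt j))"
proof -
  note t = tail_bt[OF j]
  note Xc = eA_closed(8)[OF t]
  obtain N where N: "finite N" "\<forall>n. n \<notin> N \<longrightarrow> cmp n m = \<zero>" using cmp_sum[OF m] by blast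
  obtain l where l: "\<And>n. n \<in> N \<Longrightarrow> l \<le> n" using bdd_below_finite[OF N(1)] unfolding bdd_below_def by blast
  show ?thesis
  proof (rule DFI[OF t, where d = "d - 1 - l"])
    show "envelope m j \<in> extensional (eA (tail Q (bt j)))" using j by (simp add: envelope_def)
    fix X assume X: "X \<in> eA (tail Q (bt j))"
    note hX = cmp_hc[OF M.smult_closed[OF Xc[OF X] m], of "d - 1"]
    {
      fix Y assume Y: "Y \<in> eA (tail Q (bt j))"
      note hY = cmp_hc[OF M.smult_closed[OF Xc[OF Y] m], of "d - 1"]
      show "envelope m j (X \<oplus>\<^bsub>A\<^esub> Y) = envelope m j X + envelope m j Y"
        using j X Y m Xc[OF X] Xc[OF Y]
        by (simp add: envelope_def eA_closed(2)[OF t] M.smult_l_distr cmp_add M.smult_closed coord_add[OF j hX hY])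
    }
    show "envelope m j (sc k \<star> X) = k * envelope m j X" for k
    proof -
      have "cmp (d - 1) (sc k \<star> X \<odot> m) = sc k \<odot> cmp (d - 1) (X \<odot> m)"
        using cmp_smult[OF sc_deg M.smult_closed[OF Xc[OF X] m], of "d - 1" k] M.smult_assoc[OF sc_closed Xc[OF X] m, of k]
        by simp
      then show ?thesis using j X by (simp add: envelope_def eA_closed(4)[OF t] coord_sc[OF j hX])
    qed
    show "envelope m j X = 0" if n: "n > d - 1 - l" "X \<in> dg n" for n
    proof -
      have "cmp (d - 1 - n) m = \<zero>" using N(2) l[of "d - 1 - n"] n(1) by force
      then show ?thesis using envelope_degree[OF m j X n(2)] M.smult_r_null[OF Xc[OF X]] coord_zero[OF j] by simp
    qed
  qed
qed

lemma envelope_closed: "m \<in> carrier M \<Longrightarrow> envelope m \<in> carrier (IB s bs)"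
  using envelope_DF by (auto simp: IB_bs_carrier envelope_def PiE_iff)

lemma envelope_hom: "envelope \<in> graded_hom Q I (shift (- (d - 1)) (trunc_lt d)) (IB 0 bs)"
proof (rule graded_homI)
  let ?T = "shift (- (d - 1)) (trunc_lt d)"
  obtain c where "graded_mod Q S I (IB 0 bs) c" using graded_mod_IB[OF bs_arcs] by blast
  then interpret C: graded_mod Q S I "IB 0 bs" c .
  note sub = subsetD[OF part_subset(2)[of d]]
  fix m assume "m \<in> carrier ?T"
  then have m: "m \<in> part_lt d" by simp
  note mc = sub[OF m]
  show E: "envelope m \<in> carrier (IB 0 bs)" by (rule envelope_closed[OF mc])
  {
    fix m' assume "m' \<in> carrier ?T"
    then have m': "m' \<in> carrier M" using sub by simp
    have "envelope (m \<oplus> m') = envelope m \<oplus>\<^bsub>IB 0 bs\<^esub> envelope m'"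
    proof (rule IB_eqI[OF envelope_closed C.M.M.a_closed[OF E envelope_closed[OF m']] bs_arcs])
      show "m \<oplus> m' \<in> carrier M" using mc m' by simp
      fix j X assume "j < length bs" and "X \<in> eA (tail Q (bs ! j))"
      then have j: "j < r" and X: "X \<in> eA (tail Q (bt j))" by simp_all
      note Xc = eA_closed(8)[OF tail_bt[OF j] X]
      show "envelope (m \<oplus> m') j X = (envelope m \<oplus>\<^bsub>IB 0 bs\<^esub> envelope m') j X"
        using j X Xc mc m' by (simp add: envelope_def IB_ops(1) M.smult_r_distr cmp_add M.smult_closed coord_add[OF j] cmp_hc)
    qed
    then show "envelope (m \<oplus>\<^bsub>?T\<^esub> m') = envelope m \<oplus>\<^bsub>IB 0 bs\<^esub> envelope m'" by simp
  }
  fix a assume a: "a \<in> carrier A"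
  note am = M.smult_closed[OF a mc]
  have "envelope (low d (a \<odot> m)) = a \<odot>\<^bsub>IB 0 bs\<^esub> envelope m"
  proof (rule IB_eqI[OF envelope_closed[OF low_closed[OF am]] C.M.smult_closed[OF a E] bs_arcs])
    fix j X assume "j < length bs" and "X \<in> eA (tail Q (bs ! j))"
    then have j: "j < r" and X: "X \<in> eA (tail Q (bt j))" by simp_all
    note Xc = eA_closed(8)[OF tail_bt[OF j] X]
    have "cmp (d - 1) (X \<odot> low d (a \<odot> m)) = cmp (d - 1) (X \<odot> (a \<odot> m))"
      by (rule cmp_smult_cong[OF Xc low_closed[OF am] am]) (simp add: cmp_low[OF am])
    also have "\<dots> = cmp (d - 1) (X \<star> a \<odot> m)" using M.smult_assoc[OF Xc a mc] by simp
    finally show "envelope (low d (a \<odot> m)) j X = (a \<odot>\<^bsub>IB 0 bs\<^esub> envelope m) j X"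
      using j X eA_closed(3)[OF tail_bt[OF j] X a] by (simp add: envelope_def IB_ops(2))
  qed
  then show "envelope (a \<odot>\<^bsub>?T\<^esub> m) = a \<odot>\<^bsub>IB 0 bs\<^esub> envelope m" by simp
next
  let ?T = "shift (- (d - 1)) (trunc_lt d)"
  obtain c where "graded_mod Q S I (IB 0 bs) c" using graded_mod_IB[OF bs_arcs] by blast
  then interpret C: graded_mod Q S I "IB 0 bs" c .
  fix m n assume "m \<in> hcomp ?T n"
  moreover have "n - (- (d - 1)) = n + (d - 1)" by simp
  ultimately have h: "m \<in> hcomp M (n + (d - 1))"
    using hc_zero[of "n + (d - 1)"] by (simp only: shift_sel trunc_lt_sel singleton_iff split: if_splits)
  then have mc: "m \<in> carrier M" by (rule hc_closed)
  have z: "cmp k m = \<zero>" if "k \<noteq> n + (d - 1)" for k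
    by (rule cmp_other[OF h]) (use that in simp)
  have "envelope m j \<in> hcomp (In (tail Q (bs ! j))) (n - 0)" if "j < length bs" for j
    unfolding In_hcomp
  proof (intro conjI allI impI ballI)
    have j: "j < r" using that by simp
    show "envelope m j \<in> DF (tail Q (bs ! j))" using envelope_DF[OF mc j] j by simp
    fix k X assume k: "k \<noteq> - (n - 0)" and "X \<in> eA (tail Q (bs ! j))" and X: "X \<in> dg k"
    then have X': "X \<in> eA (tail Q (bt j))" using j by simp
    have "cmp (d - 1 - k) m = \<zero>" by (rule z) (use k in simp)
    then show "envelope m j X = 0"
      using envelope_degree[OF mc j X' X] M.smult_r_null[OF dg_closed[OF X]] coord_zero[OF j] by simp
  qed
  then show "envelope m \<in> hcomp (IB 0 bs) n"
    using envelope_closed[OF mc] unfolding IB_hcomp IB_carrier PiE_iff by simp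
qed

lemma smult_component:
  assumes "X \<in> dg (int l)" "u \<in> hcomp M (d - 1 - int l)"
  shows "X \<odot> u \<in> hcomp M (d - 1)"
  using smult_hc[OF assms] by simp

text \<open>Some path moves a nonzero element to a nonzero element of degree \<open>d - 1\<close>, and one more arrow to a
  nonzero element of degree \<open>d\<close>, which has a nonzero coordinate.\<close>

lemma envelope_detects:
  assumes D: "\<And>n. n < d \<Longrightarrow> arrows_detect M n" and m: "m \<in> hcomp M (d - 1 - int l)"
    and z: "\<And>j X. j < r \<Longrightarrow> X \<in> eA (tail Q (bt j)) \<Longrightarrow> X \<in> dg (int l) \<Longrightarrow> coord j (X \<odot> m) = 0"
  shows "m = \<zero>"
  using m z
proof (induction l arbitrary: m)
  case 0
  have m: "m \<in> hcomp M (d - 1)" using 0(1) by simp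
  have "ar a \<odot> m = \<zero>" if a: "a \<in> arcs Q" for a
  proof (rule arrow_zero_coord[OF a m])
    fix j assume j: "j < r"
    note t = tail_bt[OF j]
    have "coord j (e (tail Q (bt j)) \<odot> m) = 0"
      by (rule 0(2)[OF j]) (use t e_deg[OF t] in \<open>simp_all add: eA_iff e_idem\<close>)
    then show "coord j m = 0" using coord_e[OF j hc_closed[OF m]] by simp
  qed
  then show ?case using D[of "d - 1"] m unfolding arrows_detect_def by simp
next
  case (Suc l)
  have n: "d - 1 - int (Suc l) + 1 = d - 1 - int l" by simp
  have "ar a \<odot> m = \<zero>" if a: "a \<in> arcs Q" for a
  proof (rule Suc.IH)
    show "ar a \<odot> m \<in> hcomp M (d - 1 - int l)" using ar_smult_hc[OF a Suc.prems(1)] unfolding n .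
    fix j X assume j: "j < r" and X: "X \<in> eA (tail Q (bt j))" "X \<in> dg (int l)"
    have "X \<star> ar a \<in> dg (int (Suc l))" using dg_mult[OF X(2) ar_deg[OF a]] by (simp add: add.commute)
    from Suc.prems(2)[OF j eA_closed(3)[OF tail_bt[OF j] X(1) ar_closed[OF a]] this]
    show "coord j (X \<odot> (ar a \<odot> m)) = 0"
      using M.smult_assoc[OF dg_closed[OF X(2)] ar_closed[OF a] hc_closed[OF Suc.prems(1)]] by simp
  qed
  then show ?case using D[of "d - 1 - int (Suc l)"] Suc.prems(1) unfolding arrows_detect_def by simp
qed

lemma envelope_inj:
  assumes D: "\<And>n. n < d \<Longrightarrow> arrows_detect M n"
  shows "inj_on envelope (part_lt d)"
proof (rule inj_onI)
  note hom = graded_homD[OF envelope_hom]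
  note sub = subsetD[OF part_subset(2)[of d]]
  fix m m' assume m: "m \<in> part_lt d" and m': "m' \<in> part_lt d" and eq: "envelope m = envelope m'"
  let ?x = "m \<oplus> \<ominus> m'"
  have x: "?x \<in> part_lt d" by (intro part_lt_closed m m')
  note xc = sub[OF x]
  have z: "envelope ?x j X = 0" if j: "j < r" and X: "X \<in> eA (tail Q (bt j))" for j X
  proof -
    have "?x \<oplus> m' = m" using sub[OF m] sub[OF m'] by (simp add: M.M.a_assoc M.M.l_neg)
    then have "envelope m = envelope ?x \<oplus>\<^bsub>IB 0 bs\<^esub> envelope m'" using hom(3)[of ?x m'] x m' by simp
    then have "envelope m j X = envelope ?x j X + envelope m' j X" using j X by (simp add: IB_ops(1))
    then show ?thesis using eq by simp
  qed
  have "cmp n ?x = \<zero>" for n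
  proof (cases "n < d")
    case True
    define l where "l = nat (d - 1 - n)"
    have n: "n = d - 1 - int l" using True by (simp add: l_def)
    show ?thesis
      unfolding n
    proof (rule envelope_detects[OF D cmp_hc[OF xc]])
      fix j X assume "j < r" "X \<in> eA (tail Q (bt j))" "X \<in> dg (int l)"
      then show "coord j (X \<odot> cmp (d - 1 - int l) ?x) = 0"
        using envelope_degree[OF xc, of j X "int l"] z by simp
    qed
  next
    case False
    then show ?thesis using x by (simp add: part_lt_def)
  qed
  then have "?x = \<zero>" by (intro cmp_eqI[OF xc M.M.zero_closed]) (simp add: cmp_zero)
  then show "m = m'" using M.M.minus_equality[of m "\<ominus> m'"] sub[OF m] sub[OF m'] by simp
qed

text \<open>A family of functionals that vanishes on relations is realised by an element of the module, degree
  by degree: in degree \<open>l + 1\<close> the realisations \<open>u a\<close> of the families shifted along the arrows are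
  killed by the arrows that form relations with \<open>a\<close>, hence of the form \<open>a w\<^sub>a\<close>, and the \<open>w\<^sub>a\<close> glue.\<close>

lemma envelope_lift:
  assumes D: "\<And>n. n < d \<Longrightarrow> arrows_detect M n" and sep: "\<And>n. n < d \<Longrightarrow> arrows_separate M n"
    and im: "\<And>n. n < d \<Longrightarrow> arrow_images M n" and \<phi>: "\<phi> \<in> vanishing bs"
  shows "\<exists>u\<in>hcomp M (d - 1 - int l). \<forall>j<r. \<forall>X\<in>eA (tail Q (bt j)). X \<in> dg (int l) \<longrightarrow> coord j (X \<odot> u) = \<phi> j X"
  using \<phi>
proof (induction l arbitrary: \<phi>)
  case 0
  then have \<phi>: "\<phi> j \<in> DF (tail Q (bt j))" if "j < r" for j using that by (auto simp: vanishing_def PiE_iff)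
  obtain u where u: "u \<in> hcomp M (d - 1)" "\<forall>j<r. coord j u = \<phi> j (e (tail Q (bt j)))"
    using coord_surj[OF sep, of "\<lambda>j. \<phi> j (e (tail Q (bt j)))"] by auto
  have "coord j (X \<odot> u) = \<phi> j X" if j: "j < r" and X: "X \<in> eA (tail Q (bt j))" "X \<in> dg 0" for j X
  proof -
    let ?e = "e (tail Q (bt j))" and ?k = "coef X (tail Q (bt j), [], tail Q (bt j))"
    note t = tail_bt[OF j]
    have e: "?e \<in> eA (tail Q (bt j))" using t by (simp add: eA_iff e_idem)
    have "e (tail Q (bt j)) \<star> X = X" using X(1) by (simp only: eA_iff[OF t])
    then have Xk: "X = sc ?k \<star> ?e" by (rule degree_0_left[OF X(2) t])
    have "coord j ((sc ?k \<star> ?e) \<odot> u) = ?k * coord j u"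
      using M.smult_assoc[OF sc_closed e_closed[OF t] hc_closed[OF u(1)]] coord_sc[OF j e_smult_hc[OF t u(1)]]
        coord_e[OF j hc_closed[OF u(1)]] by simp
    also have "\<dots> = \<phi> j (sc ?k \<star> ?e)" using u(2) j DFD(3)[OF t \<phi>[OF j] e] by simp
    finally show ?thesis using Xk by (simp only:)
  qed
  then show ?case using u(1) by (intro bexI[where x = u]) simp_all
next
  case (Suc l)
  let ?n = "d - 1 - int l"
  have \<phi>: "\<phi> j \<in> DF (tail Q (bt j))" if "j < r" for j using that Suc.prems by (auto simp: vanishing_def PiE_iff)
  have van: "\<phi> j (ar g \<star> X) = 0" if "j < r" "zr g (bt j)" "X \<in> eA (tail Q g)" for j g X
    using that Suc.prems by (auto simp: vanishing_def)
  have "\<exists>w. w \<in> hcomp M (?n - 1) \<and> (\<forall>j<r. \<forall>X\<in>eA (tail Q (bt j)). X \<in> dg (int l) \<longrightarrow>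
      coord j (X \<odot> (ar a \<odot> w)) = \<phi> j (X \<star> ar a))" if a: "a \<in> arcs Q" for a
  proof -
    have h: "head Q a \<in> verts Q" using a by simp
    obtain u0 where u0: "u0 \<in> hcomp M ?n" "\<forall>j<r. \<forall>X\<in>eA (tail Q (bt j)). X \<in> dg (int l) \<longrightarrow>
        coord j (X \<odot> u0) = (ar a \<odot>\<^bsub>IB 0 bs\<^esub> \<phi>) j X"
      using Suc.IH[OF vanishing_smult[OF bs_arcs ar_closed[OF a] Suc.prems, where s = 0]] by blast
    \<comment> \<open>The property \<open>arrow_images\<close> asks for an element at the vertex in which \<open>a\<close> ends.\<close>
    let ?u = "e (head Q a) \<odot> u0"
    note u0c = hc_closed[OF u0(1)]
    have uh: "?u \<in> hcomp M ?n" by (rule e_smult_hc[OF h u0(1)])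
    have uc: "?u \<in> carrier M" by (rule hc_closed[OF uh])
    have eu: "e (head Q a) \<odot> ?u = ?u"
      using M.smult_assoc[OF e_closed[OF h] e_closed[OF h] u0c] e_idem[OF h] by simp
    have u: "coord j (X \<odot> ?u) = \<phi> j (X \<star> ar a)"
      if j: "j < r" and X: "X \<in> eA (tail Q (bt j))" "X \<in> dg (int l)" for j X
    proof -
      note Xc = dg_closed[OF X(2)]
      let ?Y = "X \<star> e (head Q a)"
      have Y: "?Y \<in> eA (tail Q (bt j))" by (rule eA_closed(3)[OF tail_bt[OF j] X(1) e_closed[OF h]])
      have Yd: "?Y \<in> dg (int l)" using dg_mult[OF X(2) e_deg[OF h]] by simp
      have "coord j (X \<odot> ?u) = coord j (?Y \<odot> u0)" using M.smult_assoc[OF Xc e_closed[OF h] u0c] by simp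
      also have "\<dots> = (ar a \<odot>\<^bsub>IB 0 bs\<^esub> \<phi>) j ?Y" using u0(2) j Y Yd by blast
      also have "\<dots> = \<phi> j (?Y \<star> ar a)" using j Y by (simp add: IB_ops(2))
      also have "?Y \<star> ar a = X \<star> ar a" using Xc h a by (simp add: A.m_assoc e_head_ar)
      finally show ?thesis .
    qed
    have z: "ar b \<odot> ?u = \<zero>" if zb: "zr a b" for b
    proof (cases l)
      case 0
      note b = zr_arcs(1)[OF zb]
      show ?thesis
      proof (rule arrow_zero_coord[OF b])
        show "?u \<in> hcomp M (d - 1)" using uh 0 by simp
        fix j assume j: "j < r" "bt j = b"
        note t = tail_bt[OF j(1)]
        have ta: "tail Q a \<in> verts Q" using a by simp
        have th: "tail Q (bt j) = head Q a" using zb j(2) by (simp add: zr_def)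
        have "coord j ?u = coord j (e (tail Q (bt j)) \<odot> ?u)" by (rule coord_e[OF j(1) uc, symmetric])
        also have "\<dots> = \<phi> j (e (tail Q (bt j)) \<star> ar a)"
          by (rule u[OF j(1)]) (use t e_deg[OF t] 0 in \<open>simp_all add: eA_iff e_idem\<close>)
        also have "e (tail Q (bt j)) \<star> ar a = ar a \<star> e (tail Q a)"
          unfolding th using e_head_ar[OF a] ar_e_tail[OF a] by simp
        also have "\<phi> j (ar a \<star> e (tail Q a)) = 0"
          by (rule van[OF j(1)]) (use zb j(2) ta in \<open>simp_all add: eA_iff e_idem\<close>)
        finally show "coord j ?u = 0" .
      qed
    next
      case (Suc l')
      note b = zr_arcs(1)[OF zb]
      have n: "?n + 1 = d - 1 - int l'" by (simp add: Suc)
      show ?thesis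
      proof (rule envelope_detects[OF D])
        show "ar b \<odot> ?u \<in> hcomp M (d - 1 - int l')" using ar_smult_hc[OF b uh] unfolding n .
        fix j X assume j: "j < r" and X: "X \<in> eA (tail Q (bt j))" "X \<in> dg (int l')"
        note Xc = dg_closed[OF X(2)]
        note t = tail_bt[OF j]
        have "coord j (X \<odot> (ar b \<odot> ?u)) = coord j (X \<star> ar b \<odot> ?u)"
          using M.smult_assoc[OF Xc ar_closed[OF b] uc] by simp
        also have "\<dots> = \<phi> j (X \<star> ar b \<star> ar a)"
        proof (rule u[OF j eA_closed(3)[OF t X(1) ar_closed[OF b]]])
          show "X \<star> ar b \<in> dg (int l)" using dg_mult[OF X(2) ar_deg[OF b]] by (simp add: Suc add.commute)
        qed
        also have "X \<star> ar b \<star> ar a = \<zero>\<^bsub>A\<^esub>" using Xc a b zr_zero[OF zb] by (simp add: A.m_assoc)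
        finally show "coord j (X \<odot> (ar b \<odot> ?u)) = 0" using DF_zero[OF t \<phi>[OF j]] by simp
      qed
    qed
    have "arrow_images M ?n" by (rule im) simp
    then obtain w where "w \<in> hcomp M (?n - 1)" "ar a \<odot> w = ?u"
      using a uh eu z unfolding arrow_images_def by blast
    then show ?thesis using u by (intro exI[where x = w]) simp
  qed
  then have "\<forall>a\<in>arcs Q. \<exists>w. w \<in> hcomp M (?n - 1) \<and> (\<forall>j<r. \<forall>X\<in>eA (tail Q (bt j)). X \<in> dg (int l) \<longrightarrow>
      coord j (X \<odot> (ar a \<odot> w)) = \<phi> j (X \<star> ar a))" by blast
  then obtain w where w: "\<forall>a\<in>arcs Q. w a \<in> hcomp M (?n - 1) \<and> (\<forall>j<r. \<forall>X\<in>eA (tail Q (bt j)). X \<in> dg (int l) \<longrightarrow>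
      coord j (X \<odot> (ar a \<odot> w a)) = \<phi> j (X \<star> ar a))" by (rule bchoice[THEN exE])
  have sp: "arrows_separate M (?n - 1)" by (rule sep) simp
  obtain u where u: "u \<in> hcomp M (?n - 1)" "\<And>a. a \<in> arcs Q \<Longrightarrow> ar a \<odot> u = ar a \<odot> w a"
    by (rule arrows_glue[OF sp, of w]) (use w in blast)+
  note uc = hc_closed[OF u(1)]
  have "coord j (X \<odot> u) = \<phi> j X" if j: "j < r" and X: "X \<in> eA (tail Q (bt j))" "X \<in> dg (int (Suc l))" for j X
  proof -
    note t = tail_bt[OF j]
    note Xc = dg_closed[OF X(2)]
    have R: "rs a X \<in> eA (tail Q (bt j))" "rs a X \<in> dg (int l)" for a
      using eA_closed(7)[OF t X(1)] rs_deg[OF X(2), of a] by simp_all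
    have S: "rs a X \<star> ar a \<in> eA (tail Q (bt j))" if "a \<in> arcs Q" for a
      by (rule eA_closed(3)[OF t R(1) ar_closed[OF that]])
    have Xs: "X = (\<Oplus>\<^bsub>A\<^esub>a\<in>arcs Q. rs a X \<star> ar a)" by (rule dg_pos_right[OF X(2)]) simp
    have ru: "rs a X \<star> ar a \<odot> u = rs a X \<odot> (ar a \<odot> w a)" if "a \<in> arcs Q" for a
      using M.smult_assoc[OF dg_closed[OF R(2)] ar_closed[OF that] uc] u(2)[OF that] by simp
    have ruh: "rs a X \<star> ar a \<odot> u \<in> hcomp M (d - 1)" if a: "a \<in> arcs Q" for a
    proof -
      have "ar a \<odot> w a \<in> hcomp M (?n - 1 + 1)" by (rule ar_smult_hc[OF a]) (use w a in blast)
      moreover have "?n - 1 + 1 = ?n" by simp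
      ultimately have "ar a \<odot> w a \<in> hcomp M ?n" by (simp only:)
      from smult_component[OF R(2) this] show ?thesis unfolding ru[OF a] .
    qed
    have "X \<odot> u = (\<Oplus>\<^bsub>A\<^esub>a\<in>arcs Q. rs a X \<star> ar a) \<odot> u" by (rule arg_cong[OF Xs])
    also have "\<dots> = (\<Oplus>a\<in>arcs Q. rs a X \<star> ar a \<odot> u)"
      by (rule M.smult_l_finsum[OF uc]) (use eA_closed(8)[OF t S] in simp)
    finally have "coord j (X \<odot> u) = (\<Sum>a\<in>arcs Q. coord j (rs a X \<star> ar a \<odot> u))"
      using coord_finsum[OF j ruh] by simp
    also have "\<dots> = (\<Sum>a\<in>arcs Q. \<phi> j (rs a X \<star> ar a))"
    proof (rule sum.cong[OF refl])
      fix a assume a: "a \<in> arcs Q"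
      show "coord j (rs a X \<star> ar a \<odot> u) = \<phi> j (rs a X \<star> ar a)"
        unfolding ru[OF a] using w a j R by blast
    qed
    also have "\<dots> = \<phi> j (\<Oplus>\<^bsub>A\<^esub>a\<in>arcs Q. rs a X \<star> ar a)"
      by (rule DF_finsum[OF t \<phi>[OF j] S finite_arcs, THEN conjunct1, symmetric])
    also have "\<dots> = \<phi> j X" by (rule arg_cong[OF Xs[symmetric]])
    finally show ?thesis .
  qed
  moreover have "u \<in> hcomp M (d - 1 - int (Suc l))"
  proof -
    have "?n - 1 = d - 1 - int (Suc l)" by simp
    then show ?thesis using u(1) by (simp only:)
  qed
  ultimately show ?case by blast
qed

text \<open>A functional lives in finitely many degrees, so the elements that realise its components can be
  added up.\<close>

lemma envelope_image:
  assumes D: "\<And>n. n < d \<Longrightarrow> arrows_detect M n" and sep: "\<And>n. n < d \<Longrightarrow> arrows_separate M n"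
    and im: "\<And>n. n < d \<Longrightarrow> arrow_images M n"
  shows "envelope ` part_lt d = vanishing bs"
proof (rule equalityI; rule subsetI)
  fix \<phi> assume "\<phi> \<in> envelope ` part_lt d"
  then obtain m where m: "m \<in> part_lt d" "\<phi> = envelope m" by blast
  have mc: "m \<in> carrier M" using m(1) part_subset by blast
  have "envelope m j (ar g \<star> X) = 0"
    if j: "j < r" and z: "zr g (bt j)" and X: "X \<in> eA (tail Q g)" for j g X
  proof -
    note g = zr_arcs(2)[OF z]
    have tg: "tail Q g \<in> verts Q" using g by simp
    note Xc = eA_closed(8)[OF tg X]
    note b = gs_nth(1)[OF j]
    have gX: "ar g \<star> X \<in> eA (tail Q (bt j))" using ar_mult_eA[OF g X] z by (simp add: zr_def)
    note gXm = M.smult_closed[OF eA_closed(8)[OF tail_bt[OF j] gX] mc]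
    have "ar (bt j) \<star> (ar g \<star> X) = \<zero>\<^bsub>A\<^esub>"
      using A.m_assoc[OF ar_closed[OF b] ar_closed[OF g] Xc] zr_zero[OF z] Xc by simp
    then have z0: "ar (bt j) \<odot> (ar g \<star> X \<odot> m) = \<zero>"
      using M.smult_assoc[OF ar_closed[OF b] eA_closed(8)[OF tail_bt[OF j] gX] mc] M.smult_l_null[OF mc] by simp
    have "ar (bt j) \<odot> cmp (d - 1) (ar g \<star> X \<odot> m) = cmp (1 + (d - 1)) \<zero>"
      unfolding z0[symmetric] by (rule cmp_smult[OF ar_deg[OF b] gXm, symmetric])
    also have "\<dots> = ar (bt j) \<odot> \<zero>" unfolding cmp_zero M.smult_r_null[OF ar_closed[OF b]] ..
    finally have "ar (bt j) \<odot> cmp (d - 1) (ar g \<star> X \<odot> m) = ar (bt j) \<odot> \<zero>" .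
    from coord_cong[OF this] show ?thesis using j gX coord_zero[OF j] by (simp add: envelope_def)
  qed
  then show "\<phi> \<in> vanishing bs"
    using envelope_closed[OF mc, of 0] unfolding m(2) vanishing_def IB_carrier by simp
next
  fix \<phi> assume \<phi>: "\<phi> \<in> vanishing bs"
  then have \<phi>c: "\<phi> \<in> carrier (IB 0 bs)" by (simp add: vanishing_def IB_carrier)
  have \<phi>j: "\<phi> j \<in> DF (tail Q (bt j))" if "j < r" for j using \<phi>c that by (auto simp: IB_bs_carrier PiE_iff)
  have "\<forall>j\<in>{..<r}. \<exists>k. \<forall>n>k. \<forall>X\<in>eA (tail Q (bt j)). X \<in> dg n \<longrightarrow> \<phi> j X = 0"
    using DFD(4)[OF tail_bt \<phi>j] by simp
  then obtain k where k: "\<forall>j\<in>{..<r}. \<forall>n>k j. \<forall>X\<in>eA (tail Q (bt j)). X \<in> dg n \<longrightarrow> \<phi> j X = 0"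
    by (rule bchoice[THEN exE])
  \<comment> \<open>A degree above which all the functionals vanish.\<close>
  let ?L = "\<Sum>j<r. nat (k j)"
  have L: "\<phi> j X = 0" if j: "j < r" and l: "?L < l" and X: "X \<in> eA (tail Q (bt j))" "X \<in> dg (int l)" for j l X
  proof -
    have "nat (k j) \<le> ?L" by (rule member_le_sum) (use j in simp_all)
    then have "k j < int l" using l by linarith
    then show ?thesis using k j X by blast
  qed
  have "\<forall>l. \<exists>u. u \<in> hcomp M (d - 1 - int l) \<and>
      (\<forall>j<r. \<forall>X\<in>eA (tail Q (bt j)). X \<in> dg (int l) \<longrightarrow> coord j (X \<odot> u) = \<phi> j X)"
    using envelope_lift[OF D sep im \<phi>] by blast
  then obtain u where u: "\<forall>l. u l \<in> hcomp M (d - 1 - int l) \<and>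
      (\<forall>j<r. \<forall>X\<in>eA (tail Q (bt j)). X \<in> dg (int l) \<longrightarrow> coord j (X \<odot> u l) = \<phi> j X)"
    by (rule choice[THEN exE])
  have uh: "u l \<in> hcomp M (d - 1 - int l)" for l using u by blast
  note uc = hc_closed[OF uh]
  let ?m = "\<Oplus>l\<in>{..?L}. u l"
  have mc: "?m \<in> carrier M" by (rule M.M.finsum_closed) (use uc in simp)
  have cmp_m: "cmp n ?m = (\<Oplus>l\<in>{..?L}. cmp n (u l))" for n by (rule cmp_finsum) (rule uc)
  have low_m: "cmp (d - 1 - int l) ?m = u l" if l: "l \<le> ?L" for l
  proof -
    have "cmp (d - 1 - int l) ?m = cmp (d - 1 - int l) (u l)"
      unfolding cmp_m by (rule M.M.finsum_only) (use l cmp_closed[OF uc] cmp_other[OF uh] in auto)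
    then show ?thesis using cmp_same[OF uh] by simp
  qed
  have zero_m: "cmp n ?m = \<zero>" if n: "\<And>l. l \<le> ?L \<Longrightarrow> n \<noteq> d - 1 - int l" for n
  proof -
    have "cmp n ?m = (\<Oplus>l\<in>{..?L}. \<zero>)"
      unfolding cmp_m by (rule M.M.finsum_cong'[OF refl]) (use cmp_other[OF uh] n in fastforce)+
    then show ?thesis by simp
  qed
  have "?m \<in> part_lt d" using mc zero_m by (simp add: part_lt_def)
  moreover have "envelope ?m = \<phi>"
  proof (rule PiE_ext[of _ "{..<r}" "\<lambda>j. DF (tail Q (bt j))"])
    show "envelope ?m \<in> (\<Pi>\<^sub>E j\<in>{..<r}. DF (tail Q (bt j)))" using envelope_closed[OF mc, of 0] unfolding IB_bs_carrier .
    show "\<phi> \<in> (\<Pi>\<^sub>E j\<in>{..<r}. DF (tail Q (bt j)))" using \<phi>c unfolding IB_bs_carrier .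
    fix j assume "j \<in> {..<r}"
    then have j: "j < r" by simp
    show "envelope ?m j = \<phi> j"
    proof (rule DF_eq_degrees[OF tail_bt[OF j] envelope_DF[OF mc j] \<phi>j[OF j]])
      fix l X assume X: "X \<in> eA (tail Q (bt j))" "X \<in> dg (int l)"
      note E = envelope_degree[OF mc j X]
      show "envelope ?m j X = \<phi> j X"
      proof (cases "l \<le> ?L")
        case True
        have "coord j (X \<odot> u l) = \<phi> j X" using u j X by blast
        then show ?thesis unfolding E low_m[OF True] .
      next
        case False
        have "cmp (d - 1 - int l) ?m = \<zero>" by (rule zero_m) (use False in simp)
        then show ?thesis
          using E M.smult_r_null[OF dg_closed[OF X(2)]] coord_zero[OF j] L[OF j _ X] False by simp
      qed
    qed
  qed
  ultimately show "\<phi> \<in> envelope ` part_lt d" by (intro image_eqI[where x = ?m]) simp_all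
qed

end

context quadratic_monomial
begin

text \<open>Below the degrees of all socles, which are at least \<open>- b\<close>, arrows detect the elements of the injective
  modules; this is what the transfer to the kernel requires.\<close>

theorem finitely_copresented_truncation:
  fixes M :: "((('v, 'e) qpath \<Rightarrow> 'k) set, 'm) graded_module"
  assumes M: "graded_left_module Q I M" and fc: "finitely_copresented Q I M"
    and bound: "\<And>l. set l \<subseteq> arcs Q \<Longrightarrow> successively zr l \<Longrightarrow> length l < N"
  shows "\<exists>(N :: ((('v, 'e) qpath \<Rightarrow> 'k) set, 'm) graded_module)
      (L :: ((('v, 'e) qpath \<Rightarrow> 'k) set, 'm) graded_module) f g.
    short_exact Q I N f M g L \<and> finite_dim_module Q I N \<and> colinear_module Q I L"
proof -
  obtain cmp where gm: "graded_mod Q S I M cmp"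
    by (rule graded_left_module_graded_mod[OF quadratic_monomial_axioms M])
  interpret gm: graded_mod Q S I M cmp by (rule gm)
  have fd: "\<And>n. fd_over_field Q I M (hcomp M n)" by (rule graded_left_module.hcomp_finite_dim[OF M])
  obtain xs0 xs1 \<iota> d where xs: "fst ` set xs0 \<subseteq> verts Q" "fst ` set xs1 \<subseteq> verts Q"
    and \<iota>: "\<iota> \<in> graded_hom Q I M (Ins xs0)" and d: "d \<in> graded_hom Q I (Ins xs0) (Ins xs1)"
    and inj: "inj_on \<iota> (carrier M)" and ex: "\<iota> ` carrier M = a_kernel (Ins xs0) (Ins xs1) d"
    using fc unfolding finitely_copresented_def by (elim exE conjE) (rule that)
  note pres = gm graded_mod_Ins[OF xs(1)] graded_mod_Ins[OF xs(2)] \<iota> d inj ex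
  obtain b where b: "\<And>x i. (x, i) \<in> set xs0 \<union> set xs1 \<Longrightarrow> i \<le> b \<and> - b \<le> i"
    by (rule finite_int_bound[of xs0 xs1]) blast
  let ?d = "- b"
  have D0: "arrows_detect (Ins xs0) n" if "n < ?d" for n
    by (rule arrows_detect_Ins[OF xs(1)]) (use b that in \<open>meson UnI1 less_le_trans\<close>)
  have D1: "arrows_detect (Ins xs1) n" if "n < ?d" for n
    by (rule arrows_detect_Ins[OF xs(2)]) (use b that in \<open>meson UnI2 less_le_trans\<close>)
  have det: "arrows_detect M n" if "n < ?d" for n
    by (rule arrows_detect_ker[OF pres D0[OF that]])
  have sep: "arrows_separate M n" if "n < ?d" for n
    by (rule arrows_separate_ker[OF pres D1[OF that] arrows_separate_Ins[OF xs(1)]])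
  have im: "arrow_images M n" if "n < ?d" for n
    by (rule arrow_images_ker[OF pres D1 arrows_separate_Ins[OF xs(1)] arrow_images_Ins[OF xs(1)]]) (use that in simp)
  have high: "hcomp M n = {\<zero>\<^bsub>M\<^esub>}" if n: "b < n" for n
  proof (rule equalityI; rule subsetI)
    fix m assume m: "m \<in> hcomp M n"
    have \<iota>0: "\<iota> \<zero>\<^bsub>M\<^esub> = \<zero>\<^bsub>Ins xs0\<^esub>"
      by (rule additive_zero[OF gm.abelian graded_mod.abelian[OF pres(2)] graded_homD(1)[OF \<iota>]])
    have "\<iota> m = \<zero>\<^bsub>Ins xs0\<^esub>"
      by (rule Ins_bounded_above[OF xs(1) _ graded_homD(5)[OF \<iota> m]]) (use b n in \<open>meson UnI1 le_less_trans\<close>)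
    then have "m = \<zero>\<^bsub>M\<^esub>" using inj_onD[OF inj _ gm.hc_closed[OF m] gm.M.M.zero_closed] \<iota>0 by simp
    then show "m \<in> {\<zero>\<^bsub>M\<^esub>}" by simp
  qed (use gm.hc_zero in simp)
  obtain B gs where "arrow_basis Q S I M cmp ?d B gs" by (rule gm.arrow_basis_exists[OF fd])
  then interpret ab: arrow_basis Q S I M cmp ?d B gs .
  have "cokoszul Q I (shift (- (?d - 1)) (gm.trunc_lt ?d))"
  proof (rule cokoszulI[OF ab.bs_arcs ab.envelope_hom _ _ bound])
    show "inj_on ab.envelope (carrier (shift (- (?d - 1)) (gm.trunc_lt ?d)))"
      using ab.envelope_inj[OF det] by simp
    show "ab.envelope ` carrier (shift (- (?d - 1)) (gm.trunc_lt ?d)) = vanishing ab.bs"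
      using ab.envelope_image[OF det sep im] by simp
  qed
  then have colin: "colinear_module Q I (gm.trunc_lt ?d)" unfolding colinear_module_def by blast
  have "hcomp (gm.trunc_ge ?d) n = {\<zero>\<^bsub>gm.trunc_ge ?d\<^esub>}" if "n \<notin> {- b..b}" for n
    using that high by auto
  then have "finite_dim_module Q I (gm.trunc_ge ?d)"
    unfolding finite_dim_module_def
    by (rule graded_mod.fd_bounded[OF gm.graded_mod_trunc_ge gm.trunc_ge_fd[OF fd] finite_atLeastAtMost_int])
  then show ?thesis using gm.trunc_short_exact[OF fd] colin by blast
qed

end

section \<open>The quadratic dual\<close>

context quadratic_monomial
begin

lemma nonzero_path_not_in_I:
  assumes "nonzero_path r" shows "path_elt r \<notin> I"
proof
  assume "path_elt r \<in> I"
  then have "path_elt r r = (0 :: 'k)" using assms unfolding I_iff by blast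
  then show False by (simp add: path_elt_def)
qed

text \<open>Splitting off one arrow at a time writes a path of length \<open>n\<close> as a product of \<open>n\<close> arrows.\<close>

lemma path_in_arrow_ideal_power:
  assumes "r \<in> paths Q"
  shows "path_elt r \<in> (arrow_ideal Q :: (('v, 'e) qpath \<Rightarrow> 'k) set) [^]\<^bsub>ideals_set KQ\<^esub> path_length r"
proof -
  let ?J = "arrow_ideal Q :: (('v, 'e) qpath \<Rightarrow> 'k) set"
  have "path_elt (x, l, y) \<in> ?J [^]\<^bsub>ideals_set KQ\<^esub> length l" if "(x, l, y) \<in> paths Q" for x l y
    using that
  proof (induction l arbitrary: x)
    case Nil
    then show ?case using mono_elt_carrier[OF Nil] by (simp add: nat_pow_def ideals_set_def path_elt_mono_elt)
  next
    case (Cons a l)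
    then have a: "a \<in> arcs Q" "x = tail Q a" and l: "(head Q a, l, y) \<in> paths Q"
      by (simp_all add: paths_iff awalk_Cons_iff)
    have sub: "{path_elt p | p. p \<in> paths Q \<and> path_length p = 1} \<subseteq> carrier KQ"
      by (auto simp: path_elt_mono_elt intro: mono_elt_carrier)
    have "(x, [a], head Q a) \<in> paths Q" using ar_path[OF a(1)] a(2) by simp
    then have "path_elt (x, [a], head Q a) \<in> ?J"
      unfolding arrow_ideal_def by (intro subsetD[OF KQ.genideal_self[OF sub]]) (force simp: path_length_def)
    from ideal_prod.prod[OF Cons.IH[OF l] this]
    have "path_elt (head Q a, l, y) \<otimes>\<^bsub>KQ\<^esub> path_elt (x, [a], head Q a)
        \<in> ?J [^]\<^bsub>ideals_set KQ\<^esub> length (a # l)"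
      by (simp add: nat_pow_def ideals_set_def)
    moreover have "path_elt (head Q a, l, y) \<otimes>\<^bsub>KQ\<^esub> path_elt (x, [a], head Q a) = (path_elt (x, a # l, y) :: _ \<Rightarrow> 'k)"
      unfolding path_elt_mono_elt using mono_elt_mult[OF l \<open>(x, [a], head Q a) \<in> paths Q\<close>, of 1 1]
      by (simp add: path_source_def path_target_def path_comp_def)
    ultimately show ?case by simp
  qed
  then show ?thesis using assms by (cases r) (simp add: path_length_def)
qed

lemma nonzero_path_length:
  assumes N: "(arrow_ideal Q :: (('v, 'e) qpath \<Rightarrow> 'k) set) [^]\<^bsub>ideals_set KQ\<^esub> N \<subseteq> I"
    and r: "nonzero_path r" "path_length r = N"
  shows False
proof -
  have "r \<in> paths Q" using r(1) by (simp add: nonzero_path_def)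
  then show False using path_in_arrow_ideal_power[of r] N r(2) nonzero_path_not_in_I[OF r(1)] by blast
qed

lemma nonzero_path_chain:
  assumes "set l \<subseteq> arcs Q" "l \<noteq> []" "successively (\<lambda>a b. head Q a = tail Q b \<and> compatible a b) l"
  shows "nonzero_path (tail Q (hd l), l, head Q (last l))"
  using assms
proof (induction l)
  case (Cons a l)
  then show ?case by (cases l) (auto simp: nonzero_Cons nonzero_Nil)
qed simp

end

lemma opposite_quiver_sel [simp]:
  "verts (opposite_quiver Q) = verts Q" "arcs (opposite_quiver Q) = arcs Q"
  "tail (opposite_quiver Q) = head Q" "head (opposite_quiver Q) = tail Q"
  by (simp_all add: opposite_quiver_def)

lemma fin_digraph_opposite: "fin_digraph Q \<Longrightarrow> fin_digraph (opposite_quiver Q)"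
  unfolding fin_digraph_def fin_digraph_axioms_def wf_digraph_def by simp

text \<open>The paths of the opposite quiver that generate the dual ideal; they are obtained by reversing the
  nonzero paths of length two.\<close>

definition dual_relations ::
    "('v, 'e) pre_digraph \<Rightarrow> (('v, 'e) qpath \<Rightarrow> 'k::field) set \<Rightarrow> ('v, 'e) qpath set" where
  "dual_relations Q I = {(head Q \<beta>, [\<beta>, \<alpha>], tail Q \<alpha>) | \<alpha> \<beta>.
     \<alpha> \<in> arcs Q \<and> \<beta> \<in> arcs Q \<and> head Q \<alpha> = tail Q \<beta> \<and> path_elt (tail Q \<alpha>, [\<alpha>, \<beta>], head Q \<beta>) \<notin> I}"

lemma quadratic_monomial_dual:
  fixes I :: "(('v, 'e) qpath \<Rightarrow> 'k::field) set"
  assumes "fin_digraph Q"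
  shows "quadratic_monomial (opposite_quiver Q) (dual_relations Q I) (dual_ideal Q I)"
proof (intro quadratic_monomial.intro quadratic_monomial_axioms.intro fin_digraph_opposite[OF assms])
  interpret O: fin_digraph "opposite_quiver Q" by (rule fin_digraph_opposite[OF assms])
  have v: "tail Q a \<in> verts Q" "head Q a \<in> verts Q" if "a \<in> arcs Q" for a
    using O.head_in_verts[of a] O.tail_in_verts[of a] that by simp_all
  show "dual_relations Q I \<subseteq> {p \<in> paths (opposite_quiver Q). path_length p = 2}"
    by (auto simp: dual_relations_def paths_iff path_length_def O.awalk_Cons_iff O.awalk_Nil_iff v)
  have "(path_elt ` dual_relations Q I :: (_ \<Rightarrow> 'k) set) = {path_elt (head Q \<beta>, [\<beta>, \<alpha>], tail Q \<alpha>) | \<alpha> \<beta>.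
     \<alpha> \<in> arcs Q \<and> \<beta> \<in> arcs Q \<and> head Q \<alpha> = tail Q \<beta> \<and> path_elt (tail Q \<alpha>, [\<alpha>, \<beta>], head Q \<beta>) \<notin> I}"
    unfolding dual_relations_def by blast
  then show "dual_ideal Q I = Idl\<^bsub>path_algebra (opposite_quiver Q)\<^esub> (path_elt ` dual_relations Q I)"
    unfolding dual_ideal_def by simp
qed

text \<open>A chain of zero relations of the dual, read backwards, is a nonzero path of \<open>kQ/I\<close>, and the arrow
  ideal of \<open>kQ/I\<close> is nilpotent.\<close>

lemma dual_chain_bound:
  fixes I :: "(('v, 'e) qpath \<Rightarrow> 'k::field) set"
  assumes "fd_quadratic_monomial Q I"
  obtains N where "\<And>l. set l \<subseteq> arcs Q \<Longrightarrow>
    successively (quadratic_monomial.zr (opposite_quiver Q) (dual_relations Q I)) l \<Longrightarrow> length l < N"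
proof -
  from assms obtain S and N :: nat where fin: "fin_digraph Q" and S: "S \<subseteq> {p \<in> paths Q. path_length p = 2}"
    and I: "I = Idl\<^bsub>path_algebra Q\<^esub> (path_elt ` S)" and N: "N \<ge> 2"
    and NI: "arrow_ideal Q [^]\<^bsub>ideals_set (path_algebra Q)\<^esub> N \<subseteq> I"
    unfolding fd_quadratic_monomial_def admissible_ideal_def by (elim exE conjE) (rule that)
  interpret P: quadratic_monomial Q S I
    by (intro quadratic_monomial.intro quadratic_monomial_axioms.intro fin S I)
  interpret D: quadratic_monomial "opposite_quiver Q" "dual_relations Q I" "dual_ideal Q I"
    by (rule quadratic_monomial_dual[OF fin])
  have zr: "head Q a = tail Q b \<and> P.compatible a b" if "D.zr b a" for a b
  proof -
    have ab: "a \<in> arcs Q" "b \<in> arcs Q" "(head Q b, [b, a], tail Q a) \<in> dual_relations Q I"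
      using that by (simp_all add: D.zr_def D.compatible_def)
    then have h: "head Q a = tail Q b" and nz: "path_elt (tail Q a, [a, b], head Q b) \<notin> I"
      by (auto simp: dual_relations_def)
    have "(tail Q a, [a, b], head Q b) \<in> paths Q"
      using ab h by (simp add: paths_iff P.awalk_Cons_iff P.awalk_Nil_iff)
    then have "P.nonzero_path (tail Q a, [a, b], head Q b)"
      using nz P.zero_path_in_I[of _ 1] unfolding path_elt_mono_elt by blast
    then show ?thesis using h by (simp add: P.nonzero_path_def)
  qed
  have "length l < N" if l: "set l \<subseteq> arcs Q" and ch: "successively D.zr l" for l
  proof (rule ccontr)
    assume long: "\<not> length l < N"
    \<comment> \<open>Exactly \<open>N\<close> arrows, so that the power \<open>N\<close> of the arrow ideal contains the path.\<close>
    let ?l = "rev (take N l)"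
    have "successively D.zr (take N l @ drop N l)" using ch by simp
    then have "successively D.zr (take N l)" by (simp only: successively_append_iff)
    then have "successively (\<lambda>a b. D.zr b a) ?l" by (simp add: successively_rev)
    then have "successively (\<lambda>a b. head Q a = tail Q b \<and> P.compatible a b) ?l"
      by (rule successively_mono) (use zr in blast)
    moreover have "?l \<noteq> []" using N long by auto
    moreover have "set ?l \<subseteq> arcs Q" using l set_take_subset[of N l] by simp
    ultimately have "P.nonzero_path (tail Q (hd ?l), ?l, head Q (last ?l))" by (intro P.nonzero_path_chain)
    then show False by (rule P.nonzero_path_length[OF NI]) (use long in \<open>simp add: path_length_def\<close>)
  qed
  then show ?thesis by (rule that)
qed

theorem proposition3p12:
  fixes Q :: "('v, 'e) pre_digraph"
    and I :: "(('v, 'e) qpath \<Rightarrow> 'k::field) set"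
    and M :: "((('v, 'e) qpath \<Rightarrow> 'k) set, 'm) graded_module"
  assumes "fd_quadratic_monomial Q I"
    and "graded_left_module (opposite_quiver Q) (dual_ideal Q I) M"
  shows
    "(finitely_presented (opposite_quiver Q) (dual_ideal Q I) M \<longrightarrow>
        (\<exists>(N :: ((('v, 'e) qpath \<Rightarrow> 'k) set, 'm) graded_module)
          (L :: ((('v, 'e) qpath \<Rightarrow> 'k) set, 'm) graded_module) f g.
            short_exact (opposite_quiver Q) (dual_ideal Q I) N f M g L \<and>
            linear_module (opposite_quiver Q) (dual_ideal Q I) N \<and>
            finite_dim_module (opposite_quiver Q) (dual_ideal Q I) L)) \<and>
     (finitely_copresented (opposite_quiver Q) (dual_ideal Q I) M \<longrightarrow>
        (\<exists>(N' :: ((('v, 'e) qpath \<Rightarrow> 'k) set, 'm) graded_module)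
          (L' :: ((('v, 'e) qpath \<Rightarrow> 'k) set, 'm) graded_module) f g.
            short_exact (opposite_quiver Q) (dual_ideal Q I) N' f M g L' \<and>
            finite_dim_module (opposite_quiver Q) (dual_ideal Q I) N' \<and>
            colinear_module (opposite_quiver Q) (dual_ideal Q I) L'))"
proof -
  have fin: "fin_digraph Q" using assms(1) by (simp add: fd_quadratic_monomial_def)
  interpret D: quadratic_monomial "opposite_quiver Q" "dual_relations Q I" "dual_ideal Q I"
    by (rule quadratic_monomial_dual[OF fin])
  obtain K where K: "\<And>l. set l \<subseteq> arcs (opposite_quiver Q) \<Longrightarrow> successively D.zr l \<Longrightarrow> length l < K"
    using dual_chain_bound[OF assms(1)] by auto
  show ?thesis
    by (intro conjI impI D.finitely_presented_truncation[OF assms(2) _ K]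
        D.finitely_copresented_truncation[OF assms(2) _ K])
qed



end
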